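(* For $f\in L^2(\mathbb{H}^n)$ and $\lambda\in\mathbb{R}^\ast$, let $F_{\lambda}(\xi_1,\xi_2)=\pi_{\lambda}(\xi_1,\xi_2,0)\hat{f}(\lambda)\pi_{\lambda}(-\xi_1,-\xi_2,0)$ for $(\xi_1,\xi_2)\in\mathbb{R}^{2n}$. Then, for $f\in L^2(\mathbb{H}^n)$ and any $(\xi_1,\xi_2)\in\mathbb{R}^{2n}$, one has \[\int_{\mathbb{R}}|\lambda|^n e^{2\pi i\lambda(v\cdot\xi_1-u\cdot\xi_2)}\,\mathrm{tr}\big(\pi_\lambda(u,v,w)^{\ast}F_{\lambda}(\xi_1,\xi_2)\big)\,d\lambda=f(u,v,w),\] where $(u,v,w)\in\mathbb{H}^n$. In particular, \[\int_{\mathbb{R}}|\lambda|^n\, \mathrm{tr}\big(\pi_\lambda(u,v,w)^{\ast}F_{\lambda}(0,0)\big)\,d\lambda=f(u,v,w),\quad\text{for }(u,v,w)\in\mathbb{H}^n.\]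
   Context: The Heisenberg group $\mathbb{H}^n$ is $\mathbb{R}^n\times\mathbb{R}^n\times\mathbb{R}$ with group law $(x,y,t)(u,v,s)=(x+u,\,y+v,\,t+s+\frac12(u\cdot y-v\cdot x))$ and Haar measure the Lebesgue measure $dx\,dy\,dt$. For $\lambda\in\mathbb{R}^\ast=\mathbb{R}\setminus\{0\}$, $\pi_\lambda$ is the unitary representation of $\mathbb{H}^n$ on $L^2(\mathbb{R}^n)$ given by $\pi_\lambda(x,y,t)\phi(\xi)=e^{2\pi i\lambda t}e^{2\pi i\lambda(x\cdot\xi+\frac12 x\cdot y)}\phi(\xi+y)$. The group Fourier transform of $f\in L^1(\mathbb{H}^n)$ is $\hat f(\lambda)=\int_{\mathbb{H}^n}f(x,y,t)\pi_\lambda(x,y,t)\,dx\,dy\,dt$, and its definition is extended to $f\in L^2(\mathbb{H}^n)$ by density. It satisfies the Plancherel formula $\int_{\mathbb{R}^\ast}\|\hat f(\lambda)\|_{\mathcal{B}_2}^2|\lambda|^n d\lambda=\|f\|_{L^2(\mathbb{H}^n)}^2$, where $\mathcal{B}_2$ is the class of Hilbert–Schmidt operators on $L^2(\mathbb{R}^n)$. Here $\mathrm{tr}$ denotes the trace of an operator on $L^2(\mathbb{R}^n)$ and $\pi_\lambda(u,v,w)^\ast$ is the adjoint of $\pi_\lambda(u,v,w)$.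
   Formalization: For general f in L² the operators need not be trace class, so the integral is undefined; it is shown equal to f a.e. when it exists absolutely for a.e. (u,v,w), and for every f in L² when the left side is extended by density in L². *)

theory Defs
  imports "HOL-Analysis.Analysis"
begin

type_synonym 'n heis = "(real ^ 'n) \<times> (real ^ 'n) \<times> real"


section \<open>Square-integrable functions\<close>

text \<open>
  Elements of \<open>L\<^sup>2\<close> are represented by Borel functions; every class contains one. Equality in
  \<open>L\<^sup>2\<close> is equality almost everywhere. On the Heisenberg group, whose carrier is the product space,
  \<open>lborel\<close> is the Haar measure \<open>dx dy dt\<close>.
\<close>

definition l2_norm_sq :: "('a::euclidean_space \<Rightarrow> complex) \<Rightarrow> ennreal" where
  "l2_norm_sq f = (\<integral>\<^sup>+ x. ennreal ((cmod (f x))\<^sup>2) \<partial>lborel)"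

definition L1 :: "('a::euclidean_space \<Rightarrow> complex) set" where
  "L1 = {f. integrable lborel f}"

definition L2 :: "('a::euclidean_space \<Rightarrow> complex) set" where
  "L2 = {f. f \<in> borel_measurable borel \<and> l2_norm_sq f < \<infinity>}"

definition l2_inner :: "('a::euclidean_space \<Rightarrow> complex) \<Rightarrow> ('a \<Rightarrow> complex) \<Rightarrow> complex" where
  "l2_inner f g = (LINT x|lborel. f x * cnj (g x))"

definition l2_tendsto ::
    "(nat \<Rightarrow> 'a::euclidean_space \<Rightarrow> complex) \<Rightarrow> ('a \<Rightarrow> complex) \<Rightarrow> bool" where
  "l2_tendsto F f \<longleftrightarrow> (\<lambda>k. l2_norm_sq (\<lambda>x. F k x - f x)) \<longlonglongrightarrow> 0"

text \<open>\<open>L\<^sup>2\<close> of a Euclidean space is separable and infinite-dimensional, so its orthonormal bases are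
  sequences.\<close>

definition l2_onb :: "(nat \<Rightarrow> 'a::euclidean_space \<Rightarrow> complex) \<Rightarrow> bool" where
  "l2_onb e \<longleftrightarrow>
     (\<forall>i. e i \<in> L2) \<and>
     (\<forall>i j. l2_inner (e i) (e j) = (if i = j then 1 else 0)) \<and>
     (\<forall>\<phi>\<in>L2. (\<forall>i. l2_inner \<phi> (e i) = 0) \<longrightarrow> (AE x in lborel. \<phi> x = 0))"

text \<open>A fixed orthonormal basis. Hilbert-Schmidt norms, and traces of trace class operators, do not
  depend on the choice.\<close>

definition l2_basis :: "nat \<Rightarrow> 'a::euclidean_space \<Rightarrow> complex" where
  "l2_basis = (SOME e. l2_onb e)"


section \<open>Operators on \<open>L\<^sup>2\<close>\<close>

type_synonym 'a op = "('a \<Rightarrow> complex) \<Rightarrow> 'a \<Rightarrow> complex"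

text \<open>Linearity and boundedness together imply that the operator respects equality almost
  everywhere.\<close>

definition bounded_op :: "'a::euclidean_space op \<Rightarrow> bool" where
  "bounded_op T \<longleftrightarrow>
     (\<forall>\<phi>\<in>L2. T \<phi> \<in> L2) \<and>
     (\<forall>\<phi>\<in>L2. \<forall>\<psi>\<in>L2. \<forall>a b. AE x in lborel. T (\<lambda>x. a * \<phi> x + b * \<psi> x) x = a * T \<phi> x + b * T \<psi> x) \<and>
     (\<exists>C::real. \<forall>\<phi>\<in>L2. l2_norm_sq (T \<phi>) \<le> ennreal C * l2_norm_sq \<phi>)"

definition op_adjoint :: "'a::euclidean_space op \<Rightarrow> 'a op" where
  "op_adjoint T \<phi> = (SOME \<eta>. \<eta> \<in> L2 \<and> (\<forall>\<psi>\<in>L2. l2_inner \<psi> \<eta> = l2_inner (T \<psi>) \<phi>))"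

definition hs_norm_sq :: "'a::euclidean_space op \<Rightarrow> ennreal" where
  "hs_norm_sq T = (\<Sum>i. l2_norm_sq (T (l2_basis i)))"

definition hilbert_schmidt :: "'a::euclidean_space op \<Rightarrow> bool" where
  "hilbert_schmidt T \<longleftrightarrow> bounded_op T \<and> hs_norm_sq T < \<infinity>"

text \<open>The trace class as the class of products of two Hilbert-Schmidt operators.\<close>

definition trace_class :: "'a::euclidean_space op \<Rightarrow> bool" where
  "trace_class T \<longleftrightarrow> bounded_op T \<and>
     (\<exists>A B. hilbert_schmidt A \<and> hilbert_schmidt B \<and>
        (\<forall>\<phi>\<in>L2. AE x in lborel. T \<phi> x = A (B \<phi>) x))"

definition op_trace :: "'a::euclidean_space op \<Rightarrow> complex" where
  "op_trace T = (\<Sum>i. l2_inner (T (l2_basis i)) (l2_basis i))"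


section \<open>The group Fourier transform\<close>

fun schroedinger :: "real \<Rightarrow> 'n::finite heis \<Rightarrow> (real ^ 'n) op" where
  "schroedinger l (x, y, t) \<phi> \<xi> =
     cis (2 * pi * l * t) * cis (2 * pi * l * (x \<bullet> \<xi> + x \<bullet> y / 2)) * \<phi> (\<xi> + y)"

text \<open>For \<open>f \<in> L\<^sup>1\<close> and \<open>\<phi> \<in> L\<^sup>2\<close> the integral below converges absolutely for almost every \<open>\<xi>\<close>, and it
  is then the operator-valued integral of \<open>f(x,y,t) \<pi>\<^sub>l(x,y,t)\<close> applied to \<open>\<phi>\<close>.\<close>

definition gft_L1 :: "('n::finite heis \<Rightarrow> complex) \<Rightarrow> real \<Rightarrow> (real ^ 'n) op" where
  "gft_L1 f l \<phi> \<xi> = (LINT p|lborel. f p * schroedinger l p \<phi> \<xi>)"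

text \<open>The extension to \<open>f \<in> L\<^sup>2\<close> by density: \<open>A\<close> is a limit, in the space of square-integrable
  measurable fields of Hilbert-Schmidt operators for the Plancherel measure \<open>\<bar>l\<bar>\<^sup>n dl\<close>, of transforms
  of functions in \<open>L\<^sup>1 \<inter> L\<^sup>2\<close> approaching \<open>f\<close>. Such a field is determined up to a null set of \<open>l\<close>.
  Weak measurability has to be required here, because \<open>\<integral>\<^sup>+\<close> of a non-measurable function is only a
  lower integral.\<close>

definition is_gft :: "('n::finite heis \<Rightarrow> complex) \<Rightarrow> (real \<Rightarrow> (real ^ 'n) op) \<Rightarrow> bool" where
  "is_gft f A \<longleftrightarrow>
     (\<forall>l. l \<noteq> 0 \<longrightarrow> hilbert_schmidt (A l)) \<and>
     (\<forall>\<phi>\<in>L2. \<forall>\<psi>\<in>L2. (\<lambda>l. l2_inner (A l \<phi>) \<psi>) \<in> borel_measurable lebesgue) \<and>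
     (\<exists>F. (\<forall>k. F k \<in> L1 \<inter> L2) \<and> l2_tendsto F f \<and>
        (\<lambda>k. \<integral>\<^sup>+ l. ennreal (\<bar>l\<bar> ^ CARD('n)) *
                hs_norm_sq (\<lambda>\<phi> \<xi>. gft_L1 (F k) l \<phi> \<xi> - A l \<phi> \<xi>) \<partial>lebesgue) \<longlonglongrightarrow> 0)"

definition gft :: "('n::finite heis \<Rightarrow> complex) \<Rightarrow> real \<Rightarrow> (real ^ 'n) op" where
  "gft f = (SOME A. is_gft f A)"

definition conj_gft ::
    "('n::finite heis \<Rightarrow> complex) \<Rightarrow> real \<Rightarrow> real ^ 'n \<Rightarrow> real ^ 'n \<Rightarrow> (real ^ 'n) op" where
  "conj_gft f l \<xi>1 \<xi>2 =
     schroedinger l (\<xi>1, \<xi>2, 0) \<circ> gft f l \<circ> schroedinger l (- \<xi>1, - \<xi>2, 0)"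


section \<open>The meaning of the inversion integrals\<close>

text \<open>For general \<open>f \<in> L\<^sup>2\<close> the transform is only Hilbert-Schmidt, so the traces in the inversion
  formula need not exist, nor need the integral over \<open>l\<close> converge. The integral is therefore taken in
  two stages, as the Fourier transform itself: absolutely where possible, and by density in \<open>L\<^sup>2\<close>
  otherwise.

  The first predicate says that the integral of \<open>c l * tr (T l)\<close> over the real line exists
  absolutely.\<close>

definition trace_integrable ::
    "(real \<Rightarrow> complex) \<Rightarrow> (real \<Rightarrow> 'a::euclidean_space op) \<Rightarrow> bool" where
  "trace_integrable c T \<longleftrightarrow>
     (AE l in lebesgue. trace_class (T l)) \<and> integrable lebesgue (\<lambda>l. c l * op_trace (T l))"

definition trace_integral ::
    "(real \<Rightarrow> complex) \<Rightarrow> (real \<Rightarrow> 'a::euclidean_space op) \<Rightarrow> complex" where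
  "trace_integral c T = (LINT l|lebesgue. c l * op_trace (T l))"

definition weight :: "real ^ 'n::finite \<Rightarrow> real ^ 'n \<Rightarrow> 'n heis \<Rightarrow> real \<Rightarrow> complex" where
  "weight \<xi>1 \<xi>2 = (\<lambda>(u, v, w) l.
     complex_of_real (\<bar>l\<bar> ^ CARD('n)) * cis (2 * pi * l * (v \<bullet> \<xi>1 - u \<bullet> \<xi>2)))"

definition weight0 :: "'n::finite heis \<Rightarrow> real \<Rightarrow> complex" where
  "weight0 p l = complex_of_real (\<bar>l\<bar> ^ CARD('n))"

definition inversion_op ::
    "real ^ 'n::finite \<Rightarrow> real ^ 'n \<Rightarrow> ('n heis \<Rightarrow> complex) \<Rightarrow> 'n heis \<Rightarrow> real \<Rightarrow> (real ^ 'n) op" where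
  "inversion_op \<xi>1 \<xi>2 f p l = op_adjoint (schroedinger l p) \<circ> conj_gft f l \<xi>1 \<xi>2"

text \<open>The graph of the map sending \<open>f\<close> to the function \<open>p \<mapsto> \<integral> c\<^sub>p(l) tr(T\<^sub>f\<^sub>,\<^sub>p(l)) dl\<close>, on
  the \<open>f\<close> for which the integral exists absolutely for almost every \<open>p\<close>.\<close>

definition inversion_graph ::
    "('a::euclidean_space \<Rightarrow> real \<Rightarrow> complex) \<Rightarrow>
     (('a \<Rightarrow> complex) \<Rightarrow> 'a \<Rightarrow> real \<Rightarrow> 'b::euclidean_space op) \<Rightarrow>
     ('a \<Rightarrow> complex) \<Rightarrow> ('a \<Rightarrow> complex) \<Rightarrow> bool" where
  "inversion_graph c T f g \<longleftrightarrow>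
     (AE p in lborel. trace_integrable (c p) (T f p) \<and> trace_integral (c p) (T f p) = g p)"

text \<open>The extension by density of a partially defined map of \<open>L\<^sup>2\<close>, given by its graph \<open>R\<close>: the
  closure of the graph in \<open>L\<^sup>2 \<times> L\<^sup>2\<close>.\<close>

definition l2_extension ::
    "(('a::euclidean_space \<Rightarrow> complex) \<Rightarrow> ('a \<Rightarrow> complex) \<Rightarrow> bool) \<Rightarrow>
     ('a \<Rightarrow> complex) \<Rightarrow> ('a \<Rightarrow> complex) \<Rightarrow> bool" where
  "l2_extension R f g \<longleftrightarrow>
     (\<exists>F G. (\<forall>k. F k \<in> L2 \<and> G k \<in> L2 \<and> R (F k) (G k)) \<and> l2_tendsto F f \<and> l2_tendsto G g)"

end

theory Submission
  imports Defs "HOL-Probability.Characteristic_Functions"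
begin

text \<open>
  On \<open>L\<^sup>1 \<inter> L\<^sup>2\<close> the group Fourier transform at \<open>l\<close> is an integral operator whose kernel is the partial
  Euclidean Fourier transform of \<open>f\<close> in \<open>(x, t)\<close> after a change of variables with Jacobian \<open>\<bar>l\<bar>\<^sup>n\<close>.
  Euclidean Plancherel therefore gives an isometry from \<open>L\<^sup>2\<close> of the group to kernels in \<open>L\<^sup>2\<close>, which
  extends by completeness and determines the transform up to a null set of \<open>l\<close>.

  When the trace integral \<open>H(p)\<close> converges absolutely for almost every \<open>p\<close>, pair \<open>f\<close> with a bounded
  \<open>b\<close> supported where the integral is uniformly bounded. By Plancherel \<open>\<langle>f, b\<rangle>\<close> is the integral over \<open>l\<close> of
  the Hilbert-Schmidt products of the transforms of \<open>f\<close> and \<open>b\<close>. Writing the transform of \<open>b\<close> as an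
  integral over the group and using Fubini, one gets \<open>\<langle>H, b\<rangle>\<close>; hence \<open>f = H\<close>.

  Absolute convergence holds on a dense set: the transform of a convolution \<open>g * h\<close> is a product of two
  Hilbert-Schmidt operators, and its trace is controlled by the two Hilbert-Schmidt norms.
  Finally, conjugation by \<open>\<pi>\<^sub>l(\<xi>\<^sub>1, \<xi>\<^sub>2, 0)\<close> changes the trace by a phase that the exponential weight cancels.
\<close>


text \<open>\<open>gft\<close> is a choice among fields determined only up to null sets of
  \<open>l\<close> and known to be measurable only weakly, so its trace cannot be integrated
  directly over pairs of a group point and \<open>l\<close>. It is therefore traded for a
  square-integrable kernel in all variables, \<open>l\<close> included: the trace becomes the series
  \<open>tker\<close>, which is jointly measurable, and one null set of \<open>l\<close> serves all
  group points. The other obstacle is the exchange of the trace series with the integral over the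
  group. Trace class at one single group point already factors the transform at \<open>l\<close>
  into two Hilbert-Schmidt operators, because the representation operator is unitary. The norms of
  the two factors bound the series at every group point at once, and this constant is what dominated
  convergence uses. The absolutely convergent formula says that the graph of the inversion map lies
  in the graph of the identity, which is closed. Density of the domain then identifies the closure
  with the identity.\<close>

lemma borel_measurable_cnj [measurable (raw)]:
  "f \<in> borel_measurable M \<Longrightarrow> (\<lambda>x. cnj (f x)) \<in> borel_measurable M"
  by (rule borel_measurable_continuous_on[where f = cnj]) (auto intro: continuous_intros)

lemma borel_measurable_cis [measurable (raw)]:
  "f \<in> borel_measurable M \<Longrightarrow> (\<lambda>x. cis (f x)) \<in> borel_measurable M"
  by (rule borel_measurable_continuous_on[where f = cis]) (auto intro: continuous_intros)

section \<open>Norm, inner product and Cauchy-Schwarz on \<open>L2\<close>\<close>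

lemma L2_iff:
  "f \<in> L2 \<longleftrightarrow> f \<in> borel_measurable borel \<and> integrable lborel (\<lambda>x. (cmod (f x))\<^sup>2)"
proof -
  have "f \<in> borel_measurable borel \<Longrightarrow> (\<lambda>x. (cmod (f x))\<^sup>2) \<in> borel_measurable lborel"
    by measurable
  then show ?thesis
    unfolding L2_def l2_norm_sq_def integrable_iff_bounded by auto
qed

lemma L2_measurable [measurable_dest]: "f \<in> L2 \<Longrightarrow> f \<in> borel_measurable borel"
  by (simp add: L2_def)

lemma L2_I:
  assumes "f \<in> borel_measurable borel" "l2_norm_sq f < \<infinity>" shows "f \<in> L2"
  using assms by (simp add: L2_def)

text \<open>A finite real companion of \<open>l2_norm_sq\<close>, suited to subtraction and to
  limits. The two are tied together on \<open>L2\<close>; elsewhere the Bochner integral may fall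
  back to 0 while \<open>l2_norm_sq\<close> is infinite.\<close>

definition nsq :: "('a::euclidean_space \<Rightarrow> complex) \<Rightarrow> real" where
  "nsq f = (LINT x|lborel. (cmod (f x))\<^sup>2)"

lemma nsq_nonneg [simp]: "0 \<le> nsq f"
  unfolding nsq_def by simp

lemma l2_norm_sq_eq: "f \<in> L2 \<Longrightarrow> l2_norm_sq f = ennreal (nsq f)"
  unfolding L2_iff l2_norm_sq_def nsq_def by (intro nn_integral_eq_integral) auto

lemma l2_norm_sq_finite [simp]: "f \<in> L2 \<Longrightarrow> l2_norm_sq f < top"
  by (simp add: L2_def)

lemma l2_norm_sq_cong_AE: "AE x in lborel. f x = g x \<Longrightarrow> l2_norm_sq f = l2_norm_sq g"
  unfolding l2_norm_sq_def by (intro nn_integral_cong_AE) auto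

lemma cmod_add_sq: "(cmod (a + b))\<^sup>2 \<le> 2 * (cmod a)\<^sup>2 + 2 * (cmod b)\<^sup>2"
proof -
  have "(cmod (a + b))\<^sup>2 \<le> (cmod a + cmod b)\<^sup>2"
    by (intro power_mono norm_triangle_ineq) auto
  moreover have "(cmod a + cmod b)\<^sup>2 \<le> 2 * (cmod a)\<^sup>2 + 2 * (cmod b)\<^sup>2"
    using sum_squares_bound[of "cmod a" "cmod b"] by (simp add: power2_sum)
  ultimately show ?thesis by linarith
qed

lemma l2_norm_sq_add:
  assumes [measurable]: "f \<in> borel_measurable borel" "g \<in> borel_measurable borel"
  shows "l2_norm_sq (\<lambda>x. f x + g x) \<le> 2 * l2_norm_sq f + 2 * l2_norm_sq g"
proof -
  have "l2_norm_sq (\<lambda>x. f x + g x)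
      \<le> (\<integral>\<^sup>+ x. 2 * ennreal ((cmod (f x))\<^sup>2) + 2 * ennreal ((cmod (g x))\<^sup>2) \<partial>lborel)"
    unfolding l2_norm_sq_def
  proof (intro nn_integral_mono)
    fix x
    have "ennreal ((cmod (f x + g x))\<^sup>2) \<le> ennreal (2 * (cmod (f x))\<^sup>2 + 2 * (cmod (g x))\<^sup>2)"
      by (intro ennreal_leI cmod_add_sq)
    then show "ennreal ((cmod (f x + g x))\<^sup>2)
        \<le> 2 * ennreal ((cmod (f x))\<^sup>2) + 2 * ennreal ((cmod (g x))\<^sup>2)"
      by (simp add: ennreal_mult)
  qed
  also have "\<dots> = 2 * l2_norm_sq f + 2 * l2_norm_sq g"
    unfolding l2_norm_sq_def by (simp add: nn_integral_add nn_integral_cmult)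
  finally show ?thesis .
qed

lemma l2_norm_sq_cmult: 
  assumes [measurable]: "f \<in> borel_measurable borel"
  shows "l2_norm_sq (\<lambda>x. c * f x) = ennreal ((cmod c)\<^sup>2) * l2_norm_sq f"
  unfolding l2_norm_sq_def by (simp add: norm_mult power_mult_distrib ennreal_mult nn_integral_cmult)

lemma L2_zero [simp, intro]: "(\<lambda>x. 0) \<in> L2"
  by (simp add: L2_iff)

lemma L2_add [intro]: "f \<in> L2 \<Longrightarrow> g \<in> L2 \<Longrightarrow> (\<lambda>x. f x + g x) \<in> L2"
proof (rule L2_I)
  assume f: "f \<in> L2" and g: "g \<in> L2"
  note [measurable] = f g
  show "(\<lambda>x. f x + g x) \<in> borel_measurable borel" by measurable
  have "l2_norm_sq (\<lambda>x. f x + g x) \<le> 2 * l2_norm_sq f + 2 * l2_norm_sq g"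
    by (intro l2_norm_sq_add) measurable
  also have "\<dots> < \<infinity>" using f g by (simp add: ennreal_mult_less_top)
  finally show "l2_norm_sq (\<lambda>x. f x + g x) < \<infinity>" .
qed

lemma L2_cmult [intro]: "f \<in> L2 \<Longrightarrow> (\<lambda>x. c * f x) \<in> L2"
  unfolding L2_iff by (auto simp: norm_mult power_mult_distrib)

lemma L2_uminus [intro]: "f \<in> L2 \<Longrightarrow> (\<lambda>x. - f x) \<in> L2"
  unfolding L2_iff by auto

lemma L2_diff [intro]: "f \<in> L2 \<Longrightarrow> g \<in> L2 \<Longrightarrow> (\<lambda>x. f x - g x) \<in> L2"
  using L2_add[of f "\<lambda>x. - g x"] L2_uminus[of g] by simp

lemma L2_cnj [intro]: "f \<in> L2 \<Longrightarrow> (\<lambda>x. cnj (f x)) \<in> L2"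
  unfolding L2_iff by auto

lemma L2_sum [intro]: "(\<And>i. i \<in> I \<Longrightarrow> f i \<in> L2) \<Longrightarrow> (\<lambda>x. \<Sum>i\<in>I. f i x) \<in> L2"
  by (induction I rule: infinite_finite_induct) auto

lemma L2_dominated:
  assumes "g \<in> L2" and [measurable]: "f \<in> borel_measurable borel"
    and "AE x in lborel. cmod (f x) \<le> cmod (g x)"
  shows "f \<in> L2"
  unfolding L2_iff
proof safe
  show "integrable lborel (\<lambda>x. (cmod (f x))\<^sup>2)"
  proof (rule Bochner_Integration.integrable_bound)
    show "integrable lborel (\<lambda>x. (cmod (g x))\<^sup>2)" using assms by (simp add: L2_iff)
    show "AE x in lborel. norm ((cmod (f x))\<^sup>2) \<le> norm ((cmod (g x))\<^sup>2)"
      using assms(3) by eventually_elim (simp add: power_mono)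
  qed measurable
qed measurable

lemma integrable_L2_mult:
  assumes f: "f \<in> L2" and g: "g \<in> L2"
  shows "integrable lborel (\<lambda>x. f x * g x)"
proof (rule Bochner_Integration.integrable_bound)
  note [measurable] = f g
  show "integrable lborel (\<lambda>x. (cmod (f x))\<^sup>2 + (cmod (g x))\<^sup>2)"
    using f g by (auto simp: L2_iff)
  show "AE x in lborel. norm (f x * g x) \<le> norm ((cmod (f x))\<^sup>2 + (cmod (g x))\<^sup>2)"
  proof (intro AE_I2)
    fix x
    have "cmod (f x) * cmod (g x) \<le> (cmod (f x))\<^sup>2 + (cmod (g x))\<^sup>2"
      using sum_squares_bound[of "cmod (f x)" "cmod (g x)"]
        mult_nonneg_nonneg[OF norm_ge_zero norm_ge_zero, of "f x" "g x"] by linarith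
    then show "norm (f x * g x) \<le> norm ((cmod (f x))\<^sup>2 + (cmod (g x))\<^sup>2)"
      by (simp add: norm_mult)
  qed
qed (use f g in measurable)

lemma integrable_L2_inner: "f \<in> L2 \<Longrightarrow> g \<in> L2 \<Longrightarrow> integrable lborel (\<lambda>x. f x * cnj (g x))"
  by (intro integrable_L2_mult L2_cnj)

lemma l2_inner_add_left:
  "f \<in> L2 \<Longrightarrow> g \<in> L2 \<Longrightarrow> h \<in> L2 \<Longrightarrow> l2_inner (\<lambda>x. f x + g x) h = l2_inner f h + l2_inner g h"
  unfolding l2_inner_def distrib_right by (intro Bochner_Integration.integral_add integrable_L2_inner)

lemma l2_inner_diff_left:
  "f \<in> L2 \<Longrightarrow> g \<in> L2 \<Longrightarrow> h \<in> L2 \<Longrightarrow> l2_inner (\<lambda>x. f x - g x) h = l2_inner f h - l2_inner g h"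
  unfolding l2_inner_def left_diff_distrib by (intro Bochner_Integration.integral_diff integrable_L2_inner)

lemma l2_inner_add_right:
  "f \<in> L2 \<Longrightarrow> g \<in> L2 \<Longrightarrow> h \<in> L2 \<Longrightarrow> l2_inner h (\<lambda>x. f x + g x) = l2_inner h f + l2_inner h g"
  unfolding l2_inner_def complex_cnj_add distrib_left by (intro Bochner_Integration.integral_add integrable_L2_inner)

lemma l2_inner_cmult_left: "l2_inner (\<lambda>x. c * f x) g = c * l2_inner f g"
  unfolding l2_inner_def by (simp add: mult.assoc)

lemma l2_inner_cmult_right: "l2_inner f (\<lambda>x. c * g x) = cnj c * l2_inner f g"
  unfolding l2_inner_def by (simp add: mult.left_commute)

lemma l2_inner_commute: "l2_inner g f = cnj (l2_inner f g)"
  unfolding l2_inner_def Bochner_Integration.integral_cnj[symmetric] by (simp add: mult.commute)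

lemma l2_inner_sum_left:
  "(\<And>i. i \<in> I \<Longrightarrow> f i \<in> L2) \<Longrightarrow> g \<in> L2 \<Longrightarrow>
    l2_inner (\<lambda>x. \<Sum>i\<in>I. f i x) g = (\<Sum>i\<in>I. l2_inner (f i) g)"
  unfolding l2_inner_def sum_distrib_right
  by (intro Bochner_Integration.integral_sum integrable_L2_inner)

lemma l2_inner_self: "f \<in> L2 \<Longrightarrow> l2_inner f f = complex_of_real (nsq f)"
  unfolding l2_inner_def nsq_def complex_norm_square[symmetric] integral_complex_of_real[symmetric] by simp

lemma l2_inner_cong_AE:
  assumes [measurable]: "f \<in> L2" "f' \<in> L2" "g \<in> L2" "g' \<in> L2"
    and "AE x in lborel. f x = f' x" "AE x in lborel. g x = g' x"
  shows "l2_inner f g = l2_inner f' g'"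
  unfolding l2_inner_def
proof (rule integral_cong_AE)
  show "AE x in lborel. f x * cnj (g x) = f' x * cnj (g' x)"
    using assms(5,6) by eventually_elim simp
qed measurable

lemma nsq_eq_0_iff: "f \<in> L2 \<Longrightarrow> nsq f = 0 \<longleftrightarrow> (AE x in lborel. f x = 0)"
  unfolding nsq_def L2_iff by (subst integral_nonneg_eq_0_iff_AE) auto

lemma nsq_cmult: "nsq (\<lambda>x. c * f x) = (cmod c)\<^sup>2 * nsq f"
  unfolding nsq_def by (simp add: norm_mult power_mult_distrib)

lemma nsq_add:
  assumes "f \<in> L2" "g \<in> L2"
  shows "nsq (\<lambda>x. f x + g x) = nsq f + nsq g + 2 * Re (l2_inner f g)"
proof -
  have "complex_of_real (nsq (\<lambda>x. f x + g x)) = l2_inner (\<lambda>x. f x + g x) (\<lambda>x. f x + g x)"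
    using assms by (subst l2_inner_self) auto
  also have "\<dots> = l2_inner f f + l2_inner g g + (l2_inner f g + cnj (l2_inner f g))"
    using assms by (simp add: l2_inner_add_left l2_inner_add_right L2_add
        l2_inner_commute[of g f] algebra_simps)
  also have "\<dots> = complex_of_real (nsq f + nsq g + 2 * Re (l2_inner f g))"
    using assms by (simp add: l2_inner_self complex_add_cnj)
  finally show ?thesis by (simp only: of_real_eq_iff)
qed

lemma nsq_diff:
  assumes "f \<in> L2" "g \<in> L2"
  shows "nsq (\<lambda>x. f x - g x) = nsq f + nsq g - 2 * Re (l2_inner f g)"
  using nsq_add[of f "\<lambda>x. (-1) * g x"] assms
  by (simp add: L2_uminus l2_inner_cmult_right[of f "-1", simplified] nsq_cmult[of "-1", simplified])

text \<open>The squared form can be read in \<open>ennreal\<close>, where Cauchy-Schwarz for the two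
  moduli asks for no integrability.\<close>

lemma l2_Cauchy_Schwarz:
  assumes f: "f \<in> L2" and g: "g \<in> L2"
  shows "(cmod (l2_inner f g))\<^sup>2 \<le> nsq f * nsq g"
proof -
  note [measurable] = f g
  have "ennreal (cmod (l2_inner f g)) \<le> (\<integral>\<^sup>+ x. ennreal (cmod (f x)) * ennreal (cmod (g x)) \<partial>lborel)"
    unfolding l2_inner_def
    using integral_norm_bound_ennreal[OF integrable_L2_inner[OF f g]]
    by (simp add: norm_mult ennreal_mult)
  then have "(ennreal (cmod (l2_inner f g)))\<^sup>2 \<le> (\<integral>\<^sup>+ x. ennreal (cmod (f x)) * ennreal (cmod (g x)) \<partial>lborel)\<^sup>2"
    by (intro power_mono) auto
  also have "\<dots> \<le> l2_norm_sq f * l2_norm_sq g"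
    using Cauchy_Schwarz_nn_integral[of "\<lambda>x. ennreal (cmod (f x))" lborel "\<lambda>x. ennreal (cmod (g x))"]
    by (simp add: l2_norm_sq_def ennreal_power)
  also have "\<dots> = ennreal (nsq f * nsq g)"
    using f g by (simp add: l2_norm_sq_eq ennreal_mult)
  finally show ?thesis by (simp add: ennreal_power)
qed

lemma l2_inner_eq_0_left:
  assumes "f \<in> L2" "AE x in lborel. f x = 0" shows "l2_inner f g = 0"
  unfolding l2_inner_def
  by (rule integral_eq_zero_AE) (use assms(2) in eventually_elim, simp)

lemma l2_eqI:
  assumes "f \<in> L2" "g \<in> L2" "\<And>h. h \<in> L2 \<Longrightarrow> l2_inner f h = l2_inner g h"
  shows "AE x in lborel. f x = g x"
proof -
  have "l2_inner (\<lambda>x. f x - g x) (\<lambda>x. f x - g x) = 0"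
    using assms by (simp add: l2_inner_diff_left L2_diff)
  then have "nsq (\<lambda>x. f x - g x) = 0"
    using assms by (subst (asm) l2_inner_self) auto
  then show ?thesis using assms by (subst (asm) nsq_eq_0_iff) auto
qed

subsection \<open>Convergence and completeness\<close>

lemma l2_tendsto_iff:
  assumes "\<And>k. F k \<in> L2" "f \<in> L2"
  shows "l2_tendsto F f \<longleftrightarrow> (\<lambda>k. nsq (\<lambda>x. F k x - f x)) \<longlonglongrightarrow> 0"
proof -
  have "l2_norm_sq (\<lambda>x. F k x - f x) = ennreal (nsq (\<lambda>x. F k x - f x))" for k
    using assms by (intro l2_norm_sq_eq) auto
  then show ?thesis unfolding l2_tendsto_def
    by (simp add: tendsto_ennreal_iff[where f = "\<lambda>k. nsq (\<lambda>x. F k x - f x)" and x = 0, simplified ennreal_0])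
qed

lemma l2_inner_tendsto_left:
  assumes F: "\<And>k. F k \<in> L2" and f: "f \<in> L2" and g: "g \<in> L2" and l: "l2_tendsto F f"
  shows "(\<lambda>k. l2_inner (F k) g) \<longlonglongrightarrow> l2_inner f g"
proof -
  have "(\<lambda>k. nsq (\<lambda>x. F k x - f x)) \<longlonglongrightarrow> 0" using assms l2_tendsto_iff by blast
  then have *: "(\<lambda>k. nsq (\<lambda>x. F k x - f x) * nsq g) \<longlonglongrightarrow> 0"
    using tendsto_mult_right[of _ 0 _ "nsq g"] by simp
  have "(\<lambda>k. (cmod (l2_inner (F k) g - l2_inner f g))\<^sup>2) \<longlonglongrightarrow> 0"
  proof (rule tendsto_sandwich[OF _ _ tendsto_const *])
    show "\<forall>\<^sub>F k in sequentially. (cmod (l2_inner (F k) g - l2_inner f g))\<^sup>2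
        \<le> nsq (\<lambda>x. F k x - f x) * nsq g"
      using l2_Cauchy_Schwarz[OF L2_diff[OF F f] g]
      by (simp add: l2_inner_diff_left[OF F f g])
  qed simp
  then have "(\<lambda>k. sqrt ((cmod (l2_inner (F k) g - l2_inner f g))\<^sup>2)) \<longlonglongrightarrow> sqrt 0"
    by (rule tendsto_real_sqrt)
  then show ?thesis
    using LIM_zero_iff tendsto_norm_zero_iff by (simp add: LIM_zero_iff tendsto_norm_zero_iff)
qed

lemma l2_inner_tendsto_right:
  assumes F: "\<And>k. F k \<in> L2" and f: "f \<in> L2" and g: "g \<in> L2" and l: "l2_tendsto F f"
  shows "(\<lambda>k. l2_inner g (F k)) \<longlonglongrightarrow> l2_inner g f"
  using tendsto_cnj[OF l2_inner_tendsto_left[OF assms]] by (simp add: l2_inner_commute[of g])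

lemma nsq_triangle:
  assumes "f \<in> L2" "g \<in> L2" "h \<in> L2"
  shows "nsq (\<lambda>x. f x - h x) \<le> 2 * nsq (\<lambda>x. f x - g x) + 2 * nsq (\<lambda>x. g x - h x)"
proof -
  have "ennreal (nsq (\<lambda>x. (f x - g x) + (g x - h x)))
      \<le> 2 * ennreal (nsq (\<lambda>x. f x - g x)) + 2 * ennreal (nsq (\<lambda>x. g x - h x))"
    using l2_norm_sq_add[of "\<lambda>x. f x - g x" "\<lambda>x. g x - h x"] assms
    by (simp add: l2_norm_sq_eq[symmetric] L2_diff L2_measurable)
  then have "ennreal (nsq (\<lambda>x. f x - h x))
      \<le> ennreal (2 * nsq (\<lambda>x. f x - g x) + 2 * nsq (\<lambda>x. g x - h x))"
    by (simp add: ennreal_mult)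
  then show ?thesis by (subst (asm) ennreal_le_iff) auto
qed

lemma nsq_swap: "nsq (\<lambda>x. f x - g x) = nsq (\<lambda>x. g x - f x)"
  unfolding nsq_def by (simp add: norm_minus_commute)

text \<open>Norm convergence implies convergence of the inner products with every \<open>h\<close>,
  and those numerical limits are unique.\<close>

lemma l2_tendsto_unique:
  assumes F: "\<And>k. F k \<in> L2" and f: "f \<in> L2" and g: "g \<in> L2"
    and "l2_tendsto F f" "l2_tendsto F g"
  shows "AE x in lborel. f x = g x"
proof -
  have "(\<lambda>k. l2_inner (F k) h) \<longlonglongrightarrow> l2_inner f h" "(\<lambda>k. l2_inner (F k) h) \<longlonglongrightarrow> l2_inner g h" if "h \<in> L2" for h
    using l2_inner_tendsto_left assms that by blast+
  then show ?thesis using f g by (intro l2_eqI) (auto intro: LIMSEQ_unique)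
qed

lemma nsq_tendsto:
  assumes F: "\<And>k. F k \<in> L2" and f: "f \<in> L2" and l: "l2_tendsto F f"
  shows "(\<lambda>k. nsq (F k)) \<longlonglongrightarrow> nsq f"
proof -
  have eq: "nsq (F k) = nsq (\<lambda>x. F k x - f x) - nsq f + 2 * Re (l2_inner (F k) f)" for k
    using nsq_diff[OF F f] by simp
  have "(\<lambda>k. nsq (\<lambda>x. F k x - f x) - nsq f + 2 * Re (l2_inner (F k) f))
      \<longlonglongrightarrow> 0 - nsq f + 2 * Re (l2_inner f f)"
    using l2_tendsto_iff[of F f, OF F f] l
    by (intro tendsto_intros l2_inner_tendsto_left[OF F f f l]) simp
  then show ?thesis unfolding eq using f by (simp add: l2_inner_self)
qed

text \<open>Fatou's lemma for the squared moduli. One \<open>F k\<close> obeying the bound shows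
  that \<open>c\<close> is nonnegative, which permits the return from \<open>ennreal\<close> to the
  reals.\<close>

lemma nsq_le_liminf:
  assumes F: "\<And>k. F k \<in> L2" and [measurable]: "f \<in> borel_measurable borel"
    and lim: "AE x in lborel. (\<lambda>k. F k x) \<longlonglongrightarrow> f x" and le: "\<forall>\<^sub>F k in sequentially. nsq (F k) \<le> c"
  shows "f \<in> L2" "nsq f \<le> c"
proof -
  note [measurable] = F
  have "l2_norm_sq f = (\<integral>\<^sup>+ x. liminf (\<lambda>k. ennreal ((cmod (F k x))\<^sup>2)) \<partial>lborel)"
    unfolding l2_norm_sq_def
  proof (intro nn_integral_cong_AE, use lim in eventually_elim)
    fix x assume "(\<lambda>k. F k x) \<longlonglongrightarrow> f x"
    then have "(\<lambda>k. ennreal ((cmod (F k x))\<^sup>2)) \<longlonglongrightarrow> ennreal ((cmod (f x))\<^sup>2)"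
      by (intro tendsto_ennrealI tendsto_intros)
    then show "ennreal ((cmod (f x))\<^sup>2) = liminf (\<lambda>k. ennreal ((cmod (F k x))\<^sup>2))"
      by (intro lim_imp_Liminf[symmetric]) auto
  qed
  also have "\<dots> \<le> liminf (\<lambda>k. l2_norm_sq (F k))"
    unfolding l2_norm_sq_def by (intro nn_integral_liminf) measurable
  also have "\<dots> \<le> ennreal c"
  proof (rule Liminf_le)
    show "\<forall>\<^sub>F k in sequentially. l2_norm_sq (F k) \<le> ennreal c"
      using le by eventually_elim (simp add: l2_norm_sq_eq F ennreal_leI)
  qed simp
  finally have *: "l2_norm_sq f \<le> ennreal c" .
  then show f: "f \<in> L2" by (intro L2_I) (auto intro: le_less_trans)
  obtain k where "nsq (F k) \<le> c" using le eventually_happens' sequentially_bot by blast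
  then have "0 \<le> c" using nsq_nonneg[of "F k"] by linarith
  then show "nsq f \<le> c" using * f by (simp add: l2_norm_sq_eq ennreal_le_iff)
qed

text \<open>A subsequence with rapidly decreasing increments converges almost everywhere; its
  pointwise limit is the candidate, and Fatou upgrades pointwise convergence to convergence in
  norm.\<close>

lemma l2_complete:
  fixes F :: "nat \<Rightarrow> 'a::euclidean_space \<Rightarrow> complex"
  assumes F: "\<And>k. F k \<in> L2"
    and Cauchy: "\<And>e. e > 0 \<Longrightarrow> \<exists>N. \<forall>m\<ge>N. \<forall>n\<ge>N. nsq (\<lambda>x. F m x - F n x) < e"
  obtains f where "f \<in> L2" "l2_tendsto F f"
proof -
  note [measurable] = F
  \<comment> \<open>One factor (1/4)^k will be consumed by the weight 4^k put on the increments; the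
    other remains as a convergent geometric series.\<close>
  have "\<exists>N. \<forall>m\<ge>N. \<forall>n\<ge>N. nsq (\<lambda>x. F m x - F n x) < (1/4)^k * (1/4)^k" for k :: nat
    by (intro Cauchy) simp
  then obtain N where N: "\<And>k m n. m \<ge> N k \<Longrightarrow> n \<ge> N k \<Longrightarrow> nsq (\<lambda>x. F m x - F n x) < (1/4)^k * (1/4)^k"
    by metis
  \<comment> \<open>Summing all earlier indices makes \<open>s\<close> monotone and at least
    \<open>N k\<close>; the extra summand \<open>k\<close> drives it to infinity.\<close>
  define s where "s k = (\<Sum>j\<le>k. N j) + k" for k
  have sN: "s k \<ge> N k" for k
    unfolding s_def using member_le_sum[of k "{..k}" N] by simp
  have smono: "s k \<le> s (Suc k)" for k unfolding s_def by simp
  have sk: "s k \<ge> k" for k unfolding s_def by simp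
  define d where "d k x = F (s (Suc k)) x - F (s k) x" for k x
  have dL2: "d k \<in> L2" for k unfolding d_def using F by auto
  note [measurable] = dL2
  have dn: "nsq (d k) \<le> (1/4)^k * (1/4)^k" for k
    unfolding d_def using N[of k "s (Suc k)" "s k"] sN[of k] smono[of k] by (simp add: less_imp_le)
  \<comment> \<open>Weighting the increments makes the sum of squares finite, hence the increments summable.\<close>
  have "(\<integral>\<^sup>+ x. (\<Sum>k. ennreal (4^k * (cmod (d k x))\<^sup>2)) \<partial>lborel) = (\<Sum>k. (\<integral>\<^sup>+ x. ennreal (4^k * (cmod (d k x))\<^sup>2) \<partial>lborel))"
    by (intro nn_integral_suminf) measurable
  also have "\<dots> = (\<Sum>k. ennreal (4^k * nsq (d k)))"
    by (intro suminf_cong) (simp add: ennreal_mult nn_integral_cmult l2_norm_sq_def[symmetric] l2_norm_sq_eq dL2)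
  also have "\<dots> \<le> (\<Sum>k. ennreal ((1/4)^k))"
  proof (intro suminf_le ennreal_leI)
    fix k
    have "4^k * nsq (d k) \<le> 4^k * ((1/4)^k * (1/4)^k)" by (intro mult_left_mono dn) auto
    also have "\<dots> = (1/4)^k" by (simp add: power_mult_distrib[symmetric] mult.assoc[symmetric])
    finally show "4^k * nsq (d k) \<le> (1/4)^k" .
  qed auto
  also have "\<dots> = ennreal (\<Sum>k. (1/4)^k)"
    by (intro suminf_ennreal2) (auto intro!: summable_geometric)
  also have "\<dots> < \<infinity>" by simp
  finally have fin: "(\<integral>\<^sup>+ x. (\<Sum>k. ennreal (4^k * (cmod (d k x))\<^sup>2)) \<partial>lborel) < \<infinity>" .
  have "AE x in lborel. (\<Sum>k. ennreal (4^k * (cmod (d k x))\<^sup>2)) \<noteq> \<infinity>"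
    by (rule nn_integral_PInf_AE) (use fin in auto)
  then have conv: "AE x in lborel. convergent (\<lambda>k. F (s k) x)"
  proof eventually_elim
    fix x assume "(\<Sum>k. ennreal (4^k * (cmod (d k x))\<^sup>2)) \<noteq> \<infinity>"
    then have sm: "summable (\<lambda>k. 4^k * (cmod (d k x))\<^sup>2)"
      by (intro summable_suminf_not_top) auto
    have "summable (\<lambda>k. (1/4::real)^k + 4^k * (cmod (d k x))\<^sup>2)"
      by (intro summable_add sm summable_geometric) simp
    then have "summable (\<lambda>k. d k x)"
    proof (rule summable_comparison_test'[where N = 0])
      fix k :: nat
      \<comment> \<open>The product of 2^-k and 2^k times the increment is split by the
        arithmetic-geometric inequality into a geometric term and a term of the summable
        series.\<close>
      have "2 * (cmod (d k x)) \<le> (1/2^k)\<^sup>2 + (2^k * cmod (d k x))\<^sup>2"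
        using sum_squares_bound[of "1/2^k" "2^k * cmod (d k x)"] by simp
      also have "\<dots> = (1/4)^k + 4^k * (cmod (d k x))\<^sup>2"
      proof -
        have "((2::real)^k)\<^sup>2 = 4^k"
          unfolding power_mult[symmetric] mult.commute[of k] by (simp add: power_mult)
        then show ?thesis by (simp add: power_mult_distrib power_divide)
      qed
      finally show "norm (d k x) \<le> (1/4)^k + 4^k * (cmod (d k x))\<^sup>2"
        using norm_ge_zero[of "d k x"] by linarith
    qed
    then have "convergent (\<lambda>n. \<Sum>k<n. d k x)" by (simp add: summable_iff_convergent)
    moreover have "(\<Sum>k<n. d k x) = F (s n) x - F (s 0) x" for n
      unfolding d_def by (induction n) auto
    ultimately have "convergent (\<lambda>n. F (s n) x - F (s 0) x)" by simp
    then have "convergent (\<lambda>n. F (s n) x - F (s 0) x + F (s 0) x)"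
      by (intro convergent_add convergent_const)
    then show "convergent (\<lambda>k. F (s k) x)" by simp
  qed
  define f where "f x = lim (\<lambda>k. F (s k) x)" for x
  have fm [measurable]: "f \<in> borel_measurable borel"
    unfolding f_def by (intro borel_measurable_lim_metric) measurable
  have lim: "AE x in lborel. (\<lambda>k. F (s k) x) \<longlonglongrightarrow> f x"
    using conv unfolding f_def by eventually_elim (simp add: convergent_LIMSEQ_iff)
  \<comment> \<open>Fatou along the subsequence compares each late term of the full sequence with
    the limit, which yields both membership of \<open>f\<close> in \<open>L2\<close> and convergence
    of the whole sequence.\<close>
  have key: "(\<lambda>x. F n x - f x) \<in> L2 \<and> nsq (\<lambda>x. F n x - f x) \<le> e"
    if "\<forall>m\<ge>M. \<forall>n\<ge>M. nsq (\<lambda>x. F m x - F n x) < e" "n \<ge> M" for e M n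
  proof -
    have 1: "AE x in lborel. (\<lambda>k. F n x - F (s k) x) \<longlonglongrightarrow> F n x - f x"
      using lim by eventually_elim (intro tendsto_intros)
    have 2: "\<forall>\<^sub>F k in sequentially. nsq (\<lambda>x. F n x - F (s k) x) \<le> e"
      using eventually_ge_at_top[of M]
    proof eventually_elim
      fix k assume "M \<le> k"
      then have "s k \<ge> M" using sk le_trans by blast
      then show "nsq (\<lambda>x. F n x - F (s k) x) \<le> e" using that by (simp add: less_imp_le)
    qed
    show ?thesis
      using nsq_le_liminf[of "\<lambda>k x. F n x - F (s k) x" "\<lambda>x. F n x - f x" e] 1 2 F by auto
  qed
  obtain M where "\<forall>m\<ge>M. \<forall>n\<ge>M. nsq (\<lambda>x. F m x - F n x) < 1" using Cauchy[of 1] by auto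
  then have "(\<lambda>x. F M x - f x) \<in> L2" using key by blast
  then have "(\<lambda>x. F M x - (F M x - f x)) \<in> L2" by (rule L2_diff[OF F])
  then have fL2: "f \<in> L2" by simp
  have "(\<lambda>k. nsq (\<lambda>x. F k x - f x)) \<longlonglongrightarrow> 0"
  proof (rule LIMSEQ_I)
    fix r :: real assume "r > 0"
    then obtain M where "\<forall>m\<ge>M. \<forall>n\<ge>M. nsq (\<lambda>x. F m x - F n x) < r / 2" using Cauchy[of "r/2"] by auto
    then have "\<forall>n\<ge>M. nsq (\<lambda>x. F n x - f x) \<le> r / 2" using key by blast
    then show "\<exists>no. \<forall>n\<ge>no. norm (nsq (\<lambda>x. F n x - f x) - 0) < r"
      using \<open>r > 0\<close> by (intro exI[of _ M]) fastforce
  qed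
  then show ?thesis using that[OF fL2] l2_tendsto_iff[of F f] F fL2 by blast
qed

lemma l2_tendsto_dominated:
  assumes F: "\<And>k. F k \<in> borel_measurable borel" and f: "f \<in> borel_measurable borel"
    and g: "g \<in> L2" and lim: "AE x in lborel. (\<lambda>k. F k x) \<longlonglongrightarrow> f x"
    and bd: "\<And>k. AE x in lborel. cmod (F k x - f x) \<le> cmod (g x)"
  shows "l2_tendsto F f"
proof -
  note [measurable] = F f g
  have "(\<lambda>k. \<integral>\<^sup>+ x. ennreal ((cmod (F k x - f x))\<^sup>2) \<partial>lborel) \<longlonglongrightarrow> (\<integral>\<^sup>+ x. 0 \<partial>(lborel :: 'a measure))"
  proof (rule nn_integral_dominated_convergence[where w = "\<lambda>x. ennreal ((cmod (g x))\<^sup>2)"])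
    show "(\<integral>\<^sup>+ x. ennreal ((cmod (g x))\<^sup>2) \<partial>lborel) < \<infinity>"
      using g by (simp add: L2_def l2_norm_sq_def)
    show "AE x in lborel. ennreal ((cmod (F k x - f x))\<^sup>2) \<le> ennreal ((cmod (g x))\<^sup>2)" for k
      using bd[of k] by eventually_elim (intro ennreal_leI power_mono, auto)
    show "AE x in lborel. (\<lambda>k. ennreal ((cmod (F k x - f x))\<^sup>2)) \<longlonglongrightarrow> 0"
      using lim
    proof eventually_elim
      fix x assume "(\<lambda>k. F k x) \<longlonglongrightarrow> f x"
      then have "(\<lambda>k. ennreal ((cmod (F k x - f x))\<^sup>2)) \<longlonglongrightarrow> ennreal ((cmod (f x - f x))\<^sup>2)"
        by (intro tendsto_ennrealI tendsto_intros)
      then show "(\<lambda>k. ennreal ((cmod (F k x - f x))\<^sup>2)) \<longlonglongrightarrow> 0" by simp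
    qed
  qed measurable
  then show ?thesis unfolding l2_tendsto_def l2_norm_sq_def by simp
qed

subsection \<open>Dense classes\<close>

definition bdd_compact_supp :: "('a::euclidean_space \<Rightarrow> complex) \<Rightarrow> bool" where
  "bdd_compact_supp f \<longleftrightarrow> f \<in> borel_measurable borel \<and>
     (\<exists>B. (\<forall>x. cmod (f x) \<le> B) \<and> (\<forall>x. norm x > B \<longrightarrow> f x = 0))"

lemma bdd_compact_supp_obtain:
  assumes "bdd_compact_supp f"
  obtains B where "B > 0" "\<And>x. cmod (f x) \<le> B" "\<And>x. norm x > B \<Longrightarrow> f x = 0"
proof -
  obtain B where B: "\<And>x. cmod (f x) \<le> B" "\<And>x. norm x > B \<Longrightarrow> f x = 0"
    using assms unfolding bdd_compact_supp_def by blast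
  show ?thesis
    by (rule that[of "max 1 B"]) (use B in \<open>auto intro: order_trans[OF B(1)]\<close>)
qed

lemma integrable_indicator_ball:
  fixes r :: real
  shows "integrable lborel (\<lambda>x::'a::euclidean_space. c * indicator (cball 0 r) x :: complex)"
proof -
  have "integrable lborel (\<lambda>x::'a. indicator (cball 0 r) x *\<^sub>R c)"
    by (intro integrable_scaleR_left integrable_real_indicator) (use emeasure_bounded_finite[OF bounded_cball, of "0::'a" r] in auto)
  moreover have "(\<lambda>x::'a. c * indicator (cball 0 r) x) = (\<lambda>x. indicator (cball 0 r) x *\<^sub>R c)"
    by (auto simp: indicator_def)
  ultimately show ?thesis by simp
qed

lemma bdd_compact_supp_L1_L2:
  assumes "bdd_compact_supp f" shows "f \<in> L1" "f \<in> L2"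
proof -
  obtain B where B: "B > 0" "\<And>x. cmod (f x) \<le> B" "\<And>x. norm x > B \<Longrightarrow> f x = 0"
    using bdd_compact_supp_obtain[OF assms] by metis
  have [measurable]: "f \<in> borel_measurable borel" using assms by (simp add: bdd_compact_supp_def)
  have le: "cmod (f x) \<le> cmod (complex_of_real B * indicator (cball 0 B) x)" for x
    using B(1) B(2)[of x] B(3)[of x] by (cases "norm x \<le> B") (auto simp: norm_mult)
  show "f \<in> L1" unfolding L1_def
    using Bochner_Integration.integrable_bound[OF integrable_indicator_ball[of "complex_of_real B" B], of f] le
    by simp
  have *: "(cmod (complex_of_real B * indicator (cball 0 B) x))\<^sup>2 = cmod (complex_of_real (B\<^sup>2) * indicator (cball 0 B) x)" for x :: 'a
    by (auto simp: indicator_def norm_mult power2_eq_square)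
  have "(\<lambda>x::'a. complex_of_real B * indicator (cball 0 B) x) \<in> L2"
    unfolding L2_iff using integrable_norm[OF integrable_indicator_ball[of "complex_of_real (B\<^sup>2)" B]]
    by (simp only: *) (intro conjI borel_measurable_times borel_measurable_const borel_measurable_indicator TrueI, simp)
  then show "f \<in> L2" by (rule L2_dominated) (use le in auto)
qed

text \<open>Truncation in both the argument and the value; the error is dominated by
  \<open>f\<close> itself.\<close>

lemma bdd_compact_supp_dense_seq:
  fixes f :: "'a::euclidean_space \<Rightarrow> complex"
  assumes f: "f \<in> L2"
  obtains F where "\<And>k. bdd_compact_supp (F k)" "l2_tendsto F f"
proof -
  note [measurable] = f
  define F where "F k x = (if norm x \<le> real k \<and> cmod (f x) \<le> real k then f x else 0)" for k x
  have [measurable]: "F k \<in> borel_measurable borel" for k unfolding F_def by measurable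
  have 1: "bdd_compact_supp (F k)" for k
    unfolding bdd_compact_supp_def by (intro conjI exI[of _ "real k"]) (auto simp: F_def)
  have "l2_tendsto F f"
  proof (rule l2_tendsto_dominated[OF _ _ f])
    show "AE x in lborel. (\<lambda>k. F k x) \<longlonglongrightarrow> f x"
    proof (intro AE_I2)
      fix x :: 'a
      have "\<forall>\<^sub>F k in sequentially. F k x = f x"
        using eventually_ge_at_top[of "nat \<lceil>max (norm x) (cmod (f x))\<rceil>"]
        by eventually_elim (auto simp: F_def nat_le_iff ceiling_le_iff)
      then show "(\<lambda>k. F k x) \<longlonglongrightarrow> f x" by (rule tendsto_eventually)
    qed
  qed (auto simp: F_def)
  then show ?thesis using that 1 by blast
qed

definition cont_compact_supp :: "('a::euclidean_space \<Rightarrow> complex) \<Rightarrow> bool" where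
  "cont_compact_supp f \<longleftrightarrow> continuous_on UNIV f \<and> (\<exists>B. \<forall>x. norm x > B \<longrightarrow> f x = 0)"

lemma cont_compact_supp_bdd:
  fixes f :: "'a::euclidean_space \<Rightarrow> complex"
  assumes "cont_compact_supp f" shows "bdd_compact_supp f"
proof -
  obtain B where B: "\<And>x. norm x > B \<Longrightarrow> f x = 0" and c: "continuous_on UNIV f"
    using assms unfolding cont_compact_supp_def by blast
  have "bounded (f ` cball 0 B)"
    by (intro compact_imp_bounded compact_continuous_image continuous_on_subset[OF c]) auto
  then obtain C where C: "\<And>x. norm x \<le> B \<Longrightarrow> cmod (f x) \<le> C"
    unfolding bounded_iff by (metis image_eqI mem_cball_0)
  show ?thesis unfolding bdd_compact_supp_def
  proof (intro conjI exI[of _ "max 0 (max B C)"] allI impI)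
    show "f \<in> borel_measurable borel" using c by (rule borel_measurable_continuous_onI)
    show "cmod (f x) \<le> max 0 (max B C)" for x
      using B[of x] C[of x] by (cases "norm x \<le> B") auto
  qed (use B in auto)
qed

text \<open>Lebesgue measurability supplies continuous functions converging to \<open>f\<close> off
  a negligible set, but without any bound or support. Clamping and cutting them off restores both,
  without disturbing the limit.\<close>

lemma cont_compact_supp_dense_bdd:
  fixes f :: "'a::euclidean_space \<Rightarrow> complex"
  assumes "bdd_compact_supp f"
  obtains F where "\<And>k. cont_compact_supp (F k)" "l2_tendsto F f"
proof -
  obtain B where B: "B > 0" "\<And>x. cmod (f x) \<le> B" "\<And>x. norm x > B \<Longrightarrow> f x = 0"
    using bdd_compact_supp_obtain[OF assms] by metis
  have f: "f \<in> borel_measurable borel" using assms by (simp add: bdd_compact_supp_def)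
  then have "f measurable_on UNIV"
    by (intro lebesgue_measurable_imp_measurable_on) (auto intro: measurable_completion)
  then obtain N g where N: "negligible N" and g: "\<And>n. continuous_on UNIV (g n)"
      and lim: "\<And>x. x \<notin> N \<Longrightarrow> (\<lambda>n. g n x) \<longlonglongrightarrow> f x"
    unfolding measurable_on_def by auto
  \<comment> \<open>\<open>cl\<close> is the radial retraction onto the disc of radius
    \<open>B\<close>, and \<open>\<rho>\<close> is a continuous cutoff equal to 1 on the ball of
    radius \<open>B\<close> and to 0 outside radius \<open>B + 1\<close>; together they fix every
    value of \<open>f\<close>.\<close>
  define cl where "cl z = complex_of_real (B / max B (cmod z)) * z" for z
  define \<rho> where "\<rho> x = complex_of_real (max 0 (min 1 (B + 1 - norm x)))" for x :: 'a
  define F where "F n x = \<rho> x * cl (g n x)" for n x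
  have cl_cont: "continuous_on UNIV cl" unfolding cl_def
    using B(1) by (intro continuous_intros) (auto simp: max_def)
  have \<rho>_cont: "continuous_on UNIV \<rho>" unfolding \<rho>_def by (intro continuous_intros)
  have Fc: "continuous_on UNIV (F n)" for n unfolding F_def
    by (intro continuous_intros \<rho>_cont continuous_on_compose2[OF cl_cont g]) auto
  have F0: "F n x = 0" if "norm x > B + 1" for n x
    using that B(1) by (simp add: F_def \<rho>_def)
  have 1: "cont_compact_supp (F n)" for n
    unfolding cont_compact_supp_def using Fc F0 by blast
  have cl_le: "cmod (cl z) \<le> B" for z
  proof -
    have "B / max B (cmod z) * cmod z \<le> B"
      using B(1) by (simp add: divide_simps max_def)
    then show ?thesis using B(1) by (simp add: cl_def norm_mult norm_divide max_def split: if_splits)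
  qed
  have \<rho>_le: "cmod (\<rho> x) \<le> 1" for x by (simp add: \<rho>_def)
  have F_le: "cmod (F n x) \<le> B" for n x
    unfolding F_def norm_mult using mult_mono[OF \<rho>_le[of x] cl_le[of "g n x"]] by simp
  have N': "AE x in lborel. x \<notin> N"
    using N AE_not_in[of N lebesgue] by (simp add: negligible_iff_null_sets AE_completion_iff)
  have "l2_tendsto F f"
  proof (rule l2_tendsto_dominated[where g = "\<lambda>x. complex_of_real (2 * B) * indicator (cball 0 (B+1)) x"])
    show "F k \<in> borel_measurable borel" for k using Fc by (rule borel_measurable_continuous_onI)
    show "(\<lambda>x. complex_of_real (2 * B) * indicator (cball 0 (B+1)) x) \<in> (L2 :: ('a \<Rightarrow> complex) set)"
    proof (rule bdd_compact_supp_L1_L2(2), unfold bdd_compact_supp_def, intro conjI exI[of _ "2 * B + 1"])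
    qed (use B(1) in \<open>auto simp: norm_mult indicator_def\<close>)
    show "AE x in lborel. (\<lambda>k. F k x) \<longlonglongrightarrow> f x"
      using N'
    proof eventually_elim
      fix x assume "x \<notin> N"
      have "(\<lambda>k. \<rho> x * cl (g k x)) \<longlonglongrightarrow> \<rho> x * cl (f x)"
        using cl_cont lim[OF \<open>x \<notin> N\<close>]
        by (intro tendsto_intros continuous_on_tendsto_compose[where f = cl]) auto
      moreover have "\<rho> x * cl (f x) = f x"
        using B(1) B(2)[of x] B(3)[of x]
        by (cases "norm x \<le> B") (auto simp: cl_def \<rho>_def max_def min_def)
      ultimately show "(\<lambda>k. F k x) \<longlonglongrightarrow> f x" unfolding F_def by simp
    qed
    show "AE x in lborel. cmod (F k x - f x) \<le> cmod (complex_of_real (2 * B) * indicator (cball 0 (B+1)) x)" for k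
    proof (intro AE_I2)
      fix x :: 'a
      show "cmod (F k x - f x) \<le> cmod (complex_of_real (2 * B) * indicator (cball 0 (B+1)) x)"
      proof (cases "norm x \<le> B + 1")
        case True
        have "cmod (F k x - f x) \<le> B + B"
          using norm_triangle_ineq4[of "F k x" "f x"] F_le[of k x] B(2)[of x] by linarith
        then show ?thesis using True B(1) by (simp add: norm_mult)
      next
        case False
        then show ?thesis using F0[of x k] B(3)[of x] by simp
      qed
    qed
  qed (rule f)
  then show ?thesis using that 1 by blast
qed

lemma cont_compact_supp_dense:
  fixes f :: "'a::euclidean_space \<Rightarrow> complex"
  assumes f: "f \<in> L2" and e: "e > 0"
  obtains g where "cont_compact_supp g" "nsq (\<lambda>x. f x - g x) < e"
proof -
  obtain F where F: "\<And>k. bdd_compact_supp (F k)" "l2_tendsto F f"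
    using bdd_compact_supp_dense_seq[OF f] by metis
  have FL: "F k \<in> L2" for k using F(1) bdd_compact_supp_L1_L2 by blast
  have "(\<lambda>k. nsq (\<lambda>x. F k x - f x)) \<longlonglongrightarrow> 0"
    using F(2) l2_tendsto_iff[of F f] FL f by blast
  then have "\<forall>\<^sub>F k in sequentially. nsq (\<lambda>x. F k x - f x) < e / 4"
    by (rule order_tendstoD) (use e in simp)
  then obtain k where k: "nsq (\<lambda>x. F k x - f x) < e / 4"
    using eventually_happens' sequentially_bot by blast
  obtain G where G: "\<And>j. cont_compact_supp (G j)" "l2_tendsto G (F k)"
    using cont_compact_supp_dense_bdd[OF F(1)] by metis
  have GL: "G j \<in> L2" for j using G(1) cont_compact_supp_bdd bdd_compact_supp_L1_L2 by blast
  have "(\<lambda>j. nsq (\<lambda>x. G j x - F k x)) \<longlonglongrightarrow> 0"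
    using G(2) l2_tendsto_iff[of G "F k"] GL FL by blast
  then have "\<forall>\<^sub>F j in sequentially. nsq (\<lambda>x. G j x - F k x) < e / 4"
    by (rule order_tendstoD) (use e in simp)
  then obtain j where j: "nsq (\<lambda>x. G j x - F k x) < e / 4"
    using eventually_happens' sequentially_bot by blast
  have "nsq (\<lambda>x. f x - G j x) < e"
    using nsq_triangle[OF f FL[of k] GL[of j]] j k
    by (simp add: nsq_swap[of f "F k"] nsq_swap[of "F k" "G j"])
  then show ?thesis using that G(1) by blast
qed

section \<open>Orthonormal bases\<close>

lemma L2_lincomb: "(\<And>i. i \<in> I \<Longrightarrow> e i \<in> L2) \<Longrightarrow> (\<lambda>x. \<Sum>i\<in>I. c i * e i x) \<in> L2"
  by (intro L2_sum L2_cmult)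

lemma
  assumes I: "finite I" and e: "\<And>i. i \<in> I \<Longrightarrow> e i \<in> L2"
    and on: "\<And>i j. i \<in> I \<Longrightarrow> j \<in> I \<Longrightarrow> l2_inner (e i) (e j) = (if i = j then 1 else 0)"
  shows nsq_orthonormal_sum: "nsq (\<lambda>x. \<Sum>i\<in>I. c i * e i x) = (\<Sum>i\<in>I. (cmod (c i))\<^sup>2)"
    and l2_inner_orthonormal_sum: "\<And>j. j \<in> I \<Longrightarrow> l2_inner (\<lambda>x. \<Sum>i\<in>I. c i * e i x) (e j) = c j"
    and nsq_diff_projection: "\<And>\<phi>. \<phi> \<in> L2 \<Longrightarrow>
      nsq (\<lambda>x. \<phi> x - (\<Sum>i\<in>I. l2_inner \<phi> (e i) * e i x)) = nsq \<phi> - (\<Sum>i\<in>I. (cmod (l2_inner \<phi> (e i)))\<^sup>2)"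
proof -
  have S: "(\<lambda>x. \<Sum>i\<in>I. c i * e i x) \<in> L2" for c using e by (rule L2_lincomb)
  have left: "l2_inner (\<lambda>x. \<Sum>i\<in>I. c i * e i x) \<psi> = (\<Sum>i\<in>I. c i * l2_inner (e i) \<psi>)" if "\<psi> \<in> L2" for c \<psi>
    using e that by (subst l2_inner_sum_left) (auto simp: l2_inner_cmult_left)
  show 1: "l2_inner (\<lambda>x. \<Sum>i\<in>I. c i * e i x) (e j) = c j" if "j \<in> I" for j c
    using that e I by (simp add: left on if_distrib[of "\<lambda>z. _ * z"] sum.delta' cong: if_cong)
  have 2: "l2_inner (\<lambda>x. \<Sum>i\<in>I. c i * e i x) (\<lambda>x. \<Sum>i\<in>I. c i * e i x) = (\<Sum>i\<in>I. complex_of_real ((cmod (c i))\<^sup>2))" for c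
  proof -
    have "l2_inner (e i) (\<lambda>x. \<Sum>i\<in>I. c i * e i x) = cnj (c i)" if "i \<in> I" for i
      using 1[OF that] by (subst l2_inner_commute) simp
    then show ?thesis by (simp add: left S complex_norm_square del: of_real_power)
  qed
  show nsq: "nsq (\<lambda>x. \<Sum>i\<in>I. c i * e i x) = (\<Sum>i\<in>I. (cmod (c i))\<^sup>2)" for c
  proof -
    have "complex_of_real (nsq (\<lambda>x. \<Sum>i\<in>I. c i * e i x)) = complex_of_real (\<Sum>i\<in>I. (cmod (c i))\<^sup>2)"
      using 2[of c] unfolding l2_inner_self[OF S] of_real_sum .
    then show ?thesis by (simp only: of_real_eq_iff)
  qed
  show "nsq (\<lambda>x. \<phi> x - (\<Sum>i\<in>I. l2_inner \<phi> (e i) * e i x)) = nsq \<phi> - (\<Sum>i\<in>I. (cmod (l2_inner \<phi> (e i)))\<^sup>2)"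
    if "\<phi> \<in> L2" for \<phi>
  proof -
    have "l2_inner \<phi> (\<lambda>x. \<Sum>i\<in>I. l2_inner \<phi> (e i) * e i x)
        = cnj (\<Sum>i\<in>I. l2_inner \<phi> (e i) * l2_inner (e i) \<phi>)"
      by (subst l2_inner_commute) (simp add: left that)
    also have "\<dots> = (\<Sum>i\<in>I. complex_of_real ((cmod (l2_inner \<phi> (e i)))\<^sup>2))"
      by (simp add: l2_inner_commute[of "e _" \<phi>] complex_norm_square mult.commute del: of_real_power)
    finally have "Re (l2_inner \<phi> (\<lambda>x. \<Sum>i\<in>I. l2_inner \<phi> (e i) * e i x)) = (\<Sum>i\<in>I. (cmod (l2_inner \<phi> (e i)))\<^sup>2)"
      by simp
    then show ?thesis using nsq_diff[OF that S, of "\<lambda>i. l2_inner \<phi> (e i)"] nsq by simp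
  qed
qed

lemma bessel_inequality:
  assumes "finite I" "\<And>i. i \<in> I \<Longrightarrow> e i \<in> L2"
    and "\<And>i j. i \<in> I \<Longrightarrow> j \<in> I \<Longrightarrow> l2_inner (e i) (e j) = (if i = j then 1 else 0)"
    and "\<phi> \<in> L2"
  shows "(\<Sum>i\<in>I. (cmod (l2_inner \<phi> (e i)))\<^sup>2) \<le> nsq \<phi>"
proof -
  have "0 \<le> nsq (\<lambda>x. \<phi> x - (\<Sum>i\<in>I. l2_inner \<phi> (e i) * e i x))" by simp
  then show ?thesis using nsq_diff_projection[of I e \<phi>] assms by simp
qed

lemma l2_onb_L2: "l2_onb e \<Longrightarrow> e i \<in> L2"
  and l2_onb_inner: "l2_onb e \<Longrightarrow> l2_inner (e i) (e j) = (if i = j then 1 else 0)"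
  and l2_onb_total: "l2_onb e \<Longrightarrow> \<phi> \<in> L2 \<Longrightarrow> (\<And>i. l2_inner \<phi> (e i) = 0) \<Longrightarrow> AE x in lborel. \<phi> x = 0"
  unfolding l2_onb_def by auto

lemma l2_onb_nsq: "l2_onb e \<Longrightarrow> nsq (e i) = 1"
  using l2_inner_self[OF l2_onb_L2, of e i] by (simp add: l2_onb_inner)

lemma riesz_fischer:
  assumes e: "l2_onb e" and c: "summable (\<lambda>i. (cmod (c i))\<^sup>2)"
  obtains \<phi> where "\<phi> \<in> L2" "\<And>i. l2_inner \<phi> (e i) = c i"
    "l2_tendsto (\<lambda>n x. \<Sum>i<n. c i * e i x) \<phi>"
proof -
  let ?S = "\<lambda>n x. \<Sum>i<n. c i * e i x"
  note eL = l2_onb_L2[OF e] and eo = l2_onb_inner[OF e]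
  have S: "?S n \<in> L2" for n using eL by (rule L2_lincomb)
  have *: "nsq (\<lambda>x. ?S n x - ?S m x) = (\<Sum>i\<in>{m..<n}. (cmod (c i))\<^sup>2)" if "m \<le> n" for m n
  proof -
    have "(\<lambda>x. ?S n x - ?S m x) = (\<lambda>x. \<Sum>i\<in>{m..<n}. c i * e i x)"
      using that by (simp add: lessThan_atLeast0 sum_diff_nat_ivl)
    then show ?thesis by (simp add: nsq_orthonormal_sum eL eo)
  qed
  obtain \<phi> where \<phi>: "\<phi> \<in> L2" "l2_tendsto ?S \<phi>"
  proof (rule l2_complete[of ?S])
    fix r :: real assume "r > 0"
    then obtain N where N: "\<And>m n. m \<ge> N \<Longrightarrow> norm (\<Sum>i\<in>{m..<n}. (cmod (c i))\<^sup>2) < r"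
      using c unfolding summable_Cauchy by blast
    have "nsq (\<lambda>x. ?S m x - ?S n x) < r" if "m \<ge> N" "n \<ge> N" for m n
    proof (cases "m \<le> n")
      case True then show ?thesis using *[OF True] N[OF that(1), of n] by (simp add: nsq_swap[of "?S m"])
    next
      case False then show ?thesis using *[of n m] N[OF that(2), of m] by simp
    qed
    then show "\<exists>N. \<forall>m\<ge>N. \<forall>n\<ge>N. nsq (\<lambda>x. ?S m x - ?S n x) < r" by blast
  qed (use S in auto)
  have "l2_inner \<phi> (e i) = c i" for i
  proof (rule LIMSEQ_unique)
    show "(\<lambda>n. l2_inner (?S n) (e i)) \<longlonglongrightarrow> l2_inner \<phi> (e i)"
      by (intro l2_inner_tendsto_left S \<phi> eL)
    have "\<forall>\<^sub>F n in sequentially. l2_inner (?S n) (e i) = c i"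
      using eventually_gt_at_top[of i]
      by eventually_elim (simp add: l2_inner_orthonormal_sum eL eo)
    then show "(\<lambda>n. l2_inner (?S n) (e i)) \<longlonglongrightarrow> c i" by (rule tendsto_eventually)
  qed
  then show ?thesis using that \<phi> by blast
qed

lemma summable_coeffs:
  assumes e: "l2_onb e" and "\<phi> \<in> L2"
  shows "summable (\<lambda>i. (cmod (l2_inner \<phi> (e i)))\<^sup>2)"
  by (rule summableI_nonneg_bounded[where x = "nsq \<phi>"])
    (auto intro!: bessel_inequality simp: assms l2_onb_L2[OF e] l2_onb_inner[OF e])

text \<open>The series converges to some function by \<open>riesz_fischer\<close>; that function has
  the same coefficients as \<open>\<phi>\<close>, so totality of the basis identifies the
  two.\<close>

lemma l2_onb_expansion:
  assumes e: "l2_onb e" and \<phi>: "\<phi> \<in> L2"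
  shows "l2_tendsto (\<lambda>n x. \<Sum>i<n. l2_inner \<phi> (e i) * e i x) \<phi>"
proof -
  obtain \<psi> where \<psi>: "\<psi> \<in> L2" "\<And>i. l2_inner \<psi> (e i) = l2_inner \<phi> (e i)"
      "l2_tendsto (\<lambda>n x. \<Sum>i<n. l2_inner \<phi> (e i) * e i x) \<psi>"
    by (rule riesz_fischer[OF e summable_coeffs[OF e \<phi>]]) blast
  have "AE x in lborel. \<psi> x - \<phi> x = 0"
    using \<psi> \<phi> by (intro l2_onb_total[OF e]) (auto simp: l2_inner_diff_left l2_onb_L2[OF e])
  then have "l2_norm_sq (\<lambda>x. (\<Sum>i<n. l2_inner \<phi> (e i) * e i x) - \<psi> x)
      = l2_norm_sq (\<lambda>x. (\<Sum>i<n. l2_inner \<phi> (e i) * e i x) - \<phi> x)" for n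
    by (intro l2_norm_sq_cong_AE) auto
  then show ?thesis using \<psi>(3) unfolding l2_tendsto_def by simp
qed

lemma parseval_sums:
  assumes e: "l2_onb e" and \<phi>: "\<phi> \<in> L2"
  shows "(\<lambda>i. (cmod (l2_inner \<phi> (e i)))\<^sup>2) sums nsq \<phi>"
proof -
  have "(\<lambda>n. nsq (\<lambda>x. \<Sum>i<n. l2_inner \<phi> (e i) * e i x)) \<longlonglongrightarrow> nsq \<phi>"
    using \<phi> by (intro nsq_tendsto l2_onb_expansion[OF e] L2_lincomb l2_onb_L2[OF e])
  then show ?thesis
    unfolding sums_def by (simp add: nsq_orthonormal_sum l2_onb_L2[OF e] l2_onb_inner[OF e])
qed

lemma parseval:
  assumes e: "l2_onb e" and \<phi>: "\<phi> \<in> L2"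
  shows "(\<Sum>i. ennreal ((cmod (l2_inner \<phi> (e i)))\<^sup>2)) = l2_norm_sq \<phi>"
  unfolding l2_norm_sq_eq[OF \<phi>] by (rule suminf_ennreal_eq[OF _ parseval_sums[OF assms]]) simp

lemma parseval_inner_sums:
  assumes e: "l2_onb e" and \<phi>: "\<phi> \<in> L2" and \<psi>: "\<psi> \<in> L2"
  shows "(\<lambda>i. l2_inner \<phi> (e i) * l2_inner (e i) \<psi>) sums l2_inner \<phi> \<psi>"
proof -
  have "(\<lambda>n. l2_inner (\<lambda>x. \<Sum>i<n. l2_inner \<phi> (e i) * e i x) \<psi>) \<longlonglongrightarrow> l2_inner \<phi> \<psi>"
    using \<phi> \<psi> by (intro l2_inner_tendsto_left l2_onb_expansion[OF e] L2_lincomb l2_onb_L2[OF e])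
  moreover have "l2_inner (\<lambda>x. \<Sum>i<n. l2_inner \<phi> (e i) * e i x) \<psi> = (\<Sum>i<n. l2_inner \<phi> (e i) * l2_inner (e i) \<psi>)" for n
    using l2_onb_L2[OF e] \<psi> by (subst l2_inner_sum_left) (auto simp: l2_inner_cmult_left)
  ultimately show ?thesis unfolding sums_def by simp
qed

text \<open>An integral operator applied to a basis vector pairs its kernel with the conjugate of
  that vector, so Parseval for kernels runs over the conjugate basis.\<close>

lemma l2_onb_cnj:
  assumes e: "l2_onb e" shows "l2_onb (\<lambda>i x. cnj (e i x))"
proof -
  have inner: "l2_inner (\<lambda>x. cnj (f x)) (\<lambda>x. cnj (g x)) = cnj (l2_inner f g)" for f g :: "'a \<Rightarrow> complex"
    unfolding l2_inner_def Bochner_Integration.integral_cnj[symmetric] by simp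
  show ?thesis
    unfolding l2_onb_def
  proof (intro conjI allI ballI impI)
    fix \<phi> :: "'a \<Rightarrow> complex" assume \<phi>: "\<phi> \<in> L2" and 0: "\<forall>i. l2_inner \<phi> (\<lambda>x. cnj (e i x)) = 0"
    have "AE x in lborel. cnj (\<phi> x) = 0"
    proof (rule l2_onb_total[OF e L2_cnj[OF \<phi>]])
      show "l2_inner (\<lambda>x. cnj (\<phi> x)) (e i) = 0" for i
        using inner[of "\<lambda>x. cnj (\<phi> x)" "e i"] 0 by simp
    qed
    then show "AE x in lborel. \<phi> x = 0" by simp
  qed (use e in \<open>auto simp: inner l2_onb_def\<close>)
qed

section \<open>Separability and the existence of an orthonormal basis\<close>

text \<open>The set where \<open>Re (c * h x)\<close> is positive is itself a test set, on which a
  nonnegative function then has integral zero. The values 1, -1, \<open>\<i>\<close>,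
  \<open>- \<i>\<close> of \<open>c\<close> pin down real and imaginary part from both
  sides.\<close>

lemma L1_zero_if_integrals_zero:
  fixes h :: "'a::euclidean_space \<Rightarrow> complex"
  assumes h: "integrable lborel h"
    and z: "\<And>A. A \<in> sets borel \<Longrightarrow> (LINT x:A|lborel. h x) = 0"
  shows "AE x in lborel. h x = 0"
proof -
  note [measurable] = borel_measurable_integrable[OF h]
  have *: "AE x in lborel. Re (c * h x) \<le> 0" for c
  proof -
    let ?A = "{x. Re (c * h x) > 0}"
    have A: "?A \<in> sets borel" by measurable
    then have int: "integrable lborel (\<lambda>x. indicator ?A x *\<^sub>R h x)"
      using integrable_mult_indicator[of ?A lborel h] h by simp
    define g where "g x = indicator ?A x *\<^sub>R h x" for x
    have int': "integrable lborel (\<lambda>x. c * g x)"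
      using int unfolding g_def by (rule Bochner_Integration.integrable_mult_right)
    have "(LINT x|lborel. Re (c * g x)) = Re (c * (LINT x|lborel. g x))"
      using integral_Re[OF int'] by (simp only: integral_mult_right_zero)
    also have "\<dots> = 0" using z[OF A] unfolding set_lebesgue_integral_def g_def by simp
    finally have "AE x in lborel. Re (c * g x) = 0"
      by (subst (asm) integral_nonneg_eq_0_iff_AE)
        (use integrable_Re[OF int'] in \<open>auto simp: g_def indicator_def\<close>)
    then show ?thesis by eventually_elim (auto simp: g_def indicator_def split: if_splits)
  qed
  show ?thesis
    using *[of 1] *[of "-1"] *[of \<i>] *[of "-\<i>"]
    by eventually_elim (auto simp: complex_eq_iff)
qed

text \<open>The total family consists of indicators of a countable pi-system cut off by balls, so
  that they are square-integrable. Orthogonality spreads from the pi-system to all Borel sets by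
  Dynkin induction, and integrals that vanish on all Borel sets force the function to
  vanish.\<close>

lemma ex_countable_total:
  obtains S :: "('a::euclidean_space \<Rightarrow> complex) set"
  where "countable S" "S \<subseteq> L2"
    "\<And>\<phi>. \<phi> \<in> L2 \<Longrightarrow> (\<And>s. s \<in> S \<Longrightarrow> l2_inner \<phi> s = 0) \<Longrightarrow> AE x in lborel. \<phi> x = 0"
proof -
  obtain B :: "'a set set" where B: "countable B" "topological_basis B"
    using ex_countable_basis by blast
  \<comment> \<open>Finite intersections keep the base countable and make it stable under
    intersection; the empty intersection contributes \<open>UNIV\<close>, from which the complement
    case of the induction starts.\<close>
  define G where "G = Inter ` {F. F \<subseteq> B \<and> finite F}"
  have G: "countable G" unfolding G_def
    using countable_Collect_finite_subset[OF B(1)] by (simp add: conj_commute)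
  have BG: "B \<subseteq> G" unfolding G_def by (force intro!: image_eqI[where x = "{_}"])
  have UG: "UNIV \<in> G" unfolding G_def by (force intro!: image_eqI[where x = "{}"])
  have Gopen: "open A" if "A \<in> G" for A
    using that B(2) topological_basis_open unfolding G_def by (auto intro!: open_Inter)
  have GInt: "Int_stable G"
  proof (rule Int_stableI)
    fix a b assume "a \<in> G" "b \<in> G"
    then obtain F F' where "a = \<Inter>F" "b = \<Inter>F'" "F \<subseteq> B" "finite F" "F' \<subseteq> B" "finite F'"
      unfolding G_def by blast
    then show "a \<inter> b \<in> G" unfolding G_def by (intro image_eqI[where x = "F \<union> F'"]) auto
  qed
  have gen: "sets borel = sigma_sets UNIV G"
  proof -
    have "sets borel = sigma_sets UNIV B"
      by (subst borel_eq_countable_basis[OF B]) (simp add: sets_measure_of)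
    also have "\<dots> \<subseteq> sigma_sets UNIV G" by (rule sigma_sets_mono') (rule BG)
    finally have 1: "sets borel \<subseteq> sigma_sets UNIV G" .
    have "sigma_sets UNIV G \<subseteq> sets (borel :: 'a measure)"
    proof -
      have "G \<subseteq> sets borel" using Gopen by auto
      then show ?thesis using sets.sigma_sets_subset[of G "borel :: 'a measure"] by simp
    qed
    then show ?thesis using 1 by auto
  qed
  define s where "s A n = (\<lambda>x. indicator (A \<inter> ball (0::'a) (real n)) x :: complex)" for A n
  define S where "S = (\<lambda>(A, n). s A n) ` (G \<times> UNIV)"
  have sL: "s A n \<in> L2" if "A \<in> sets borel" for A n
  proof (rule bdd_compact_supp_L1_L2(2), unfold bdd_compact_supp_def, intro conjI exI[of _ "real n + 1"])
    show "s A n \<in> borel_measurable borel" unfolding s_def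
      using that by (intro borel_measurable_indicator sets.Int) auto
  qed (auto simp: s_def indicator_def)
  show ?thesis
  proof (rule that[of S])
    show "countable S" unfolding S_def using G by (intro countable_image countable_SIGMA) auto
    show "S \<subseteq> L2" unfolding S_def using sL Gopen by auto
    fix \<phi> :: "'a \<Rightarrow> complex" assume \<phi>: "\<phi> \<in> L2" and 0: "\<And>s. s \<in> S \<Longrightarrow> l2_inner \<phi> s = 0"
    note [measurable] = \<phi>
    have "AE x in lborel. indicator (ball 0 (real n)) x * \<phi> x = 0" for n
    proof (rule L1_zero_if_integrals_zero)
      have "integrable lborel (\<lambda>x. \<phi> x * s UNIV n x)"
        by (intro integrable_L2_mult \<phi> sL) auto
      then show h: "integrable lborel (\<lambda>x. indicator (ball 0 (real n)) x * \<phi> x)"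
        by (simp add: s_def mult.commute)
      have hA: "set_integrable lborel A (\<lambda>x. indicator (ball 0 (real n)) x * \<phi> x)" if "A \<in> sets borel" for A
        unfolding set_integrable_def using integrable_mult_indicator[OF _ h, of A] that by simp
      fix A :: "'a set" assume "A \<in> sets borel"
      then have "A \<in> sigma_sets UNIV G" by (simp add: gen)
      with GInt Pow_UNIV[THEN equalityD2, THEN order_trans[OF subset_UNIV[of G]]]
      show "(LINT x:A|lborel. indicator (ball 0 (real n)) x * \<phi> x) = 0"
      proof (induction rule: sigma_sets_induct_disjoint)
        case (basic A)
        then have "l2_inner \<phi> (s A n) = 0" using 0 unfolding S_def by auto
        moreover have "indicator A x *\<^sub>R (indicator (ball 0 (real n)) x * \<phi> x) = \<phi> x * cnj (s A n x)" for x
          by (auto simp: s_def indicator_def)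
        ultimately show ?case unfolding set_lebesgue_integral_def l2_inner_def by simp
      next
        case empty show ?case by (simp add: set_lebesgue_integral_def)
      next
        case (compl A)
        have A: "A \<in> sets borel" using compl gen by simp
        have "l2_inner \<phi> (s UNIV n) = 0" using 0 UG unfolding S_def by auto
        then have U: "(LINT x:UNIV|lborel. indicator (ball 0 (real n)) x * \<phi> x) = 0"
        proof -
          have "indicator UNIV x *\<^sub>R (indicator (ball 0 (real n)) x * \<phi> x) = \<phi> x * cnj (s UNIV n x)" for x
            by (auto simp: s_def indicator_def)
          then show ?thesis using \<open>l2_inner \<phi> (s UNIV n) = 0\<close>
            unfolding set_lebesgue_integral_def l2_inner_def by (simp only:)
        qed
        have "(LINT x:A \<union> (UNIV - A)|lborel. indicator (ball 0 (real n)) x * \<phi> x)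
           = (LINT x:A|lborel. indicator (ball 0 (real n)) x * \<phi> x) + (LINT x:UNIV - A|lborel. indicator (ball 0 (real n)) x * \<phi> x)"
          using A by (intro set_integral_Un hA) auto
        then show ?case using U compl by simp
      next
        case (union A)
        have A: "A i \<in> sets borel" for i using union gen by auto
        have "(LINT x:(\<Union>i. A i)|lborel. indicator (ball 0 (real n)) x * \<phi> x)
          = (\<Sum>i. (LINT x:A i|lborel. indicator (ball 0 (real n)) x * \<phi> x))"
          using A union by (intro lebesgue_integral_countable_add hA) (auto simp: disjoint_family_on_def)
        then show ?case using union by simp
      qed
    qed
    then have "AE x in lborel. \<forall>n. indicator (ball 0 (real n)) x * \<phi> x = 0"
      by (subst AE_all_countable) auto
    then show "AE x in lborel. \<phi> x = 0"
    proof eventually_elim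
      fix x :: 'a assume *: "\<forall>n. indicator (ball 0 (real n)) x * \<phi> x = 0"
      obtain n where "norm x < real n" using reals_Archimedean2 by blast
      then show "\<phi> x = 0" using *[rule_format, of n] by simp
    qed
  qed
qed

text \<open>Indicators of disjoint unit cubes along the diagonal. Placed at the bottom of the Zorn
  argument, this family makes the maximal orthonormal set infinite, so that it can be enumerated by
  the natural numbers.\<close>

lemma ex_infinite_orthonormal:
  obtains q :: "nat \<Rightarrow> 'a::euclidean_space \<Rightarrow> complex"
  where "\<And>k. q k \<in> L2" "\<And>j k. l2_inner (q j) (q k) = (if j = k then 1 else 0)"
proof
  define Q where "Q k = box (real k *\<^sub>R One) (real (Suc k) *\<^sub>R (One :: 'a))" for k
  let ?q = "\<lambda>k x. complex_of_real (indicator (Q k) x)"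
  have Q [measurable]: "Q k \<in> sets borel" for k unfolding Q_def by simp
  have m: "emeasure lborel (Q k) = 1" for k
    unfolding Q_def by (subst emeasure_lborel_box) (auto simp: inner_diff_left algebra_simps)
  have disj: "Q j \<inter> Q k = {}" if "j \<noteq> k" for j k
  proof -
    have False if "x \<in> Q j" "x \<in> Q k" for x
    proof -
      obtain b :: 'a where b: "b \<in> Basis" using nonempty_Basis by blast
      have "real j < x \<bullet> b \<and> x \<bullet> b < real (Suc j)" "real k < x \<bullet> b \<and> x \<bullet> b < real (Suc k)"
        using that b unfolding Q_def mem_box by auto
      then have "real j < real (Suc k)" "real k < real (Suc j)" by linarith+
      then show False using \<open>j \<noteq> k\<close> by linarith
    qed
    then show ?thesis by blast
  qed
  show "?q k \<in> L2" for k
  proof -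
    have "integrable lborel (\<lambda>x. indicator (Q k) x :: real)"
      using Q m by (intro integrable_real_indicator) auto
    moreover have "(cmod (?q k x))\<^sup>2 = indicator (Q k) x" for x by (simp add: indicator_def)
    ultimately show ?thesis unfolding L2_iff by simp
  qed
  show "l2_inner (?q j) (?q k) = (if j = k then 1 else 0)" for j k
  proof -
    have "l2_inner (?q j) (?q k) = (LINT x|lborel. complex_of_real (indicator (Q j \<inter> Q k) x))"
      unfolding l2_inner_def by (intro Bochner_Integration.integral_cong) (auto simp: indicator_def)
    also have "\<dots> = complex_of_real (measure lborel (Q j \<inter> Q k))"
      unfolding integral_complex_of_real by simp
    finally show ?thesis using m[of k] disj[of j k] by (auto simp: measure_def)
  qed
qed

text \<open>Every member of \<open>M\<close> has a nonzero inner product with some element of a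
  countable total set, and by Bessel each such element sees only finitely many members of
  \<open>M\<close> above a given threshold 1/(n+1).\<close>

lemma countable_orthonormal:
  fixes M :: "('a::euclidean_space \<Rightarrow> complex) set"
  assumes M: "M \<subseteq> L2" "\<And>b c. b \<in> M \<Longrightarrow> c \<in> M \<Longrightarrow> l2_inner b c = (if b = c then 1 else 0)"
  shows "countable M"
proof -
  obtain S :: "('a \<Rightarrow> complex) set" where S: "countable S" "S \<subseteq> L2"
      "\<And>\<phi>. \<phi> \<in> L2 \<Longrightarrow> (\<And>s. s \<in> S \<Longrightarrow> l2_inner \<phi> s = 0) \<Longrightarrow> AE x in lborel. \<phi> x = 0"
    using ex_countable_total by metis
  define C where "C s n = {b \<in> M. (cmod (l2_inner s b))\<^sup>2 > 1 / real (Suc n)}" for s n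
  have fin: "finite (C s n)" if s: "s \<in> S" for s n
  proof (rule ccontr)
    assume "infinite (C s n)"
    obtain N where N: "real N > real (Suc n) * nsq s" using reals_Archimedean2 by blast
    obtain F where F: "finite F" "card F = N" "F \<subseteq> C s n"
      using infinite_arbitrarily_large[OF \<open>infinite (C s n)\<close>] by blast
    have "real N * (1 / real (Suc n)) = (\<Sum>b\<in>F. 1 / real (Suc n))" using F by simp
    also have "\<dots> \<le> (\<Sum>b\<in>F. (cmod (l2_inner s b))\<^sup>2)"
      using F by (intro sum_mono) (auto simp: C_def)
    also have "\<dots> \<le> nsq s"
    proof (intro bessel_inequality)
      fix b c assume "b \<in> F" "c \<in> F"
      then show "l2_inner b c = (if b = c then 1 else 0)" using F by (intro M(2)) (auto simp: C_def)
    qed (use F M s S in \<open>auto simp: C_def\<close>)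
    finally show False using N by (simp add: field_simps)
  qed
  have "M \<subseteq> (\<Union>s\<in>S. \<Union>n. C s n)"
  proof
    fix b assume b: "b \<in> M"
    have "\<exists>s\<in>S. l2_inner s b \<noteq> 0"
    proof (rule ccontr)
      assume "\<not> ?thesis"
      then have "AE x in lborel. b x = 0"
        using S b M by (intro S(3)) (auto simp: l2_inner_commute[of b])
      then have "l2_inner b b = 0" using b M by (intro l2_inner_eq_0_left) auto
      then show False using M b by simp
    qed
    then obtain s where s: "s \<in> S" "(cmod (l2_inner s b))\<^sup>2 > 0" by auto
    obtain n where "inverse (real (Suc n)) < (cmod (l2_inner s b))\<^sup>2"
      using reals_Archimedean[OF s(2)] by blast
    then show "b \<in> (\<Union>s\<in>S. \<Union>n. C s n)"
      using s b unfolding C_def by (auto simp: inverse_eq_divide)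
  qed
  moreover have "countable (\<Union>s\<in>S. \<Union>n. C s n)"
    using S(1) fin by (auto intro!: countable_UN intro: countable_finite)
  ultimately show ?thesis by (rule countable_subset)
qed

text \<open>This existence is what gives meaning to \<open>l2_basis\<close>, which is a choice.
  Among orthonormal sets containing a fixed infinite one, a maximal set is total: a nonzero vector
  orthogonal to it could be normalised and added.\<close>

lemma ex_l2_onb: "\<exists>e :: nat \<Rightarrow> 'a::euclidean_space \<Rightarrow> complex. l2_onb e"
proof -
  define orth where "orth B \<longleftrightarrow> B \<subseteq> L2 \<and> (\<forall>b\<in>B. \<forall>c\<in>B. l2_inner b c = (if b = c then 1 else 0))"
    for B :: "('a \<Rightarrow> complex) set"
  obtain q :: "nat \<Rightarrow> 'a \<Rightarrow> complex" where q: "\<And>k. q k \<in> L2"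
      "\<And>j k. l2_inner (q j) (q k) = (if j = k then 1 else 0)"
    using ex_infinite_orthonormal by metis
  have qinj: "inj q"
  proof
    fix j k assume "q j = q k"
    then show "j = k" using q(2)[of j k] q(2)[of k k] by (auto split: if_splits)
  qed
  let ?A = "{B. range q \<subseteq> B \<and> orth B}"
  have "\<exists>M\<in>?A. \<forall>X\<in>?A. M \<subseteq> X \<longrightarrow> X = M"
  proof (rule subset_Zorn_nonempty)
    have "orth (range q)" unfolding orth_def using q by (auto simp: inj_eq[OF qinj])
    then show "?A \<noteq> {}" by blast
    fix \<C> assume \<C>: "\<C> \<noteq> {}" "subset.chain ?A \<C>"
    have "orth (\<Union>\<C>)" unfolding orth_def
    proof (intro conjI ballI)
      show "\<Union>\<C> \<subseteq> L2" using \<C> unfolding subset_chain_def orth_def by blast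
      fix b c assume "b \<in> \<Union>\<C>" "c \<in> \<Union>\<C>"
      then obtain X Y where "X \<in> \<C>" "Y \<in> \<C>" "b \<in> X" "c \<in> Y" by blast
      then obtain Z where "Z \<in> \<C>" "b \<in> Z" "c \<in> Z" using \<C>(2) unfolding subset_chain_def by blast
      then show "l2_inner b c = (if b = c then 1 else 0)"
        using \<C>(2) unfolding subset_chain_def orth_def by blast
    qed
    moreover have "range q \<subseteq> \<Union>\<C>" using \<C> unfolding subset_chain_def by blast
    ultimately show "\<Union>\<C> \<in> ?A" by simp
  qed
  then obtain M where M: "range q \<subseteq> M" "orth M" and max: "\<And>X. orth X \<Longrightarrow> M \<subseteq> X \<Longrightarrow> X = M"
    by (smt (verit) mem_Collect_eq order_trans)
  have MsubL2: "M \<subseteq> L2" and Mo: "\<And>b c. b \<in> M \<Longrightarrow> c \<in> M \<Longrightarrow> l2_inner b c = (if b = c then 1 else 0)"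
    using M(2) unfolding orth_def by auto
  have inf: "infinite M" using M(1) qinj finite_subset range_inj_infinite by blast
  have bij: "bij_betw (from_nat_into M) UNIV M"
    using countable_orthonormal[OF MsubL2 Mo] inf by (rule bij_betw_from_nat_into)
  have inM: "from_nat_into M i \<in> M" for i using bij bij_betwE by blast
  have "l2_onb (from_nat_into M)" unfolding l2_onb_def
  proof (intro conjI allI ballI impI)
    show "from_nat_into M i \<in> L2" for i using inM MsubL2 by blast
    show "l2_inner (from_nat_into M i) (from_nat_into M j) = (if i = j then 1 else 0)" for i j
    proof -
      have "from_nat_into M i = from_nat_into M j \<longleftrightarrow> i = j"
        using bij by (metis bij_betw_imp_inj_on inj_eq)
      then show ?thesis by (simp add: Mo inM)
    qed
    fix \<phi> :: "'a \<Rightarrow> complex" assume \<phi>: "\<phi> \<in> L2" and "\<forall>i. l2_inner \<phi> (from_nat_into M i) = 0"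
    then have 0: "l2_inner \<phi> b = 0" if "b \<in> M" for b using bij that by (metis bij_betw_iff_bijections)
    have "nsq \<phi> = 0"
    proof (rule ccontr)
      assume "nsq \<phi> \<noteq> 0"
      then have pos: "nsq \<phi> > 0" using nsq_nonneg[of \<phi>] by linarith
      define \<psi> where "\<psi> = (\<lambda>x. complex_of_real (1 / sqrt (nsq \<phi>)) * \<phi> x)"
      have \<psi>L: "\<psi> \<in> L2" unfolding \<psi>_def using \<phi> by blast
      have "nsq \<psi> = 1" unfolding \<psi>_def nsq_cmult using pos by (simp add: norm_divide power_divide)
      then have 1: "l2_inner \<psi> \<psi> = 1" using l2_inner_self[OF \<psi>L] by simp
      have b0: "l2_inner \<psi> b = 0" "l2_inner b \<psi> = 0" if "b \<in> M" for b
      proof -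
        show "l2_inner \<psi> b = 0" using 0[OF that] unfolding \<psi>_def l2_inner_cmult_left by simp
        then show "l2_inner b \<psi> = 0" by (subst l2_inner_commute) simp
      qed
      then have "\<psi> \<notin> M" using 1 by auto
      have "orth (insert \<psi> M)" unfolding orth_def
        using \<psi>L MsubL2 Mo 1 b0 \<open>\<psi> \<notin> M\<close> by auto
      then have "insert \<psi> M = M" by (rule max) auto
      then show False using \<open>\<psi> \<notin> M\<close> by blast
    qed
    then show "AE x in lborel. \<phi> x = 0" using \<phi> by (simp add: nsq_eq_0_iff)
  qed
  then show ?thesis by blast
qed

lemma l2_onb_basis: "l2_onb l2_basis"
  unfolding l2_basis_def using ex_l2_onb by (rule someI_ex)

section \<open>Operators\<close>

lemma AE_eq_trans:
  assumes "AE x in M. f x = g x" "AE x in M. g x = h x" shows "AE x in M. f x = h x"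
  using assms by eventually_elim simp

lemma AE_eq_sym: "AE x in M. f x = g x \<Longrightarrow> AE x in M. g x = f x"
  by (simp add: eq_commute)

lemma bounded_op_L2: "bounded_op T \<Longrightarrow> \<phi> \<in> L2 \<Longrightarrow> T \<phi> \<in> L2"
  unfolding bounded_op_def by blast

lemma bounded_op_linear:
  "bounded_op T \<Longrightarrow> \<phi> \<in> L2 \<Longrightarrow> \<psi> \<in> L2 \<Longrightarrow>
    AE x in lborel. T (\<lambda>x. a * \<phi> x + b * \<psi> x) x = a * T \<phi> x + b * T \<psi> x"
  unfolding bounded_op_def by blast

lemma bounded_op_add:
  "bounded_op T \<Longrightarrow> \<phi> \<in> L2 \<Longrightarrow> \<psi> \<in> L2 \<Longrightarrow> AE x in lborel. T (\<lambda>x. \<phi> x + \<psi> x) x = T \<phi> x + T \<psi> x"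
  using bounded_op_linear[of T \<phi> \<psi> 1 1] by simp

lemma bounded_op_diff:
  "bounded_op T \<Longrightarrow> \<phi> \<in> L2 \<Longrightarrow> \<psi> \<in> L2 \<Longrightarrow> AE x in lborel. T (\<lambda>x. \<phi> x - \<psi> x) x = T \<phi> x - T \<psi> x"
  using bounded_op_linear[of T \<phi> \<psi> 1 "-1"] by simp

lemma bounded_op_cmult:
  "bounded_op T \<Longrightarrow> \<phi> \<in> L2 \<Longrightarrow> AE x in lborel. T (\<lambda>x. a * \<phi> x) x = a * T \<phi> x"
  using bounded_op_linear[of T \<phi> \<phi> a 0] by simp

lemma bounded_op_bound:
  assumes "bounded_op T"
  obtains C where "C \<ge> 0" "\<And>\<phi>. \<phi> \<in> L2 \<Longrightarrow> nsq (T \<phi>) \<le> C * nsq \<phi>"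
proof -
  obtain C where C: "\<And>\<phi>. \<phi> \<in> L2 \<Longrightarrow> l2_norm_sq (T \<phi>) \<le> ennreal C * l2_norm_sq \<phi>"
    using assms unfolding bounded_op_def by blast
  have "nsq (T \<phi>) \<le> max 0 C * nsq \<phi>" if "\<phi> \<in> L2" for \<phi>
  proof -
    have "ennreal (nsq (T \<phi>)) \<le> ennreal (max 0 C) * ennreal (nsq \<phi>)"
      using C[OF that] that bounded_op_L2[OF assms that]
      by (simp add: l2_norm_sq_eq ennreal_max_0)
    then show ?thesis by (simp flip: ennreal_mult)
  qed
  then show ?thesis using that[of "max 0 C"] by simp
qed

lemma bounded_opI:
  fixes T :: "'a::euclidean_space op"
  assumes "\<And>\<phi>. \<phi> \<in> L2 \<Longrightarrow> T \<phi> \<in> L2"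
    and "\<And>\<phi> \<psi> a b. \<phi> \<in> L2 \<Longrightarrow> \<psi> \<in> L2 \<Longrightarrow> AE x in lborel. T (\<lambda>x. a * \<phi> x + b * \<psi> x) x = a * T \<phi> x + b * T \<psi> x"
    and "\<And>\<phi>. \<phi> \<in> L2 \<Longrightarrow> nsq (T \<phi>) \<le> C * nsq \<phi>" "C \<ge> 0"
  shows "bounded_op T"
  unfolding bounded_op_def
proof (intro conjI ballI allI exI[of _ C])
  fix \<phi> :: "'a \<Rightarrow> complex" assume "\<phi> \<in> L2"
  then show "l2_norm_sq (T \<phi>) \<le> ennreal C * l2_norm_sq \<phi>"
    using assms(1,3,4) by (simp add: l2_norm_sq_eq ennreal_leI flip: ennreal_mult)
qed (use assms in auto)

lemma bounded_op_tendsto: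
  assumes T: "bounded_op T" and F: "\<And>k. F k \<in> L2" and f: "f \<in> L2" and l: "l2_tendsto F f"
  shows "l2_tendsto (\<lambda>k. T (F k)) (T f)"
proof -
  obtain C where C: "C \<ge> 0" "\<And>\<phi>. \<phi> \<in> L2 \<Longrightarrow> nsq (T \<phi>) \<le> C * nsq \<phi>"
    using bounded_op_bound[OF T] by blast
  have TL: "T (F k) \<in> L2" "T f \<in> L2" for k using bounded_op_L2[OF T] F f by auto
  have eq: "nsq (\<lambda>x. T (F k) x - T f x) = nsq (T (\<lambda>x. F k x - f x))" for k
  proof -
    have "l2_norm_sq (\<lambda>x. T (F k) x - T f x) = l2_norm_sq (T (\<lambda>x. F k x - f x))"
      by (rule l2_norm_sq_cong_AE[OF AE_eq_sym[OF bounded_op_diff[OF T F f]]])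
    then show ?thesis
      using TL F f bounded_op_L2[OF T] by (simp add: l2_norm_sq_eq L2_diff)
  qed
  have "(\<lambda>k. nsq (\<lambda>x. F k x - f x)) \<longlonglongrightarrow> 0" using l l2_tendsto_iff[of F f] F f by blast
  then have *: "(\<lambda>k. C * nsq (\<lambda>x. F k x - f x)) \<longlonglongrightarrow> 0"
    using tendsto_mult_left[of _ 0 _ C] by simp
  have "(\<lambda>k. nsq (\<lambda>x. T (F k) x - T f x)) \<longlonglongrightarrow> 0"
    by (rule tendsto_sandwich[OF _ _ tendsto_const *]) (auto simp: eq intro!: always_eventually C F f)
  then show ?thesis using l2_tendsto_iff[of "\<lambda>k. T (F k)" "T f"] TL by blast
qed

lemma bounded_op_cong:
  assumes T: "bounded_op T" and \<phi>: "\<phi> \<in> L2" and \<psi>: "\<psi> \<in> L2" and eq: "AE x in lborel. \<phi> x = \<psi> x"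
  shows "AE x in lborel. T \<phi> x = T \<psi> x"
proof -
  obtain C where C: "C \<ge> 0" "\<And>\<phi>. \<phi> \<in> L2 \<Longrightarrow> nsq (T \<phi>) \<le> C * nsq \<phi>"
    using bounded_op_bound[OF T] by blast
  have "nsq (\<lambda>x. \<phi> x - \<psi> x) = 0"
    using \<phi> \<psi> eq by (subst nsq_eq_0_iff) auto
  then have "nsq (T (\<lambda>x. \<phi> x - \<psi> x)) = 0"
    using C(2)[OF L2_diff[OF \<phi> \<psi>]] nsq_nonneg[of "T (\<lambda>x. \<phi> x - \<psi> x)"] by simp
  then have "AE x in lborel. T (\<lambda>x. \<phi> x - \<psi> x) x = 0"
    using bounded_op_L2[OF T L2_diff[OF \<phi> \<psi>]] by (simp add: nsq_eq_0_iff)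
  then show ?thesis using bounded_op_diff[OF T \<phi> \<psi>] by eventually_elim simp
qed

lemma bounded_op_sum:
  assumes T: "bounded_op T" and e: "\<And>i. i \<in> I \<Longrightarrow> e i \<in> L2"
  shows "AE x in lborel. T (\<lambda>x. \<Sum>i\<in>I. c i * e i x) x = (\<Sum>i\<in>I. c i * T (e i) x)"
  using e
proof (induction I rule: infinite_finite_induct)
  case (insert j I)
  have "AE x in lborel. T (\<lambda>x. c j * e j x + (\<Sum>i\<in>I. c i * e i x)) x = T (\<lambda>x. c j * e j x) x + T (\<lambda>x. \<Sum>i\<in>I. c i * e i x) x"
    using insert by (intro bounded_op_add T L2_lincomb L2_cmult) auto
  moreover have "AE x in lborel. T (\<lambda>x. c j * e j x) x = c j * T (e j) x"
    using insert by (intro bounded_op_cmult T) auto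
  moreover have "AE x in lborel. T (\<lambda>x. \<Sum>i\<in>I. c i * e i x) x = (\<Sum>i\<in>I. c i * T (e i) x)"
    using insert by auto
  ultimately have "AE x in lborel. T (\<lambda>x. c j * e j x + (\<Sum>i\<in>I. c i * e i x)) x
      = c j * T (e j) x + (\<Sum>i\<in>I. c i * T (e i) x)"
    by eventually_elim simp
  then show ?case using insert(1,2) by simp
qed (use bounded_op_cmult[OF T L2_zero, of 0] in auto)

lemma bounded_op_comp:
  assumes S: "bounded_op S" and T: "bounded_op T"
  shows "bounded_op (\<lambda>\<phi>. S (T \<phi>))"
proof -
  obtain C where C: "C \<ge> 0" "\<And>\<phi>. \<phi> \<in> L2 \<Longrightarrow> nsq (S \<phi>) \<le> C * nsq \<phi>"
    using bounded_op_bound[OF S] by blast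
  obtain D where D: "D \<ge> 0" "\<And>\<phi>. \<phi> \<in> L2 \<Longrightarrow> nsq (T \<phi>) \<le> D * nsq \<phi>"
    using bounded_op_bound[OF T] by blast
  show ?thesis
  proof (rule bounded_opI)
    fix \<phi> \<psi> :: "'a \<Rightarrow> complex" and a b assume \<phi>: "\<phi> \<in> L2" and \<psi>: "\<psi> \<in> L2"
    have "AE x in lborel. S (T (\<lambda>x. a * \<phi> x + b * \<psi> x)) x = S (\<lambda>x. a * T \<phi> x + b * T \<psi> x) x"
      using \<phi> \<psi> by (intro bounded_op_cong[OF S] bounded_op_linear[OF T] L2_add L2_cmult bounded_op_L2[OF T])
    moreover have "AE x in lborel. S (\<lambda>x. a * T \<phi> x + b * T \<psi> x) x = a * S (T \<phi>) x + b * S (T \<psi>) x"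
      using \<phi> \<psi> by (intro bounded_op_linear[OF S] bounded_op_L2[OF T])
    ultimately show "AE x in lborel. S (T (\<lambda>x. a * \<phi> x + b * \<psi> x)) x = a * S (T \<phi>) x + b * S (T \<psi>) x"
      by (rule AE_eq_trans)
  next
    fix \<phi> :: "'a \<Rightarrow> complex" assume \<phi>: "\<phi> \<in> L2"
    have "nsq (S (T \<phi>)) \<le> C * nsq (T \<phi>)" using C \<phi> bounded_op_L2[OF T] by auto
    also have "\<dots> \<le> C * (D * nsq \<phi>)" using D \<phi> C by (intro mult_left_mono) auto
    finally show "nsq (S (T \<phi>)) \<le> C * D * nsq \<phi>" by (simp add: mult.assoc)
  qed (use C D in \<open>auto intro: bounded_op_L2[OF S] bounded_op_L2[OF T]\<close>)
qed

text \<open>Operators act on representatives, so they can be compared only almost everywhere.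
  Membership of both images in \<open>L2\<close> is built in, so that chains of such equalities
  carry no side conditions.\<close>

definition op_eq :: "'a::euclidean_space op \<Rightarrow> 'a op \<Rightarrow> bool" where
  "op_eq S T \<longleftrightarrow> (\<forall>\<phi>\<in>L2. S \<phi> \<in> L2 \<and> T \<phi> \<in> L2 \<and> (AE x in lborel. S \<phi> x = T \<phi> x))"

lemma op_eq_sym: "op_eq S T \<Longrightarrow> op_eq T S"
  unfolding op_eq_def using AE_eq_sym by blast

lemma op_eq_trans: "op_eq R S \<Longrightarrow> op_eq S T \<Longrightarrow> op_eq R T"
  unfolding op_eq_def using AE_eq_trans by blast

text \<open>Boundedness of \<open>S\<close> lets it be applied to two arguments that agree only
  almost everywhere.\<close>

lemma op_eq_comp:
  assumes S: "bounded_op S" and "op_eq S S'" "op_eq T T'"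
  shows "op_eq (\<lambda>\<phi>. S (T \<phi>)) (\<lambda>\<phi>. S' (T' \<phi>))"
  unfolding op_eq_def
proof (intro ballI conjI)
  fix \<phi> :: "'a \<Rightarrow> complex" assume "\<phi> \<in> L2"
  then have T: "T \<phi> \<in> L2" "T' \<phi> \<in> L2" "AE x in lborel. T \<phi> x = T' \<phi> x"
    using assms unfolding op_eq_def by auto
  then show "S (T \<phi>) \<in> L2" "S' (T' \<phi>) \<in> L2" using assms unfolding op_eq_def by auto
  have "AE x in lborel. S (T \<phi>) x = S (T' \<phi>) x" using T by (intro bounded_op_cong[OF S])
  moreover have "AE x in lborel. S (T' \<phi>) x = S' (T' \<phi>) x" using assms T unfolding op_eq_def by blast
  ultimately show "AE x in lborel. S (T \<phi>) x = S' (T' \<phi>) x" by (rule AE_eq_trans)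
qed

lemma bounded_op_op_eq:
  assumes "bounded_op S" "op_eq S T" shows "bounded_op T"
proof -
  obtain C where C: "C \<ge> 0" "\<And>\<phi>. \<phi> \<in> L2 \<Longrightarrow> nsq (S \<phi>) \<le> C * nsq \<phi>"
    using bounded_op_bound[OF assms(1)] by blast
  have ST: "S \<phi> \<in> L2" "T \<phi> \<in> L2" "AE x in lborel. S \<phi> x = T \<phi> x" if "\<phi> \<in> L2" for \<phi>
    using assms(2) that unfolding op_eq_def by auto
  show ?thesis
  proof (rule bounded_opI)
    fix \<phi> \<psi> :: "'a \<Rightarrow> complex" and a b assume \<phi>: "\<phi> \<in> L2" and \<psi>: "\<psi> \<in> L2"
    show "AE x in lborel. T (\<lambda>x. a * \<phi> x + b * \<psi> x) x = a * T \<phi> x + b * T \<psi> x"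
      using bounded_op_linear[OF assms(1) \<phi> \<psi>, of a b] ST(3)[OF \<phi>] ST(3)[OF \<psi>]
        ST(3)[OF L2_add[OF L2_cmult[OF \<phi>, of a] L2_cmult[OF \<psi>, of b]]]
      by eventually_elim simp
  next
    fix \<phi> :: "'a \<Rightarrow> complex" assume \<phi>: "\<phi> \<in> L2"
    have "nsq (T \<phi>) = nsq (S \<phi>)"
      using l2_norm_sq_cong_AE[OF ST(3)[OF \<phi>]] ST[OF \<phi>] by (simp add: l2_norm_sq_eq)
    then show "nsq (T \<phi>) \<le> C * nsq \<phi>" using C \<phi> by simp
  qed (use ST C in auto)
qed

subsection \<open>Adjoints\<close>

text \<open>A relation in place of the function \<open>op_adjoint\<close>, whose values are chosen
  representatives: concrete formulas, such as the Schroedinger operator of the inverse element, can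
  then serve as adjoints directly.\<close>

definition adj_pair :: "'a::euclidean_space op \<Rightarrow> 'a op \<Rightarrow> bool" where
  "adj_pair C A \<longleftrightarrow> (\<forall>\<phi>\<in>L2. C \<phi> \<in> L2 \<and> A \<phi> \<in> L2) \<and>
     (\<forall>\<phi>\<in>L2. \<forall>\<psi>\<in>L2. l2_inner \<phi> (A \<psi>) = l2_inner (C \<phi>) \<psi>)"

lemma adj_pair_L2: "adj_pair C A \<Longrightarrow> \<phi> \<in> L2 \<Longrightarrow> C \<phi> \<in> L2"
    "adj_pair C A \<Longrightarrow> \<phi> \<in> L2 \<Longrightarrow> A \<phi> \<in> L2"
  unfolding adj_pair_def by auto

lemma adj_pair_inner: "adj_pair C A \<Longrightarrow> \<phi> \<in> L2 \<Longrightarrow> \<psi> \<in> L2 \<Longrightarrow> l2_inner \<phi> (A \<psi>) = l2_inner (C \<phi>) \<psi>"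
  unfolding adj_pair_def by auto

lemma adj_pair_sym: "adj_pair C A \<Longrightarrow> adj_pair A C"
  unfolding adj_pair_def by (metis l2_inner_commute)

lemma adj_pair_lincomb:
  assumes "adj_pair C A" "adj_pair C' A'"
  shows "adj_pair (\<lambda>\<phi> x. C \<phi> x + c * C' \<phi> x) (\<lambda>\<phi> x. A \<phi> x + cnj c * A' \<phi> x)"
  using assms unfolding adj_pair_def
  by (auto simp: l2_inner_add_left l2_inner_add_right L2_cmult l2_inner_cmult_left l2_inner_cmult_right)

section \<open>Hilbert-Schmidt sums and traces in arbitrary bases\<close>

lemma suminf_swap_ennreal:
  fixes a :: "nat \<Rightarrow> nat \<Rightarrow> ennreal"
  shows "(\<Sum>i. \<Sum>j. a i j) = (\<Sum>j. \<Sum>i. a i j)"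
proof -
  have "(\<Sum>i. \<Sum>j. a i j) = (\<Sum>i. \<integral>\<^sup>+ j. a i j \<partial>count_space UNIV)"
    by (simp only: nn_integral_count_space_nat)
  also have "\<dots> = (\<integral>\<^sup>+ j. (\<Sum>i. a i j) \<partial>count_space UNIV)"
    by (rule nn_integral_suminf[symmetric]) simp
  finally show ?thesis by (simp only: nn_integral_count_space_nat)
qed

text \<open>Both sides are the double sum of the squared matrix coefficients between
  \<open>d\<close> and \<open>e\<close>, expanded by Parseval in either order. Since the two bases
  vary independently, each side is independent of its basis.\<close>

lemma hs_sum_adj_pair:
  assumes p: "adj_pair C A" and e: "l2_onb e" and d: "l2_onb d"
  shows "(\<Sum>i. l2_norm_sq (C (d i))) = (\<Sum>j. l2_norm_sq (A (e j)))"
proof -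
  have "(\<Sum>i. l2_norm_sq (C (d i))) = (\<Sum>i. \<Sum>j. ennreal ((cmod (l2_inner (C (d i)) (e j)))\<^sup>2))"
    using p l2_onb_L2[OF d] by (simp add: parseval[OF e] adj_pair_L2)
  also have "\<dots> = (\<Sum>j. \<Sum>i. ennreal ((cmod (l2_inner (C (d i)) (e j)))\<^sup>2))"
    by (rule suminf_swap_ennreal)
  also have "\<dots> = (\<Sum>j. \<Sum>i. ennreal ((cmod (l2_inner (A (e j)) (d i)))\<^sup>2))"
  proof -
    have "cmod (l2_inner (C (d i)) (e j)) = cmod (l2_inner (A (e j)) (d i))" for i j
      using adj_pair_inner[OF p l2_onb_L2[OF d, of i] l2_onb_L2[OF e, of j]]
      by (metis complex_mod_cnj l2_inner_commute)
    then show ?thesis by simp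
  qed
  also have "\<dots> = (\<Sum>j. l2_norm_sq (A (e j)))"
    using p l2_onb_L2[OF e] by (simp add: parseval[OF d] adj_pair_L2)
  finally show ?thesis .
qed

lemma hs_norm_sq_onb:
  assumes "adj_pair C A" "l2_onb d"
  shows "(\<Sum>i. l2_norm_sq (C (d i))) = hs_norm_sq C" and "hs_norm_sq A = hs_norm_sq C"
  using hs_sum_adj_pair[OF assms(1) l2_onb_basis assms(2)] hs_sum_adj_pair[OF assms(1) l2_onb_basis l2_onb_basis]
  unfolding hs_norm_sq_def by auto

lemma hs_norm_sq_sums:
  assumes "adj_pair C A" "l2_onb d" "hs_norm_sq C < top"
  shows "(\<lambda>i. nsq (C (d i))) sums enn2real (hs_norm_sq C)"
proof -
  have *: "(\<Sum>i. ennreal (nsq (C (d i)))) = hs_norm_sq C"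
    using hs_norm_sq_onb(1)[OF assms(1,2)] assms(1) l2_onb_L2[OF assms(2)]
    by (simp add: l2_norm_sq_eq adj_pair_L2)
  then have "summable (\<lambda>i. nsq (C (d i)))"
    using assms(3) by (intro summable_suminf_not_top) auto
  then have s: "summable (\<lambda>i. nsq (C (d i)))" .
  have "hs_norm_sq C = ennreal (\<Sum>i. nsq (C (d i)))"
    unfolding *[symmetric] by (rule suminf_ennreal2[OF _ s]) simp
  then have "enn2real (hs_norm_sq C) = (\<Sum>i. nsq (C (d i)))"
    using suminf_nonneg[OF s] by simp
  then show ?thesis using summable_sums[OF s] by simp
qed

lemma op_adjoint_spec:
  assumes "\<eta> \<in> L2" "\<And>\<psi>. \<psi> \<in> L2 \<Longrightarrow> l2_inner \<psi> \<eta> = l2_inner (T \<psi>) \<phi>"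
  shows "op_adjoint T \<phi> \<in> L2" "\<And>\<psi>. \<psi> \<in> L2 \<Longrightarrow> l2_inner \<psi> (op_adjoint T \<phi>) = l2_inner (T \<psi>) \<phi>"
proof -
  have "op_adjoint T \<phi> \<in> L2 \<and> (\<forall>\<psi>\<in>L2. l2_inner \<psi> (op_adjoint T \<phi>) = l2_inner (T \<psi>) \<phi>)"
    unfolding op_adjoint_def by (rule someI[of _ \<eta>]) (use assms in blast)
  then show "op_adjoint T \<phi> \<in> L2" "\<And>\<psi>. \<psi> \<in> L2 \<Longrightarrow> l2_inner \<psi> (op_adjoint T \<phi>) = l2_inner (T \<psi>) \<phi>"
    by auto
qed

lemma op_adjoint_op_eq:
  assumes "adj_pair T A" shows "op_eq (op_adjoint T) A"
  unfolding op_eq_def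
proof (intro ballI conjI)
  fix \<phi> :: "'a \<Rightarrow> complex" assume \<phi>: "\<phi> \<in> L2"
  have s: "op_adjoint T \<phi> \<in> L2" "\<And>\<psi>. \<psi> \<in> L2 \<Longrightarrow> l2_inner \<psi> (op_adjoint T \<phi>) = l2_inner (T \<psi>) \<phi>"
    using op_adjoint_spec[of "A \<phi>" T \<phi>] adj_pair_L2(2)[OF assms \<phi>] adj_pair_inner[OF assms _ \<phi>]
    by blast+
  show 1: "op_adjoint T \<phi> \<in> L2" by (rule s(1))
  show "A \<phi> \<in> L2" using adj_pair_L2(2)[OF assms \<phi>] .
  show "AE x in lborel. op_adjoint T \<phi> x = A \<phi> x"
  proof (rule l2_eqI[OF 1 adj_pair_L2(2)[OF assms \<phi>]])
    fix h :: "'a \<Rightarrow> complex" assume h: "h \<in> L2"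
    then have "l2_inner h (op_adjoint T \<phi>) = l2_inner h (A \<phi>)"
      using s(2)[OF h] adj_pair_inner[OF assms h \<phi>] by simp
    then show "l2_inner (op_adjoint T \<phi>) h = l2_inner (A \<phi>) h" by (metis l2_inner_commute)
  qed
qed

text \<open>The coefficients prescribed for the adjoint vector are square-summable, by
  Cauchy-Schwarz and the finite Hilbert-Schmidt norm. \<open>riesz_fischer\<close> builds the vector
  from them, and continuity of \<open>C\<close> extends the identity from finite sums to all of
  \<open>L2\<close>.\<close>

lemma hilbert_schmidt_adj_pair:
  assumes C: "hilbert_schmidt C"
  shows "adj_pair C (op_adjoint C)"
proof -
  let ?e = "l2_basis :: nat \<Rightarrow> 'a \<Rightarrow> complex"
  note eL = l2_onb_L2[OF l2_onb_basis]
  have b: "bounded_op C" and fin: "hs_norm_sq C < top" using C by (auto simp: hilbert_schmidt_def)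
  have *: "\<exists>\<eta>\<in>L2. \<forall>\<phi>\<in>L2. l2_inner \<phi> \<eta> = l2_inner (C \<phi>) \<psi>" if \<psi>: "\<psi> \<in> L2" for \<psi>
  proof -
    have "(\<Sum>i. ennreal (nsq (C (?e i)))) < top"
      using fin unfolding hs_norm_sq_def by (simp add: l2_norm_sq_eq bounded_op_L2[OF b] eL)
    then have "summable (\<lambda>i. nsq (C (?e i)))"
      by (intro summable_suminf_not_top) auto
    then have "summable (\<lambda>i. nsq (C (?e i)) * nsq \<psi>)" by (rule summable_mult2)
    then have "summable (\<lambda>i. (cmod (l2_inner (C (?e i)) \<psi>))\<^sup>2)"
      by (rule summable_comparison_test'[where N = 0])
        (use l2_Cauchy_Schwarz[OF bounded_op_L2[OF b eL] \<psi>] in auto)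
    then have "summable (\<lambda>i. (cmod (cnj (l2_inner (C (?e i)) \<psi>)))\<^sup>2)" by simp
    then obtain \<eta> where \<eta>: "\<eta> \<in> L2" "\<And>i. l2_inner \<eta> (?e i) = cnj (l2_inner (C (?e i)) \<psi>)"
      by (rule riesz_fischer[OF l2_onb_basis]) blast
    have "l2_inner \<phi> \<eta> = l2_inner (C \<phi>) \<psi>" if \<phi>: "\<phi> \<in> L2" for \<phi>
    proof (rule LIMSEQ_unique)
      let ?S = "\<lambda>n x. \<Sum>i<n. l2_inner \<phi> (?e i) * ?e i x"
      have S: "?S n \<in> L2" for n by (rule L2_lincomb) (rule eL)
      have "l2_inner (C (?S n)) \<psi> = (\<Sum>i<n. l2_inner \<phi> (?e i) * l2_inner (?e i) \<eta>)" for n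
      proof -
        have "l2_inner (C (?S n)) \<psi> = l2_inner (\<lambda>x. \<Sum>i<n. l2_inner \<phi> (?e i) * C (?e i) x) \<psi>"
          using bounded_op_L2[OF b] S eL \<psi>
          by (intro l2_inner_cong_AE bounded_op_sum[OF b] L2_lincomb) auto
        also have "\<dots> = (\<Sum>i<n. l2_inner \<phi> (?e i) * l2_inner (C (?e i)) \<psi>)"
          using bounded_op_L2[OF b eL] \<psi> by (subst l2_inner_sum_left) (auto simp: l2_inner_cmult_left)
        also have "\<dots> = (\<Sum>i<n. l2_inner \<phi> (?e i) * l2_inner (?e i) \<eta>)"
          by (subst (2) l2_inner_commute) (simp add: \<eta>)
        finally show ?thesis .
      qed
      then show "(\<lambda>n. l2_inner (C (?S n)) \<psi>) \<longlonglongrightarrow> l2_inner \<phi> \<eta>"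
        using parseval_inner_sums[OF l2_onb_basis \<phi> \<eta>(1)] unfolding sums_def by simp
      show "(\<lambda>n. l2_inner (C (?S n)) \<psi>) \<longlonglongrightarrow> l2_inner (C \<phi>) \<psi>"
        using bounded_op_L2[OF b] S \<phi> \<psi>
        by (intro l2_inner_tendsto_left bounded_op_tendsto[OF b] l2_onb_expansion[OF l2_onb_basis]) auto
    qed
    then show ?thesis using \<eta> by blast
  qed
  show ?thesis unfolding adj_pair_def
    using * op_adjoint_spec bounded_op_L2[OF b] by (metis (no_types, lifting))
qed

text \<open>Each term is a polarised combination of squared norms of \<open>C\<close>,
  \<open>A\<close> and \<open>C + c A\<close> on \<open>e i\<close>, and the sums of those are
  Hilbert-Schmidt norms, hence the same in every basis. The absolute bound uses the
  arithmetic-geometric inequality instead of the product of norms.\<close>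

lemma
  assumes B: "adj_pair B A" and C: "adj_pair C D" and fin: "hs_norm_sq B < top" "hs_norm_sq C < top"
  shows trace_sums_onb: "\<exists>t. \<forall>e. l2_onb e \<longrightarrow> (\<lambda>i. l2_inner (C (e i)) (A (e i))) sums t"
    and trace_abs_bound: "\<And>e n. l2_onb e \<Longrightarrow>
      (\<Sum>i<n. cmod (l2_inner (C (e i)) (A (e i)))) \<le> (enn2real (hs_norm_sq C) + enn2real (hs_norm_sq B)) / 2"
proof -
  have finA: "hs_norm_sq A < top" using hs_norm_sq_onb(2)[OF B l2_onb_basis] fin by simp
  have eqA: "hs_norm_sq A = hs_norm_sq B" using hs_norm_sq_onb(2)[OF B l2_onb_basis] .
  define E where "E c = (\<lambda>\<phi> x. C \<phi> x + c * A \<phi> x)" for c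
  have Ep: "adj_pair (E c) (\<lambda>\<phi> x. D \<phi> x + cnj c * B \<phi> x)" for c
    unfolding E_def by (rule adj_pair_lincomb[OF C adj_pair_sym[OF B]])
  have CL: "C \<phi> \<in> L2" and AL: "A \<phi> \<in> L2" if "\<phi> \<in> L2" for \<phi>
    using adj_pair_L2[OF C that] adj_pair_L2[OF B that] by auto
  have finE: "hs_norm_sq (E c) < top" for c
  proof -
    have "hs_norm_sq (E c) \<le> (\<Sum>i. 2 * l2_norm_sq (C (l2_basis i)) + 2 * (ennreal ((cmod c)\<^sup>2) * l2_norm_sq (A (l2_basis i))))"
      unfolding hs_norm_sq_def E_def
    proof (intro suminf_le)
      fix i
      show "l2_norm_sq (\<lambda>x. C (l2_basis i) x + c * A (l2_basis i) x)
         \<le> 2 * l2_norm_sq (C (l2_basis i)) + 2 * (ennreal ((cmod c)\<^sup>2) * l2_norm_sq (A (l2_basis i)))"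
        using l2_norm_sq_add[of "C (l2_basis i)" "\<lambda>x. c * A (l2_basis i) x"]
          CL[OF l2_onb_L2[OF l2_onb_basis]] AL[OF l2_onb_L2[OF l2_onb_basis]]
        by (simp add: l2_norm_sq_cmult L2_measurable)
    qed auto
    also have "\<dots> = 2 * hs_norm_sq C + 2 * (ennreal ((cmod c)\<^sup>2) * hs_norm_sq A)"
      by (simp add: suminf_add[symmetric] ennreal_suminf_cmult hs_norm_sq_def)
    also have "\<dots> < top" using fin finA by (simp add: ennreal_mult_less_top)
    finally show ?thesis .
  qed
  \<comment> \<open>Two values of \<open>c\<close> suffice: 1 recovers the real part of the inner
    product and \<open>\<i>\<close> its imaginary part, the inner product being conjugate linear on
    the right.\<close>
  have pol: "2 * l2_inner x y = complex_of_real (nsq (\<lambda>t. x t + 1 * y t) - nsq x - nsq y)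
      + \<i> * complex_of_real (nsq (\<lambda>t. x t + \<i> * y t) - nsq x - nsq y)"
    if "x \<in> L2" "y \<in> L2" for x y :: "'a \<Rightarrow> complex"
    using that nsq_add[of x y] nsq_add[of x "\<lambda>t. \<i> * y t"]
    by (simp add: L2_cmult nsq_cmult l2_inner_cmult_right complex_eq_iff)
  \<comment> \<open>The value of the trace, written through Hilbert-Schmidt norms only, so that no
    basis occurs in it.\<close>
  define t where "t = (complex_of_real (enn2real (hs_norm_sq (E 1)) - enn2real (hs_norm_sq C) - enn2real (hs_norm_sq A))
      + \<i> * complex_of_real (enn2real (hs_norm_sq (E \<i>)) - enn2real (hs_norm_sq C) - enn2real (hs_norm_sq A))) / 2"
  have "(\<lambda>i. l2_inner (C (e i)) (A (e i))) sums t" if e: "l2_onb e" for e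
  proof -
    note s = hs_norm_sq_sums[OF C e fin(2)] hs_norm_sq_sums[OF adj_pair_sym[OF B] e finA]
      hs_norm_sq_sums[OF Ep e finE]
    have "(\<lambda>i. (complex_of_real (nsq (E 1 (e i)) - nsq (C (e i)) - nsq (A (e i)))
      + \<i> * complex_of_real (nsq (E \<i> (e i)) - nsq (C (e i)) - nsq (A (e i)))) / 2) sums t"
      unfolding t_def
      by (intro sums_divide sums_add sums_mult sums_of_real sums_diff s)
    moreover have "(complex_of_real (nsq (E 1 (e i)) - nsq (C (e i)) - nsq (A (e i)))
      + \<i> * complex_of_real (nsq (E \<i> (e i)) - nsq (C (e i)) - nsq (A (e i)))) / 2
      = l2_inner (C (e i)) (A (e i))" for i
      using pol[OF CL AL, of "e i" "e i"] l2_onb_L2[OF e, of i] unfolding E_def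
      by (simp add: mult.commute[of _ "2 :: complex"])
    ultimately show ?thesis by simp
  qed
  then show "\<exists>t. \<forall>e. l2_onb e \<longrightarrow> (\<lambda>i. l2_inner (C (e i)) (A (e i))) sums t" by blast
  fix e :: "nat \<Rightarrow> 'a \<Rightarrow> complex" and n assume e: "l2_onb e"
  have "cmod (l2_inner x y) \<le> (nsq x + nsq y) / 2" if "x \<in> L2" "y \<in> L2" for x y :: "'a \<Rightarrow> complex"
  proof -
    have "(cmod (l2_inner x y))\<^sup>2 \<le> ((nsq x + nsq y) / 2)\<^sup>2"
      using l2_Cauchy_Schwarz[OF that] sum_squares_bound[of "nsq x" "nsq y"]
      by (simp add: power2_eq_square field_simps)
    then show ?thesis by (rule power2_le_imp_le) simp
  qed
  then have "(\<Sum>i<n. cmod (l2_inner (C (e i)) (A (e i)))) \<le> (\<Sum>i<n. (nsq (C (e i)) + nsq (A (e i))) / 2)"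
    using CL AL l2_onb_L2[OF e] by (intro sum_mono) auto
  also have "\<dots> \<le> (enn2real (hs_norm_sq C) + enn2real (hs_norm_sq A)) / 2"
  proof -
    note s = sums_add[OF hs_norm_sq_sums[OF C e fin(2)] hs_norm_sq_sums[OF adj_pair_sym[OF B] e finA]]
    have "(\<Sum>i<n. nsq (C (e i)) + nsq (A (e i))) \<le> (\<Sum>i. nsq (C (e i)) + nsq (A (e i)))"
      by (rule sum_le_suminf[OF sums_summable[OF s]]) auto
    then show ?thesis unfolding sum_divide_distrib[symmetric] sums_unique[OF s, symmetric]
      by (intro divide_right_mono) auto
  qed
  finally show "(\<Sum>i<n. cmod (l2_inner (C (e i)) (A (e i)))) \<le> (enn2real (hs_norm_sq C) + enn2real (hs_norm_sq B)) / 2"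
    by (simp add: eqA)
qed

subsection \<open>Unitary operators\<close>

text \<open>The cancellation laws are equalities of functions, for arbitrary arguments. Schroedinger
  operators satisfy them pointwise, so that inverse operators cancel by rewriting, without null
  sets.\<close>

definition unitary_pair :: "'a::euclidean_space op \<Rightarrow> 'a op \<Rightarrow> bool" where
  "unitary_pair U W \<longleftrightarrow> bounded_op U \<and> bounded_op W \<and> adj_pair U W \<and>
     (\<forall>\<phi>. U (W \<phi>) = \<phi>) \<and> (\<forall>\<phi>. W (U \<phi>) = \<phi>)"

lemma
  assumes "unitary_pair U W"
  shows unitary_pair_bounded: "bounded_op U" and unitary_pair_bounded': "bounded_op W"
    and unitary_pair_adj: "adj_pair U W"
    and unitary_pair_left: "U (W \<phi>) = \<phi>" and unitary_pair_right: "W (U \<phi>) = \<phi>"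
  using assms unfolding unitary_pair_def by blast+

lemma unitary_pair_sym: "unitary_pair U W \<Longrightarrow> unitary_pair W U"
  unfolding unitary_pair_def using adj_pair_sym by blast

lemma unitary_pair_inner:
  assumes "unitary_pair U W" "\<phi> \<in> L2" "\<psi> \<in> L2"
  shows "l2_inner (U \<phi>) (U \<psi>) = l2_inner \<phi> \<psi>"
  using adj_pair_inner[OF unitary_pair_adj[OF assms(1)] assms(2) adj_pair_L2(1)[OF unitary_pair_adj[OF assms(1)] assms(3)]]
  by (simp only: unitary_pair_right[OF assms(1)])

lemma unitary_pair_norm:
  assumes "unitary_pair U W" "\<phi> \<in> L2"
  shows "l2_norm_sq (U \<phi>) = l2_norm_sq \<phi>"
proof -
  have U: "U \<phi> \<in> L2" using adj_pair_L2(1)[OF unitary_pair_adj[OF assms(1)] assms(2)] .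
  have "complex_of_real (nsq (U \<phi>)) = complex_of_real (nsq \<phi>)"
    using unitary_pair_inner[OF assms(1,2,2)] by (simp only: l2_inner_self[OF U] l2_inner_self[OF assms(2)])
  then show ?thesis using assms(2) U by (simp add: l2_norm_sq_eq)
qed

lemma unitary_pair_onb:
  assumes U: "unitary_pair U W" and e: "l2_onb e"
  shows "l2_onb (\<lambda>i. U (e i))"
  unfolding l2_onb_def
proof (intro conjI allI ballI impI)
  have p: "adj_pair U W" using U by (rule unitary_pair_adj)
  show "U (e i) \<in> L2" for i using adj_pair_L2[OF p l2_onb_L2[OF e]] by simp
  show "l2_inner (U (e i)) (U (e j)) = (if i = j then 1 else 0)" for i j
    using unitary_pair_inner[OF U l2_onb_L2[OF e] l2_onb_L2[OF e]] l2_onb_inner[OF e] by simp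
  fix \<phi> :: "'a \<Rightarrow> complex" assume \<phi>: "\<phi> \<in> L2" and 0: "\<forall>i. l2_inner \<phi> (U (e i)) = 0"
  have "l2_inner (W \<phi>) (e i) = 0" for i
    using 0 adj_pair_inner[OF adj_pair_sym[OF p] \<phi> l2_onb_L2[OF e, of i]] by simp
  then have "AE x in lborel. W \<phi> x = (\<lambda>x. 0) x"
    using l2_onb_total[OF e adj_pair_L2(2)[OF p \<phi>]] by simp
  then have "AE x in lborel. U (W \<phi>) x = U (\<lambda>x. 0) x"
    by (rule bounded_op_cong[OF unitary_pair_bounded[OF U] adj_pair_L2(2)[OF p \<phi>] L2_zero])
  moreover have "AE x in lborel. U (\<lambda>x. 0) x = 0"
    using bounded_op_cmult[OF unitary_pair_bounded[OF U] L2_zero, of 0] by simp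
  ultimately show "AE x in lborel. \<phi> x = 0"
    unfolding unitary_pair_left[OF U] by (rule AE_eq_trans)
qed

section \<open>Hilbert-Schmidt and trace class operators composed with unitaries\<close>

lemma hilbert_schmidt_unitary_left:
  assumes U: "unitary_pair U W" and B: "hilbert_schmidt B"
  shows "hilbert_schmidt (\<lambda>\<phi>. U (B \<phi>))"
proof -
  have b: "bounded_op B" using B by (simp add: hilbert_schmidt_def)
  have "hs_norm_sq (\<lambda>\<phi>. U (B \<phi>)) = hs_norm_sq B"
    unfolding hs_norm_sq_def unitary_pair_norm[OF U bounded_op_L2[OF b l2_onb_L2[OF l2_onb_basis]]] ..
  then show ?thesis
    using B bounded_op_comp[OF unitary_pair_bounded[OF U] b] by (simp add: hilbert_schmidt_def)
qed

lemma hilbert_schmidt_unitary_right: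
  assumes U: "unitary_pair U W" and B: "hilbert_schmidt B"
  shows "hilbert_schmidt (\<lambda>\<phi>. B (U \<phi>))"
proof -
  have b: "bounded_op B" using B by (simp add: hilbert_schmidt_def)
  have "hs_norm_sq (\<lambda>\<phi>. B (U \<phi>)) = hs_norm_sq B"
    using hs_norm_sq_onb(1)[OF hilbert_schmidt_adj_pair[OF B] unitary_pair_onb[OF U l2_onb_basis]]
    unfolding hs_norm_sq_def .
  then show ?thesis
    using B bounded_op_comp[OF b unitary_pair_bounded[OF U]] by (simp add: hilbert_schmidt_def)
qed

lemma trace_classI:
  assumes "hilbert_schmidt A" "hilbert_schmidt B" "op_eq T (\<lambda>\<phi>. A (B \<phi>))"
  shows "trace_class T"
proof -
  have "bounded_op (\<lambda>\<phi>. A (B \<phi>))"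
    by (rule bounded_op_comp[of A B]) (use assms(1,2) in \<open>simp_all add: hilbert_schmidt_def\<close>)
  then have "bounded_op T" by (rule bounded_op_op_eq[OF _ op_eq_sym[OF assms(3)]])
  moreover have "\<forall>\<phi>\<in>L2. AE x in lborel. T \<phi> x = A (B \<phi>) x"
    using assms(3) by (simp add: op_eq_def)
  ultimately show ?thesis unfolding trace_class_def
    by (intro conjI exI[of _ A] exI[of _ B] assms(1,2))
qed

lemma trace_classE:
  assumes "trace_class T"
  obtains A B where "hilbert_schmidt A" "hilbert_schmidt B" "op_eq T (\<lambda>\<phi>. A (B \<phi>))"
proof -
  obtain A B where AB: "hilbert_schmidt A" "hilbert_schmidt B" "\<forall>\<phi>\<in>L2. AE x in lborel. T \<phi> x = A (B \<phi>) x"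
    using assms unfolding trace_class_def by (elim conjE exE)
  have b: "bounded_op T" "bounded_op A" "bounded_op B"
    using AB(1,2) assms by (simp_all add: hilbert_schmidt_def trace_class_def)
  have "op_eq T (\<lambda>\<phi>. A (B \<phi>))" unfolding op_eq_def
    using AB(3) bounded_op_L2[OF b(1)] bounded_op_L2[OF b(2)] bounded_op_L2[OF b(3)] by simp
  then show ?thesis by (rule that[OF AB(1,2)])
qed

lemma trace_class_op_eq: "trace_class S \<Longrightarrow> op_eq S T \<Longrightarrow> trace_class T"
proof -
  assume T: "trace_class S" and eq: "op_eq S T"
  obtain A B where AB: "hilbert_schmidt A" "hilbert_schmidt B" "op_eq S (\<lambda>\<phi>. A (B \<phi>))"
    using T by (rule trace_classE)
  show "trace_class T"
    by (rule trace_classI[OF AB(1,2) op_eq_trans[OF op_eq_sym[OF eq] AB(3)]])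
qed

text \<open>In a factorisation of \<open>T\<close>, the left unitary is absorbed by the left factor
  and the right unitary by the right one.\<close>

lemma trace_class_unitary:
  assumes U: "unitary_pair U U'" and V: "unitary_pair V V'" and T: "trace_class T"
  shows "trace_class (\<lambda>\<phi>. U (T (V \<phi>)))"
proof -
  obtain A B where AB: "hilbert_schmidt A" "hilbert_schmidt B" "op_eq T (\<lambda>\<phi>. A (B \<phi>))"
    using T by (rule trace_classE)
  have V': "op_eq V V" using bounded_op_L2[OF unitary_pair_bounded[OF V]] unfolding op_eq_def by simp
  have U': "op_eq U U" using bounded_op_L2[OF unitary_pair_bounded[OF U]] unfolding op_eq_def by simp
  have T': "bounded_op T" using T by (simp add: trace_class_def)
  have "op_eq (\<lambda>\<phi>. U (T (V \<phi>))) (\<lambda>\<phi>. U (A (B (V \<phi>))))"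
    by (rule op_eq_comp[OF unitary_pair_bounded[OF U] U' op_eq_comp[OF T' AB(3) V']])
  then show ?thesis
    using trace_classI[OF hilbert_schmidt_unitary_left[OF U AB(1)] hilbert_schmidt_unitary_right[OF V AB(2)]]
    by blast
qed

text \<open>For \<open>T = A B\<close> the diagonal terms are inner products of \<open>B\<close>
  with the adjoint of \<open>A\<close>, whose sum is the same in every basis. Invariance of the
  trace under unitary conjugation is obtained from this by changing the basis.\<close>

lemma trace_onb:
  assumes T: "trace_class T" and e: "l2_onb e"
  shows "(\<lambda>i. l2_inner (T (e i)) (e i)) sums op_trace T"
proof -
  obtain A B where AB: "hilbert_schmidt A" "hilbert_schmidt B" "op_eq T (\<lambda>\<phi>. A (B \<phi>))"
    using T by (rule trace_classE)
  note pA = hilbert_schmidt_adj_pair[OF AB(1)] and pB = hilbert_schmidt_adj_pair[OF AB(2)]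
  have eq: "l2_inner (T \<phi>) \<phi> = l2_inner (B \<phi>) (op_adjoint A \<phi>)" if \<phi>: "\<phi> \<in> L2" for \<phi>
  proof -
    have "l2_inner (T \<phi>) \<phi> = l2_inner (A (B \<phi>)) \<phi>"
      using AB(3) \<phi> unfolding op_eq_def by (intro l2_inner_cong_AE) auto
    then show ?thesis using adj_pair_inner[OF pA adj_pair_L2(1)[OF pB \<phi>] \<phi>] by simp
  qed
  obtain t where t: "\<And>e. l2_onb e \<Longrightarrow> (\<lambda>i. l2_inner (B (e i)) (op_adjoint A (e i))) sums t"
    using trace_sums_onb[OF pA pB] AB unfolding hilbert_schmidt_def by auto
  have t': "(\<lambda>i. l2_inner (T (e i)) (e i)) sums t" if "l2_onb e" for e
    using t[OF that] eq[OF l2_onb_L2[OF that]] by simp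
  show ?thesis using t'[OF e] t'[OF l2_onb_basis] unfolding op_trace_def by (metis sums_unique)
qed

section \<open>Plancherel's theorem on Euclidean space\<close>

lemma fubini_prod_bound:
  fixes f :: "'a::euclidean_space \<Rightarrow> 'b::euclidean_space \<Rightarrow> complex" and a b :: "_ \<Rightarrow> real"
  assumes f [measurable]: "case_prod f \<in> borel_measurable (borel \<Otimes>\<^sub>M borel)"
    and a: "integrable lborel a" and b: "integrable lborel b"
    and le: "\<And>x y. cmod (f x y) \<le> a x * b y"
  shows "(LINT x|lborel. LINT y|lborel. f x y) = (LINT y|lborel. LINT x|lborel. f x y)"
proof -
  note [measurable] = borel_measurable_integrable[OF a] borel_measurable_integrable[OF b]
  have "(\<integral>\<^sup>+ p. ennreal (norm (case_prod f p)) \<partial>(lborel \<Otimes>\<^sub>M lborel))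
      = (\<integral>\<^sup>+ x. \<integral>\<^sup>+ y. ennreal (norm (f x y)) \<partial>lborel \<partial>lborel)"
    by (subst lborel.nn_integral_fst[symmetric]) auto
  also have "\<dots> \<le> (\<integral>\<^sup>+ x. \<integral>\<^sup>+ y. ennreal (norm (a x)) * ennreal (norm (b y)) \<partial>lborel \<partial>lborel)"
  proof (intro nn_integral_mono)
    fix x y
    have "norm (f x y) \<le> norm (a x) * norm (b y)"
      using le[of x y] abs_ge_self[of "a x * b y"] by (simp add: abs_mult)
    then show "ennreal (norm (f x y)) \<le> ennreal (norm (a x)) * ennreal (norm (b y))"
      by (simp add: ennreal_leI flip: ennreal_mult)
  qed
  also have "\<dots> = (\<integral>\<^sup>+ x. ennreal (norm (a x)) \<partial>lborel) * (\<integral>\<^sup>+ y. ennreal (norm (b y)) \<partial>lborel)"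
    by (simp add: nn_integral_cmult nn_integral_multc)
  also have "\<dots> < \<infinity>"
    using a b unfolding integrable_iff_bounded by (simp add: ennreal_mult_less_top)
  finally have i: "integrable (lborel \<Otimes>\<^sub>M lborel) (case_prod f)"
    unfolding integrable_iff_bounded by simp
  show "(LINT x|lborel. LINT y|lborel. f x y) = (LINT y|lborel. LINT x|lborel. f x y)"
    using lborel_pair.Fubini_integral[OF i] by simp
qed

lemma
  fixes F :: "'a::euclidean_space \<Rightarrow> complex" and t :: 'a and c :: real
  assumes [measurable]: "F \<in> borel_measurable borel" and c: "c \<noteq> 0"
  shows integral_lborel_affine: "(LINT x|lborel. F x) = complex_of_real (\<bar>c\<bar> ^ DIM('a)) * (LINT x|lborel. F (t + c *\<^sub>R x))"
    and integrable_lborel_affine: "integrable lborel F \<Longrightarrow> integrable lborel (\<lambda>x. F (t + c *\<^sub>R x))"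
proof -
  have "(LINT x|lborel. F x) = (LINT x|density (distr lborel borel (\<lambda>x. t + c *\<^sub>R x)) (\<lambda>x. ennreal (\<bar>c\<bar> ^ DIM('a))). F x)"
    by (subst (1) lborel_affine[OF c, of t]) simp
  also have "\<dots> = complex_of_real (\<bar>c\<bar> ^ DIM('a)) * (LINT x|lborel. F (t + c *\<^sub>R x))"
    by (subst integral_density, simp, simp, simp) (subst integral_distr, simp, simp, simp add: scaleR_conv_of_real)
  finally show "(LINT x|lborel. F x) = complex_of_real (\<bar>c\<bar> ^ DIM('a)) * (LINT x|lborel. F (t + c *\<^sub>R x))" .
  assume "integrable lborel F"
  then have "integrable (density (distr lborel borel (\<lambda>x. t + c *\<^sub>R x)) (\<lambda>x. ennreal (\<bar>c\<bar> ^ DIM('a)))) F"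
    by (subst (asm) lborel_affine[OF c, of t]) simp
  then have "integrable lborel (\<lambda>x. \<bar>c\<bar> ^ DIM('a) *\<^sub>R F (t + c *\<^sub>R x))"
    by (subst (asm) integrable_density, simp, simp, simp) (subst (asm) integrable_distr_eq, simp_all)
  then have "integrable lborel (\<lambda>x. (1 / \<bar>c\<bar> ^ DIM('a)) *\<^sub>R \<bar>c\<bar> ^ DIM('a) *\<^sub>R F (t + c *\<^sub>R x))"
    by (rule integrable_scaleR_right)
  then show "integrable lborel (\<lambda>x. F (t + c *\<^sub>R x))" using c by simp
qed

lemma nn_integral_lborel_affine:
  fixes F :: "'a::euclidean_space \<Rightarrow> ennreal" and t :: 'a and c :: real
  assumes [measurable]: "F \<in> borel_measurable borel" and c: "c \<noteq> 0"
  shows "(\<integral>\<^sup>+ x. F x \<partial>lborel) = ennreal (\<bar>c\<bar> ^ DIM('a)) * (\<integral>\<^sup>+ x. F (t + c *\<^sub>R x) \<partial>lborel)"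
proof -
  have "(\<integral>\<^sup>+ x. F x \<partial>lborel) = (\<integral>\<^sup>+ x. F x \<partial>density (distr lborel borel (\<lambda>x. t + c *\<^sub>R x)) (\<lambda>x. ennreal (\<bar>c\<bar> ^ DIM('a))))"
    by (subst (1) lborel_affine[OF c, of t]) simp
  also have "\<dots> = ennreal (\<bar>c\<bar> ^ DIM('a)) * (\<integral>\<^sup>+ x. F (t + c *\<^sub>R x) \<partial>lborel)"
    by (subst nn_integral_density, simp, simp) (subst nn_integral_distr, simp, simp, simp add: nn_integral_cmult)
  finally show ?thesis .
qed

lemma nn_integral_lborel_translate:
  fixes F :: "'a::euclidean_space \<Rightarrow> ennreal"
  assumes "F \<in> borel_measurable borel"
  shows "(\<integral>\<^sup>+ x. F (x + t) \<partial>lborel) = (\<integral>\<^sup>+ x. F x \<partial>lborel)"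
  using nn_integral_lborel_affine[OF assms, of 1 t] by (simp add: add.commute)

lemma l2_translate:
  assumes "f \<in> L2"
  shows "(\<lambda>x. f (x + t)) \<in> L2" "nsq (\<lambda>x. f (x + t)) = nsq f"
proof -
  note [measurable] = L2_measurable[OF assms]
  have eq: "l2_norm_sq (\<lambda>x. f (x + t)) = l2_norm_sq f"
    unfolding l2_norm_sq_def by (rule nn_integral_lborel_translate) measurable
  have "(\<lambda>x. f (x + t)) \<in> borel_measurable borel" by measurable
  then show 1: "(\<lambda>x. f (x + t)) \<in> L2" using assms eq by (intro L2_I) simp_all
  show "nsq (\<lambda>x. f (x + t)) = nsq f"
    using eq 1 assms by (simp add: l2_norm_sq_eq)
qed

text \<open>For a continuous function of compact support this is dominated convergence, the bounded
  shifts keeping all supports in one ball. Translations are isometries, so approximation carries it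
  over to \<open>f\<close>.\<close>

lemma l2_translate_tendsto:
  fixes f :: "'a::euclidean_space \<Rightarrow> complex"
  assumes f: "f \<in> L2" and h: "h \<longlonglongrightarrow> 0"
  shows "l2_tendsto (\<lambda>k x. f (x + h k)) f"
proof -
  have "(\<lambda>k. nsq (\<lambda>x. f (x + h k) - f x)) \<longlonglongrightarrow> 0"
  proof (rule LIMSEQ_I)
    fix r :: real assume r: "r > 0"
    \<comment> \<open>The quadratic triangle inequality costs a factor 2 at each use: two
      applications give at most 2/12 + 4/12 + 4/12 of \<open>r\<close>.\<close>
    obtain g where g: "cont_compact_supp g" "nsq (\<lambda>x. f x - g x) < r / 12"
      using cont_compact_supp_dense[OF f, of "r / 12"] r by auto
    have gL: "g \<in> L2" and gb: "bdd_compact_supp g"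
      using g(1) cont_compact_supp_bdd bdd_compact_supp_L1_L2 by auto
    note [measurable] = L2_measurable[OF gL]
    obtain B where B: "B > 0" "\<And>x. cmod (g x) \<le> B" "\<And>x. norm x > B \<Longrightarrow> g x = 0"
      using bdd_compact_supp_obtain[OF gb] by metis
    obtain H where H: "\<And>k. norm (h k) \<le> H"
      using h convergent_imp_Bseq[of h] unfolding convergent_def Bseq_def by blast
    have "l2_tendsto (\<lambda>k x. g (x + h k)) g"
    proof (rule l2_tendsto_dominated[where g = "\<lambda>x. complex_of_real (2 * B) * indicator (cball 0 (B + H)) x"])
      show "(\<lambda>x. complex_of_real (2 * B) * indicator (cball 0 (B + H)) x) \<in> (L2 :: ('a \<Rightarrow> complex) set)"
      proof (rule bdd_compact_supp_L1_L2(2), unfold bdd_compact_supp_def, intro conjI exI[of _ "max (2 * B) (B + H)"])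
      qed (use B(1) in \<open>auto simp: norm_mult indicator_def\<close>)
      have "continuous_on UNIV g" using g(1) by (simp add: cont_compact_supp_def)
      then have "isCont g x" for x by (simp add: continuous_on_eq_continuous_at)
      then show "AE x in lborel. (\<lambda>k. g (x + h k)) \<longlonglongrightarrow> g x"
        using tendsto_add[OF tendsto_const h] by (intro AE_I2 isCont_tendsto_compose[of _ g]) auto
      show "AE x in lborel. cmod (g (x + h k) - g x) \<le> cmod (complex_of_real (2 * B) * indicator (cball 0 (B + H)) x)" for k
      proof (intro AE_I2)
        fix x :: 'a
        show "cmod (g (x + h k) - g x) \<le> cmod (complex_of_real (2 * B) * indicator (cball 0 (B + H)) x)"
        proof (cases "norm x \<le> B + H")
          case True
          have "cmod (g (x + h k) - g x) \<le> B + B"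
            using norm_triangle_ineq4[of "g (x + h k)" "g x"] B(2)[of x] B(2)[of "x + h k"] by linarith
          then show ?thesis using True B(1) by (simp add: norm_mult)
        next
          case False
          have "norm x \<le> norm (x + h k) + norm (h k)"
            using norm_triangle_ineq4[of "x + h k" "h k"] by simp
          then have "norm (x + h k) > B" "norm x > B" using False H[of k] norm_ge_zero[of "h k"] by linarith+
          then show ?thesis using B(3) by simp
        qed
      qed
    qed measurable
    then have "(\<lambda>k. nsq (\<lambda>x. g (x + h k) - g x)) \<longlonglongrightarrow> 0"
      using l2_tendsto_iff[of "\<lambda>k x. g (x + h k)" g] gL l2_translate(1) by blast
    then obtain N where N: "\<And>k. k \<ge> N \<Longrightarrow> nsq (\<lambda>x. g (x + h k) - g x) < r / 12"
      using LIMSEQ_D[of _ 0 "r / 12"] r by fastforce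
    have "nsq (\<lambda>x. f (x + h k) - f x) < r" if "k \<ge> N" for k
    proof -
      have "nsq (\<lambda>x. f (x + h k) - f x) \<le> 2 * nsq (\<lambda>x. f (x + h k) - g (x + h k)) + 2 * nsq (\<lambda>x. g (x + h k) - f x)"
        by (intro nsq_triangle l2_translate f gL)
      moreover have "nsq (\<lambda>x. f (x + h k) - g (x + h k)) = nsq (\<lambda>x. f x - g x)"
        using l2_translate(2)[OF L2_diff[OF f gL]] by simp
      moreover have "nsq (\<lambda>x. g (x + h k) - f x) \<le> 2 * nsq (\<lambda>x. g (x + h k) - g x) + 2 * nsq (\<lambda>x. g x - f x)"
        by (intro nsq_triangle l2_translate f gL)
      ultimately show ?thesis using g(2) N[OF that] nsq_swap[of f g] r by linarith
    qed
    then show "\<exists>N. \<forall>k\<ge>N. norm (nsq (\<lambda>x. f (x + h k) - f x) - 0) < r" by auto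
  qed
  then show ?thesis using l2_tendsto_iff[of "\<lambda>k x. f (x + h k)" f] f l2_translate(1) by blast
qed

subsection \<open>The Gaussian\<close>

text \<open>Normalised to have integral 1 and to be its own Fourier transform for the kernel
  \<open>cis (2 * pi * (x \<bullet> z))\<close>.\<close>

definition gaussian :: "'a::euclidean_space \<Rightarrow> real" where
  "gaussian x = exp (- pi * (norm x)\<^sup>2)"

lemma gaussian_nonneg [simp]: "0 \<le> gaussian x" by (simp add: gaussian_def)

lemma gaussian_measurable [measurable]: "gaussian \<in> borel_measurable borel"
  unfolding gaussian_def[abs_def] by measurable

lemma gaussian_prod: "gaussian x = (\<Prod>b\<in>Basis. exp (- pi * (x \<bullet> b)\<^sup>2))"
proof -
  have "(norm x)\<^sup>2 = (\<Sum>b\<in>Basis. (x \<bullet> b)\<^sup>2)"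
    by (subst power2_norm_eq_inner, subst euclidean_inner) (simp add: power2_eq_square)
  then show ?thesis unfolding gaussian_def by (simp add: exp_sum[symmetric] sum_distrib_left)
qed

text \<open>The characteristic function of the standard normal distribution, rescaled by
  \<open>sqrt (2 * pi)\<close> so that both exponents carry the factor \<open>pi\<close>.\<close>

lemma
  shows integrable_gaussian_1: "integrable lborel (\<lambda>x::real. cis (2 * pi * (h * x)) * complex_of_real (exp (- pi * x\<^sup>2)))"
    and integral_gaussian_1: "(LINT x|lborel. cis (2 * pi * (h * x)) * complex_of_real (exp (- pi * x\<^sup>2))) = complex_of_real (exp (- pi * h\<^sup>2))"
proof -
  define c where "c = 1 / sqrt (2 * pi)"
  have c: "c \<noteq> 0" "c > 0" unfolding c_def by auto
  let ?t = "sqrt (2 * pi) * h"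
  let ?F = "\<lambda>x::real. complex_of_real (std_normal_density x) * iexp (?t * x)"
  have int: "integrable lborel ?F"
  proof (rule Bochner_Integration.integrable_bound)
    show "integrable lborel std_normal_density" by (rule integrable_normal_density) simp
  qed (auto simp: norm_mult)
  have "(LINT x|lborel. ?F x) = char std_normal_distribution ?t"
    unfolding char_def by (subst integral_density) (auto simp: scaleR_conv_of_real)
  also have "\<dots> = complex_of_real (exp (- pi * h\<^sup>2))"
    unfolding char_std_normal_distribution by (simp add: power_mult_distrib)
  finally have I: "(LINT x|lborel. ?F x) = complex_of_real (exp (- pi * h\<^sup>2))" .
  have s: "sqrt (2 * pi) * sqrt (2 * pi) = 2 * pi" by simp
  have eq: "complex_of_real (sqrt (2 * pi)) * ?F (0 + sqrt (2 * pi) * x)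
      = cis (2 * pi * (h * x)) * complex_of_real (exp (- pi * x\<^sup>2))" for x
  proof -
    have "?t * (sqrt (2 * pi) * x) = 2 * pi * (h * x)" using s by (simp add: algebra_simps)
    moreover have "sqrt (2 * pi) * std_normal_density (sqrt (2 * pi) * x) = exp (- pi * x\<^sup>2)"
      by (simp add: std_normal_density_def power_mult_distrib)
    moreover have "complex_of_real (sqrt (2 * pi)) * ?F (0 + sqrt (2 * pi) * x)
        = complex_of_real (sqrt (2 * pi) * std_normal_density (sqrt (2 * pi) * x)) * iexp (?t * (sqrt (2 * pi) * x))"
      by simp
    ultimately show ?thesis by (simp only: cis_conv_exp mult.commute)
  qed
  have "integrable lborel (\<lambda>x. complex_of_real (sqrt (2 * pi)) * ?F (0 + sqrt (2 * pi) * x))"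
    using int by (intro Bochner_Integration.integrable_mult_right lborel_integrable_real_affine) auto
  then show "integrable lborel (\<lambda>x::real. cis (2 * pi * (h * x)) * complex_of_real (exp (- pi * x\<^sup>2)))"
    unfolding eq .
  have "(LINT x|lborel. ?F x) = sqrt (2 * pi) *\<^sub>R (LINT x|lborel. ?F (0 + sqrt (2 * pi) * x))"
    using lborel_integral_real_affine[of "sqrt (2 * pi)" ?F 0] by simp
  also have "\<dots> = (LINT x|lborel. complex_of_real (sqrt (2 * pi)) * ?F (0 + sqrt (2 * pi) * x))"
    by (simp only: scaleR_conv_of_real integral_mult_right_zero)
  finally show "(LINT x|lborel. cis (2 * pi * (h * x)) * complex_of_real (exp (- pi * x\<^sup>2))) = complex_of_real (exp (- pi * h\<^sup>2))"
    unfolding eq I by simp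
qed

lemma integral_lborel_prod:
  fixes f :: "'a::euclidean_space \<Rightarrow> real \<Rightarrow> complex"
  assumes f: "\<And>b. b \<in> Basis \<Longrightarrow> integrable lborel (f b)"
  shows "(LINT x|lborel. (\<Prod>b\<in>Basis. f b (x \<bullet> b))) = (\<Prod>b\<in>Basis. LINT x|lborel. f b x)"
proof -
  interpret product_sigma_finite "\<lambda>_::'a. lborel :: real measure" ..
  note [measurable] = borel_measurable_integrable[OF f]
  have "(LINT x|lborel. (\<Prod>b\<in>Basis. f b (x \<bullet> b)))
      = (LINT g|(\<Pi>\<^sub>M b\<in>Basis. lborel). (\<Prod>b\<in>Basis. f b ((\<Sum>c\<in>Basis. g c *\<^sub>R c) \<bullet> b)))"
    by (subst lborel_eq, subst integral_distr) auto
  also have "\<dots> = (LINT g|(\<Pi>\<^sub>M b\<in>Basis. lborel). (\<Prod>b\<in>Basis. f b (g b)))"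
    by (intro Bochner_Integration.integral_cong prod.cong refl arg_cong2[where f = f]) auto
  also have "\<dots> = (\<Prod>b\<in>Basis. LINT x|lborel. f b x)"
    by (rule product_integral_prod) (use f in auto)
  finally show ?thesis .
qed

lemma cis_sum: "finite I \<Longrightarrow> cis (\<Sum>i\<in>I. a i) = (\<Prod>i\<in>I. cis (a i))"
  by (induction I rule: finite_induct) (auto simp: cis_mult[symmetric])

lemma integral_gaussian:
  fixes h :: "'a::euclidean_space"
  shows "(LINT x|lborel. cis (2 * pi * (h \<bullet> x)) * complex_of_real (gaussian x)) = complex_of_real (gaussian h)"
proof -
  have "cis (2 * pi * (h \<bullet> x)) = (\<Prod>b\<in>Basis. cis (2 * pi * ((h \<bullet> b) * (x \<bullet> b))))" for x
    by (subst euclidean_inner) (simp add: sum_distrib_left cis_sum)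
  then have "cis (2 * pi * (h \<bullet> x)) * complex_of_real (gaussian x)
      = (\<Prod>b\<in>Basis. cis (2 * pi * ((h \<bullet> b) * (x \<bullet> b))) * complex_of_real (exp (- pi * (x \<bullet> b)\<^sup>2)))" for x
    unfolding gaussian_prod by (simp add: prod.distrib of_real_prod)
  then have "(LINT x|lborel. cis (2 * pi * (h \<bullet> x)) * complex_of_real (gaussian x))
      = (LINT x|lborel. (\<Prod>b\<in>Basis. cis (2 * pi * ((h \<bullet> b) * (x \<bullet> b))) * complex_of_real (exp (- pi * (x \<bullet> b)\<^sup>2))))"
    by simp
  also have "\<dots> = (\<Prod>b\<in>Basis. complex_of_real (exp (- pi * (h \<bullet> b)\<^sup>2)))"
    by (subst integral_lborel_prod[OF integrable_gaussian_1]) (simp only: integral_gaussian_1)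
  finally show ?thesis by (simp add: gaussian_prod of_real_prod)
qed

lemma integrable_gaussian: "integrable lborel (gaussian :: 'a::euclidean_space \<Rightarrow> real)"
proof (rule integrableI_nonneg)
  have "(\<integral>\<^sup>+ x. ennreal (exp (- pi * x\<^sup>2)) \<partial>lborel) < \<infinity>"
    using integrable_gaussian_1[of 0] unfolding integrable_iff_bounded by (simp add: norm_mult)
  then show "(\<integral>\<^sup>+ x. ennreal (gaussian (x :: 'a)) \<partial>lborel) < \<infinity>"
    unfolding gaussian_prod prod_ennreal[symmetric]
    by (subst prod_ennreal[symmetric], simp, subst nn_integral_lborel_prod) (auto simp: power_less_top_ennreal)
qed auto

lemma integral_gaussian_eq_1: "(LINT x|lborel. gaussian (x :: 'a::euclidean_space)) = 1"
proof -
  have "complex_of_real (LINT x|lborel. gaussian (x :: 'a)) = 1"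
    using integral_gaussian[of "0 :: 'a"] by (simp add: gaussian_def)
  then show ?thesis by simp
qed

lemma integral_gaussian_scaled:
  fixes h :: "'a::euclidean_space"
  assumes e: "e > 0"
  shows "(LINT x|lborel. cis (2 * pi * (h \<bullet> x)) * complex_of_real (gaussian (e *\<^sub>R x)))
       = complex_of_real (gaussian ((1 / e) *\<^sub>R h) / e ^ DIM('a))"
proof -
  let ?F = "\<lambda>x. cis (2 * pi * (((1 / e) *\<^sub>R h) \<bullet> x)) * complex_of_real (gaussian x)"
  have m: "?F \<in> borel_measurable borel"
    by measurable
  have "complex_of_real (gaussian ((1 / e) *\<^sub>R h))
      = complex_of_real (\<bar>e\<bar> ^ DIM('a)) * (LINT x|lborel. ?F (0 + e *\<^sub>R x))"
    using e integral_lborel_affine[OF m, of e 0] unfolding integral_gaussian by simp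
  moreover have "?F (0 + e *\<^sub>R x) = cis (2 * pi * (h \<bullet> x)) * complex_of_real (gaussian (e *\<^sub>R x))" for x
    using e by simp
  ultimately show ?thesis using e by (simp add: field_simps)
qed


subsection \<open>The transform\<close>

text \<open>The exponent has a positive sign to agree with the phases of the Schroedinger
  operators.\<close>

definition fourier :: "('a::euclidean_space \<Rightarrow> complex) \<Rightarrow> 'a \<Rightarrow> complex" where
  "fourier f z = (LINT x|lborel. cis (2 * pi * (x \<bullet> z)) * f x)"

lemma fourier_measurable:
  assumes [measurable]: "f \<in> borel_measurable borel"
  shows "fourier f \<in> borel_measurable borel"
  unfolding fourier_def[abs_def] by measurable

lemma fourier_bound:
  assumes "f \<in> L1" shows "cmod (fourier f z) \<le> (LINT x|lborel. cmod (f x))"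
proof -
  have "cmod (fourier f z) \<le> (LINT x|lborel. cmod (cis (2 * pi * (x \<bullet> z)) * f x))"
    unfolding fourier_def by (rule integral_norm_bound)
  then show ?thesis by (simp add: norm_mult)
qed

lemma integrable_gaussian_scaled:
  "e \<noteq> 0 \<Longrightarrow> integrable lborel (\<lambda>x. gaussian (e *\<^sub>R x :: 'a::euclidean_space))"
proof -
  assume e: "e \<noteq> 0"
  have "integrable lborel (\<lambda>x. complex_of_real (gaussian (0 + e *\<^sub>R x :: 'a)))"
    by (rule integrable_lborel_affine[OF _ e]) (auto intro: integrable_gaussian)
  from integrable_Re[OF this] show ?thesis by simp
qed

text \<open>The Gaussian makes the \<open>z\<close>-integral absolutely convergent. Carrying it out
  first, after expanding the squared modulus as a double integral, leaves a Gaussian in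
  \<open>x - y\<close> concentrated at scale \<open>e\<close>, that is, an average over translates
  of \<open>f\<close>.\<close>

lemma fourier_gaussian_weighted:
  fixes f :: "'a::euclidean_space \<Rightarrow> complex"
  assumes f1: "f \<in> L1" and f2: "f \<in> L2" and e: "e > 0"
  shows "(LINT z|lborel. complex_of_real ((cmod (fourier f z))\<^sup>2 * gaussian (e *\<^sub>R z)))
       = (LINT s|lborel. complex_of_real (gaussian s) * l2_inner f (\<lambda>x. f (x + (- e) *\<^sub>R s)))"
proof -
  note [measurable] = L2_measurable[OF f2] fourier_measurable[OF L2_measurable[OF f2]]
  define C where "C = (LINT x|lborel. cmod (f x))"
  have C: "C \<ge> 0" by (simp add: C_def)
  have fi: "integrable lborel (\<lambda>x. cmod (f x))" using f1 by (simp add: L1_def)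
  have gi: "integrable lborel (\<lambda>z. gaussian (e *\<^sub>R z :: 'a))" using e by (intro integrable_gaussian_scaled) simp
  have inner: "(LINT z|lborel. cis (2 * pi * (x \<bullet> z)) * (cnj (fourier f z) * complex_of_real (gaussian (e *\<^sub>R z))))
     = (LINT s|lborel. complex_of_real (gaussian s) * cnj (f (x + (- e) *\<^sub>R s)))" for x
  proof -
    have "cis (2 * pi * (x \<bullet> z)) * (cnj (fourier f z) * complex_of_real (gaussian (e *\<^sub>R z)))
       = (LINT y|lborel. cnj (f y) * (cis (2 * pi * ((x - y) \<bullet> z)) * complex_of_real (gaussian (e *\<^sub>R z))))" for z
    proof -
      have "cnj (f y) * (cis (2 * pi * ((x - y) \<bullet> z)) * complex_of_real (gaussian (e *\<^sub>R z)))
        = (cis (2 * pi * (x \<bullet> z)) * complex_of_real (gaussian (e *\<^sub>R z))) * cnj (cis (2 * pi * (y \<bullet> z)) * f y)" for y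
      proof -
        have "cis (2 * pi * ((x - y) \<bullet> z)) = cis (2 * pi * (x \<bullet> z)) * cnj (cis (2 * pi * (y \<bullet> z)))"
          by (simp add: cis_cnj cis_mult inner_diff_left right_diff_distrib)
        then show ?thesis by (simp only: complex_cnj_mult ac_simps)
      qed
      then show ?thesis
        by (simp only: fourier_def integral_mult_right_zero Bochner_Integration.integral_cnj) (simp add: ac_simps)
    qed
    then have "(LINT z|lborel. cis (2 * pi * (x \<bullet> z)) * (cnj (fourier f z) * complex_of_real (gaussian (e *\<^sub>R z))))
      = (LINT z|lborel. LINT y|lborel. cnj (f y) * (cis (2 * pi * ((x - y) \<bullet> z)) * complex_of_real (gaussian (e *\<^sub>R z))))"
      by simp
    also have "\<dots> = (LINT y|lborel. LINT z|lborel. cnj (f y) * (cis (2 * pi * ((x - y) \<bullet> z)) * complex_of_real (gaussian (e *\<^sub>R z))))"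
      by (rule fubini_prod_bound[OF _ gi fi]) (auto simp: norm_mult mult.commute)
    also have "\<dots> = (LINT y|lborel. cnj (f y) * complex_of_real (gaussian ((1 / e) *\<^sub>R (x - y)) / e ^ DIM('a)))"
      by (simp only: integral_mult_right_zero integral_gaussian_scaled[OF e])
    \<comment> \<open>Substitution y = x - e s: its Jacobian cancels the power of \<open>e\<close>
      left by the Gaussian integral, and the Gaussian itself loses its dependence on
      \<open>e\<close>.\<close>
    also have "\<dots> = complex_of_real (\<bar>- e\<bar> ^ DIM('a)) * (LINT s|lborel. cnj (f (x + (- e) *\<^sub>R s)) * complex_of_real (gaussian ((1 / e) *\<^sub>R (x - (x + (- e) *\<^sub>R s))) / e ^ DIM('a)))"
      by (rule integral_lborel_affine) (measurable, use e in simp)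
    also have "\<dots> = (LINT s|lborel. complex_of_real (gaussian s) * cnj (f (x + (- e) *\<^sub>R s)))"
      using e by (subst integral_mult_right_zero[symmetric]) (simp add: ac_simps)
    finally show ?thesis .
  qed
  have "(LINT z|lborel. complex_of_real ((cmod (fourier f z))\<^sup>2 * gaussian (e *\<^sub>R z)))
     = (LINT z|lborel. LINT x|lborel. f x * (cis (2 * pi * (x \<bullet> z)) * (cnj (fourier f z) * complex_of_real (gaussian (e *\<^sub>R z)))))"
  proof (intro Bochner_Integration.integral_cong refl)
    fix z
    have "complex_of_real ((cmod (fourier f z))\<^sup>2 * gaussian (e *\<^sub>R z))
        = (cnj (fourier f z) * complex_of_real (gaussian (e *\<^sub>R z))) * fourier f z"
      by (simp add: complex_norm_square ac_simps del: of_real_power)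
    also have "\<dots> = (LINT x|lborel. (cnj (fourier f z) * complex_of_real (gaussian (e *\<^sub>R z))) * (cis (2 * pi * (x \<bullet> z)) * f x))"
      by (simp only: fourier_def integral_mult_right_zero)
    finally show "complex_of_real ((cmod (fourier f z))\<^sup>2 * gaussian (e *\<^sub>R z))
       = (LINT x|lborel. f x * (cis (2 * pi * (x \<bullet> z)) * (cnj (fourier f z) * complex_of_real (gaussian (e *\<^sub>R z)))))"
      by (simp add: ac_simps)
  qed
  also have "\<dots> = (LINT x|lborel. LINT z|lborel. f x * (cis (2 * pi * (x \<bullet> z)) * (cnj (fourier f z) * complex_of_real (gaussian (e *\<^sub>R z)))))"
  proof (rule fubini_prod_bound[where a = "\<lambda>z. C * gaussian (e *\<^sub>R z)", OF _ _ fi])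
    show "integrable lborel (\<lambda>z. C * gaussian (e *\<^sub>R z :: 'a))" using gi by simp
    show "cmod (f x * (cis (2 * pi * (x \<bullet> z)) * (cnj (fourier f z) * complex_of_real (gaussian (e *\<^sub>R z)))))
        \<le> C * gaussian (e *\<^sub>R z) * cmod (f x)" for x z
      using mult_right_mono[OF fourier_bound[OF f1, of z], of "gaussian (e *\<^sub>R z) * cmod (f x)"]
      by (simp add: norm_mult C_def ac_simps)
  qed measurable
  also have "\<dots> = (LINT x|lborel. LINT s|lborel. f x * (complex_of_real (gaussian s) * cnj (f (x + (- e) *\<^sub>R s))))"
    by (simp only: integral_mult_right_zero inner)
  also have "\<dots> = (LINT s|lborel. LINT x|lborel. f x * (complex_of_real (gaussian s) * cnj (f (x + (- e) *\<^sub>R s))))"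
  \<comment> \<open>Two shifted values of \<open>f\<close> are multiplied here, so a product
    majorant in \<open>x\<close> and \<open>s\<close> is not at hand. Their product is bounded by
    the sum of their squares, whose integrals over \<open>x\<close> do not depend on
    \<open>s\<close>.\<close>
  proof (rule lborel_pair.Fubini_integral[symmetric], unfold integrable_iff_bounded, intro conjI)
    have "(\<integral>\<^sup>+ p. ennreal (norm (case_prod (\<lambda>x s. f x * (complex_of_real (gaussian s) * cnj (f (x + (- e) *\<^sub>R s)))) p)) \<partial>(lborel \<Otimes>\<^sub>M lborel))
       = (\<integral>\<^sup>+ s. \<integral>\<^sup>+ x. ennreal (norm (f x * (complex_of_real (gaussian s) * cnj (f (x + (- e) *\<^sub>R s))))) \<partial>lborel \<partial>lborel)"
      by (subst lborel_pair.nn_integral_snd[symmetric]) auto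
    also have "\<dots> \<le> (\<integral>\<^sup>+ s. ennreal (gaussian (s :: 'a)) * (2 * l2_norm_sq f) \<partial>lborel)"
    proof (intro nn_integral_mono)
      fix s :: 'a
      have "(\<integral>\<^sup>+ x. ennreal (norm (f x * (complex_of_real (gaussian s) * cnj (f (x + (- e) *\<^sub>R s))))) \<partial>lborel)
         \<le> (\<integral>\<^sup>+ x. ennreal (gaussian s) * (ennreal ((cmod (f x))\<^sup>2) + ennreal ((cmod (f (x + (- e) *\<^sub>R s)))\<^sup>2)) \<partial>lborel)"
      proof (intro nn_integral_mono)
        fix x
        have "cmod (f x) * cmod (f (x + (- e) *\<^sub>R s)) \<le> (cmod (f x))\<^sup>2 + (cmod (f (x + (- e) *\<^sub>R s)))\<^sup>2"
          using sum_squares_bound[of "cmod (f x)" "cmod (f (x + (- e) *\<^sub>R s))"]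
            mult_nonneg_nonneg[OF norm_ge_zero norm_ge_zero, of "f x" "f (x + (- e) *\<^sub>R s)"] by linarith
        then have "gaussian s * (cmod (f x) * cmod (f (x + (- e) *\<^sub>R s)))
           \<le> gaussian s * ((cmod (f x))\<^sup>2 + (cmod (f (x + (- e) *\<^sub>R s)))\<^sup>2)"
          by (intro mult_left_mono) auto
        then show "ennreal (norm (f x * (complex_of_real (gaussian s) * cnj (f (x + (- e) *\<^sub>R s)))))
           \<le> ennreal (gaussian s) * (ennreal ((cmod (f x))\<^sup>2) + ennreal ((cmod (f (x + (- e) *\<^sub>R s)))\<^sup>2))"
          by (simp add: norm_mult ac_simps ennreal_leI flip: ennreal_plus ennreal_mult)
      qed
      also have "\<dots> = ennreal (gaussian s) * (l2_norm_sq f + l2_norm_sq (\<lambda>x. f (x + (- e) *\<^sub>R s)))"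
        unfolding l2_norm_sq_def by (subst nn_integral_cmult, simp, subst nn_integral_add) auto
      also have "l2_norm_sq (\<lambda>x. f (x + (- e) *\<^sub>R s)) = l2_norm_sq f"
        using f2 by (simp only: l2_norm_sq_eq l2_translate)
      finally show "(\<integral>\<^sup>+ x. ennreal (norm (f x * (complex_of_real (gaussian s) * cnj (f (x + (- e) *\<^sub>R s))))) \<partial>lborel)
         \<le> ennreal (gaussian s) * (2 * l2_norm_sq f)" by (simp only: mult_2)
    qed
    also have "\<dots> = (\<integral>\<^sup>+ s. ennreal (gaussian (s :: 'a)) \<partial>lborel) * (2 * l2_norm_sq f)"
      by (simp add: nn_integral_multc)
    also have "\<dots> < \<infinity>"
      using integrable_gaussian[where 'a = 'a] f2 unfolding integrable_iff_bounded
      by (simp add: ennreal_mult_less_top)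
    finally show "(\<integral>\<^sup>+ p. ennreal (norm (case_prod (\<lambda>x s. f x * (complex_of_real (gaussian s) * cnj (f (x + (- e) *\<^sub>R s)))) p)) \<partial>(lborel \<Otimes>\<^sub>M lborel)) < \<infinity>" .
  qed measurable
  also have "\<dots> = (LINT s|lborel. complex_of_real (gaussian s) * l2_inner f (\<lambda>x. f (x + (- e) *\<^sub>R s)))"
    by (simp only: l2_inner_def mult.left_commute[of "f _" "complex_of_real (gaussian _)"] integral_mult_right_zero)
  finally show ?thesis .
qed

text \<open>Let \<open>e\<close> tend to 0 in \<open>fourier_gaussian_weighted\<close>. On the left
  the weights increase to 1, so monotone convergence applies and finiteness of the limit comes out
  as a result; on the right, continuity of translation and the majorant
  \<open>gaussian s * nsq f\<close> give the limit.\<close>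

lemma plancherel:
  fixes f :: "'a::euclidean_space \<Rightarrow> complex"
  assumes f1: "f \<in> L1" and f2: "f \<in> L2"
  shows "l2_norm_sq (fourier f) = l2_norm_sq f"
proof -
  note [measurable] = L2_measurable[OF f2] fourier_measurable[OF L2_measurable[OF f2]]
  define e where "e k = 1 / real (Suc k)" for k
  have e: "e k > 0" for k by (simp add: e_def)
  have e0: "e \<longlonglongrightarrow> 0" unfolding e_def using LIMSEQ_inverse_real_of_nat by (simp add: inverse_eq_divide)
  let ?W = "\<lambda>k z. (cmod (fourier f z))\<^sup>2 * gaussian (e k *\<^sub>R z)"
  have "(\<lambda>k. LINT s|lborel. complex_of_real (gaussian (s :: 'a)) * l2_inner f (\<lambda>x. f (x + (- e k) *\<^sub>R s)))
     \<longlonglongrightarrow> (LINT s|lborel. complex_of_real (gaussian (s :: 'a)) * l2_inner f f)"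
  proof (rule integral_dominated_convergence[where w = "\<lambda>s. gaussian s * nsq f"])
    show "integrable lborel (\<lambda>s::'a. gaussian s * nsq f)" using integrable_gaussian[where 'a = 'a] by simp
    show "(\<lambda>s. complex_of_real (gaussian (s :: 'a)) * l2_inner f (\<lambda>x. f (x + (- e k) *\<^sub>R s))) \<in> borel_measurable lborel" for k
      unfolding l2_inner_def by measurable
    show "AE s in lborel. (\<lambda>k. complex_of_real (gaussian (s :: 'a)) * l2_inner f (\<lambda>x. f (x + (- e k) *\<^sub>R s)))
       \<longlonglongrightarrow> complex_of_real (gaussian s) * l2_inner f f"
    proof (intro AE_I2 tendsto_mult tendsto_const l2_inner_tendsto_right l2_translate f2 l2_translate_tendsto)
      fix s :: 'a
      show "(\<lambda>k. (- e k) *\<^sub>R s) \<longlonglongrightarrow> 0"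
        using tendsto_scaleR[OF tendsto_minus[OF e0] tendsto_const[of s]] by simp
    qed
    show "AE s in lborel. norm (complex_of_real (gaussian (s :: 'a)) * l2_inner f (\<lambda>x. f (x + (- e k) *\<^sub>R s))) \<le> gaussian s * nsq f" for k
    proof (intro AE_I2)
      fix s :: 'a
      have "(cmod (l2_inner f (\<lambda>x. f (x + (- e k) *\<^sub>R s))))\<^sup>2 \<le> (nsq f)\<^sup>2"
        using l2_Cauchy_Schwarz[OF f2 l2_translate(1)[OF f2, of "(- e k) *\<^sub>R s"]] l2_translate(2)[OF f2, of "(- e k) *\<^sub>R s"]
        by (simp only: power2_eq_square)
      then have "cmod (l2_inner f (\<lambda>x. f (x + (- e k) *\<^sub>R s))) \<le> nsq f"
        by (rule power2_le_imp_le) simp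
      then show "norm (complex_of_real (gaussian s) * l2_inner f (\<lambda>x. f (x + (- e k) *\<^sub>R s))) \<le> gaussian s * nsq f"
        by (simp add: norm_mult mult_left_mono)
    qed
  qed simp
  moreover have "(LINT s|lborel. complex_of_real (gaussian (s :: 'a)) * l2_inner f f) = complex_of_real (nsq f)"
  proof -
    have "(LINT s|lborel. complex_of_real (gaussian (s :: 'a)) * l2_inner f f)
       = (LINT s|lborel. complex_of_real (gaussian (s :: 'a))) * l2_inner f f"
      by (rule integral_mult_left_zero)
    then show ?thesis using integral_gaussian_eq_1[where 'a = 'a] f2
      by (simp add: l2_inner_self integral_complex_of_real)
  qed
  ultimately have "(\<lambda>k. complex_of_real (LINT z|lborel. ?W k z)) \<longlonglongrightarrow> complex_of_real (nsq f)"
    using fourier_gaussian_weighted[OF f1 f2 e] by (simp add: integral_complex_of_real del: of_real_mult)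
  then have lim: "(\<lambda>k. LINT z|lborel. ?W k z) \<longlonglongrightarrow> nsq f" by (simp only: tendsto_of_real_iff)
  have int: "integrable lborel (?W k)" for k
  proof (rule Bochner_Integration.integrable_bound)
    show "integrable lborel (\<lambda>z::'a. (LINT x|lborel. cmod (f x))\<^sup>2 * gaussian (e k *\<^sub>R z))"
      using integrable_gaussian_scaled[where 'a = 'a and e = "e k"] e[of k] by simp
    show "AE z in lborel. norm (?W k z) \<le> norm ((LINT x|lborel. cmod (f x))\<^sup>2 * gaussian (e k *\<^sub>R z))"
      by (intro AE_I2) (simp add: abs_mult mult_right_mono power_mono fourier_bound[OF f1])
  qed measurable
  have "(\<lambda>k. \<integral>\<^sup>+ z. ennreal (?W k z) \<partial>lborel) \<longlonglongrightarrow> l2_norm_sq (fourier f)"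
    unfolding l2_norm_sq_def
  proof (rule nn_integral_LIMSEQ)
    have "gaussian (e k *\<^sub>R z) \<le> gaussian (e (Suc k) *\<^sub>R z)" for k and z :: 'a
    proof -
      have "norm (e (Suc k) *\<^sub>R z) \<le> norm (e k *\<^sub>R z)"
        by (simp add: e_def frac_le divide_right_mono mult_right_mono)
      then have "(norm (e (Suc k) *\<^sub>R z))\<^sup>2 \<le> (norm (e k *\<^sub>R z))\<^sup>2" by (intro power_mono) auto
      then show ?thesis unfolding gaussian_def by simp
    qed
    then show "incseq (\<lambda>k z. ennreal (?W k z))"
      by (intro incseq_SucI le_funI ennreal_leI mult_left_mono) auto
    show "(\<lambda>k. ennreal (?W k z)) \<longlonglongrightarrow> ennreal ((cmod (fourier f z))\<^sup>2)" for z
    proof -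
      have "(\<lambda>k. norm (e k *\<^sub>R z)) \<longlonglongrightarrow> norm (0 *\<^sub>R z)" by (intro tendsto_intros e0)
      then have "(\<lambda>k. gaussian (e k *\<^sub>R z)) \<longlonglongrightarrow> exp (- pi * (norm (0 *\<^sub>R z))\<^sup>2)"
        unfolding gaussian_def by (intro tendsto_exp tendsto_mult tendsto_const tendsto_power)
      then have "(\<lambda>k. ?W k z) \<longlonglongrightarrow> (cmod (fourier f z))\<^sup>2 * 1"
        by (intro tendsto_mult tendsto_const) simp
      then show ?thesis by (intro tendsto_ennrealI) simp
    qed
  qed measurable
  moreover have "(\<lambda>k. \<integral>\<^sup>+ z. ennreal (?W k z) \<partial>lborel) \<longlonglongrightarrow> ennreal (nsq f)"
    using lim int by (subst nn_integral_eq_integral) (auto intro: tendsto_ennrealI)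
  ultimately show ?thesis using f2 by (simp add: l2_norm_sq_eq LIMSEQ_unique)
qed

section \<open>The Schroedinger representations\<close>

lemma schroedinger_eq:
  "schroedinger l (x, y, t) \<phi> \<xi> = cis (2 * pi * l * (t + x \<bullet> \<xi> + x \<bullet> y / 2)) * \<phi> (\<xi> + y)"
  by (simp add: cis_mult distrib_left add.assoc)

declare schroedinger.simps [simp del]

lemma schroedinger_zero: "schroedinger l (0, 0, 0) \<phi> = \<phi>"
  by (rule ext) (simp add: schroedinger_eq)

text \<open>Negation is inversion in the Heisenberg group, because the antisymmetric term of the
  group law vanishes on \<open>p\<close> and \<open>- p\<close>.\<close>

lemma schroedinger_inverse: "schroedinger l p (schroedinger l (- p) \<phi>) = \<phi>"
proof (rule ext)
  fix \<xi>
  obtain x y t where p: "p = (x, y, t)" by (cases p)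
  have "schroedinger l p (schroedinger l (- p) \<phi>) \<xi>
     = cis (2 * pi * l * (t + x \<bullet> \<xi> + x \<bullet> y / 2) + 2 * pi * l * (- t + (- x) \<bullet> (\<xi> + y) + (- x) \<bullet> (- y) / 2)) * \<phi> \<xi>"
    unfolding p by (simp add: schroedinger_eq cis_mult[symmetric] del: cis_mult)
  also have "2 * pi * l * (t + x \<bullet> \<xi> + x \<bullet> y / 2) + 2 * pi * l * (- t + (- x) \<bullet> (\<xi> + y) + (- x) \<bullet> (- y) / 2) = 0"
    by (simp add: inner_add_right algebra_simps)
  finally show "schroedinger l p (schroedinger l (- p) \<phi>) \<xi> = \<phi> \<xi>" by simp
qed

lemma schroedinger_measurable_pair:
  assumes [measurable]: "\<phi> \<in> borel_measurable borel"
  shows "(\<lambda>(l, p, \<xi>). schroedinger l p \<phi> \<xi>) \<in> borel_measurable (borel :: (real \<times> 'n::finite heis \<times> (real ^ 'n)) measure)"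
proof -
  have "(\<lambda>(l, p, \<xi>). schroedinger l p \<phi> \<xi>)
    = (\<lambda>q :: real \<times> 'n heis \<times> (real ^ 'n). cis (2 * pi * fst q * (snd (snd (fst (snd q))) + fst (fst (snd q)) \<bullet> snd (snd q)
       + fst (fst (snd q)) \<bullet> fst (snd (fst (snd q))) / 2)) * \<phi> (snd (snd q) + fst (snd (fst (snd q)))))"
    by (auto simp: schroedinger_eq fun_eq_iff)
  moreover have "\<dots> \<in> borel_measurable borel"
    unfolding borel_prod[symmetric] by measurable
  ultimately show ?thesis by simp
qed

lemma schroedinger_measurable [measurable]:
  fixes l :: "'c \<Rightarrow> real" and p :: "'c \<Rightarrow> 'n::finite heis" and \<xi> :: "'c \<Rightarrow> real ^ 'n"
  assumes \<phi>: "\<phi> \<in> borel_measurable borel"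
    and [measurable]: "l \<in> borel_measurable M" "p \<in> borel_measurable M" "\<xi> \<in> borel_measurable M"
  shows "(\<lambda>x. schroedinger (l x) (p x) \<phi> (\<xi> x)) \<in> borel_measurable M"
proof -
  have "(\<lambda>x. (l x, p x, \<xi> x)) \<in> borel_measurable M"
    by (intro borel_measurable_Pair) measurable
  from measurable_compose[OF this schroedinger_measurable_pair[OF \<phi>]] show ?thesis by simp
qed

lemma cmod_schroedinger: "cmod (schroedinger l p \<phi> \<xi>) = cmod (\<phi> (\<xi> + fst (snd p)))"
  by (cases p) (simp add: schroedinger_eq norm_mult)

lemma schroedinger_L2:
  assumes "\<phi> \<in> L2" shows "schroedinger l p \<phi> \<in> L2" "nsq (schroedinger l p \<phi>) = nsq \<phi>"
proof -
  note [measurable] = L2_measurable[OF assms]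
  have m: "schroedinger l p \<phi> \<in> borel_measurable borel" by measurable
  show "schroedinger l p \<phi> \<in> L2"
    by (rule L2_dominated[OF l2_translate(1)[OF assms, of "fst (snd p)"] m]) (simp add: cmod_schroedinger)
  show "nsq (schroedinger l p \<phi>) = nsq \<phi>"
    using l2_translate(2)[OF assms, of "fst (snd p)"] unfolding nsq_def cmod_schroedinger .
qed

lemma schroedinger_linear:
  "schroedinger l p (\<lambda>x. a * \<phi> x + b * \<psi> x) \<xi> = a * schroedinger l p \<phi> \<xi> + b * schroedinger l p \<psi> \<xi>"
  by (cases p) (simp add: schroedinger_eq algebra_simps)

lemma integral_lborel_translate:
  fixes F :: "'a::euclidean_space \<Rightarrow> complex"
  assumes "F \<in> borel_measurable borel"
  shows "(LINT x|lborel. F (x + t)) = (LINT x|lborel. F x)"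
  using integral_lborel_affine[OF assms, of 1 t] by (simp add: add.commute)

text \<open>Shifting the integration variable by \<open>y\<close> moves the translation from one
  factor of the inner product to the other, and the phases at the shifted points are
  conjugate.\<close>

lemma unitary_schroedinger:
  fixes p :: "'n::finite heis"
  shows "unitary_pair (schroedinger l p) (schroedinger l (- p))"
proof -
  have b: "bounded_op (schroedinger l p)" for p :: "'n heis"
    by (rule bounded_opI[where C = 1]) (auto simp: schroedinger_L2 schroedinger_linear)
  have "adj_pair (schroedinger l p) (schroedinger l (- p))"
    unfolding adj_pair_def
  proof (intro conjI ballI)
    fix \<phi> \<psi> :: "real ^ 'n \<Rightarrow> complex" assume \<phi>: "\<phi> \<in> L2" and \<psi>: "\<psi> \<in> L2"
    note [measurable] = L2_measurable[OF \<phi>] L2_measurable[OF \<psi>]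
    obtain x y t where p: "p = (x, y, t)" by (cases p)
    let ?F = "\<lambda>\<xi>. \<phi> \<xi> * cnj (schroedinger l (- p) \<psi> \<xi>)"
    have "?F (\<xi> + y) = schroedinger l p \<phi> \<xi> * cnj (\<psi> \<xi>)" for \<xi>
    proof -
      have "- (2 * pi * l * (- t + (- x) \<bullet> (\<xi> + y) + (- x) \<bullet> (- y) / 2)) = 2 * pi * l * (t + x \<bullet> \<xi> + x \<bullet> y / 2)"
        by (simp add: inner_add_right algebra_simps)
      then have "cnj (cis (2 * pi * l * (- t + (- x) \<bullet> (\<xi> + y) + (- x) \<bullet> (- y) / 2))) = cis (2 * pi * l * (t + x \<bullet> \<xi> + x \<bullet> y / 2))"
        by (simp only: cis_cnj)
      then show ?thesis unfolding p by (simp add: schroedinger_eq)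
    qed
    then show "l2_inner \<phi> (schroedinger l (- p) \<psi>) = l2_inner (schroedinger l p \<phi>) \<psi>"
      unfolding l2_inner_def using integral_lborel_translate[of ?F y] by simp
  qed (auto simp: schroedinger_L2)
  then show ?thesis unfolding unitary_pair_def
    using b schroedinger_inverse[of l p] schroedinger_inverse[of l "- p"] by simp
qed

section \<open>Operators with square-integrable kernels\<close>

lemma nn_integral_lborel_pair:
  fixes F :: "'a::euclidean_space \<times> 'b::euclidean_space \<Rightarrow> ennreal"
  assumes "F \<in> borel_measurable borel"
  shows "(\<integral>\<^sup>+ p. F p \<partial>lborel) = (\<integral>\<^sup>+ x. \<integral>\<^sup>+ y. F (x, y) \<partial>lborel \<partial>lborel)"
proof -
  have "F \<in> borel_measurable (lborel \<Otimes>\<^sub>M lborel)" using assms by (simp add: lborel_prod)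
  from lborel.nn_integral_fst[OF this] show ?thesis by (simp add: lborel_prod)
qed

lemma nn_integral_lborel_swap:
  fixes F :: "'a::euclidean_space \<Rightarrow> 'b::euclidean_space \<Rightarrow> ennreal"
  assumes "case_prod F \<in> borel_measurable borel"
  shows "(\<integral>\<^sup>+ x. \<integral>\<^sup>+ y. F x y \<partial>lborel \<partial>lborel) = (\<integral>\<^sup>+ y. \<integral>\<^sup>+ x. F x y \<partial>lborel \<partial>lborel)"
proof -
  have "case_prod F \<in> borel_measurable (lborel \<Otimes>\<^sub>M lborel)" using assms by (simp add: lborel_prod)
  from lborel_pair.Fubini[OF this, symmetric] show ?thesis by (simp only: prod.case)
qed

lemma l2_norm_sq_pair:
  fixes k :: "'a::euclidean_space \<times> 'b::euclidean_space \<Rightarrow> complex"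
  assumes [measurable]: "k \<in> borel_measurable borel"
  shows "l2_norm_sq k = (\<integral>\<^sup>+ x. l2_norm_sq (\<lambda>y. k (x, y)) \<partial>lborel)"
  unfolding l2_norm_sq_def by (rule nn_integral_lborel_pair) measurable

lemma AE_L2_slice:
  fixes k :: "'a::euclidean_space \<times> 'b::euclidean_space \<Rightarrow> complex"
  assumes k: "k \<in> L2"
  shows "AE x in lborel. (\<lambda>y. k (x, y)) \<in> L2"
proof -
  note [measurable] = L2_measurable[OF k]
  have m: "(\<lambda>x. l2_norm_sq (\<lambda>y. k (x, y))) \<in> borel_measurable lborel"
    unfolding l2_norm_sq_def by measurable
  have "(\<integral>\<^sup>+ x. l2_norm_sq (\<lambda>y. k (x, y)) \<partial>lborel) \<noteq> \<infinity>"
    unfolding l2_norm_sq_pair[OF L2_measurable[OF k], symmetric] using l2_norm_sq_finite[OF k] by simp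
  from nn_integral_PInf_AE[OF m this] show ?thesis
    by eventually_elim (auto intro!: L2_I simp: less_top)
qed

definition kop :: "('a::euclidean_space \<times> 'a \<Rightarrow> complex) \<Rightarrow> 'a op" where
  "kop k \<phi> x = (LINT y|lborel. k (x, y) * \<phi> y)"

lemma kop_measurable:
  assumes [measurable]: "k \<in> borel_measurable borel" "\<phi> \<in> borel_measurable borel"
  shows "kop k \<phi> \<in> borel_measurable borel"
  unfolding kop_def[abs_def] by measurable

lemma kop_eq_inner: "kop k \<phi> x = l2_inner (\<lambda>y. k (x, y)) (\<lambda>y. cnj (\<phi> y))"
  unfolding kop_def l2_inner_def by simp

lemma kop_L2:
  assumes k: "k \<in> L2" and \<phi>: "\<phi> \<in> L2"
  shows "kop k \<phi> \<in> L2" "nsq (kop k \<phi>) \<le> nsq k * nsq \<phi>"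
proof -
  note [measurable] = L2_measurable[OF k] kop_measurable[OF L2_measurable[OF k] L2_measurable[OF \<phi>]]
  have n: "nsq (\<lambda>y. cnj (\<phi> y)) = nsq \<phi>" by (simp add: nsq_def)
  have "l2_norm_sq (kop k \<phi>) \<le> (\<integral>\<^sup>+ x. l2_norm_sq (\<lambda>y. k (x, y)) * ennreal (nsq \<phi>) \<partial>lborel)"
    unfolding l2_norm_sq_def[of "kop k \<phi>"]
  proof (intro nn_integral_mono_AE, use AE_L2_slice[OF k] in eventually_elim)
    fix x assume "(\<lambda>y. k (x, y)) \<in> L2"
    then show "ennreal ((cmod (kop k \<phi> x))\<^sup>2) \<le> l2_norm_sq (\<lambda>y. k (x, y)) * ennreal (nsq \<phi>)"
      using l2_Cauchy_Schwarz[of "\<lambda>y. k (x, y)" "\<lambda>y. cnj (\<phi> y)"] \<phi>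
      by (simp add: l2_norm_sq_eq kop_eq_inner L2_cnj n ennreal_leI flip: ennreal_mult)
  qed
  also have "\<dots> = l2_norm_sq k * ennreal (nsq \<phi>)"
    unfolding l2_norm_sq_pair[OF L2_measurable[OF k]]
    by (rule nn_integral_multc) (unfold l2_norm_sq_def, measurable)
  finally have le: "l2_norm_sq (kop k \<phi>) \<le> ennreal (nsq k * nsq \<phi>)"
    using k by (simp add: l2_norm_sq_eq ennreal_mult)
  then show 1: "kop k \<phi> \<in> L2" by (intro L2_I) (auto intro: le_less_trans)
  show "nsq (kop k \<phi>) \<le> nsq k * nsq \<phi>" using le 1 by (simp add: l2_norm_sq_eq)
qed

lemma bounded_op_kop: "k \<in> L2 \<Longrightarrow> bounded_op (kop k)"
proof (rule bounded_opI[where C = "nsq k"])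
  fix \<phi> \<psi> :: "'a \<Rightarrow> complex" and a b assume k: "k \<in> L2" and \<phi>: "\<phi> \<in> L2" and \<psi>: "\<psi> \<in> L2"
  show "AE x in lborel. kop k (\<lambda>x. a * \<phi> x + b * \<psi> x) x = a * kop k \<phi> x + b * kop k \<psi> x"
    using AE_L2_slice[OF k]
  proof eventually_elim
    fix x assume "(\<lambda>y. k (x, y)) \<in> L2"
    then have "integrable lborel (\<lambda>y. k (x, y) * \<phi> y)" "integrable lborel (\<lambda>y. k (x, y) * \<psi> y)"
      using \<phi> \<psi> by (auto intro: integrable_L2_mult)
    then show "kop k (\<lambda>x. a * \<phi> x + b * \<psi> x) x = a * kop k \<phi> x + b * kop k \<psi> x"
      unfolding kop_def by (simp add: distrib_left mult.left_commute[of "k _"])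
  qed
qed (auto simp: kop_L2)

text \<open>Exchange the sum with the integral over the first variable; for almost every
  \<open>x\<close> the inner sum is Parseval for the slice of \<open>k\<close> in the conjugate
  basis.\<close>

lemma kop_hs_sum:
  assumes k: "k \<in> L2" and e: "l2_onb e"
  shows "(\<Sum>i. l2_norm_sq (kop k (e i))) = l2_norm_sq k"
proof -
  note [measurable] = L2_measurable[OF k] kop_measurable[OF L2_measurable[OF k] L2_measurable[OF l2_onb_L2[OF e]]]
  have "(\<Sum>i. l2_norm_sq (kop k (e i))) = (\<integral>\<^sup>+ x. (\<Sum>i. ennreal ((cmod (kop k (e i) x))\<^sup>2)) \<partial>lborel)"
    unfolding l2_norm_sq_def by (intro nn_integral_suminf[symmetric]) measurable
  also have "\<dots> = (\<integral>\<^sup>+ x. l2_norm_sq (\<lambda>y. k (x, y)) \<partial>lborel)"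
  proof (intro nn_integral_cong_AE, use AE_L2_slice[OF k] in eventually_elim)
    fix x assume "(\<lambda>y. k (x, y)) \<in> L2"
    then show "(\<Sum>i. ennreal ((cmod (kop k (e i) x))\<^sup>2)) = l2_norm_sq (\<lambda>y. k (x, y))"
      using parseval[OF l2_onb_cnj[OF e]] by (simp add: kop_eq_inner)
  qed
  also have "\<dots> = l2_norm_sq k" by (rule l2_norm_sq_pair[symmetric]) measurable
  finally show ?thesis .
qed

lemma hilbert_schmidt_kop: "k \<in> L2 \<Longrightarrow> hilbert_schmidt (kop k)" "k \<in> L2 \<Longrightarrow> hs_norm_sq (kop k) = l2_norm_sq k"
  using kop_hs_sum[OF _ l2_onb_basis, of k] bounded_op_kop[of k]
  unfolding hilbert_schmidt_def hs_norm_sq_def by auto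

lemma kop_lincomb:
  assumes k: "k \<in> L2" and k': "k' \<in> L2" and \<phi>: "\<phi> \<in> L2"
  shows "AE x in lborel. kop (\<lambda>p. k p + c * k' p) \<phi> x = kop k \<phi> x + c * kop k' \<phi> x"
  using AE_L2_slice[OF k] AE_L2_slice[OF k']
proof eventually_elim
  fix x assume "(\<lambda>y. k (x, y)) \<in> L2" "(\<lambda>y. k' (x, y)) \<in> L2"
  then have "integrable lborel (\<lambda>y. k (x, y) * \<phi> y)" "integrable lborel (\<lambda>y. k' (x, y) * \<phi> y)"
    using \<phi> by (auto intro: integrable_L2_mult)
  then show "kop (\<lambda>p. k p + c * k' p) \<phi> x = kop k \<phi> x + c * kop k' \<phi> x"
    unfolding kop_def by (simp add: distrib_right mult.assoc)
qed

lemma l2_inner_polarization: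
  assumes "x \<in> L2" "y \<in> L2"
  shows "l2_inner x y = (complex_of_real (nsq (\<lambda>t. x t + 1 * y t) - nsq x - nsq y)
      + \<i> * complex_of_real (nsq (\<lambda>t. x t + \<i> * y t) - nsq x - nsq y)) / 2"
  using assms nsq_add[of x y] nsq_add[of x "\<lambda>t. \<i> * y t"]
  by (simp add: L2_cmult nsq_cmult l2_inner_cmult_right complex_eq_iff)

text \<open>The polarised form of \<open>kop_hs_sum\<close>: the Hilbert-Schmidt inner product of
  two integral operators is the inner product of their kernels.\<close>

lemma kop_inner_sums:
  assumes k: "k \<in> L2" and k': "k' \<in> L2" and e: "l2_onb e"
  shows "(\<lambda>i. l2_inner (kop k (e i)) (kop k' (e i))) sums l2_inner k k'"
proof -
  have sums: "(\<lambda>i. nsq (kop j (e i))) sums nsq j" if j: "j \<in> L2" for j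
  proof -
    have "(\<Sum>i. ennreal (nsq (kop j (e i)))) = ennreal (nsq j)"
      using kop_hs_sum[OF j e] kop_L2(1)[OF j l2_onb_L2[OF e]] j by (simp add: l2_norm_sq_eq)
    then have eq: "ennreal (nsq j) = (\<Sum>i. ennreal (nsq (kop j (e i))))" ..
    have s: "summable (\<lambda>i. nsq (kop j (e i)))"
      by (rule summable_suminf_not_top) (simp_all add: eq[symmetric])
    have "ennreal (nsq j) = ennreal (\<Sum>i. nsq (kop j (e i)))"
      unfolding eq by (rule suminf_ennreal2[OF _ s]) simp
    then have "nsq j = (\<Sum>i. nsq (kop j (e i)))"
      by (subst (asm) ennreal_inj) (auto intro: suminf_nonneg s)
    then show ?thesis using summable_sums[OF s] by simp
  qed
  have eq: "nsq (\<lambda>t. kop k (e i) t + c * kop k' (e i) t) = nsq (kop (\<lambda>p. k p + c * k' p) (e i))" for i c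
  proof -
    have "l2_norm_sq (\<lambda>t. kop k (e i) t + c * kop k' (e i) t) = l2_norm_sq (kop (\<lambda>p. k p + c * k' p) (e i))"
      by (rule l2_norm_sq_cong_AE[OF AE_eq_sym[OF kop_lincomb[OF k k' l2_onb_L2[OF e]]]])
    then show ?thesis
      using kop_L2(1)[OF _ l2_onb_L2[OF e, of i]] k k' by (simp add: l2_norm_sq_eq L2_add L2_cmult)
  qed
  have L: "(\<lambda>p. k p + c * k' p) \<in> L2" for c by (intro L2_add L2_cmult k k')
  have "(\<lambda>i. (complex_of_real (nsq (kop (\<lambda>p. k p + 1 * k' p) (e i)) - nsq (kop k (e i)) - nsq (kop k' (e i)))
     + \<i> * complex_of_real (nsq (kop (\<lambda>p. k p + \<i> * k' p) (e i)) - nsq (kop k (e i)) - nsq (kop k' (e i)))) / 2)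
     sums l2_inner k k'"
    unfolding l2_inner_polarization[OF k k']
    by (intro sums_divide sums_add sums_mult sums_of_real sums_diff sums L k k')
  then show ?thesis
    unfolding eq[symmetric] l2_inner_polarization[OF kop_L2(1)[OF k l2_onb_L2[OF e]] kop_L2(1)[OF k' l2_onb_L2[OF e]]] .
qed

section \<open>The group Fourier transform as a kernel operator\<close>

text \<open>Brings \<open>y\<close> to the front and leaves \<open>(x, t)\<close> as one Euclidean
  variable, in which the partial Fourier transform is taken.\<close>

definition heis_swap :: "(real ^ 'n) \<times> (real ^ 'n) \<times> real \<Rightarrow> 'n::finite heis" where
  "heis_swap r = (fst (snd r), fst r, snd (snd r))"

lemma heis_swap_simp [simp]: "heis_swap (y, x, t) = (x, y, t)" by (simp add: heis_swap_def)

lemma heis_swap_measurable [measurable]: "heis_swap \<in> borel_measurable borel"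
  unfolding heis_swap_def[abs_def] borel_prod[symmetric] by measurable

lemma nn_integral_heis:
  fixes F :: "'n::finite heis \<Rightarrow> ennreal"
  assumes [measurable]: "F \<in> borel_measurable borel"
  shows "(\<integral>\<^sup>+ p. F p \<partial>lborel) = (\<integral>\<^sup>+ r. F (heis_swap r) \<partial>lborel)"
proof -
  have [measurable]: "F \<in> borel_measurable (borel \<Otimes>\<^sub>M borel \<Otimes>\<^sub>M borel)"
    using assms by (simp add: borel_prod)
  have "(\<integral>\<^sup>+ p. F p \<partial>lborel) = (\<integral>\<^sup>+ x. \<integral>\<^sup>+ y. \<integral>\<^sup>+ t. F (x, y, t) \<partial>lborel \<partial>lborel \<partial>lborel)"
    by (subst nn_integral_lborel_pair, measurable, intro nn_integral_cong nn_integral_lborel_pair)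
      (unfold borel_prod[symmetric], measurable)
  also have "\<dots> = (\<integral>\<^sup>+ y. \<integral>\<^sup>+ x. \<integral>\<^sup>+ t. F (x, y, t) \<partial>lborel \<partial>lborel \<partial>lborel)"
    by (rule nn_integral_lborel_swap) (unfold borel_prod[symmetric], measurable)
  also have "\<dots> = (\<integral>\<^sup>+ r. F (heis_swap r) \<partial>lborel)"
  proof -
    have Fs [measurable]: "(\<lambda>r. F (heis_swap r)) \<in> borel_measurable (borel \<Otimes>\<^sub>M borel)"
      unfolding borel_prod using assms by measurable
    have "(\<integral>\<^sup>+ r. F (heis_swap r) \<partial>lborel) = (\<integral>\<^sup>+ y. \<integral>\<^sup>+ q. F (heis_swap (y, q)) \<partial>lborel \<partial>lborel)"
      by (rule nn_integral_lborel_pair) (use Fs in \<open>simp add: borel_prod\<close>)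
    also have "\<dots> = (\<integral>\<^sup>+ y. \<integral>\<^sup>+ x. \<integral>\<^sup>+ t. F (x, y, t) \<partial>lborel \<partial>lborel \<partial>lborel)"
    proof (rule nn_integral_cong)
      fix y :: "real ^ 'n"
      have "(\<lambda>q. F (heis_swap (y, q))) \<in> borel_measurable borel" by measurable
      from nn_integral_lborel_pair[OF this]
      show "(\<integral>\<^sup>+ q. F (heis_swap (y, q)) \<partial>lborel) = (\<integral>\<^sup>+ x. \<integral>\<^sup>+ t. F (x, y, t) \<partial>lborel \<partial>lborel)"
        by simp
    qed
    finally show ?thesis ..
  qed
  finally show ?thesis .
qed

lemma distr_heis_swap: "distr lborel borel (heis_swap :: _ \<Rightarrow> 'n::finite heis) = lborel"
proof (rule measure_eqI)
  fix A :: "'n heis set" assume "A \<in> sets (distr lborel borel heis_swap)"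
  then have A [measurable]: "A \<in> sets borel" by simp
  have "emeasure (distr lborel borel heis_swap) A = (\<integral>\<^sup>+ r. indicator A (heis_swap r) \<partial>lborel)"
    using A by (subst nn_integral_indicator[symmetric], simp) (subst nn_integral_distr, auto)
  also have "\<dots> = (\<integral>\<^sup>+ p. indicator A p \<partial>lborel)"
    by (rule nn_integral_heis[symmetric]) measurable
  finally show "emeasure (distr lborel borel heis_swap) A = emeasure lborel A" using A by simp
qed simp

lemma integral_heis:
  fixes F :: "'n::finite heis \<Rightarrow> complex"
  assumes [measurable]: "F \<in> borel_measurable borel"
  shows "(LINT p|lborel. F p) = (LINT r|lborel. F (heis_swap r))"
  by (subst distr_heis_swap[symmetric], subst integral_distr) auto

text \<open>The dual variable \<open>z\<close> is a pair: its vector part is dual to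
  \<open>x\<close>, and its real part is dual to \<open>t\<close> and will be the parameter
  \<open>l\<close>.\<close>

definition pft :: "('n::finite heis \<Rightarrow> complex) \<Rightarrow> (real ^ 'n) \<times> (real ^ 'n) \<times> real \<Rightarrow> complex" where
  "pft f = (\<lambda>(y, z). fourier (\<lambda>q. f (heis_swap (y, q))) z)"

lemma pft_measurable:
  assumes [measurable]: "f \<in> borel_measurable borel"
  shows "pft f \<in> borel_measurable borel"
proof -
  have [measurable]: "(\<lambda>r. f (heis_swap r)) \<in> borel_measurable (borel \<Otimes>\<^sub>M borel)"
    unfolding borel_prod by measurable
  have "pft f = (\<lambda>r. LINT q|lborel. cis (2 * pi * (q \<bullet> snd r)) * f (heis_swap (fst r, q)))"
    unfolding pft_def fourier_def by auto
  also have "\<dots> \<in> borel_measurable (borel \<Otimes>\<^sub>M borel)" by measurable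
  finally show ?thesis by (simp add: borel_prod)
qed

lemma
  fixes f :: "'n::finite heis \<Rightarrow> complex"
  shows AE_heis_slice_L1: "f \<in> L1 \<Longrightarrow> AE y in lborel. (\<lambda>q. f (heis_swap (y, q))) \<in> L1"
    and AE_heis_slice_L2: "f \<in> L2 \<Longrightarrow> AE y in lborel. (\<lambda>q. f (heis_swap (y, q))) \<in> L2"
proof -
  assume "f \<in> L1"
  then have f: "integrable lborel f" by (simp add: L1_def)
  note [measurable] = borel_measurable_integrable[OF f]
  have "integrable lborel (\<lambda>r. f (heis_swap r))"
    using f by (subst (asm) distr_heis_swap[symmetric], subst (asm) integrable_distr_eq) auto
  then have "integrable (lborel \<Otimes>\<^sub>M lborel) (\<lambda>r. f (heis_swap r))" by (simp add: lborel_prod)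
  from lborel_pair.AE_integrable_fst'[OF this]
  show "AE y in lborel. (\<lambda>q. f (heis_swap (y, q))) \<in> L1" by (simp add: L1_def)
next
  assume f: "f \<in> L2"
  note [measurable] = L2_measurable[OF f]
  have "l2_norm_sq (\<lambda>r. f (heis_swap r)) = l2_norm_sq f"
    unfolding l2_norm_sq_def by (rule nn_integral_heis[symmetric]) measurable
  moreover have "(\<lambda>r. f (heis_swap r)) \<in> borel_measurable borel" by measurable
  ultimately have "(\<lambda>r. f (heis_swap r)) \<in> L2" using l2_norm_sq_finite[OF f] by (intro L2_I) simp_all
  then show "AE y in lborel. (\<lambda>q. f (heis_swap (y, q))) \<in> L2" by (rule AE_L2_slice)
qed

text \<open>Almost every slice of \<open>f\<close> in \<open>(x, t)\<close> is integrable and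
  square-integrable, so Plancherel applies slice by slice.\<close>

lemma l2_norm_sq_pft:
  assumes f1: "f \<in> L1" and f2: "f \<in> L2"
  shows "l2_norm_sq (pft f) = l2_norm_sq f"
proof -
  note [measurable] = L2_measurable[OF f2]
  have "l2_norm_sq (pft f) = (\<integral>\<^sup>+ y. l2_norm_sq (\<lambda>z. pft f (y, z)) \<partial>lborel)"
    by (rule l2_norm_sq_pair[OF pft_measurable]) measurable
  also have "\<dots> = (\<integral>\<^sup>+ y. l2_norm_sq (\<lambda>q. f (heis_swap (y, q))) \<partial>lborel)"
  proof (rule nn_integral_cong_AE)
    show "AE y in lborel. l2_norm_sq (\<lambda>z. pft f (y, z)) = l2_norm_sq (\<lambda>q. f (heis_swap (y, q)))"
      using AE_heis_slice_L1[OF f1] AE_heis_slice_L2[OF f2]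
    proof eventually_elim
      fix y assume "(\<lambda>q. f (heis_swap (y, q))) \<in> L1" "(\<lambda>q. f (heis_swap (y, q))) \<in> L2"
      from plancherel[OF this] show "l2_norm_sq (\<lambda>z. pft f (y, z)) = l2_norm_sq (\<lambda>q. f (heis_swap (y, q)))"
        by (simp only: pft_def prod.case)
    qed
  qed
  also have "\<dots> = l2_norm_sq (\<lambda>r. f (heis_swap r))"
    by (rule l2_norm_sq_pair[symmetric]) measurable
  also have "\<dots> = l2_norm_sq f"
    unfolding l2_norm_sq_def by (rule nn_integral_heis[symmetric]) measurable
  finally show ?thesis .
qed

lemma AE_fst_lborel:
  fixes P :: "'a::euclidean_space \<Rightarrow> bool"
  assumes "AE y in lborel. P y"
  shows "AE r in (lborel :: ('a \<times> 'b::euclidean_space) measure). P (fst r)"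
proof -
  from AE_E[OF assms] obtain N where N: "{y \<in> space lborel. \<not> P y} \<subseteq> N" "emeasure lborel N = 0" "N \<in> sets lborel"
    by blast
  have "emeasure (lborel \<Otimes>\<^sub>M lborel) (N \<times> (UNIV :: 'b set)) = 0"
    using N by (subst lborel.emeasure_pair_measure_Times) auto
  then have "N \<times> (UNIV :: 'b set) \<in> null_sets lborel"
    using N by (auto simp: lborel_prod null_sets_def borel_prod[symmetric] intro!: pair_measureI)
  from AE_not_in[OF this] show ?thesis
    by eventually_elim (use N in auto)
qed

lemma pft_lincomb:
  fixes f g :: "'n::finite heis \<Rightarrow> complex"
  assumes f: "f \<in> L1" and g: "g \<in> L1"
  shows "AE r in lborel. pft (\<lambda>p. f p + c * g p) r = pft f r + c * pft g r"
  using AE_fst_lborel[OF AE_heis_slice_L1[OF f]] AE_fst_lborel[OF AE_heis_slice_L1[OF g]]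
proof eventually_elim
  fix r :: "(real ^ 'n) \<times> (real ^ 'n) \<times> real"
  assume f: "(\<lambda>q. f (heis_swap (fst r, q))) \<in> L1" and g: "(\<lambda>q. g (heis_swap (fst r, q))) \<in> L1"
  have i: "integrable lborel (\<lambda>q. cis (2 * pi * (q \<bullet> snd r)) * h q)" if h: "h \<in> L1" for h :: "(real ^ 'n) \<times> real \<Rightarrow> complex"
  proof (rule Bochner_Integration.integrable_bound)
    show "integrable lborel h" using h by (simp add: L1_def)
    note [measurable] = borel_measurable_integrable[OF this]
    show "(\<lambda>q. cis (2 * pi * (q \<bullet> snd r)) * h q) \<in> borel_measurable lborel" by measurable
  qed (simp add: norm_mult)
  show "pft (\<lambda>p. f p + c * g p) r = pft f r + c * pft g r"
    unfolding pft_def fourier_def using i[OF f] i[OF g]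
    by (simp add: case_prod_unfold distrib_left mult.left_commute[of _ c])
qed

text \<open>The change of variables that turns the partial Fourier transform into the integral kernel of the
  group Fourier transform; the factor \<open>\<bar>l\<bar>\<^sup>n\<close> of the Plancherel measure is its Jacobian.\<close>

definition cvk :: "((real ^ 'n::finite) \<times> (real ^ 'n) \<times> real \<Rightarrow> complex) \<Rightarrow>
    real \<times> (real ^ 'n) \<times> (real ^ 'n) \<Rightarrow> complex" where
  "cvk \<Psi> r = complex_of_real (sqrt (\<bar>fst r\<bar> ^ CARD('n))) *
     \<Psi> (snd (snd r) - fst (snd r), fst r *\<^sub>R ((1 / 2) *\<^sub>R (fst (snd r) + snd (snd r))), fst r)"

lemma cvk_measurable:
  assumes "\<Psi> \<in> borel_measurable borel" shows "cvk \<Psi> \<in> borel_measurable borel"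
proof -
  have [measurable]: "\<Psi> \<in> borel_measurable (borel \<Otimes>\<^sub>M borel \<Otimes>\<^sub>M borel)" using assms by (simp add: borel_prod)
  show ?thesis unfolding cvk_def[abs_def] borel_prod[symmetric] by measurable
qed

text \<open>At fixed nonzero \<open>l\<close> the substitution is y = \<eta> - \<xi>, z = l (\<xi> +
  \<eta>) / 2. It is done in two moves: a translation of \<eta>, then for fixed \<open>y\<close> the
  affine map sending \<xi> to (l/2) y + l \<xi>, whose Jacobian cancels the squared prefactor. The
  value l = 0 is a null set.\<close>

lemma l2_norm_sq_cvk:
  fixes \<Psi> :: "(real ^ 'n::finite) \<times> (real ^ 'n) \<times> real \<Rightarrow> complex"
  assumes \<Psi>: "\<Psi> \<in> borel_measurable borel"
  shows "l2_norm_sq (cvk \<Psi>) = l2_norm_sq \<Psi>"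
proof -
  have [measurable]: "\<Psi> \<in> borel_measurable (borel \<Otimes>\<^sub>M borel \<Otimes>\<^sub>M borel)" using \<Psi> by (simp add: borel_prod)
  note [measurable] = cvk_measurable[OF \<Psi>] \<Psi>
  define H where "H l y z = ennreal ((cmod (\<Psi> (y, z, l)))\<^sup>2)" for l y z
  have [measurable]: "(\<lambda>(l, y, z). H l y z) \<in> borel_measurable (borel \<Otimes>\<^sub>M borel \<Otimes>\<^sub>M borel)"
    unfolding H_def by measurable
  have l: "(\<integral>\<^sup>+ \<xi>. \<integral>\<^sup>+ \<eta>. ennreal ((cmod (cvk \<Psi> (l, \<xi>, \<eta>)))\<^sup>2) \<partial>lborel \<partial>lborel) = (\<integral>\<^sup>+ y. \<integral>\<^sup>+ z. H l y z \<partial>lborel \<partial>lborel)"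
    if "l \<noteq> 0" for l
  proof -
    let ?c = "ennreal (\<bar>l\<bar> ^ CARD('n))"
    have "ennreal ((cmod (cvk \<Psi> (l, \<xi>, \<eta>)))\<^sup>2) = ?c * H l (\<eta> - \<xi>) (l *\<^sub>R ((1 / 2) *\<^sub>R (\<xi> + \<eta>)))" for \<xi> \<eta>
      unfolding cvk_def H_def by (simp add: norm_mult power_mult_distrib ennreal_mult)
    then have "(\<integral>\<^sup>+ \<xi>. \<integral>\<^sup>+ \<eta>. ennreal ((cmod (cvk \<Psi> (l, \<xi>, \<eta>)))\<^sup>2) \<partial>lborel \<partial>lborel)
      = (\<integral>\<^sup>+ \<xi>. \<integral>\<^sup>+ \<eta>. ?c * H l (\<eta> - \<xi>) (l *\<^sub>R ((1 / 2) *\<^sub>R (\<xi> + \<eta>))) \<partial>lborel \<partial>lborel)" by simp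
    also have "\<dots> = (\<integral>\<^sup>+ \<xi>. \<integral>\<^sup>+ y. ?c * H l (y + \<xi> - \<xi>) (l *\<^sub>R ((1 / 2) *\<^sub>R (\<xi> + (y + \<xi>)))) \<partial>lborel \<partial>lborel)"
      by (intro nn_integral_cong nn_integral_lborel_translate[symmetric, where F = "\<lambda>\<eta>. ?c * H l (\<eta> - _) (l *\<^sub>R ((1 / 2) *\<^sub>R (_ + \<eta>)))"]) measurable
    also have "\<dots> = (\<integral>\<^sup>+ \<xi>. \<integral>\<^sup>+ y. ?c * H l y ((l / 2) *\<^sub>R y + l *\<^sub>R \<xi>) \<partial>lborel \<partial>lborel)"
    proof -
      have "l *\<^sub>R ((1 / 2) *\<^sub>R (\<xi> + (y + \<xi>))) = (l / 2) *\<^sub>R y + l *\<^sub>R \<xi>" for y \<xi> :: "real ^ 'n"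
        by (simp add: scaleR_add_right flip: scaleR_add_left)
      then show ?thesis by simp
    qed
    also have "\<dots> = (\<integral>\<^sup>+ y. \<integral>\<^sup>+ \<xi>. ?c * H l y ((l / 2) *\<^sub>R y + l *\<^sub>R \<xi>) \<partial>lborel \<partial>lborel)"
      by (rule nn_integral_lborel_swap) (unfold borel_prod[symmetric], measurable)
    also have "\<dots> = (\<integral>\<^sup>+ y. \<integral>\<^sup>+ z. H l y z \<partial>lborel \<partial>lborel)"
    proof (rule nn_integral_cong)
      fix y :: "real ^ 'n"
      have "(\<integral>\<^sup>+ \<xi>. ?c * H l y ((l / 2) *\<^sub>R y + l *\<^sub>R \<xi>) \<partial>lborel) = ?c * (\<integral>\<^sup>+ \<xi>. H l y ((l / 2) *\<^sub>R y + l *\<^sub>R \<xi>) \<partial>lborel)"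
        by (rule nn_integral_cmult) measurable
      also have "\<dots> = (\<integral>\<^sup>+ z. H l y z \<partial>lborel)"
        using nn_integral_lborel_affine[of "H l y" l "(l / 2) *\<^sub>R y"] that by simp
      finally show "(\<integral>\<^sup>+ \<xi>. ?c * H l y ((l / 2) *\<^sub>R y + l *\<^sub>R \<xi>) \<partial>lborel) = (\<integral>\<^sup>+ z. H l y z \<partial>lborel)" .
    qed
    finally show ?thesis .
  qed
  have "l2_norm_sq (cvk \<Psi>) = (\<integral>\<^sup>+ l. \<integral>\<^sup>+ \<xi>. \<integral>\<^sup>+ \<eta>. ennreal ((cmod (cvk \<Psi> (l, \<xi>, \<eta>)))\<^sup>2) \<partial>lborel \<partial>lborel \<partial>lborel)"
    unfolding l2_norm_sq_def
    by (subst nn_integral_lborel_pair, measurable, intro nn_integral_cong nn_integral_lborel_pair) measurable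
  also have "\<dots> = (\<integral>\<^sup>+ l. \<integral>\<^sup>+ y. \<integral>\<^sup>+ z. H l y z \<partial>lborel \<partial>lborel \<partial>lborel)"
  proof (rule nn_integral_cong_AE)
    show "AE l in lborel. (\<integral>\<^sup>+ \<xi>. \<integral>\<^sup>+ \<eta>. ennreal ((cmod (cvk \<Psi> (l, \<xi>, \<eta>)))\<^sup>2) \<partial>lborel \<partial>lborel)
        = (\<integral>\<^sup>+ y. \<integral>\<^sup>+ z. H l y z \<partial>lborel \<partial>lborel)"
      using AE_lborel_singleton[of 0] by eventually_elim (rule l)
  qed
  also have "\<dots> = (\<integral>\<^sup>+ y. \<integral>\<^sup>+ l. \<integral>\<^sup>+ z. H l y z \<partial>lborel \<partial>lborel \<partial>lborel)"
    by (rule nn_integral_lborel_swap) (unfold H_def borel_prod[symmetric], measurable)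
  also have "\<dots> = (\<integral>\<^sup>+ y. \<integral>\<^sup>+ z. \<integral>\<^sup>+ l. H l y z \<partial>lborel \<partial>lborel \<partial>lborel)"
    by (intro nn_integral_cong nn_integral_lborel_swap) (unfold H_def borel_prod[symmetric], measurable)
  also have "\<dots> = l2_norm_sq \<Psi>"
    unfolding l2_norm_sq_def H_def
    by (subst nn_integral_lborel_pair, measurable, intro nn_integral_cong nn_integral_lborel_pair[symmetric]) measurable
  finally show ?thesis .
qed

section \<open>The isometry from functions to kernels and its extension\<close>

text \<open>The kernels of all operators \<open>gft_L1 f l\<close>, each multiplied by the square
  root of the Plancherel density, so that plain Lebesgue measure in \<open>(l, x, y)\<close> makes
  the map isometric.\<close>

definition kap :: "('n::finite heis \<Rightarrow> complex) \<Rightarrow> real \<times> (real ^ 'n) \<times> (real ^ 'n) \<Rightarrow> complex" where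
  "kap f = cvk (pft f)"

text \<open>Removes the density again and so recovers the true integral kernel at \<open>l\<close>.
  At \<open>l = 0\<close> the quotient is 0 by the convention for division, and the slice
  vanishes.\<close>

definition kslice :: "(real \<times> (real ^ 'n::finite) \<times> (real ^ 'n) \<Rightarrow> complex) \<Rightarrow> real \<Rightarrow>
    (real ^ 'n) \<times> (real ^ 'n) \<Rightarrow> complex" where
  "kslice \<kappa> l r = complex_of_real (1 / sqrt (\<bar>l\<bar> ^ CARD('n))) * \<kappa> (l, r)"

lemma kap_measurable: "f \<in> borel_measurable borel \<Longrightarrow> kap f \<in> borel_measurable borel"
  unfolding kap_def by (intro cvk_measurable pft_measurable)

lemma
  assumes "f \<in> L1" "f \<in> L2"
  shows kap_L2: "kap f \<in> L2" and nsq_kap: "nsq (kap f) = nsq f"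
proof -
  have *: "l2_norm_sq (kap f) = l2_norm_sq f"
    unfolding kap_def l2_norm_sq_cvk[OF pft_measurable[OF L2_measurable[OF assms(2)]]]
    by (rule l2_norm_sq_pft[OF assms])
  show 1: "kap f \<in> L2"
    by (rule L2_I[OF kap_measurable[OF L2_measurable[OF assms(2)]]]) (simp add: * assms)
  show "nsq (kap f) = nsq f" using * 1 assms by (simp add: l2_norm_sq_eq)
qed

text \<open>\<open>pft_lincomb\<close> holds off a null set that would have to be pulled back
  through the change of variables. The norm identity for \<open>cvk\<close> does this at once: it
  sends a function of norm zero to one of norm zero.\<close>

lemma kap_lincomb:
  assumes "f \<in> L1" "f \<in> L2" "g \<in> L1" "g \<in> L2"
  shows "AE r in lborel. kap (\<lambda>p. f p + c * g p) r = kap f r + c * kap g r"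
proof -
  let ?D = "\<lambda>r. pft (\<lambda>p. f p + c * g p) r - (pft f r + c * pft g r)"
  have [measurable]: "pft (\<lambda>p. f p + c * g p) \<in> borel_measurable borel" "pft f \<in> borel_measurable borel"
    "pft g \<in> borel_measurable borel"
    by (intro pft_measurable L2_measurable assms L2_add L2_cmult)+
  have Dm: "?D \<in> borel_measurable borel" by measurable
  have cm: "cvk ?D \<in> borel_measurable borel" by (rule cvk_measurable[OF Dm])
  have "l2_norm_sq ?D = l2_norm_sq (\<lambda>r :: (real ^ 'a) \<times> (real ^ 'a) \<times> real. 0)"
    by (rule l2_norm_sq_cong_AE) (use pft_lincomb[OF assms(1,3), of c] in eventually_elim, simp)
  then have 0: "l2_norm_sq (cvk ?D) = 0" unfolding l2_norm_sq_cvk[OF Dm] by (simp add: l2_norm_sq_def)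
  then have L: "cvk ?D \<in> L2" using cm by (intro L2_I) auto
  then have "nsq (cvk ?D) = 0" using 0 by (simp add: l2_norm_sq_eq)
  then have "AE r in lborel. cvk ?D r = 0" using L by (simp add: nsq_eq_0_iff)
  then show ?thesis unfolding kap_def
    by eventually_elim (auto simp: cvk_def algebra_simps)
qed

lemma L1_L2_diff: "f \<in> L1 \<Longrightarrow> g \<in> L1 \<Longrightarrow> (\<lambda>x. f x - g x) \<in> L1"
  by (simp add: L1_def)

lemma nsq_kap_diff:
  assumes "f \<in> L1" "f \<in> L2" "g \<in> L1" "g \<in> L2"
  shows "nsq (\<lambda>r. kap f r - kap g r) = nsq (\<lambda>p. f p - g p)"
proof -
  have "AE r in lborel. kap f r - kap g r = kap (\<lambda>p. f p - g p) r"
    using kap_lincomb[OF assms, of "-1"] by eventually_elim simp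
  then have "l2_norm_sq (\<lambda>r. kap f r - kap g r) = l2_norm_sq (kap (\<lambda>p. f p - g p))"
    by (rule l2_norm_sq_cong_AE)
  then have "nsq (\<lambda>r. kap f r - kap g r) = nsq (kap (\<lambda>p. f p - g p))"
    using assms by (simp add: l2_norm_sq_eq L2_diff kap_L2 L1_L2_diff)
  then show ?thesis using assms by (simp add: nsq_kap L1_L2_diff L2_diff)
qed

lemma l2_inner_kap:
  assumes f: "f \<in> L1" "f \<in> L2" and g: "g \<in> L1" "g \<in> L2"
  shows "l2_inner (kap f) (kap g) = l2_inner f g"
proof -
  have "nsq (\<lambda>r. kap f r + c * kap g r) = nsq (\<lambda>p. f p + c * g p)" for c
  proof -
    have L: "(\<lambda>p. f p + c * g p) \<in> L1" "(\<lambda>p. f p + c * g p) \<in> L2"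
      using f g by (auto simp: L1_def intro: L2_add L2_cmult)
    have "l2_norm_sq (\<lambda>r. kap f r + c * kap g r) = l2_norm_sq (kap (\<lambda>p. f p + c * g p))"
      by (rule l2_norm_sq_cong_AE[OF AE_eq_sym[OF kap_lincomb[OF f g]]])
    then show ?thesis
      using f g by (simp add: l2_norm_sq_eq L2_add L2_cmult kap_L2[OF L] nsq_kap[OF L] kap_L2)
  qed
  then show ?thesis
    unfolding l2_inner_polarization[OF f(2) g(2)] l2_inner_polarization[OF kap_L2[OF f] kap_L2[OF g]]
    by (simp only: nsq_kap[OF f] nsq_kap[OF g])
qed

text \<open>The continuous extension of the isometry \<open>kap\<close> to all of \<open>L2\<close>,
  as a relation between representatives.\<close>

definition kernel_of :: "('n::finite heis \<Rightarrow> complex) \<Rightarrow> (real \<times> (real ^ 'n) \<times> (real ^ 'n) \<Rightarrow> complex) \<Rightarrow> bool" where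
  "kernel_of f \<kappa> \<longleftrightarrow> \<kappa> \<in> L2 \<and> (\<exists>F. (\<forall>k. F k \<in> L1 \<inter> L2) \<and> l2_tendsto F f \<and> l2_tendsto (\<lambda>k. kap (F k)) \<kappa>)"

lemma l2_tendsto_Cauchy:
  assumes F: "\<And>k. F k \<in> L2" and f: "f \<in> L2" and l: "l2_tendsto F f" and e: "e > 0"
  shows "\<exists>N. \<forall>m\<ge>N. \<forall>n\<ge>N. nsq (\<lambda>x. F m x - F n x) < e"
proof -
  have "(\<lambda>k. nsq (\<lambda>x. F k x - f x)) \<longlonglongrightarrow> 0" using l l2_tendsto_iff[of F f] F f by blast
  then obtain N where N: "\<And>k. k \<ge> N \<Longrightarrow> nsq (\<lambda>x. F k x - f x) < e / 4"
    using LIMSEQ_D[of _ 0 "e / 4"] e by fastforce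
  have "nsq (\<lambda>x. F m x - F n x) < e" if "m \<ge> N" "n \<ge> N" for m n
    using nsq_triangle[OF F f F, of m n] N[OF that(1)] N[OF that(2)] nsq_swap[of f "F n"] by linarith
  then show ?thesis by blast
qed

lemma kap_limit:
  assumes F: "\<And>k. F k \<in> L1 \<inter> L2" and f: "f \<in> L2" and l: "l2_tendsto F f"
  obtains \<kappa> where "\<kappa> \<in> L2" "l2_tendsto (\<lambda>k. kap (F k)) \<kappa>"
proof (rule l2_complete[of "\<lambda>k. kap (F k)"])
  show "kap (F k) \<in> L2" for k using F[of k] by (intro kap_L2) auto
  show "\<exists>N. \<forall>m\<ge>N. \<forall>n\<ge>N. nsq (\<lambda>x. kap (F m) x - kap (F n) x) < e" if "e > 0" for e
  proof -
    have "nsq (\<lambda>x. kap (F m) x - kap (F n) x) = nsq (\<lambda>p. F m p - F n p)" for m n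
      using F[of m] F[of n] by (intro nsq_kap_diff) auto
    then show ?thesis using l2_tendsto_Cauchy[of F, OF _ f l that] F by auto
  qed
qed (use that in blast)

lemma kernel_of_exists:
  assumes f: "f \<in> L2" obtains \<kappa> where "kernel_of f \<kappa>"
proof -
  obtain F where F: "\<And>k. bdd_compact_supp (F k)" "l2_tendsto F f"
    using bdd_compact_supp_dense_seq[OF f] by metis
  have FL: "F k \<in> L1 \<inter> L2" for k using bdd_compact_supp_L1_L2[OF F(1)] by blast
  obtain \<kappa> where \<kappa>: "\<kappa> \<in> L2" "l2_tendsto (\<lambda>k. kap (F k)) \<kappa>"
    using kap_limit[OF FL f F(2)] by metis
  show ?thesis by (rule that[of \<kappa>]) (use FL F(2) \<kappa> in \<open>auto simp: kernel_of_def\<close>)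
qed

lemma kernel_of_kap:
  assumes "f \<in> L1" "f \<in> L2" shows "kernel_of f (kap f)"
  unfolding kernel_of_def
proof (intro conjI exI[of _ "\<lambda>k. f"])
  show "kap f \<in> L2" using assms by (rule kap_L2)
qed (use assms in \<open>auto simp: l2_tendsto_def l2_norm_sq_def\<close>)

lemma kernel_of_L2: "kernel_of f \<kappa> \<Longrightarrow> \<kappa> \<in> L2"
  by (simp add: kernel_of_def)

text \<open>Two sequences approaching \<open>f\<close> become close to each other, and
  \<open>kap\<close> preserves their distance. In this way the sequence hidden in
  \<open>is_gft\<close> can be matched with the one that produced \<open>\<kappa>\<close>.\<close>

lemma kernel_of_unique:
  fixes f :: "'n::finite heis \<Rightarrow> complex"
  assumes f: "f \<in> L2" and k: "kernel_of f \<kappa>" and G: "\<And>k. G k \<in> L1 \<inter> L2" "l2_tendsto G f"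
  shows "l2_tendsto (\<lambda>k. kap (G k)) \<kappa>"
proof -
  obtain F where F: "\<And>k. F k \<in> L1 \<inter> L2" "l2_tendsto F f" "l2_tendsto (\<lambda>k. kap (F k)) \<kappa>"
    using k unfolding kernel_of_def by auto
  have \<kappa>: "\<kappa> \<in> L2" using k by (rule kernel_of_L2)
  have L: "F k \<in> L2" "G k \<in> L2" "kap (F k) \<in> L2" "kap (G k) \<in> L2" for k
    using F(1)[of k] G(1)[of k] kap_L2[of "F k"] kap_L2[of "G k"] by auto
  have lim: "(\<lambda>k. nsq (\<lambda>x. F k x - f x)) \<longlonglongrightarrow> 0" "(\<lambda>k. nsq (\<lambda>x. G k x - f x)) \<longlonglongrightarrow> 0"
    "(\<lambda>k. nsq (\<lambda>x. kap (F k) x - \<kappa> x)) \<longlonglongrightarrow> 0"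
    using l2_tendsto_iff[of F f] l2_tendsto_iff[of G f] l2_tendsto_iff[of "\<lambda>k. kap (F k)" \<kappa>] F G L f \<kappa> by blast+
  have up: "(\<lambda>k. 2 * (2 * nsq (\<lambda>x. G k x - f x) + 2 * nsq (\<lambda>x. F k x - f x)) + 2 * nsq (\<lambda>x. kap (F k) x - \<kappa> x)) \<longlonglongrightarrow> 2 * (2 * 0 + 2 * 0) + 2 * 0"
    by (intro tendsto_intros lim)
  have "(\<lambda>k. nsq (\<lambda>x. kap (G k) x - \<kappa> x)) \<longlonglongrightarrow> 0"
  proof (rule tendsto_sandwich[OF _ _ tendsto_const])
    show "(\<lambda>k. 2 * (2 * nsq (\<lambda>x. G k x - f x) + 2 * nsq (\<lambda>x. F k x - f x)) + 2 * nsq (\<lambda>x. kap (F k) x - \<kappa> x)) \<longlonglongrightarrow> 0"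
      using up by simp
    show "\<forall>\<^sub>F k in sequentially. nsq (\<lambda>x. kap (G k) x - \<kappa> x)
       \<le> 2 * (2 * nsq (\<lambda>x. G k x - f x) + 2 * nsq (\<lambda>x. F k x - f x)) + 2 * nsq (\<lambda>x. kap (F k) x - \<kappa> x)"
    proof (intro always_eventually allI)
      fix k
      have 1: "nsq (\<lambda>x. kap (G k) x - kap (F k) x) = nsq (\<lambda>p. G k p - F k p)"
        using F(1)[of k] G(1)[of k] by (intro nsq_kap_diff) auto
      have 2: "nsq (\<lambda>p. G k p - F k p) \<le> 2 * nsq (\<lambda>x. G k x - f x) + 2 * nsq (\<lambda>x. F k x - f x)"
        using nsq_triangle[OF L(2) f L(1), of k k] unfolding nsq_swap[of f "F k"] .
      have "nsq (\<lambda>x. kap (G k) x - \<kappa> x) \<le> 2 * nsq (\<lambda>x. kap (G k) x - kap (F k) x) + 2 * nsq (\<lambda>x. kap (F k) x - \<kappa> x)"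
        by (rule nsq_triangle[OF L(4) L(3) \<kappa>])
      also have "\<dots> \<le> 2 * (2 * nsq (\<lambda>x. G k x - f x) + 2 * nsq (\<lambda>x. F k x - f x)) + 2 * nsq (\<lambda>x. kap (F k) x - \<kappa> x)"
        unfolding 1 by (intro add_right_mono mult_left_mono 2) simp
      finally show "nsq (\<lambda>x. kap (G k) x - \<kappa> x)
         \<le> 2 * (2 * nsq (\<lambda>x. G k x - f x) + 2 * nsq (\<lambda>x. F k x - f x)) + 2 * nsq (\<lambda>x. kap (F k) x - \<kappa> x)" .
    qed
  qed auto
  then show ?thesis using l2_tendsto_iff[of "\<lambda>k. kap (G k)" \<kappa>] L \<kappa> by blast
qed

lemma kernel_of_inner:
  assumes f: "f \<in> L2" and k: "kernel_of f \<kappa>" and g: "g \<in> L1" "g \<in> L2"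
  shows "l2_inner f g = l2_inner \<kappa> (kap g)"
proof -
  obtain F where F: "\<And>k. F k \<in> L1 \<inter> L2" "l2_tendsto F f" "l2_tendsto (\<lambda>k. kap (F k)) \<kappa>"
    using k unfolding kernel_of_def by auto
  have L: "F k \<in> L2" "kap (F k) \<in> L2" for k using F(1)[of k] kap_L2[of "F k"] by auto
  have "(\<lambda>k. l2_inner (kap (F k)) (kap g)) \<longlonglongrightarrow> l2_inner \<kappa> (kap g)"
    by (intro l2_inner_tendsto_left L kernel_of_L2[OF k] kap_L2 g F)
  moreover have "l2_inner (kap (F k)) (kap g) = l2_inner (F k) g" for k
    using F(1)[of k] g by (intro l2_inner_kap) auto
  moreover have "(\<lambda>k. l2_inner (F k) g) \<longlonglongrightarrow> l2_inner f g"
    by (intro l2_inner_tendsto_left L f g F)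
  ultimately show ?thesis by (simp add: LIMSEQ_unique)
qed

subsection \<open>Kernel slices\<close>

lemma kslice_measurable:
  fixes \<kappa> :: "real \<times> (real ^ 'n::finite) \<times> (real ^ 'n) \<Rightarrow> complex"
  assumes [measurable]: "\<kappa> \<in> borel_measurable borel"
  shows "kslice \<kappa> l \<in> borel_measurable borel"
  unfolding kslice_def[abs_def] by measurable

lemma l2_norm_sq_kslice:
  fixes \<kappa> :: "real \<times> (real ^ 'n::finite) \<times> (real ^ 'n) \<Rightarrow> complex"
  assumes [measurable]: "\<kappa> \<in> borel_measurable borel" and l: "l \<noteq> 0"
  shows "ennreal (\<bar>l\<bar> ^ CARD('n)) * l2_norm_sq (kslice \<kappa> l) = l2_norm_sq (\<lambda>r. \<kappa> (l, r))"
proof -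
  have "l2_norm_sq (kslice \<kappa> l) = ennreal (1 / \<bar>l\<bar> ^ CARD('n)) * l2_norm_sq (\<lambda>r. \<kappa> (l, r))"
    unfolding kslice_def[abs_def] by (subst l2_norm_sq_cmult, measurable) (simp add: norm_divide power_divide)
  then have "ennreal (\<bar>l\<bar> ^ CARD('n)) * l2_norm_sq (kslice \<kappa> l)
      = ennreal (\<bar>l\<bar> ^ CARD('n) * (1 / \<bar>l\<bar> ^ CARD('n))) * l2_norm_sq (\<lambda>r. \<kappa> (l, r))"
    by (subst ennreal_mult) (auto simp: mult.assoc)
  then show ?thesis using l by simp
qed

lemma AE_lborel_nonzero: "AE l in lborel. l \<noteq> (0 :: real)"
  using AE_lborel_singleton[of 0] by eventually_elim

lemma nn_integral_kslice:
  fixes \<kappa> :: "real \<times> (real ^ 'n::finite) \<times> (real ^ 'n) \<Rightarrow> complex"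
  assumes \<kappa>: "\<kappa> \<in> borel_measurable borel"
  shows "(\<integral>\<^sup>+ l. ennreal (\<bar>l\<bar> ^ CARD('n)) * l2_norm_sq (kslice \<kappa> l) \<partial>lborel) = l2_norm_sq \<kappa>"
proof -
  have "(\<integral>\<^sup>+ l. ennreal (\<bar>l\<bar> ^ CARD('n)) * l2_norm_sq (kslice \<kappa> l) \<partial>lborel) = (\<integral>\<^sup>+ l. l2_norm_sq (\<lambda>r. \<kappa> (l, r)) \<partial>lborel)"
  proof (rule nn_integral_cong_AE)
    show "AE l in lborel. ennreal (\<bar>l\<bar> ^ CARD('n)) * l2_norm_sq (kslice \<kappa> l) = l2_norm_sq (\<lambda>r. \<kappa> (l, r))"
      using AE_lborel_nonzero by eventually_elim (rule l2_norm_sq_kslice[OF \<kappa>])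
  qed
  also have "\<dots> = l2_norm_sq \<kappa>" by (rule l2_norm_sq_pair[OF \<kappa>, symmetric])
  finally show ?thesis .
qed

lemma AE_kslice_L2:
  assumes "\<kappa> \<in> L2" shows "AE l in lborel. kslice \<kappa> l \<in> L2"
  using AE_L2_slice[OF assms]
  by eventually_elim (unfold kslice_def[abs_def], rule L2_cmult)

lemma kslice_diff: "kslice (\<lambda>r. \<kappa> r - \<kappa>' r) l = (\<lambda>p. kslice \<kappa> l p + (-1) * kslice \<kappa>' l p)"
  by (rule ext) (simp add: kslice_def right_diff_distrib)

lemma kop_kslice_measurable:
  fixes \<kappa> :: "real \<times> (real ^ 'n::finite) \<times> (real ^ 'n) \<Rightarrow> complex"
  assumes \<kappa>: "\<kappa> \<in> borel_measurable borel" and [measurable]: "\<phi> \<in> borel_measurable borel"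
  shows "(\<lambda>r. kop (kslice \<kappa> (fst r)) \<phi> (snd r)) \<in> borel_measurable (borel \<Otimes>\<^sub>M borel)"
proof -
  have [measurable]: "\<kappa> \<in> borel_measurable (borel \<Otimes>\<^sub>M borel \<Otimes>\<^sub>M borel)" using \<kappa> by (simp add: borel_prod)
  show ?thesis unfolding kop_def kslice_def by measurable
qed

lemma kop_kslice_inner_measurable:
  fixes \<kappa> :: "real \<times> (real ^ 'n::finite) \<times> (real ^ 'n) \<Rightarrow> complex"
  assumes \<kappa>: "\<kappa> \<in> borel_measurable borel" and \<phi>: "\<phi> \<in> borel_measurable borel"
    and [measurable]: "\<psi> \<in> borel_measurable borel"
  shows "(\<lambda>l. l2_inner (kop (kslice \<kappa> l) \<phi>) \<psi>) \<in> borel_measurable borel"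
proof -
  note [measurable] = kop_kslice_measurable[OF \<kappa> \<phi>]
  have "(\<lambda>r. kop (kslice \<kappa> (fst r)) \<phi> (snd r) * cnj (\<psi> (snd r))) \<in> borel_measurable (borel \<Otimes>\<^sub>M lborel)"
    by measurable
  then have "(\<lambda>(l, \<xi>). kop (kslice \<kappa> l) \<phi> \<xi> * cnj (\<psi> \<xi>)) \<in> borel_measurable (borel \<Otimes>\<^sub>M lborel)"
    by (simp add: case_prod_unfold)
  from lborel.borel_measurable_lebesgue_integral[OF this] show ?thesis unfolding l2_inner_def .
qed

lemma l2_norm_sq_kslice_measurable:
  fixes \<kappa> :: "real \<times> (real ^ 'n::finite) \<times> (real ^ 'n) \<Rightarrow> complex"
  assumes \<kappa>: "\<kappa> \<in> borel_measurable borel"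
  shows "(\<lambda>l. l2_norm_sq (kslice \<kappa> l)) \<in> borel_measurable borel"
proof -
  have [measurable]: "\<kappa> \<in> borel_measurable (borel \<Otimes>\<^sub>M borel)" using \<kappa> by (simp add: borel_prod)
  show ?thesis unfolding l2_norm_sq_def kslice_def by measurable
qed

subsection \<open>The transform of integrable functions\<close>

lemma gft_L1_measurable:
  fixes f :: "'n::finite heis \<Rightarrow> complex"
  assumes [measurable]: "f \<in> borel_measurable borel" "\<phi> \<in> borel_measurable borel"
  shows "gft_L1 f l \<phi> \<in> borel_measurable borel"
  unfolding gft_L1_def[abs_def] by measurable

text \<open>Tonelli and translation invariance control the integral of the modulus of
  \<open>f\<close> times the square of \<open>\<phi>\<close>; the bound of a modulus by 1 plus its
  square, with \<open>f\<close> integrable, then covers the first power.\<close>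

lemma AE_gft_integrable:
  fixes f :: "'n::finite heis \<Rightarrow> complex"
  assumes f: "f \<in> L1" and \<phi>: "\<phi> \<in> L2"
  shows "AE \<xi> in lborel. integrable lborel (\<lambda>p. f p * schroedinger l p \<phi> \<xi>)"
proof -
  have fi: "integrable lborel f" using f by (simp add: L1_def)
  note [measurable] = borel_measurable_integrable[OF fi] L2_measurable[OF \<phi>]
  have fm: "f \<in> borel_measurable borel" by measurable
  let ?G = "\<lambda>\<xi> p. ennreal (cmod (f p)) * ennreal ((cmod (\<phi> (\<xi> + fst (snd p))))\<^sup>2)"
  have Gm: "(\<lambda>(\<xi>, p). ?G \<xi> p) \<in> borel_measurable borel"
  proof -
    have [measurable]: "f \<in> borel_measurable (borel \<Otimes>\<^sub>M borel \<Otimes>\<^sub>M borel)" using fm by (simp add: borel_prod)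
    show ?thesis unfolding borel_prod[symmetric] by measurable
  qed
  note [measurable] = fm
  have [measurable]: "(\<lambda>p::'n heis. fst (snd p)) \<in> borel_measurable borel"
    unfolding borel_prod[symmetric] by measurable
  have "(\<integral>\<^sup>+ \<xi>. \<integral>\<^sup>+ p. ?G \<xi> p \<partial>lborel \<partial>lborel) = (\<integral>\<^sup>+ p. \<integral>\<^sup>+ \<xi>. ?G \<xi> p \<partial>lborel \<partial>lborel)"
    by (rule nn_integral_lborel_swap[OF Gm])
  also have "\<dots> = (\<integral>\<^sup>+ p. ennreal (cmod (f p)) * l2_norm_sq \<phi> \<partial>lborel)"
  proof (rule nn_integral_cong)
    fix p :: "'n heis"
    have "(\<integral>\<^sup>+ \<xi>. ?G \<xi> p \<partial>lborel) = ennreal (cmod (f p)) * l2_norm_sq (\<lambda>\<xi>. \<phi> (\<xi> + fst (snd p)))"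
      unfolding l2_norm_sq_def by (rule nn_integral_cmult) measurable
    also have "l2_norm_sq (\<lambda>\<xi>. \<phi> (\<xi> + fst (snd p))) = l2_norm_sq \<phi>"
      by (simp only: l2_norm_sq_eq[OF \<phi>] l2_norm_sq_eq[OF l2_translate(1)[OF \<phi>]] l2_translate(2)[OF \<phi>])
    finally show "(\<integral>\<^sup>+ \<xi>. ?G \<xi> p \<partial>lborel) = ennreal (cmod (f p)) * l2_norm_sq \<phi>" .
  qed
  also have "\<dots> = (\<integral>\<^sup>+ p. ennreal (cmod (f p)) \<partial>lborel) * l2_norm_sq \<phi>"
    by (rule nn_integral_multc) measurable
  also have "\<dots> < \<infinity>"
    using fi l2_norm_sq_finite[OF \<phi>] unfolding integrable_iff_bounded by (simp add: ennreal_mult_less_top)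
  finally have "(\<integral>\<^sup>+ \<xi>. \<integral>\<^sup>+ p. ?G \<xi> p \<partial>lborel \<partial>lborel) \<noteq> \<infinity>" by simp
  moreover have "(\<lambda>\<xi>. \<integral>\<^sup>+ p. ?G \<xi> p \<partial>lborel) \<in> borel_measurable lborel"
    using Gm unfolding borel_prod[symmetric] by measurable
  ultimately have "AE \<xi> in lborel. (\<integral>\<^sup>+ p. ?G \<xi> p \<partial>lborel) \<noteq> \<infinity>"
    by (intro nn_integral_PInf_AE)
  then show ?thesis
  proof eventually_elim
    fix \<xi> assume fin: "(\<integral>\<^sup>+ p. ?G \<xi> p \<partial>lborel) \<noteq> \<infinity>"
    have "(\<integral>\<^sup>+ p. ennreal (norm (f p * schroedinger l p \<phi> \<xi>)) \<partial>lborel) \<le> (\<integral>\<^sup>+ p. ennreal (cmod (f p)) + ?G \<xi> p \<partial>lborel)"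
    proof (rule nn_integral_mono)
      fix p :: "'n heis"
      let ?z = "\<phi> (\<xi> + fst (snd p))"
      have "2 * cmod ?z \<le> 1 + (cmod ?z)\<^sup>2" using sum_squares_bound[of 1 "cmod ?z"] by simp
      then have "cmod ?z \<le> 1 + (cmod ?z)\<^sup>2" using norm_ge_zero[of ?z] by linarith
      then have "cmod (f p) * cmod ?z \<le> cmod (f p) * (1 + (cmod ?z)\<^sup>2)" by (intro mult_left_mono) auto
      then have "ennreal (cmod (f p) * cmod ?z) \<le> ennreal (cmod (f p) + cmod (f p) * (cmod ?z)\<^sup>2)"
        by (intro ennreal_leI) (simp add: distrib_left)
      then show "ennreal (norm (f p * schroedinger l p \<phi> \<xi>)) \<le> ennreal (cmod (f p)) + ?G \<xi> p"
        by (simp add: norm_mult cmod_schroedinger ennreal_mult)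
    qed
    also have "\<dots> = (\<integral>\<^sup>+ p. ennreal (cmod (f p)) \<partial>lborel) + (\<integral>\<^sup>+ p. ?G \<xi> p \<partial>lborel)"
      by (rule nn_integral_add) measurable
    also have "\<dots> < \<infinity>" using fin fi unfolding integrable_iff_bounded by (simp add: less_top)
    finally show "integrable lborel (\<lambda>p. f p * schroedinger l p \<phi> \<xi>)"
      unfolding integrable_iff_bounded by (intro conjI) measurable
  qed
qed

text \<open>The phase is linear in (x, t): it pairs (x, t) with (l (\<xi> + y/2), l). With \<eta> =
  y + \<xi> the first entry is \<open>l\<close> times the midpoint of \<xi> and \<eta>, so
  integrating over (x, t) leaves the partial Fourier transform at exactly the arguments used in
  \<open>cvk\<close>.\<close>

lemma gft_L1_eq_kop:
  fixes f :: "'n::finite heis \<Rightarrow> complex"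
  assumes f: "f \<in> L1" and \<phi>: "\<phi> \<in> L2" and l: "l \<noteq> 0"
  shows "AE \<xi> in lborel. gft_L1 f l \<phi> \<xi> = kop (kslice (kap f) l) \<phi> \<xi>"
  using AE_gft_integrable[OF f \<phi>, of l]
proof eventually_elim
  fix \<xi> assume int: "integrable lborel (\<lambda>p. f p * schroedinger l p \<phi> \<xi>)"
  have fi: "integrable lborel f" using f by (simp add: L1_def)
  have fm: "f \<in> borel_measurable borel" using borel_measurable_integrable[OF fi] by simp
  note [measurable] = fm L2_measurable[OF \<phi>]
  let ?H = "\<lambda>r. f (heis_swap r) * schroedinger l (heis_swap r) \<phi> \<xi>"
  have Hi: "integrable (lborel \<Otimes>\<^sub>M lborel) ?H"
    unfolding lborel_prod
    using int by (subst (asm) distr_heis_swap[symmetric], subst (asm) integrable_distr_eq) auto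
  have slice: "(LINT q|lborel. ?H (y, q)) = pft f (y, l *\<^sub>R ((1 / 2) *\<^sub>R (\<xi> + (y + \<xi>))), l) * \<phi> (y + \<xi>)" for y
  proof -
    have "?H (y, q) = (cis (2 * pi * (q \<bullet> (l *\<^sub>R ((1 / 2) *\<^sub>R (\<xi> + (y + \<xi>))), l))) * f (heis_swap (y, q))) * \<phi> (y + \<xi>)" for q
    proof -
      obtain x t where q: "q = (x, t)" by (cases q)
      have "2 * pi * (q \<bullet> (l *\<^sub>R ((1 / 2) *\<^sub>R (\<xi> + (y + \<xi>))), l)) = 2 * pi * l * (t + x \<bullet> \<xi> + x \<bullet> y / 2)"
      proof -
        have h: "(1 / 2) *\<^sub>R (\<xi> + (y + \<xi>)) = (1 / 2) *\<^sub>R y + \<xi>"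
          unfolding add.left_commute[of \<xi> y \<xi>] scaleR_add_right[of _ y] scaleR_half_double ..
        show ?thesis unfolding q h by (simp add: inner_add_right algebra_simps)
      qed
      then have c: "cis (2 * pi * (q \<bullet> (l *\<^sub>R ((1 / 2) *\<^sub>R (\<xi> + (y + \<xi>))), l))) = cis (2 * pi * l * (t + x \<bullet> \<xi> + x \<bullet> y / 2))"
        by (rule arg_cong)
      show ?thesis
        unfolding c unfolding q heis_swap_simp schroedinger_eq add.commute[of \<xi> y]
        by (simp only: mult.assoc mult.left_commute)
    qed
    then have "(LINT q|lborel. ?H (y, q)) = (LINT q|lborel. (cis (2 * pi * (q \<bullet> (l *\<^sub>R ((1 / 2) *\<^sub>R (\<xi> + (y + \<xi>))), l))) * f (heis_swap (y, q))) * \<phi> (y + \<xi>))"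
      by (rule Bochner_Integration.integral_cong[OF refl])
    then show ?thesis unfolding pft_def fourier_def by (simp only: prod.case integral_mult_left_zero)
  qed
  have "gft_L1 f l \<phi> \<xi> = (LINT r|lborel. ?H r)"
    unfolding gft_L1_def by (rule integral_heis) measurable
  also have "\<dots> = (LINT y|lborel. LINT q|lborel. ?H (y, q))"
    using lborel_pair.integral_fst'[OF Hi] by (simp add: lborel_prod)
  also have "\<dots> = (LINT y|lborel. pft f (y + \<xi> - \<xi>, l *\<^sub>R ((1 / 2) *\<^sub>R (\<xi> + (y + \<xi>))), l) * \<phi> (y + \<xi>))"
    by (simp only: slice add_diff_cancel_right')
  also have "\<dots> = (LINT \<eta>|lborel. pft f (\<eta> - \<xi>, l *\<^sub>R ((1 / 2) *\<^sub>R (\<xi> + \<eta>)), l) * \<phi> \<eta>)"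
  proof (rule integral_lborel_translate[where F = "\<lambda>\<eta>. pft f (\<eta> - \<xi>, l *\<^sub>R ((1 / 2) *\<^sub>R (\<xi> + \<eta>)), l) * \<phi> \<eta>"])
    have [measurable]: "pft f \<in> borel_measurable (borel \<Otimes>\<^sub>M borel \<Otimes>\<^sub>M borel)"
      using pft_measurable[OF fm] by (simp add: borel_prod)
    show "(\<lambda>\<eta>. pft f (\<eta> - \<xi>, l *\<^sub>R ((1 / 2) *\<^sub>R (\<xi> + \<eta>)), l) * \<phi> \<eta>) \<in> borel_measurable borel" by measurable
  qed
  also have "\<dots> = kop (kslice (kap f) l) \<phi> \<xi>"
    unfolding kop_def kslice_def kap_def cvk_def using l by simp
  finally show "gft_L1 f l \<phi> \<xi> = kop (kslice (kap f) l) \<phi> \<xi>" .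
qed

lemma AE_gft_L1_kop:
  fixes f :: "'n::finite heis \<Rightarrow> complex"
  assumes f: "f \<in> L1" "f \<in> L2"
  shows "AE l in lborel. kslice (kap f) l \<in> L2 \<and> op_eq (gft_L1 f l) (kop (kslice (kap f) l))"
  using AE_kslice_L2[OF kap_L2[OF f]] AE_lborel_nonzero
proof eventually_elim
  fix l :: real assume k: "kslice (kap f) l \<in> L2" and l: "l \<noteq> 0"
  have "gft_L1 f l \<phi> \<in> L2" if \<phi>: "\<phi> \<in> L2" for \<phi>
  proof (rule L2_I)
    show "gft_L1 f l \<phi> \<in> borel_measurable borel"
      by (rule gft_L1_measurable[OF L2_measurable[OF f(2)] L2_measurable[OF \<phi>]])
    show "l2_norm_sq (gft_L1 f l \<phi>) < \<infinity>"
      unfolding l2_norm_sq_cong_AE[OF gft_L1_eq_kop[OF f(1) \<phi> l]]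
      using l2_norm_sq_finite[OF kop_L2(1)[OF k \<phi>]] by simp
  qed
  then show "kslice (kap f) l \<in> L2 \<and> op_eq (gft_L1 f l) (kop (kslice (kap f) l))"
    unfolding op_eq_def using k gft_L1_eq_kop[OF f(1) _ l] kop_L2(1)[OF k] by simp
qed

subsection \<open>The transform of square-integrable functions\<close>

lemma op_eq_coeffs:
  assumes S: "bounded_op S" and T: "bounded_op T" and e: "l2_onb e"
    and eq: "\<And>i j. l2_inner (S (e i)) (e j) = l2_inner (T (e i)) (e j)"
  shows "op_eq S T"
  unfolding op_eq_def
proof (intro ballI conjI)
  fix \<phi> :: "'a \<Rightarrow> complex" assume \<phi>: "\<phi> \<in> L2"
  show SL: "S \<phi> \<in> L2" and TL: "T \<phi> \<in> L2" using \<phi> by (simp_all add: bounded_op_L2 S T)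
  note eL = l2_onb_L2[OF e]
  have ei: "AE x in lborel. S (e i) x = T (e i) x" for i
  proof -
    have "AE x in lborel. S (e i) x - T (e i) x = 0"
      by (rule l2_onb_total[OF e])
        (simp_all add: l2_inner_diff_left bounded_op_L2[OF S] bounded_op_L2[OF T] eL L2_diff eq)
    then show ?thesis by simp
  qed
  let ?S = "\<lambda>n x. \<Sum>i<n. l2_inner \<phi> (e i) * e i x"
  have sL: "?S n \<in> L2" for n by (rule L2_lincomb) (rule eL)
  have *: "AE x in lborel. S (?S n) x = T (?S n) x" for n
  proof -
    have "AE x in lborel. \<forall>i\<in>{..<n}. S (e i) x = T (e i) x"
      by (rule AE_finite_allI) (simp_all add: ei)
    with bounded_op_sum[where e = e and I = "{..<n}" and c = "\<lambda>i. l2_inner \<phi> (e i)", OF S eL]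
      bounded_op_sum[where e = e and I = "{..<n}" and c = "\<lambda>i. l2_inner \<phi> (e i)", OF T eL]
    show ?thesis by eventually_elim simp
  qed
  have "l2_tendsto (\<lambda>n. S (?S n)) (S \<phi>)"
    by (rule bounded_op_tendsto[OF S sL \<phi> l2_onb_expansion[OF e \<phi>]])
  moreover have "l2_tendsto (\<lambda>n. T (?S n)) (T \<phi>)"
    by (rule bounded_op_tendsto[OF T sL \<phi> l2_onb_expansion[OF e \<phi>]])
  moreover have "l2_norm_sq (\<lambda>x. S (?S n) x - T \<phi> x) = l2_norm_sq (\<lambda>x. T (?S n) x - T \<phi> x)" for n
    by (rule l2_norm_sq_cong_AE) (use *[of n] in eventually_elim, simp)
  ultimately have "l2_tendsto (\<lambda>n. S (?S n)) (S \<phi>)" "l2_tendsto (\<lambda>n. S (?S n)) (T \<phi>)"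
    unfolding l2_tendsto_def by simp_all
  then show "AE x in lborel. S \<phi> x = T \<phi> x"
    by (rule l2_tendsto_unique[OF bounded_op_L2[OF S sL] SL TL])
qed

lemma hs_norm_sq_kop_diff:
  assumes k: "k \<in> L2" and k': "k' \<in> L2" and "op_eq S (kop k)" "op_eq T (kop k')"
  shows "hs_norm_sq (\<lambda>\<phi> x. S \<phi> x - T \<phi> x) = l2_norm_sq (\<lambda>p. k p + (-1) * k' p)"
proof -
  let ?e = "l2_basis :: nat \<Rightarrow> 'a \<Rightarrow> complex"
  have "l2_norm_sq (\<lambda>x. S (?e i) x - T (?e i) x) = l2_norm_sq (kop (\<lambda>p. k p + (-1) * k' p) (?e i))" for i
  proof (rule l2_norm_sq_cong_AE)
    have eL: "?e i \<in> L2" by (rule l2_onb_L2[OF l2_onb_basis])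
    have "AE x in lborel. S (?e i) x = kop k (?e i) x" "AE x in lborel. T (?e i) x = kop k' (?e i) x"
      using assms(3,4) eL unfolding op_eq_def by auto
    then show "AE x in lborel. S (?e i) x - T (?e i) x = kop (\<lambda>p. k p + (-1) * k' p) (?e i) x"
      using kop_lincomb[OF k k' eL, of "-1"] by eventually_elim simp
  qed
  then have "hs_norm_sq (\<lambda>\<phi> x. S \<phi> x - T \<phi> x) = hs_norm_sq (kop (\<lambda>p. k p + (-1) * k' p))"
    unfolding hs_norm_sq_def by simp
  also have "\<dots> = l2_norm_sq (\<lambda>p. k p + (-1) * k' p)"
    by (rule hilbert_schmidt_kop(2)) (intro L2_add L2_cmult k k')
  finally show ?thesis .
qed

lemma ennreal_le_tendsto_zero:
  fixes x :: ennreal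
  assumes "\<And>k. x \<le> y k" "y \<longlonglongrightarrow> 0" shows "x = 0"
proof -
  have "x \<le> 0" by (rule LIMSEQ_le_const[OF assms(2)]) (use assms(1) in auto)
  then show ?thesis by simp
qed

text \<open>Every matrix coefficient of \<open>A l\<close> and of the kernel operator is a limit, in
  the space weighted by the Plancherel density, of the same coefficients of the approximants.
  Working with coefficients is dictated by \<open>is_gft\<close>, which grants measurability only
  weakly.\<close>

lemma gft_kernel_unique:
  fixes f :: "'n::finite heis \<Rightarrow> complex"
  assumes f: "f \<in> L2" and \<kappa>: "kernel_of f \<kappa>" and A: "is_gft f A"
  shows "AE l in lborel. kslice \<kappa> l \<in> L2 \<and> op_eq (A l) (kop (kslice \<kappa> l))"
proof -
  let ?e = "l2_basis :: nat \<Rightarrow> (real ^ 'n) \<Rightarrow> complex"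
  have eL: "?e i \<in> L2" for i by (rule l2_onb_L2[OF l2_onb_basis])
  have \<kappa>L: "\<kappa> \<in> L2" using \<kappa> by (rule kernel_of_L2)
  have hs: "\<And>l. l \<noteq> 0 \<Longrightarrow> hilbert_schmidt (A l)"
    and meas: "\<And>\<phi> \<psi>. \<phi> \<in> L2 \<Longrightarrow> \<psi> \<in> L2 \<Longrightarrow> (\<lambda>l. l2_inner (A l \<phi>) \<psi>) \<in> borel_measurable lebesgue"
    using A unfolding is_gft_def by auto
  obtain G where G: "\<And>k. G k \<in> L1 \<inter> L2" "l2_tendsto G f"
      "(\<lambda>k. \<integral>\<^sup>+ l. ennreal (\<bar>l\<bar> ^ CARD('n)) * hs_norm_sq (\<lambda>\<phi> \<xi>. gft_L1 (G k) l \<phi> \<xi> - A l \<phi> \<xi>) \<partial>lebesgue) \<longlonglongrightarrow> 0"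
    using A unfolding is_gft_def by auto
  have GL: "G k \<in> L1" "G k \<in> L2" for k using G(1)[of k] by auto
  have lim: "l2_tendsto (\<lambda>k. kap (G k)) \<kappa>" by (rule kernel_of_unique[OF f \<kappa> G(1,2)])
  have coeff: "AE l in lborel. l2_inner (A l (?e i)) (?e j) = l2_inner (kop (kslice \<kappa> l) (?e i)) (?e j)" for i j
  proof -
    define a where "a l = l2_inner (A l (?e i)) (?e j)" for l
    define b where "b l = l2_inner (kop (kslice \<kappa> l) (?e i)) (?e j)" for l
    define g where "g k l = l2_inner (kop (kslice (kap (G k)) l) (?e i)) (?e j)" for k l
    have [measurable]: "a \<in> borel_measurable lebesgue" unfolding a_def using meas eL by blast
    have "b \<in> borel_measurable borel" unfolding b_def
      by (rule kop_kslice_inner_measurable[OF L2_measurable[OF \<kappa>L] L2_measurable[OF eL] L2_measurable[OF eL]])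
    then have [measurable]: "b \<in> borel_measurable lebesgue" by (simp add: measurable_completion)
    have "g k \<in> borel_measurable borel" for k unfolding g_def
      by (rule kop_kslice_inner_measurable[OF L2_measurable[OF kap_L2[OF GL]] L2_measurable[OF eL] L2_measurable[OF eL]])
    then have [measurable]: "g k \<in> borel_measurable lebesgue" for k by (simp add: measurable_completion)
    have [measurable]: "(\<lambda>l::real. \<bar>l\<bar> ^ CARD('n)) \<in> borel_measurable lebesgue"
      by (simp add: measurable_completion)
    define P where "P k = (\<integral>\<^sup>+ l. ennreal (\<bar>l\<bar> ^ CARD('n)) * ennreal ((cmod (g k l - a l))\<^sup>2) \<partial>lebesgue)" for k
    define Q where "Q k = (\<integral>\<^sup>+ l. ennreal (\<bar>l\<bar> ^ CARD('n)) * ennreal ((cmod (g k l - b l))\<^sup>2) \<partial>lebesgue)" for k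
    \<comment> \<open>A coefficient against a unit vector is bounded by one term of the
      Hilbert-Schmidt sum. \<open>S'\<close> may differ from \<open>S\<close> on a null set, as the
      group integral differs from its kernel operator.\<close>
    have term_le: "ennreal ((cmod (l2_inner (S (?e i)) (?e j) - l2_inner (T (?e i)) (?e j)))\<^sup>2)
        \<le> hs_norm_sq (\<lambda>\<phi> x. S' \<phi> x - T \<phi> x)"
      if "S (?e i) \<in> L2" "T (?e i) \<in> L2" "AE x in lborel. S' (?e i) x = S (?e i) x" for S S' T :: "(real ^ 'n) op"
    proof -
      have "(cmod (l2_inner (S (?e i)) (?e j) - l2_inner (T (?e i)) (?e j)))\<^sup>2 \<le> nsq (\<lambda>x. S (?e i) x - T (?e i) x)"
        using l2_Cauchy_Schwarz[OF L2_diff[OF that(1,2)] eL, of j] that(1,2)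
        by (simp add: l2_inner_diff_left eL l2_onb_nsq[OF l2_onb_basis])
      then have "ennreal ((cmod (l2_inner (S (?e i)) (?e j) - l2_inner (T (?e i)) (?e j)))\<^sup>2) \<le> l2_norm_sq (\<lambda>x. S (?e i) x - T (?e i) x)"
        using that(1,2) by (simp add: l2_norm_sq_eq L2_diff ennreal_leI)
      also have "\<dots> = l2_norm_sq (\<lambda>x. S' (?e i) x - T (?e i) x)"
        by (rule l2_norm_sq_cong_AE) (use that(3) in eventually_elim, simp)
      also have "\<dots> \<le> hs_norm_sq (\<lambda>\<phi> x. S' \<phi> x - T \<phi> x)"
        unfolding hs_norm_sq_def
        using sum_le_suminf[of "\<lambda>i. l2_norm_sq (\<lambda>x. S' (?e i) x - T (?e i) x)" "{i}"] by simp
      finally show ?thesis .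
    qed
    \<comment> \<open>The right side may be the lower integral of a function not known to be
      measurable. It is used only as an upper bound, while the measurable coefficient stands on the
      left.\<close>
    have "P k \<le> (\<integral>\<^sup>+ l. ennreal (\<bar>l\<bar> ^ CARD('n)) * hs_norm_sq (\<lambda>\<phi> \<xi>. gft_L1 (G k) l \<phi> \<xi> - A l \<phi> \<xi>) \<partial>lebesgue)" for k
      unfolding P_def
    proof (rule nn_integral_mono_AE)
      have "AE l in lborel. ennreal (\<bar>l\<bar> ^ CARD('n)) * ennreal ((cmod (g k l - a l))\<^sup>2)
        \<le> ennreal (\<bar>l\<bar> ^ CARD('n)) * hs_norm_sq (\<lambda>\<phi> \<xi>. gft_L1 (G k) l \<phi> \<xi> - A l \<phi> \<xi>)"
        using AE_gft_L1_kop[OF GL[of k]] AE_lborel_nonzero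
      proof eventually_elim
        fix l :: real assume *: "kslice (kap (G k)) l \<in> L2 \<and> op_eq (gft_L1 (G k) l) (kop (kslice (kap (G k)) l))" and l: "l \<noteq> 0"
        have "bounded_op (A l)" using hs[OF l] by (simp add: hilbert_schmidt_def)
        then show "ennreal (\<bar>l\<bar> ^ CARD('n)) * ennreal ((cmod (g k l - a l))\<^sup>2)
          \<le> ennreal (\<bar>l\<bar> ^ CARD('n)) * hs_norm_sq (\<lambda>\<phi> \<xi>. gft_L1 (G k) l \<phi> \<xi> - A l \<phi> \<xi>)"
          unfolding g_def a_def using * eL
          by (intro mult_left_mono term_le) (auto simp: op_eq_def kop_L2 bounded_op_L2)
      qed
      then show "AE l in lebesgue. ennreal (\<bar>l\<bar> ^ CARD('n)) * ennreal ((cmod (g k l - a l))\<^sup>2)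
        \<le> ennreal (\<bar>l\<bar> ^ CARD('n)) * hs_norm_sq (\<lambda>\<phi> \<xi>. gft_L1 (G k) l \<phi> \<xi> - A l \<phi> \<xi>)"
        by (simp add: AE_completion_iff)
    qed
    then have P0: "P \<longlonglongrightarrow> 0"
      using tendsto_sandwich[OF _ _ tendsto_const G(3), of P] by simp
    have "Q k \<le> l2_norm_sq (\<lambda>r. kap (G k) r - \<kappa> r)" for k
    proof -
      have "Q k \<le> (\<integral>\<^sup>+ l. ennreal (\<bar>l\<bar> ^ CARD('n)) * l2_norm_sq (kslice (\<lambda>r. kap (G k) r - \<kappa> r) l) \<partial>lborel)"
        unfolding Q_def nn_integral_completion
      proof (rule nn_integral_mono_AE)
        show "AE l in lborel. ennreal (\<bar>l\<bar> ^ CARD('n)) * ennreal ((cmod (g k l - b l))\<^sup>2)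
          \<le> ennreal (\<bar>l\<bar> ^ CARD('n)) * l2_norm_sq (kslice (\<lambda>r. kap (G k) r - \<kappa> r) l)"
          using AE_kslice_L2[OF kap_L2[OF GL[of k]]] AE_kslice_L2[OF \<kappa>L]
        proof eventually_elim
          fix l assume k: "kslice (kap (G k)) l \<in> L2" "kslice \<kappa> l \<in> L2"
          have r: "op_eq (kop j) (kop j)" if "j \<in> L2" for j :: "(real ^ 'n) \<times> (real ^ 'n) \<Rightarrow> complex"
            using kop_L2(1)[OF that] by (simp add: op_eq_def)
          have "ennreal ((cmod (g k l - b l))\<^sup>2) \<le> hs_norm_sq (\<lambda>\<phi> x. kop (kslice (kap (G k)) l) \<phi> x - kop (kslice \<kappa> l) \<phi> x)"
            unfolding g_def b_def using k eL by (intro term_le) (auto simp: kop_L2)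
          also have "\<dots> = l2_norm_sq (kslice (\<lambda>r. kap (G k) r - \<kappa> r) l)"
            unfolding kslice_diff by (rule hs_norm_sq_kop_diff[OF k r[OF k(1)] r[OF k(2)]])
          finally show "ennreal (\<bar>l\<bar> ^ CARD('n)) * ennreal ((cmod (g k l - b l))\<^sup>2)
            \<le> ennreal (\<bar>l\<bar> ^ CARD('n)) * l2_norm_sq (kslice (\<lambda>r. kap (G k) r - \<kappa> r) l)"
            by (rule mult_left_mono) simp
        qed
      qed
      also have "\<dots> = l2_norm_sq (\<lambda>r. kap (G k) r - \<kappa> r)"
        by (rule nn_integral_kslice[OF L2_measurable[OF L2_diff[OF kap_L2[OF GL] \<kappa>L]]])
      finally show ?thesis .
    qed
    then have Q0: "Q \<longlonglongrightarrow> 0"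
      using tendsto_sandwich[OF _ _ tendsto_const lim[unfolded l2_tendsto_def], of Q] by simp
    have "(\<integral>\<^sup>+ l. ennreal (\<bar>l\<bar> ^ CARD('n)) * ennreal ((cmod (a l - b l))\<^sup>2) \<partial>lebesgue) \<le> 2 * P k + 2 * Q k" for k
    proof -
      have "(\<integral>\<^sup>+ l. ennreal (\<bar>l\<bar> ^ CARD('n)) * ennreal ((cmod (a l - b l))\<^sup>2) \<partial>lebesgue)
         \<le> (\<integral>\<^sup>+ l. 2 * (ennreal (\<bar>l\<bar> ^ CARD('n)) * ennreal ((cmod (g k l - a l))\<^sup>2))
            + 2 * (ennreal (\<bar>l\<bar> ^ CARD('n)) * ennreal ((cmod (g k l - b l))\<^sup>2)) \<partial>lebesgue)"
      proof (rule nn_integral_mono)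
        fix l :: real
        have "(cmod (a l - b l))\<^sup>2 \<le> 2 * (cmod (g k l - a l))\<^sup>2 + 2 * (cmod (g k l - b l))\<^sup>2"
          using cmod_add_sq[of "a l - g k l" "g k l - b l"] by (simp add: norm_minus_commute)
        then have "\<bar>l\<bar> ^ CARD('n) * (cmod (a l - b l))\<^sup>2 \<le> \<bar>l\<bar> ^ CARD('n) * (2 * (cmod (g k l - a l))\<^sup>2 + 2 * (cmod (g k l - b l))\<^sup>2)"
          by (intro mult_left_mono) auto
        also have "\<dots> = 2 * (\<bar>l\<bar> ^ CARD('n) * (cmod (g k l - a l))\<^sup>2) + 2 * (\<bar>l\<bar> ^ CARD('n) * (cmod (g k l - b l))\<^sup>2)"
          by (simp add: algebra_simps)
        finally have "ennreal (\<bar>l\<bar> ^ CARD('n) * (cmod (a l - b l))\<^sup>2) \<le> ennreal (\<dots>)" by (rule ennreal_leI)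
        then show "ennreal (\<bar>l\<bar> ^ CARD('n)) * ennreal ((cmod (a l - b l))\<^sup>2)
          \<le> 2 * (ennreal (\<bar>l\<bar> ^ CARD('n)) * ennreal ((cmod (g k l - a l))\<^sup>2))
            + 2 * (ennreal (\<bar>l\<bar> ^ CARD('n)) * ennreal ((cmod (g k l - b l))\<^sup>2))"
          by (simp add: ennreal_mult)
      qed
      also have "\<dots> = 2 * P k + 2 * Q k"
        unfolding P_def Q_def by (subst nn_integral_add, measurable) (simp add: nn_integral_cmult)
      finally show ?thesis .
    qed
    moreover have "(\<lambda>k. 2 * P k + 2 * Q k) \<longlonglongrightarrow> 0"
    proof -
      have "(\<lambda>k. 2 * P k + 2 * Q k) \<longlonglongrightarrow> 2 * 0 + 2 * 0"
        by (intro tendsto_add ennreal_tendsto_cmult P0 Q0) auto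
      then show ?thesis by simp
    qed
    ultimately have "(\<integral>\<^sup>+ l. ennreal (\<bar>l\<bar> ^ CARD('n)) * ennreal ((cmod (a l - b l))\<^sup>2) \<partial>lebesgue) = 0"
      by (rule ennreal_le_tendsto_zero)
    then have "AE l in lebesgue. ennreal (\<bar>l\<bar> ^ CARD('n)) * ennreal ((cmod (a l - b l))\<^sup>2) = 0"
      by (subst (asm) nn_integral_0_iff_AE) measurable
    then have "AE l in lborel. ennreal (\<bar>l\<bar> ^ CARD('n)) * ennreal ((cmod (a l - b l))\<^sup>2) = 0"
      by (simp only: AE_completion_iff)
    then show ?thesis using AE_lborel_nonzero
      unfolding a_def[symmetric] b_def[symmetric] by eventually_elim (simp add: ennreal_eq_0_iff power_le_zero_eq)
  qed
  \<comment> \<open>There are countably many coefficients, so a single null set of \<open>l\<close>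
    covers them all.\<close>
  have "AE l in lborel. \<forall>i j. l2_inner (A l (?e i)) (?e j) = l2_inner (kop (kslice \<kappa> l) (?e i)) (?e j)"
    unfolding AE_all_countable using coeff by blast
  then show ?thesis using AE_kslice_L2[OF \<kappa>L] AE_lborel_nonzero
  proof eventually_elim
    fix l :: real assume c: "\<forall>i j. l2_inner (A l (?e i)) (?e j) = l2_inner (kop (kslice \<kappa> l) (?e i)) (?e j)"
      and k: "kslice \<kappa> l \<in> L2" and l: "l \<noteq> 0"
    have "bounded_op (A l)" using hs[OF l] by (simp add: hilbert_schmidt_def)
    from op_eq_coeffs[OF this bounded_op_kop[OF k] l2_onb_basis] c k
    show "kslice \<kappa> l \<in> L2 \<and> op_eq (A l) (kop (kslice \<kappa> l))" by simp
  qed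
qed

section \<open>Existence of the transform\<close>

text \<open>The zero operator fills in the exceptional \<open>l\<close>, since \<open>is_gft\<close>
  asks for a Hilbert-Schmidt operator at every nonzero \<open>l\<close>.\<close>

lemma is_gft_kernel:
  fixes f :: "'n::finite heis \<Rightarrow> complex"
  assumes f: "f \<in> L2" and \<kappa>: "kernel_of f \<kappa>"
  shows "is_gft f (\<lambda>l. if l \<noteq> 0 \<and> kslice \<kappa> l \<in> L2 then kop (kslice \<kappa> l) else (\<lambda>\<phi> x. 0))"
    (is "is_gft f ?A")
proof -
  have \<kappa>L: "\<kappa> \<in> L2" using \<kappa> by (rule kernel_of_L2)
  obtain F where F: "\<And>k. F k \<in> L1 \<inter> L2" "l2_tendsto F f" "l2_tendsto (\<lambda>k. kap (F k)) \<kappa>"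
    using \<kappa> unfolding kernel_of_def by auto
  have FL: "F k \<in> L1" "F k \<in> L2" for k using F(1)[of k] by auto
  have zero: "hilbert_schmidt ((\<lambda>\<phi> x. 0) :: (real ^ 'n) op)"
    unfolding hilbert_schmidt_def hs_norm_sq_def
    by (intro conjI bounded_opI[where C = 0]) (simp_all add: l2_norm_sq_def nsq_def)
  show ?thesis unfolding is_gft_def
  proof (intro conjI allI impI ballI exI[of _ F])
    show "hilbert_schmidt (?A l)" for l
      using zero hilbert_schmidt_kop(1)[of "kslice \<kappa> l"] by simp
    fix \<phi> \<psi> :: "real ^ 'n \<Rightarrow> complex" assume \<phi>: "\<phi> \<in> L2" and \<psi>: "\<psi> \<in> L2"
    note [measurable] = kop_kslice_inner_measurable[OF L2_measurable[OF \<kappa>L] L2_measurable[OF \<phi>] L2_measurable[OF \<psi>]]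
      l2_norm_sq_kslice_measurable[OF L2_measurable[OF \<kappa>L]]
    \<comment> \<open>Membership of a slice in \<open>L2\<close> is read as finiteness of a Borel
      function of \<open>l\<close>, which makes the case distinction measurable.\<close>
    have iff: "kslice \<kappa> l \<in> L2 \<longleftrightarrow> l2_norm_sq (kslice \<kappa> l) < \<infinity>" for l
      using kslice_measurable[OF L2_measurable[OF \<kappa>L]] L2_I[of "kslice \<kappa> l"] l2_norm_sq_finite[of "kslice \<kappa> l"] by auto
    have "l2_inner (?A l \<phi>) \<psi> = (if l \<noteq> 0 \<and> l2_norm_sq (kslice \<kappa> l) < \<infinity> then l2_inner (kop (kslice \<kappa> l) \<phi>) \<psi> else 0)" for l
      unfolding iff by (simp add: l2_inner_def)
    moreover have "(\<lambda>l. if l \<noteq> 0 \<and> l2_norm_sq (kslice \<kappa> l) < \<infinity> then l2_inner (kop (kslice \<kappa> l) \<phi>) \<psi> else 0) \<in> borel_measurable borel"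
      by measurable
    ultimately have "(\<lambda>l. l2_inner (?A l \<phi>) \<psi>) \<in> borel_measurable borel" by presburger
    then show "(\<lambda>l. l2_inner (?A l \<phi>) \<psi>) \<in> borel_measurable lebesgue"
      by (intro measurable_completion) simp
  next
    have "(\<integral>\<^sup>+ l. ennreal (\<bar>l\<bar> ^ CARD('n)) * hs_norm_sq (\<lambda>\<phi> \<xi>. gft_L1 (F k) l \<phi> \<xi> - ?A l \<phi> \<xi>) \<partial>lebesgue)
      = l2_norm_sq (\<lambda>r. kap (F k) r - \<kappa> r)" for k
    proof -
      have "(\<integral>\<^sup>+ l. ennreal (\<bar>l\<bar> ^ CARD('n)) * hs_norm_sq (\<lambda>\<phi> \<xi>. gft_L1 (F k) l \<phi> \<xi> - ?A l \<phi> \<xi>) \<partial>lebesgue)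
        = (\<integral>\<^sup>+ l. ennreal (\<bar>l\<bar> ^ CARD('n)) * l2_norm_sq (kslice (\<lambda>r. kap (F k) r - \<kappa> r) l) \<partial>lborel)"
        unfolding nn_integral_completion
      proof (rule nn_integral_cong_AE)
        show "AE l in lborel. ennreal (\<bar>l\<bar> ^ CARD('n)) * hs_norm_sq (\<lambda>\<phi> \<xi>. gft_L1 (F k) l \<phi> \<xi> - ?A l \<phi> \<xi>)
          = ennreal (\<bar>l\<bar> ^ CARD('n)) * l2_norm_sq (kslice (\<lambda>r. kap (F k) r - \<kappa> r) l)"
          using AE_gft_L1_kop[OF FL[of k]] AE_kslice_L2[OF \<kappa>L] AE_lborel_nonzero
        proof eventually_elim
          fix l :: real assume *: "kslice (kap (F k)) l \<in> L2 \<and> op_eq (gft_L1 (F k) l) (kop (kslice (kap (F k)) l))"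
            and k: "kslice \<kappa> l \<in> L2" and l: "l \<noteq> 0"
          have "op_eq (?A l) (kop (kslice \<kappa> l))" using k l kop_L2(1)[OF k] by (simp add: op_eq_def)
          then have "hs_norm_sq (\<lambda>\<phi> \<xi>. gft_L1 (F k) l \<phi> \<xi> - ?A l \<phi> \<xi>) = l2_norm_sq (kslice (\<lambda>r. kap (F k) r - \<kappa> r) l)"
            unfolding kslice_diff using * k by (intro hs_norm_sq_kop_diff) auto
          then show "ennreal (\<bar>l\<bar> ^ CARD('n)) * hs_norm_sq (\<lambda>\<phi> \<xi>. gft_L1 (F k) l \<phi> \<xi> - ?A l \<phi> \<xi>)
            = ennreal (\<bar>l\<bar> ^ CARD('n)) * l2_norm_sq (kslice (\<lambda>r. kap (F k) r - \<kappa> r) l)" by simp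
        qed
      qed
      also have "\<dots> = l2_norm_sq (\<lambda>r. kap (F k) r - \<kappa> r)"
        by (rule nn_integral_kslice[OF L2_measurable[OF L2_diff[OF kap_L2[OF FL] \<kappa>L]]])
      finally show ?thesis .
    qed
    then show "(\<lambda>k. \<integral>\<^sup>+ l. ennreal (\<bar>l\<bar> ^ CARD('n)) * hs_norm_sq (\<lambda>\<phi> \<xi>. gft_L1 (F k) l \<phi> \<xi> - ?A l \<phi> \<xi>) \<partial>lebesgue) \<longlonglongrightarrow> 0"
      using F(3) unfolding l2_tendsto_def by simp
  qed (use F in auto)
qed

lemma is_gft_gft:
  assumes f: "f \<in> L2" shows "is_gft f (gft f)"
proof -
  obtain \<kappa> where "kernel_of f \<kappa>" using kernel_of_exists[OF f] by metis
  from is_gft_kernel[OF f this] show ?thesis unfolding gft_def by (rule someI[of "is_gft f"])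
qed

lemma gft_hilbert_schmidt: "f \<in> L2 \<Longrightarrow> l \<noteq> 0 \<Longrightarrow> hilbert_schmidt (gft f l)"
  using is_gft_gft unfolding is_gft_def by blast

lemma AE_gft_kop:
  assumes "f \<in> L2" "kernel_of f \<kappa>"
  shows "AE l in lborel. kslice \<kappa> l \<in> L2 \<and> op_eq (gft f l) (kop (kslice \<kappa> l))"
  using gft_kernel_unique[OF assms is_gft_gft[OF assms(1)]] .

section \<open>Inversion\<close>

lemma hs_norm_sq_unitary_left:
  assumes U: "unitary_pair U W" and B: "bounded_op B"
  shows "hs_norm_sq (\<lambda>\<phi>. U (B \<phi>)) = hs_norm_sq B"
  unfolding hs_norm_sq_def unitary_pair_norm[OF U bounded_op_L2[OF B l2_onb_L2[OF l2_onb_basis]]] ..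

lemma l2_inner_op_adjoint_unitary:
  assumes U: "unitary_pair U W" and \<phi>: "\<phi> \<in> L2" and \<psi>: "\<psi> \<in> L2"
  shows "l2_inner (op_adjoint U \<phi>) \<psi> = l2_inner \<phi> (U \<psi>)"
proof -
  have "l2_inner (op_adjoint U \<phi>) \<psi> = l2_inner (W \<phi>) \<psi>"
    using op_adjoint_op_eq[OF unitary_pair_adj[OF U]] \<phi> \<psi> unfolding op_eq_def
    by (intro l2_inner_cong_AE) auto
  then show ?thesis using adj_pair_inner[OF adj_pair_sym[OF unitary_pair_adj[OF U]] \<phi> \<psi>] by simp
qed

text \<open>Multiplying a factorisation of the product by \<open>U\<close> from the left undoes the
  adjoint. Hence trace class at one group point gives a factorisation of the transform itself, in
  which the group point no longer matters.\<close>

lemma trace_class_adjoint_factor: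
  assumes U: "unitary_pair U U'" and D: "bounded_op D" and T: "trace_class (op_adjoint U \<circ> D)"
  obtains A B where "hilbert_schmidt A" "hilbert_schmidt B" "op_eq D (\<lambda>\<phi>. A (B \<phi>))"
proof -
  obtain A B where AB: "hilbert_schmidt A" "hilbert_schmidt B" "op_eq (op_adjoint U \<circ> D) (\<lambda>\<phi>. A (B \<phi>))"
    using T by (rule trace_classE)
  have eq: "op_eq D (\<lambda>\<phi>. U (A (B \<phi>)))"
    unfolding op_eq_def
  proof (intro ballI conjI)
    fix \<phi> :: "'a \<Rightarrow> complex" assume \<phi>: "\<phi> \<in> L2"
    show DL: "D \<phi> \<in> L2" by (rule bounded_op_L2[OF D \<phi>])
    have 1: "A (B \<phi>) \<in> L2" "op_adjoint U (D \<phi>) \<in> L2" "AE x in lborel. op_adjoint U (D \<phi>) x = A (B \<phi>) x"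
      using AB(3) \<phi> unfolding op_eq_def by auto
    show "U (A (B \<phi>)) \<in> L2" by (rule bounded_op_L2[OF unitary_pair_bounded[OF U] 1(1)])
    have 2: "U' (D \<phi>) \<in> L2" "AE x in lborel. op_adjoint U (D \<phi>) x = U' (D \<phi>) x"
      using op_adjoint_op_eq[OF unitary_pair_adj[OF U]] DL unfolding op_eq_def by auto
    have "AE x in lborel. U (U' (D \<phi>)) x = U (A (B \<phi>)) x"
      by (rule bounded_op_cong[OF unitary_pair_bounded[OF U] 2(1) 1(1) AE_eq_trans[OF AE_eq_sym[OF 2(2)] 1(3)]])
    then show "AE x in lborel. D \<phi> x = U (A (B \<phi>)) x" unfolding unitary_pair_left[OF U] .
  qed
  show ?thesis by (rule that[OF hilbert_schmidt_unitary_left[OF U AB(1)] AB(2) eq])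
qed

text \<open>The unitary is absorbed into \<open>A\<close> without changing its Hilbert-Schmidt norm,
  so the bound does not depend on \<open>U\<close>. With \<open>U\<close> running over the
  representation it is uniform over the group.\<close>

lemma trace_unitary_bound:
  assumes A: "hilbert_schmidt A" and B: "hilbert_schmidt B" and D: "op_eq D (\<lambda>\<phi>. A (B \<phi>))"
    and U: "unitary_pair U U'"
  shows "(\<Sum>i<n. cmod (l2_inner (D (l2_basis i)) (U (l2_basis i)))) \<le> (enn2real (hs_norm_sq B) + enn2real (hs_norm_sq A)) / 2"
    and "summable (\<lambda>i. l2_inner (D (l2_basis i)) (U (l2_basis i)))"
proof -
  let ?A = "\<lambda>\<phi>. U' (A \<phi>)"
  note eL = l2_onb_L2[OF l2_onb_basis]
  have bA: "bounded_op A" "bounded_op B" using A B by (simp_all add: hilbert_schmidt_def)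
  have hA: "hilbert_schmidt ?A" by (rule hilbert_schmidt_unitary_left[OF unitary_pair_sym[OF U] A])
  have nA: "hs_norm_sq ?A = hs_norm_sq A" by (rule hs_norm_sq_unitary_left[OF unitary_pair_sym[OF U] bA(1)])
  note pA = hilbert_schmidt_adj_pair[OF hA] and pB = hilbert_schmidt_adj_pair[OF B]
  have fin: "hs_norm_sq ?A < top" "hs_norm_sq B < top" using hA B by (simp_all add: hilbert_schmidt_def)
  have eq: "l2_inner (D (l2_basis i)) (U (l2_basis i)) = l2_inner (B (l2_basis i)) (op_adjoint ?A (l2_basis i))" for i
  proof -
    have L: "A (B (l2_basis i)) \<in> L2" "U (l2_basis i) \<in> L2" "B (l2_basis i) \<in> L2" "D (l2_basis i) \<in> L2"
      using bounded_op_L2[OF bA(2) eL[of i]] bounded_op_L2[OF bA(1) bounded_op_L2[OF bA(2) eL[of i]]]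
        bounded_op_L2[OF unitary_pair_bounded[OF U] eL[of i]] D eL[of i] unfolding op_eq_def by auto
    have "l2_inner (D (l2_basis i)) (U (l2_basis i)) = l2_inner (A (B (l2_basis i))) (U (l2_basis i))"
      using D eL[of i] L unfolding op_eq_def by (intro l2_inner_cong_AE) auto
    also have "\<dots> = l2_inner (?A (B (l2_basis i))) (l2_basis i)"
      by (rule adj_pair_inner[OF adj_pair_sym[OF unitary_pair_adj[OF U]] L(1) eL])
    also have "\<dots> = l2_inner (B (l2_basis i)) (op_adjoint ?A (l2_basis i))"
      by (rule adj_pair_inner[OF pA L(3) eL, symmetric])
    finally show ?thesis .
  qed
  show "(\<Sum>i<n. cmod (l2_inner (D (l2_basis i)) (U (l2_basis i)))) \<le> (enn2real (hs_norm_sq B) + enn2real (hs_norm_sq A)) / 2"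
    unfolding eq nA[symmetric] by (rule trace_abs_bound[OF pA pB fin l2_onb_basis])
  show "summable (\<lambda>i. l2_inner (D (l2_basis i)) (U (l2_basis i)))"
    unfolding eq using trace_sums_onb[OF pA pB fin] l2_onb_basis by (metis sums_summable)
qed

section \<open>The trace as a jointly measurable kernel\<close>

text \<open>The trace of the adjoint Schroedinger operator times the kernel operator, with the
  adjoint moved to the other side of each inner product. Built from \<open>\<kappa>\<close> instead
  of the chosen field \<open>gft\<close>, it is Borel in the pair of \<open>p\<close> and
  \<open>l\<close>.\<close>

definition tker :: "(real \<times> (real ^ 'n::finite) \<times> (real ^ 'n) \<Rightarrow> complex) \<Rightarrow> 'n heis \<Rightarrow> real \<Rightarrow> complex" where
  "tker \<kappa> p l = (\<Sum>i. l2_inner (kop (kslice \<kappa> l) (l2_basis i)) (schroedinger l p (l2_basis i)))"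

lemma tker_term_measurable:
  fixes \<kappa> :: "real \<times> (real ^ 'n::finite) \<times> (real ^ 'n) \<Rightarrow> complex"
  assumes \<kappa>: "\<kappa> \<in> borel_measurable borel" and \<phi>: "\<phi> \<in> borel_measurable borel"
    and \<psi> [measurable]: "\<psi> \<in> borel_measurable borel"
  shows "(\<lambda>x. l2_inner (kop (kslice \<kappa> (snd x)) \<phi>) (schroedinger (snd x) (fst x) \<psi>))
    \<in> borel_measurable (borel \<Otimes>\<^sub>M borel)"
proof -
  have k: "(\<lambda>r. kop (kslice \<kappa> (fst r)) \<phi> (snd r)) \<in> borel_measurable (borel \<Otimes>\<^sub>M borel)"
    by (rule kop_kslice_measurable[OF \<kappa> \<phi>])
  have "(\<lambda>x::('n heis \<times> real) \<times> (real ^ 'n). (snd (fst x), snd x)) \<in> (borel \<Otimes>\<^sub>M borel) \<Otimes>\<^sub>M lborel \<rightarrow>\<^sub>M borel \<Otimes>\<^sub>M borel"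
    by measurable
  from measurable_compose[OF this k]
  have [measurable]: "(\<lambda>x::('n heis \<times> real) \<times> (real ^ 'n). kop (kslice \<kappa> (snd (fst x))) \<phi> (snd x)) \<in> borel_measurable ((borel \<Otimes>\<^sub>M borel) \<Otimes>\<^sub>M lborel)"
    by simp
  have "(\<lambda>x::('n heis \<times> real) \<times> (real ^ 'n). kop (kslice \<kappa> (snd (fst x))) \<phi> (snd x) * cnj (schroedinger (snd (fst x)) (fst (fst x)) \<psi> (snd x)))
    \<in> borel_measurable ((borel \<Otimes>\<^sub>M borel) \<Otimes>\<^sub>M lborel)"
    by measurable
  then have "(\<lambda>(x::'n heis \<times> real, \<xi>). kop (kslice \<kappa> (snd x)) \<phi> \<xi> * cnj (schroedinger (snd x) (fst x) \<psi> \<xi>))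
    \<in> borel_measurable ((borel \<Otimes>\<^sub>M borel) \<Otimes>\<^sub>M lborel)"
    by (simp add: case_prod_unfold)
  from lborel.borel_measurable_lebesgue_integral[OF this] show ?thesis unfolding l2_inner_def .
qed

lemma tker_measurable:
  fixes \<kappa> :: "real \<times> (real ^ 'n::finite) \<times> (real ^ 'n) \<Rightarrow> complex"
  assumes \<kappa>: "\<kappa> \<in> borel_measurable borel"
  shows "(\<lambda>x. tker \<kappa> (fst x) (snd x)) \<in> borel_measurable (borel \<Otimes>\<^sub>M borel)"
  unfolding tker_def
  by (intro borel_measurable_suminf tker_term_measurable[OF \<kappa>] L2_measurable[OF l2_onb_L2[OF l2_onb_basis]])

lemma conj_gft_zero: "conj_gft f l 0 0 = gft f l"
proof -
  have "schroedinger l (0, 0, 0) \<circ> gft f l \<circ> schroedinger l (- 0, - 0, 0) = gft f l"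
    by (rule ext) (simp add: schroedinger_zero)
  then show ?thesis unfolding conj_gft_def .
qed

lemma op_trace_eq_tker:
  assumes k: "kslice \<kappa> l \<in> L2" and D: "op_eq D (kop (kslice \<kappa> l))"
  shows "op_trace (op_adjoint (schroedinger l p) \<circ> D) = tker \<kappa> p l"
    and "\<And>i. l2_inner (D (l2_basis i)) (schroedinger l p (l2_basis i)) = l2_inner (kop (kslice \<kappa> l) (l2_basis i)) (schroedinger l p (l2_basis i))"
proof -
  note eL = l2_onb_L2[OF l2_onb_basis]
  show 1: "l2_inner (D (l2_basis i)) (schroedinger l p (l2_basis i)) = l2_inner (kop (kslice \<kappa> l) (l2_basis i)) (schroedinger l p (l2_basis i))" for i
    using D eL[of i] schroedinger_L2(1)[OF eL[of i], of l p] unfolding op_eq_def by (intro l2_inner_cong_AE) auto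
  have "l2_inner ((op_adjoint (schroedinger l p) \<circ> D) (l2_basis i)) (l2_basis i) = l2_inner (D (l2_basis i)) (schroedinger l p (l2_basis i))" for i
    using D eL[of i] unfolding op_eq_def comp_def by (intro l2_inner_op_adjoint_unitary[OF unitary_schroedinger]) auto
  then show "op_trace (op_adjoint (schroedinger l p) \<circ> D) = tker \<kappa> p l"
    unfolding op_trace_def tker_def by (simp only: 1)
qed

text \<open>Fubini applies because the Schroedinger operators preserve norms: after integration over
  \<xi> the majorant is a constant times the modulus of \<open>b\<close>.\<close>

lemma l2_inner_gft_L1:
  fixes b :: "'n::finite heis \<Rightarrow> complex"
  assumes b: "b \<in> L1" and \<phi>: "\<phi> \<in> L2" and \<psi>: "\<psi> \<in> L2"
  shows "l2_inner \<phi> (gft_L1 b l \<psi>) = (LINT p|lborel. cnj (b p) * l2_inner \<phi> (schroedinger l p \<psi>))"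
proof -
  have bi: "integrable lborel b" using b by (simp add: L1_def)
  have bm [measurable]: "b \<in> borel_measurable borel" using borel_measurable_integrable[OF bi] by simp
  note [measurable] = L2_measurable[OF \<phi>] L2_measurable[OF \<psi>]
  let ?H = "\<lambda>\<xi> p. cnj (b p) * (\<phi> \<xi> * cnj (schroedinger l p \<psi> \<xi>))"
  have Hm [measurable]: "case_prod ?H \<in> borel_measurable (lborel \<Otimes>\<^sub>M lborel)"
    unfolding case_prod_unfold by measurable
  have "integrable (lborel \<Otimes>\<^sub>M lborel) (case_prod ?H)"
    unfolding integrable_iff_bounded
  proof (intro conjI Hm)
    have "(\<integral>\<^sup>+ x. ennreal (norm (case_prod ?H x)) \<partial>(lborel \<Otimes>\<^sub>M lborel)) = (\<integral>\<^sup>+ p. \<integral>\<^sup>+ \<xi>. ennreal (norm (?H \<xi> p)) \<partial>lborel \<partial>lborel)"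
      by (subst lborel_pair.nn_integral_snd[symmetric], measurable)
    also have "\<dots> \<le> (\<integral>\<^sup>+ p. ennreal (cmod (b p)) * (l2_norm_sq \<phi> + l2_norm_sq \<psi>) \<partial>lborel)"
    proof (rule nn_integral_mono)
      fix p :: "'n heis"
      have "(\<integral>\<^sup>+ \<xi>. ennreal (norm (?H \<xi> p)) \<partial>lborel) \<le> (\<integral>\<^sup>+ \<xi>. ennreal (cmod (b p)) * (ennreal ((cmod (\<phi> \<xi>))\<^sup>2) + ennreal ((cmod (schroedinger l p \<psi> \<xi>))\<^sup>2)) \<partial>lborel)"
      proof (rule nn_integral_mono)
        fix \<xi>
        let ?u = "cmod (\<phi> \<xi>)" and ?v = "cmod (schroedinger l p \<psi> \<xi>)"
        have "?u * ?v \<le> ?u\<^sup>2 + ?v\<^sup>2"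
          using sum_squares_bound[of ?u ?v] mult_nonneg_nonneg[OF norm_ge_zero norm_ge_zero, of "\<phi> \<xi>" "schroedinger l p \<psi> \<xi>"] by linarith
        then have "cmod (b p) * (?u * ?v) \<le> cmod (b p) * (?u\<^sup>2 + ?v\<^sup>2)" by (intro mult_left_mono) auto
        then show "ennreal (norm (?H \<xi> p)) \<le> ennreal (cmod (b p)) * (ennreal (?u\<^sup>2) + ennreal (?v\<^sup>2))"
          by (simp add: norm_mult ennreal_leI flip: ennreal_plus ennreal_mult)
      qed
      also have "\<dots> = ennreal (cmod (b p)) * (l2_norm_sq \<phi> + l2_norm_sq (schroedinger l p \<psi>))"
        unfolding l2_norm_sq_def by (simp add: nn_integral_cmult nn_integral_add)
      also have "l2_norm_sq (schroedinger l p \<psi>) = l2_norm_sq \<psi>"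
        by (rule unitary_pair_norm[OF unitary_schroedinger \<psi>])
      finally show "(\<integral>\<^sup>+ \<xi>. ennreal (norm (?H \<xi> p)) \<partial>lborel) \<le> ennreal (cmod (b p)) * (l2_norm_sq \<phi> + l2_norm_sq \<psi>)" .
    qed
    also have "\<dots> = (\<integral>\<^sup>+ p. ennreal (cmod (b p)) \<partial>lborel) * (l2_norm_sq \<phi> + l2_norm_sq \<psi>)"
      by (rule nn_integral_multc) measurable
    also have "\<dots> < \<infinity>"
      using bi l2_norm_sq_finite[OF \<phi>] l2_norm_sq_finite[OF \<psi>] unfolding integrable_iff_bounded
      by (simp add: ennreal_mult_less_top)
    finally show "(\<integral>\<^sup>+ x. ennreal (norm (case_prod ?H x)) \<partial>(lborel \<Otimes>\<^sub>M lborel)) < \<infinity>" .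
  qed
  from lborel_pair.Fubini_integral[OF this]
  have F: "(LINT p|lborel. LINT \<xi>|lborel. ?H \<xi> p) = (LINT \<xi>|lborel. LINT p|lborel. ?H \<xi> p)" .
  have "l2_inner \<phi> (gft_L1 b l \<psi>) = (LINT \<xi>|lborel. LINT p|lborel. ?H \<xi> p)"
    unfolding l2_inner_def
  proof (intro Bochner_Integration.integral_cong refl)
    fix \<xi>
    have "\<phi> \<xi> * cnj (gft_L1 b l \<psi> \<xi>) = \<phi> \<xi> * (LINT p|lborel. cnj (b p * schroedinger l p \<psi> \<xi>))"
      by (simp only: gft_L1_def Bochner_Integration.integral_cnj)
    also have "\<dots> = (LINT p|lborel. \<phi> \<xi> * cnj (b p * schroedinger l p \<psi> \<xi>))"
      by (rule integral_mult_right_zero[symmetric])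
    also have "\<dots> = (LINT p|lborel. ?H \<xi> p)"
      by (intro Bochner_Integration.integral_cong refl) simp
    finally show "\<phi> \<xi> * cnj (gft_L1 b l \<psi> \<xi>) = (LINT p|lborel. ?H \<xi> p)" .
  qed
  also have "\<dots> = (LINT p|lborel. cnj (b p) * l2_inner \<phi> (schroedinger l p \<psi>))"
    unfolding F[symmetric] l2_inner_def by (simp only: integral_mult_right_zero)
  finally show ?thesis .
qed

text \<open>The left side is the Hilbert-Schmidt product, a limit of partial sums over the basis.
  Each partial sum is an integral over the group by \<open>l2_inner_gft_L1\<close>, and the bound by
  \<open>C\<close>, uniform in the group point, lets the sum pass under that integral.\<close>

lemma kslice_inner_eq_tker:
  fixes b :: "'n::finite heis \<Rightarrow> complex"
  assumes b: "b \<in> L1" and k: "kslice \<kappa> l \<in> L2" and D: "op_eq D (kop (kslice \<kappa> l))"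
    and kb: "kslice (kap b) l \<in> L2" and E: "op_eq (gft_L1 b l) (kop (kslice (kap b) l))"
    and \<kappa>: "\<kappa> \<in> borel_measurable borel"
    and AB: "hilbert_schmidt A" "hilbert_schmidt B" "op_eq D (\<lambda>\<phi>. A (B \<phi>))"
  shows "l2_inner (kslice \<kappa> l) (kslice (kap b) l) = (LINT p|lborel. cnj (b p) * tker \<kappa> p l)"
proof -
  let ?e = "l2_basis :: nat \<Rightarrow> (real ^ 'n) \<Rightarrow> complex"
  have eL: "?e i \<in> L2" for i by (rule l2_onb_L2[OF l2_onb_basis])
  have bi: "integrable lborel b" using b by (simp add: L1_def)
  have bm [measurable]: "b \<in> borel_measurable borel" using borel_measurable_integrable[OF bi] by simp
  let ?t = "\<lambda>i p. l2_inner (kop (kslice \<kappa> l) (?e i)) (schroedinger l p (?e i))"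
  define C where "C = (enn2real (hs_norm_sq B) + enn2real (hs_norm_sq A)) / 2"
  have le: "(\<Sum>i<n. cmod (?t i p)) \<le> C" for n p
    using trace_unitary_bound(1)[OF AB unitary_schroedinger[of l p], of n] unfolding op_trace_eq_tker(2)[OF k D] C_def .
  have sm: "summable (\<lambda>i. ?t i p)" for p
    using trace_unitary_bound(2)[OF AB unitary_schroedinger[of l p]] unfolding op_trace_eq_tker(2)[OF k D] .
  have tm [measurable]: "?t i \<in> borel_measurable borel" for i
  proof -
    have "(\<lambda>p::'n heis. (p, l)) \<in> borel \<rightarrow>\<^sub>M borel \<Otimes>\<^sub>M borel" by measurable
    from measurable_compose[OF this tker_term_measurable[OF \<kappa> L2_measurable[OF eL] L2_measurable[OF eL]]]
    show ?thesis by simp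
  qed
  have term_int: "integrable lborel (\<lambda>p. cnj (b p) * ?t i p)" for i
  proof (rule Bochner_Integration.integrable_bound[where f = "\<lambda>p. C * cmod (b p)"])
    show "integrable lborel (\<lambda>p. C * cmod (b p))" using bi by simp
    show "AE p in lborel. norm (cnj (b p) * ?t i p) \<le> norm (C * cmod (b p))"
    proof (intro AE_I2)
      fix p :: "'n heis"
      have "cmod (?t i p) \<le> (\<Sum>i<Suc i. cmod (?t i p))"
        by (simp add: sum_nonneg)
      then have "cmod (?t i p) \<le> C" using le[of p "Suc i"] by linarith
      then have "cmod (b p) * cmod (?t i p) \<le> cmod (b p) * C" by (intro mult_left_mono) auto
      moreover have "cmod (b p) * C \<le> \<bar>C * cmod (b p)\<bar>" by (simp add: mult.commute)
      ultimately show "norm (cnj (b p) * ?t i p) \<le> norm (C * cmod (b p))" by (simp add: norm_mult)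
    qed
  qed measurable
  have "(\<lambda>n. LINT p|lborel. cnj (b p) * (\<Sum>i<n. ?t i p)) \<longlonglongrightarrow> (LINT p|lborel. cnj (b p) * tker \<kappa> p l)"
  proof (rule integral_dominated_convergence[where w = "\<lambda>p. C * cmod (b p)"])
    have "(\<lambda>p::'n heis. (p, l)) \<in> borel \<rightarrow>\<^sub>M borel \<Otimes>\<^sub>M borel" by measurable
    from measurable_compose[OF this tker_measurable[OF \<kappa>]]
    have [measurable]: "(\<lambda>p. tker \<kappa> p l) \<in> borel_measurable borel" by simp
    show "(\<lambda>p. cnj (b p) * tker \<kappa> p l) \<in> borel_measurable lborel" by measurable
    show "(\<lambda>p. cnj (b p) * (\<Sum>i<n. ?t i p)) \<in> borel_measurable lborel" for n by measurable
    show "integrable lborel (\<lambda>p. C * cmod (b p))" using bi by simp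
    show "AE p in lborel. (\<lambda>n. cnj (b p) * (\<Sum>i<n. ?t i p)) \<longlonglongrightarrow> cnj (b p) * tker \<kappa> p l"
      using sm unfolding tker_def by (intro AE_I2 tendsto_mult tendsto_const summable_LIMSEQ)
    show "AE p in lborel. norm (cnj (b p) * (\<Sum>i<n. ?t i p)) \<le> C * cmod (b p)" for n
    proof (intro AE_I2)
      fix p :: "'n heis"
      have "cmod (\<Sum>i<n. ?t i p) \<le> C" using norm_sum[of "\<lambda>i. ?t i p" "{..<n}"] le[of p n] by linarith
      then have "cmod (b p) * cmod (\<Sum>i<n. ?t i p) \<le> cmod (b p) * C" by (intro mult_left_mono) auto
      then show "norm (cnj (b p) * (\<Sum>i<n. ?t i p)) \<le> C * cmod (b p)" by (simp add: norm_mult mult.commute)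
    qed
  qed
  moreover have "(LINT p|lborel. cnj (b p) * (\<Sum>i<n. ?t i p)) = (\<Sum>i<n. l2_inner (kop (kslice \<kappa> l) (?e i)) (kop (kslice (kap b) l) (?e i)))" for n
  proof -
    have "(LINT p|lborel. cnj (b p) * (\<Sum>i<n. ?t i p)) = (\<Sum>i<n. LINT p|lborel. cnj (b p) * ?t i p)"
      unfolding sum_distrib_left by (rule Bochner_Integration.integral_sum) (rule term_int)
    also have "\<dots> = (\<Sum>i<n. l2_inner (kop (kslice \<kappa> l) (?e i)) (gft_L1 b l (?e i)))"
      by (simp only: l2_inner_gft_L1[OF b kop_L2(1)[OF k eL] eL])
    also have "\<dots> = (\<Sum>i<n. l2_inner (kop (kslice \<kappa> l) (?e i)) (kop (kslice (kap b) l) (?e i)))"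
      using E eL kop_L2(1)[OF k eL] unfolding op_eq_def
      by (intro sum.cong refl l2_inner_cong_AE) auto
    finally show ?thesis .
  qed
  moreover have "(\<lambda>n. \<Sum>i<n. l2_inner (kop (kslice \<kappa> l) (?e i)) (kop (kslice (kap b) l) (?e i))) \<longlonglongrightarrow> l2_inner (kslice \<kappa> l) (kslice (kap b) l)"
    using kop_inner_sums[OF k kb l2_onb_basis] unfolding sums_def .
  ultimately show ?thesis using LIMSEQ_unique by simp
qed

lemma integral_lborel_pair:
  fixes F :: "'a::euclidean_space \<times> 'b::euclidean_space \<Rightarrow> complex"
  assumes "integrable lborel F"
  shows "(LINT p|lborel. F p) = (LINT x|lborel. LINT y|lborel. F (x, y))"
proof -
  have "integrable (lborel \<Otimes>\<^sub>M lborel) F" using assms by (simp add: lborel_prod)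
  from lborel_pair.integral_fst'[OF this] show ?thesis by (simp add: lborel_prod)
qed

lemma l2_inner_kslice:
  fixes \<kappa> \<mu> :: "real \<times> (real ^ 'n::finite) \<times> (real ^ 'n) \<Rightarrow> complex"
  assumes \<kappa>: "\<kappa> \<in> L2" and \<mu>: "\<mu> \<in> L2"
  shows "l2_inner \<kappa> \<mu> = (LINT l|lborel. complex_of_real (\<bar>l\<bar> ^ CARD('n)) * l2_inner (kslice \<kappa> l) (kslice \<mu> l))"
proof -
  note [measurable] = L2_measurable[OF \<kappa>] L2_measurable[OF \<mu>]
  have "l2_inner \<kappa> \<mu> = (LINT l|lborel. LINT r|lborel. \<kappa> (l, r) * cnj (\<mu> (l, r)))"
    unfolding l2_inner_def by (rule integral_lborel_pair[OF integrable_L2_inner[OF \<kappa> \<mu>]])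
  also have "\<dots> = (LINT l|lborel. complex_of_real (\<bar>l\<bar> ^ CARD('n)) * l2_inner (kslice \<kappa> l) (kslice \<mu> l))"
  proof (rule integral_cong_AE)
    show "(\<lambda>l. LINT r|lborel. \<kappa> (l, r) * cnj (\<mu> (l, r))) \<in> borel_measurable lborel" by measurable
    show "(\<lambda>l. complex_of_real (\<bar>l\<bar> ^ CARD('n)) * l2_inner (kslice \<kappa> l) (kslice \<mu> l)) \<in> borel_measurable lborel"
      unfolding l2_inner_def kslice_def by measurable
    show "AE l in lborel. (LINT r|lborel. \<kappa> (l, r) * cnj (\<mu> (l, r)))
       = complex_of_real (\<bar>l\<bar> ^ CARD('n)) * l2_inner (kslice \<kappa> l) (kslice \<mu> l)"
      using AE_lborel_nonzero
    proof eventually_elim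
      fix l :: real assume l: "l \<noteq> 0"
      define s where "s = complex_of_real (1 / sqrt (\<bar>l\<bar> ^ CARD('n)))"
      have s: "complex_of_real (\<bar>l\<bar> ^ CARD('n)) * (s * cnj s) = 1"
        unfolding s_def using l by (simp flip: of_real_mult of_real_power)
      have "l2_inner (kslice \<kappa> l) (kslice \<mu> l) = s * (cnj s * (LINT r|lborel. \<kappa> (l, r) * cnj (\<mu> (l, r))))"
        unfolding kslice_def[abs_def] s_def[symmetric] l2_inner_cmult_left l2_inner_cmult_right
        by (simp add: l2_inner_def)
      then show "(LINT r|lborel. \<kappa> (l, r) * cnj (\<mu> (l, r)))
         = complex_of_real (\<bar>l\<bar> ^ CARD('n)) * l2_inner (kslice \<kappa> l) (kslice \<mu> l)"
        using s by (simp add: mult.assoc[symmetric])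
    qed
  qed
  finally show ?thesis .
qed

lemma inversion_op_zero: "inversion_op 0 0 f p l = op_adjoint (schroedinger l p) \<circ> gft f l"
  by (simp add: inversion_op_def conj_gft_zero)

text \<open>Testing \<open>f\<close> against bounded functions \<open>b\<close> living on a set on which the trace integral is
  absolutely convergent with a uniform bound, Plancherel and Fubini identify \<open>f\<close> with that integral.\<close>

lemma inversion_zero:
  fixes f :: "'n::finite heis \<Rightarrow> complex"
  assumes f: "f \<in> L2" and ti: "AE p in lborel. trace_integrable (weight0 p) (inversion_op 0 0 f p)"
  shows "AE p in lborel. trace_integral (weight0 p) (inversion_op 0 0 f p) = f p"
proof -
  obtain \<kappa> where \<kappa>: "kernel_of f \<kappa>" using kernel_of_exists[OF f] by metis
  have \<kappa>L: "\<kappa> \<in> L2" using \<kappa> by (rule kernel_of_L2)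
  note [measurable] = L2_measurable[OF f] tker_measurable[OF L2_measurable[OF \<kappa>L]]
  define W where "W l = complex_of_real (\<bar>l\<bar> ^ CARD('n))" for l :: real
  have [measurable]: "W \<in> borel_measurable borel" unfolding W_def[abs_def] by measurable
  have W: "weight0 p l = W l" for p :: "'n heis" and l by (simp add: weight0_def W_def)
  define M where "M p = (\<integral>\<^sup>+ l. ennreal (cmod (W l * tker \<kappa> p l)) \<partial>lborel)" for p
  define H where "H p = (LINT l|lborel. W l * tker \<kappa> p l)" for p
  have tm [measurable]: "(\<lambda>l. tker \<kappa> p l) \<in> borel_measurable borel" for p
  proof -
    have "(\<lambda>l. (p, l)) \<in> borel \<rightarrow>\<^sub>M borel \<Otimes>\<^sub>M borel" by measurable
    from measurable_compose[OF this tker_measurable[OF L2_measurable[OF \<kappa>L]]] show ?thesis by simp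
  qed
  have WT: "(\<lambda>x. W (snd x) * tker \<kappa> (fst x) (snd x)) \<in> borel_measurable (borel \<Otimes>\<^sub>M lborel)" by measurable
  then have WT': "(\<lambda>(p, l). W l * tker \<kappa> p l) \<in> borel_measurable (borel \<Otimes>\<^sub>M lborel)" by (simp add: case_prod_unfold)
  have Mm [measurable]: "M \<in> borel_measurable borel"
    unfolding M_def[abs_def] using WT' by measurable
  have Hm [measurable]: "H \<in> borel_measurable borel"
    unfolding H_def[abs_def] by (rule lborel.borel_measurable_lebesgue_integral[OF WT'])
  have good: "AE l in lborel. kslice \<kappa> l \<in> L2 \<and> op_eq (gft f l) (kop (kslice \<kappa> l))"
    by (rule AE_gft_kop[OF f \<kappa>])
  \<comment> \<open>The exceptional set of \<open>l\<close> comes from the kernel alone and is the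
    same for all group points.\<close>
  then have tr: "AE l in lborel. \<forall>p. op_trace (inversion_op 0 0 f p l) = tker \<kappa> p l"
    by eventually_elim (simp add: inversion_op_zero op_trace_eq_tker(1))
  have "AE p in lborel. integrable lborel (\<lambda>l. W l * tker \<kappa> p l) \<and> trace_integral (weight0 p) (inversion_op 0 0 f p) = H p"
    using ti
  proof eventually_elim
    fix p :: "'n heis" assume "trace_integrable (weight0 p) (inversion_op 0 0 f p)"
    then have i: "integrable lebesgue (\<lambda>l. W l * op_trace (inversion_op 0 0 f p l))"
      unfolding trace_integrable_def W by blast
    have "AE l in lborel. W l * op_trace (inversion_op 0 0 f p l) = W l * tker \<kappa> p l"
      using tr by eventually_elim (drule spec[of _ p], simp)
    then have eq: "AE l in lebesgue. W l * op_trace (inversion_op 0 0 f p l) = W l * tker \<kappa> p l"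
      by (simp only: AE_completion_iff)
    have m: "(\<lambda>l. W l * tker \<kappa> p l) \<in> borel_measurable lebesgue"
      by (rule measurable_completion) measurable
    have "integrable lebesgue (\<lambda>l. W l * tker \<kappa> p l)" by (rule integrable_cong_AE_imp[OF i m eq])
    then have 1: "integrable lborel (\<lambda>l. W l * tker \<kappa> p l)"
      by (subst (asm) integrable_completion) measurable
    have "trace_integral (weight0 p) (inversion_op 0 0 f p) = (LINT l|lebesgue. W l * tker \<kappa> p l)"
      unfolding trace_integral_def W by (rule integral_cong_AE[OF borel_measurable_integrable[OF i] m eq])
    also have "\<dots> = H p" unfolding H_def by (rule integral_completion) measurable
    finally show "integrable lborel (\<lambda>l. W l * tker \<kappa> p l) \<and> trace_integral (weight0 p) (inversion_op 0 0 f p) = H p"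
      using 1 by blast
  qed
  then have fin: "AE p in lborel. M p < \<infinity> \<and> trace_integral (weight0 p) (inversion_op 0 0 f p) = H p"
    by eventually_elim (simp add: M_def integrable_iff_bounded)
  have HM: "ennreal (cmod (H p)) \<le> M p" for p
  proof (cases "integrable lborel (\<lambda>l. W l * tker \<kappa> p l)")
    case True then show ?thesis unfolding H_def M_def by (rule integral_norm_bound_ennreal)
  next
    case False then show ?thesis unfolding H_def by (simp add: not_integrable_integral_eq)
  qed
  \<comment> \<open>The group has nonzero measure, so a property true almost everywhere holds at
    some point. Trace class at this one point is all that is used to factor the transform for almost
    every \<open>l\<close>.\<close>
  obtain p0 :: "'n heis" where "trace_integrable (weight0 p0) (inversion_op 0 0 f p0)"
  proof -
    have "\<exists>p :: 'n heis. trace_integrable (weight0 p) (inversion_op 0 0 f p)"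
    proof (rule ccontr)
      assume "\<not> ?thesis"
      then have n: "\<not> trace_integrable (weight0 p) (inversion_op 0 0 f p)" for p by blast
      have "AE p in (lborel :: 'n heis measure). False" using ti by eventually_elim (rule notE[OF n])
      then have "emeasure (lborel :: 'n heis measure) UNIV = 0"
        by (subst (asm) AE_iff_measurable[OF _ refl]) auto
      then show False by (simp add: emeasure_lborel_UNIV)
    qed
    then show ?thesis using that by blast
  qed
  then have tc: "AE l in lborel. trace_class (inversion_op 0 0 f p0 l)"
    unfolding trace_integrable_def by (simp only: AE_completion_iff)
  have test: "l2_inner f b = (LINT p|lborel. cnj (b p) * H p)"
    if b: "bdd_compact_supp b" and bN: "\<And>p. b p \<noteq> 0 \<Longrightarrow> M p \<le> ennreal N" for b N
  proof -
    have bL: "b \<in> L1" "b \<in> L2" using bdd_compact_supp_L1_L2[OF b] by auto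
    have bi: "integrable lborel b" using bL by (simp add: L1_def)
    note [measurable] = L2_measurable[OF bL(2)] kslice_measurable[OF L2_measurable[OF \<kappa>L]]
    have [measurable]: "b \<in> borel_measurable borel" by (rule L2_measurable[OF bL(2)])
    have l: "AE l in lborel. l2_inner (kslice \<kappa> l) (kslice (kap b) l) = (LINT p|lborel. cnj (b p) * tker \<kappa> p l)"
      using good tc AE_gft_L1_kop[OF bL] AE_lborel_nonzero
    proof eventually_elim
      fix l :: real
      assume D: "kslice \<kappa> l \<in> L2 \<and> op_eq (gft f l) (kop (kslice \<kappa> l))" and T: "trace_class (inversion_op 0 0 f p0 l)"
        and E: "kslice (kap b) l \<in> L2 \<and> op_eq (gft_L1 b l) (kop (kslice (kap b) l))" and l: "l \<noteq> 0"
      have "bounded_op (gft f l)" using gft_hilbert_schmidt[OF f l] by (simp add: hilbert_schmidt_def)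
      then obtain A B where AB: "hilbert_schmidt A" "hilbert_schmidt B" "op_eq (gft f l) (\<lambda>\<phi>. A (B \<phi>))"
        using trace_class_adjoint_factor[OF unitary_schroedinger _ T[unfolded inversion_op_zero]] by metis
      show "l2_inner (kslice \<kappa> l) (kslice (kap b) l) = (LINT p|lborel. cnj (b p) * tker \<kappa> p l)"
        by (rule kslice_inner_eq_tker[OF bL(1) conjunct1[OF D] conjunct2[OF D] conjunct1[OF E] conjunct2[OF E]
              L2_measurable[OF \<kappa>L] AB])
    qed
    let ?G = "\<lambda>p l. cnj (b p) * (W l * tker \<kappa> p l)"
    have Gm [measurable]: "case_prod ?G \<in> borel_measurable (lborel \<Otimes>\<^sub>M lborel)"
      unfolding case_prod_unfold by measurable
    have Gi: "integrable (lborel \<Otimes>\<^sub>M lborel) (case_prod ?G)"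
      unfolding integrable_iff_bounded
    proof (intro conjI Gm)
      have "(\<integral>\<^sup>+ x. ennreal (norm (case_prod ?G x)) \<partial>(lborel \<Otimes>\<^sub>M lborel)) = (\<integral>\<^sup>+ p. \<integral>\<^sup>+ l. ennreal (norm (?G p l)) \<partial>lborel \<partial>lborel)"
        by (subst lborel.nn_integral_fst[symmetric], measurable)
      also have "\<dots> = (\<integral>\<^sup>+ p. ennreal (cmod (b p)) * M p \<partial>lborel)"
        unfolding M_def by (intro nn_integral_cong) (simp add: norm_mult ennreal_mult nn_integral_cmult mult.assoc)
      also have "\<dots> \<le> (\<integral>\<^sup>+ p. ennreal (cmod (b p)) * ennreal N \<partial>lborel)"
      proof (rule nn_integral_mono)
        fix p show "ennreal (cmod (b p)) * M p \<le> ennreal (cmod (b p)) * ennreal N"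
          using bN[of p] by (cases "b p = 0") (auto intro: mult_left_mono)
      qed
      also have "\<dots> = (\<integral>\<^sup>+ p. ennreal (cmod (b p)) \<partial>lborel) * ennreal N" by (rule nn_integral_multc) measurable
      also have "\<dots> < \<infinity>" using bi unfolding integrable_iff_bounded by (simp add: ennreal_mult_less_top)
      finally show "(\<integral>\<^sup>+ x. ennreal (norm (case_prod ?G x)) \<partial>(lborel \<Otimes>\<^sub>M lborel)) < \<infinity>" .
    qed
    have "l2_inner f b = l2_inner \<kappa> (kap b)" by (rule kernel_of_inner[OF f \<kappa> bL])
    also have "\<dots> = (LINT l|lborel. W l * l2_inner (kslice \<kappa> l) (kslice (kap b) l))"
      unfolding W_def by (rule l2_inner_kslice[OF \<kappa>L kap_L2[OF bL]])
    also have "\<dots> = (LINT l|lborel. W l * (LINT p|lborel. cnj (b p) * tker \<kappa> p l))"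
    proof (rule integral_cong_AE)
      have km: "kap b \<in> borel_measurable borel" "\<kappa> \<in> borel_measurable borel"
        by (rule L2_measurable[OF kap_L2[OF bL]], rule L2_measurable[OF \<kappa>L])
      then show "(\<lambda>l. W l * l2_inner (kslice \<kappa> l) (kslice (kap b) l)) \<in> borel_measurable lborel"
        unfolding l2_inner_def kslice_def by measurable
      have "(\<lambda>x. cnj (b (snd x)) * tker \<kappa> (snd x) (fst x)) \<in> borel_measurable (borel \<Otimes>\<^sub>M lborel)"
      proof -
        have "(\<lambda>x::real \<times> 'n heis. (snd x, fst x)) \<in> borel \<Otimes>\<^sub>M lborel \<rightarrow>\<^sub>M borel \<Otimes>\<^sub>M borel" by measurable
        from measurable_compose[OF this tker_measurable[OF L2_measurable[OF \<kappa>L]]]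
        have [measurable]: "(\<lambda>x::real \<times> 'n heis. tker \<kappa> (snd x) (fst x)) \<in> borel_measurable (borel \<Otimes>\<^sub>M lborel)" by simp
        show ?thesis by measurable
      qed
      then have "(\<lambda>(l, p). cnj (b p) * tker \<kappa> p l) \<in> borel_measurable (borel \<Otimes>\<^sub>M lborel)" by (simp add: case_prod_unfold)
      from lborel.borel_measurable_lebesgue_integral[OF this]
      show "(\<lambda>l. W l * (LINT p|lborel. cnj (b p) * tker \<kappa> p l)) \<in> borel_measurable lborel" by measurable
      show "AE l in lborel. W l * l2_inner (kslice \<kappa> l) (kslice (kap b) l) = W l * (LINT p|lborel. cnj (b p) * tker \<kappa> p l)"
        using l by eventually_elim simp
    qed
    also have "\<dots> = (LINT l|lborel. LINT p|lborel. ?G p l)"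
      by (simp only: integral_mult_right_zero[symmetric] mult.left_commute[of "W _"])
    also have "\<dots> = (LINT p|lborel. LINT l|lborel. ?G p l)"
      by (rule lborel_pair.Fubini_integral[OF Gi])
    also have "\<dots> = (LINT p|lborel. cnj (b p) * H p)"
      unfolding H_def by (simp only: integral_mult_right_zero)
    finally show ?thesis .
  qed
  have eq: "AE p in lborel. \<forall>N::nat. norm p \<le> real N \<and> M p \<le> ennreal (real N) \<and> cmod (f p) \<le> real N \<longrightarrow> f p = H p"
    unfolding AE_all_countable
  proof (rule allI)
    fix N :: nat
    let ?S = "\<lambda>p. norm p \<le> real N \<and> M p \<le> ennreal (real N) \<and> cmod (f p) \<le> real N"
    \<comment> \<open>The test function is the error itself, cut off where the point,
      \<open>M\<close> and \<open>f\<close> are bounded by \<open>N\<close>, which bounds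
      \<open>H\<close> as well. The pairing identity then says that the squared norm of
      \<open>b\<close> is zero, and the cutoff sets exhaust almost all of the group as
      \<open>N\<close> grows.\<close>
    define b where "b p = (if ?S p then f p - H p else 0)" for p
    have HN: "cmod (H p) \<le> real N" if "?S p" for p
    proof -
      have "ennreal (cmod (H p)) \<le> ennreal (real N)" by (rule order_trans[OF HM]) (use that in blast)
      then show ?thesis by (simp add: ennreal_le_iff)
    qed
    have bm [measurable]: "b \<in> borel_measurable borel" unfolding b_def[abs_def] by measurable
    have b: "bdd_compact_supp b"
      unfolding bdd_compact_supp_def
    proof (intro conjI exI[of _ "2 * real N"] allI impI bm)
      fix p
      show "cmod (b p) \<le> 2 * real N"
        using norm_triangle_ineq4[of "f p" "H p"] HN[of p] by (auto simp: b_def)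
      show "b p = 0" if "norm p > 2 * real N" using that by (auto simp: b_def)
    qed
    have bL: "b \<in> L1" "b \<in> L2" using bdd_compact_supp_L1_L2[OF b] by auto
    have i1: "integrable lborel (\<lambda>p. f p * cnj (b p))" by (rule integrable_L2_inner[OF f bL(2)])
    have i2: "integrable lborel (\<lambda>p. cnj (b p) * H p)"
    proof (rule Bochner_Integration.integrable_bound[where f = "\<lambda>p. real N * cmod (b p)"])
      show "integrable lborel (\<lambda>p. real N * cmod (b p))" using bL by (simp add: L1_def)
      show "AE p in lborel. norm (cnj (b p) * H p) \<le> norm (real N * cmod (b p))"
      proof (intro AE_I2)
        fix p
        show "norm (cnj (b p) * H p) \<le> norm (real N * cmod (b p))"
        proof (cases "?S p")
          case True
          then show ?thesis
            using mult_right_mono[OF HN[OF True] norm_ge_zero[of "b p"]] by (simp add: norm_mult mult.commute)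
        next
          case False
          then have "b p = 0" unfolding b_def by (rule if_not_P)
          then show ?thesis by simp
        qed
      qed
    qed measurable
    have "l2_inner b b = (LINT p|lborel. f p * cnj (b p) - cnj (b p) * H p)"
      unfolding l2_inner_def by (intro Bochner_Integration.integral_cong refl) (auto simp: b_def algebra_simps)
    also have "\<dots> = l2_inner f b - (LINT p|lborel. cnj (b p) * H p)"
      unfolding l2_inner_def by (rule Bochner_Integration.integral_diff[OF i1 i2])
    also have "\<dots> = 0"
      using test[OF b, of "real N"] by (auto simp: b_def split: if_splits)
    finally have "nsq b = 0" using l2_inner_self[OF bL(2)] by simp
    then have "AE p in lborel. b p = 0" using bL by (simp add: nsq_eq_0_iff)
    then show "AE p in lborel. ?S p \<longrightarrow> f p = H p"
      by eventually_elim (auto simp: b_def)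
  qed
  show ?thesis using fin eq
  proof eventually_elim
    fix p assume 1: "M p < \<infinity> \<and> trace_integral (weight0 p) (inversion_op 0 0 f p) = H p"
      and 2: "\<forall>N::nat. norm p \<le> real N \<and> M p \<le> ennreal (real N) \<and> cmod (f p) \<le> real N \<longrightarrow> f p = H p"
    obtain N where N: "max (max (norm p) (enn2real (M p))) (cmod (f p)) \<le> real N"
      using real_arch_simple by blast
    have "M p \<le> ennreal (real N)"
      using 1 N ennreal_enn2real[of "M p"] by (metis ennreal_leI infinity_ennreal_def max.bounded_iff)
    then show "trace_integral (weight0 p) (inversion_op 0 0 f p) = f p" using 1 2 N by auto
  qed
qed

section \<open>Convolutions are in the domain of absolute convergence\<close>

definition hmul :: "'n::finite heis \<Rightarrow> 'n heis \<Rightarrow> 'n heis" where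
  "hmul p q = (fst p + fst q, fst (snd p) + fst (snd q),
     snd (snd p) + snd (snd q) + (fst q \<bullet> fst (snd p) - fst (snd q) \<bullet> fst p) / 2)"

lemma hmul_simp: "hmul (x, y, t) (u, v, s) = (x + u, y + v, t + s + (u \<bullet> y - v \<bullet> x) / 2)"
  by (simp add: hmul_def)

text \<open>The antisymmetric term of the group law and the cross terms of (x + u).(y + v)/2 add up
  to u.y, which is the phase gained when the inner operator is evaluated at \<xi> + y.\<close>

lemma schroedinger_hmul: "schroedinger l (hmul p q) \<phi> = schroedinger l p (schroedinger l q \<phi>)"
proof (rule ext)
  fix \<xi>
  obtain x y t where p: "p = (x, y, t)" by (cases p)
  obtain u v s where q: "q = (u, v, s)" by (cases q)
  have "2 * pi * l * ((t + s + (u \<bullet> y - v \<bullet> x) / 2) + (x + u) \<bullet> \<xi> + (x + u) \<bullet> (y + v) / 2)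
    = 2 * pi * l * (t + x \<bullet> \<xi> + x \<bullet> y / 2) + 2 * pi * l * (s + u \<bullet> (\<xi> + y) + u \<bullet> v / 2)"
    by (simp add: inner_add_left inner_add_right inner_commute[of v x] field_simps)
  then have "cis (2 * pi * l * ((t + s + (u \<bullet> y - v \<bullet> x) / 2) + (x + u) \<bullet> \<xi> + (x + u) \<bullet> (y + v) / 2))
    = cis (2 * pi * l * (t + x \<bullet> \<xi> + x \<bullet> y / 2)) * cis (2 * pi * l * (s + u \<bullet> (\<xi> + y) + u \<bullet> v / 2))"
    by (simp only: cis_mult)
  then show "schroedinger l (hmul p q) \<phi> \<xi> = schroedinger l p (schroedinger l q \<phi>) \<xi>"
    unfolding p q hmul_simp schroedinger_eq by (simp only: mult.assoc add.assoc)
qed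

lemma hmul_inverse: "hmul (hmul q r) (- r) = q"
  by (cases q; cases r)
    (simp add: hmul_simp inner_add_left inner_add_right inner_commute field_simps)

lemma hmul_inverse': "hmul (hmul q (- r)) r = q"
  using hmul_inverse[of q "- r"] by simp

lemma hmul_measurable [measurable (raw)]:
  fixes f g :: "'c \<Rightarrow> 'n::finite heis"
  assumes "f \<in> borel_measurable M" "g \<in> borel_measurable M"
  shows "(\<lambda>x. hmul (f x) (g x)) \<in> borel_measurable M"
proof -
  have "continuous_on UNIV (\<lambda>z :: 'n heis \<times> 'n heis. hmul (fst z) (snd z))"
    unfolding hmul_def by (intro continuous_intros) simp
  then have c: "(\<lambda>z :: 'n heis \<times> 'n heis. hmul (fst z) (snd z)) \<in> borel_measurable borel"
    by (rule borel_measurable_continuous_onI)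
  have "(\<lambda>x. (f x, g x)) \<in> borel_measurable M" using assms by (rule borel_measurable_Pair)
  from measurable_compose[OF this c] show ?thesis by simp
qed

text \<open>Right multiplication is a shear: the shift in \<open>t\<close> depends on
  \<open>x\<close> and \<open>y\<close>. Integrating over \<open>t\<close> first removes it by
  translation invariance, after which \<open>y\<close> and \<open>x\<close> are plain
  translations.\<close>

lemma nn_integral_hmul:
  fixes F :: "'n::finite heis \<Rightarrow> ennreal"
  assumes F: "F \<in> borel_measurable borel"
  shows "(\<integral>\<^sup>+ q. F (hmul q r) \<partial>lborel) = (\<integral>\<^sup>+ q. F q \<partial>lborel)"
proof -
  obtain u v s where r: "r = (u, v, s)" by (cases r)
  have [measurable]: "F \<in> borel_measurable (borel \<Otimes>\<^sub>M borel \<Otimes>\<^sub>M borel)" using F by (simp add: borel_prod)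
  have pair: "(\<integral>\<^sup>+ q. G q \<partial>lborel) = (\<integral>\<^sup>+ x. \<integral>\<^sup>+ y. \<integral>\<^sup>+ t. G (x, y, t) \<partial>lborel \<partial>lborel \<partial>lborel)"
    if G: "G \<in> borel_measurable borel" for G :: "'n heis \<Rightarrow> ennreal"
  proof -
    have [measurable]: "G \<in> borel_measurable (borel \<Otimes>\<^sub>M borel)" using G by (simp add: borel_prod)
    have "(\<integral>\<^sup>+ q. G q \<partial>lborel) = (\<integral>\<^sup>+ x. \<integral>\<^sup>+ z. G (x, z) \<partial>lborel \<partial>lborel)"
      by (rule nn_integral_lborel_pair[OF G])
    also have "\<dots> = (\<integral>\<^sup>+ x. \<integral>\<^sup>+ y. \<integral>\<^sup>+ t. G (x, y, t) \<partial>lborel \<partial>lborel \<partial>lborel)"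
    proof (rule nn_integral_cong)
      fix x
      have "(\<lambda>z. G (x, z)) \<in> borel_measurable borel" by measurable
      from nn_integral_lborel_pair[OF this]
      show "(\<integral>\<^sup>+ z. G (x, z) \<partial>lborel) = (\<integral>\<^sup>+ y. \<integral>\<^sup>+ t. G (x, y, t) \<partial>lborel \<partial>lborel)" .
    qed
    finally show ?thesis .
  qed
  have "(\<lambda>q. F (hmul q r)) \<in> borel_measurable borel" using F by measurable
  then have "(\<integral>\<^sup>+ q. F (hmul q r) \<partial>lborel)
    = (\<integral>\<^sup>+ x. \<integral>\<^sup>+ y. \<integral>\<^sup>+ t. F (x + u, y + v, t + (s + (u \<bullet> y - v \<bullet> x) / 2)) \<partial>lborel \<partial>lborel \<partial>lborel)"
    by (subst pair, assumption) (simp add: r hmul_simp add.assoc)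
  also have "\<dots> = (\<integral>\<^sup>+ x. \<integral>\<^sup>+ y. \<integral>\<^sup>+ t. F (x + u, y + v, t) \<partial>lborel \<partial>lborel \<partial>lborel)"
  proof -
    have "(\<integral>\<^sup>+ t. F (x + u, y + v, t + c) \<partial>lborel) = (\<integral>\<^sup>+ t. F (x + u, y + v, t) \<partial>lborel)" for x y and c :: real
      by (rule nn_integral_lborel_translate[where F = "\<lambda>t. F (x + u, y + v, t)"]) measurable
    then show ?thesis by (simp only:)
  qed
  also have "\<dots> = (\<integral>\<^sup>+ x. \<integral>\<^sup>+ y. \<integral>\<^sup>+ t. F (x + u, y, t) \<partial>lborel \<partial>lborel \<partial>lborel)"
  proof -
    have "(\<integral>\<^sup>+ y. \<integral>\<^sup>+ t. F (x + u, y + v, t) \<partial>lborel \<partial>lborel) = (\<integral>\<^sup>+ y. \<integral>\<^sup>+ t. F (x + u, y, t) \<partial>lborel \<partial>lborel)" for x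
      by (rule nn_integral_lborel_translate[where F = "\<lambda>y. \<integral>\<^sup>+ t. F (x + u, y, t) \<partial>lborel"]) measurable
    then show ?thesis by (simp only:)
  qed
  also have "\<dots> = (\<integral>\<^sup>+ x. \<integral>\<^sup>+ y. \<integral>\<^sup>+ t. F (x, y, t) \<partial>lborel \<partial>lborel \<partial>lborel)"
    by (rule nn_integral_lborel_translate[where F = "\<lambda>x. \<integral>\<^sup>+ y. \<integral>\<^sup>+ t. F (x, y, t) \<partial>lborel \<partial>lborel"]) measurable
  also have "\<dots> = (\<integral>\<^sup>+ q. F q \<partial>lborel)" by (rule pair[OF F, symmetric])
  finally show ?thesis .
qed

lemma distr_hmul: "distr lborel borel (\<lambda>q. hmul q r) = (lborel :: 'n::finite heis measure)"
proof (rule measure_eqI)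
  fix A :: "'n heis set" assume "A \<in> sets (distr lborel borel (\<lambda>q. hmul q r))"
  then have A [measurable]: "A \<in> sets borel" by simp
  have "emeasure (distr lborel borel (\<lambda>q. hmul q r)) A = (\<integral>\<^sup>+ q. indicator A (hmul q r) \<partial>lborel)"
    using A by (subst nn_integral_indicator[symmetric], simp) (subst nn_integral_distr, auto)
  also have "\<dots> = (\<integral>\<^sup>+ p. indicator A p \<partial>lborel)"
    by (rule nn_integral_hmul) measurable
  finally show "emeasure (distr lborel borel (\<lambda>q. hmul q r)) A = emeasure lborel A" using A by simp
qed simp

lemma integral_hmul:
  fixes F :: "'n::finite heis \<Rightarrow> complex"
  assumes F: "F \<in> borel_measurable borel"
  shows "(LINT q|lborel. F (hmul q r)) = (LINT q|lborel. F q)"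
proof -
  have "(\<lambda>q. hmul q r) \<in> lborel \<rightarrow>\<^sub>M borel" by measurable
  from integral_distr[OF this F] show ?thesis by (simp add: distr_hmul)
qed

text \<open>With the inverse on the argument of \<open>g\<close>, the substitution p = q r turns the
  transform of the convolution into the transform of \<open>g\<close> applied after that of
  \<open>h\<close>.\<close>

definition hconv :: "('n::finite heis \<Rightarrow> complex) \<Rightarrow> ('n heis \<Rightarrow> complex) \<Rightarrow> 'n heis \<Rightarrow> complex" where
  "hconv g h p = (LINT r|lborel. g (hmul p (- r)) * h r)"

text \<open>The bounded factor \<open>c\<close> serves two uses: the constant 1 for integrability of
  the convolution, and a matrix coefficient of the representation for the exchange of integrals in
  its transform.\<close>

lemma hconv_integrable_pair:
  fixes g h :: "'n::finite heis \<Rightarrow> complex"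
  assumes g: "g \<in> L1" and h: "h \<in> L1" and c: "\<And>p r. cmod (c p r) \<le> C"
    and cm: "(\<lambda>x. c (fst x) (snd x)) \<in> borel_measurable (lborel \<Otimes>\<^sub>M lborel)"
  shows "integrable (lborel \<Otimes>\<^sub>M lborel) (\<lambda>x. g (hmul (fst x) (- snd x)) * h (snd x) * c (fst x) (snd x))"
proof -
  have gi: "integrable lborel g" and hi: "integrable lborel h" using g h by (auto simp: L1_def)
  have [measurable]: "g \<in> borel_measurable borel" "h \<in> borel_measurable borel"
    using borel_measurable_integrable[OF gi] borel_measurable_integrable[OF hi] by simp_all
  note [measurable] = cm
  let ?F = "\<lambda>x. g (hmul (fst x) (- snd x)) * h (snd x) * c (fst x) (snd x)"
  have Fm [measurable]: "?F \<in> borel_measurable (lborel \<Otimes>\<^sub>M lborel)" by measurable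
  have "(\<integral>\<^sup>+ x. ennreal (norm (?F x)) \<partial>(lborel \<Otimes>\<^sub>M lborel)) = (\<integral>\<^sup>+ r. \<integral>\<^sup>+ p. ennreal (norm (?F (p, r))) \<partial>lborel \<partial>lborel)"
    by (subst lborel_pair.nn_integral_snd[symmetric], measurable)
  also have "\<dots> \<le> (\<integral>\<^sup>+ r. (\<integral>\<^sup>+ p. ennreal (cmod (g p)) \<partial>lborel) * (ennreal C * ennreal (cmod (h r))) \<partial>lborel)"
  proof (rule nn_integral_mono)
    fix r :: "'n heis"
    have C0: "C \<ge> 0" using c[of undefined undefined] norm_ge_zero[of "c undefined undefined"] by linarith
    have "(\<integral>\<^sup>+ p. ennreal (norm (?F (p, r))) \<partial>lborel) \<le> (\<integral>\<^sup>+ p. ennreal (cmod (g (hmul p (- r)))) * (ennreal C * ennreal (cmod (h r))) \<partial>lborel)"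
    proof (rule nn_integral_mono)
      fix p
      have "norm (?F (p, r)) \<le> cmod (g (hmul p (- r))) * (C * cmod (h r))"
        using mult_left_mono[OF c[of p r], of "cmod (g (hmul p (- r))) * cmod (h r)"] by (simp add: norm_mult ac_simps)
      then have "ennreal (norm (?F (p, r))) \<le> ennreal (cmod (g (hmul p (- r))) * (C * cmod (h r)))"
        by (rule ennreal_leI)
      then show "ennreal (norm (?F (p, r))) \<le> ennreal (cmod (g (hmul p (- r)))) * (ennreal C * ennreal (cmod (h r)))"
        using C0 by (simp add: ennreal_mult)
    qed
    also have "\<dots> = (\<integral>\<^sup>+ p. ennreal (cmod (g (hmul p (- r)))) \<partial>lborel) * (ennreal C * ennreal (cmod (h r)))"
      by (rule nn_integral_multc) measurable
    also have "(\<integral>\<^sup>+ p. ennreal (cmod (g (hmul p (- r)))) \<partial>lborel) = (\<integral>\<^sup>+ p. ennreal (cmod (g p)) \<partial>lborel)"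
      by (rule nn_integral_hmul) measurable
    finally show "(\<integral>\<^sup>+ p. ennreal (norm (?F (p, r))) \<partial>lborel) \<le> (\<integral>\<^sup>+ p. ennreal (cmod (g p)) \<partial>lborel) * (ennreal C * ennreal (cmod (h r)))" .
  qed
  also have "\<dots> = (\<integral>\<^sup>+ p. ennreal (cmod (g p)) \<partial>lborel) * (ennreal C * (\<integral>\<^sup>+ r. ennreal (cmod (h r)) \<partial>lborel))"
    by (simp add: nn_integral_cmult)
  also have "\<dots> < \<infinity>" using gi hi unfolding integrable_iff_bounded by (simp add: ennreal_mult_less_top)
  finally show ?thesis unfolding integrable_iff_bounded using Fm by simp
qed

lemma hconv_L1:
  fixes g h :: "'n::finite heis \<Rightarrow> complex"
  assumes g: "g \<in> L1" and h: "h \<in> L1"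
  shows "hconv g h \<in> L1"
proof -
  have "integrable (lborel \<Otimes>\<^sub>M lborel) (\<lambda>x. g (hmul (fst x) (- snd x)) * h (snd x) * 1)"
    by (rule hconv_integrable_pair[OF g h, of _ 1]) auto
  from lborel_pair.integrable_fst'[OF this] show ?thesis unfolding L1_def hconv_def[abs_def] by simp
qed

lemma hconv_bound:
  fixes g h :: "'n::finite heis \<Rightarrow> complex"
  assumes gm: "g \<in> borel_measurable borel" and h: "h \<in> L1" and B: "\<And>p. cmod (g p) \<le> B"
  shows "cmod (hconv g h p) \<le> B * (LINT r|lborel. cmod (h r))"
proof -
  have hi: "integrable lborel h" using h by (simp add: L1_def)
  have [measurable]: "g \<in> borel_measurable borel" "h \<in> borel_measurable borel"
    using gm borel_measurable_integrable[OF hi] by simp_all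
  have i: "integrable lborel (\<lambda>r. B * cmod (h r))" using hi by simp
  have le: "norm (g (hmul p (- r)) * h r) \<le> B * cmod (h r)" for r
    unfolding norm_mult by (intro mult_right_mono B) simp
  have "integrable lborel (\<lambda>r. g (hmul p (- r)) * h r)"
    by (rule Bochner_Integration.integrable_bound[OF i], measurable)
      (intro AE_I2 order_trans[OF le], simp)
  then have "cmod (hconv g h p) \<le> (LINT r|lborel. B * cmod (h r))"
    unfolding hconv_def by (intro order_trans[OF integral_norm_bound] integral_mono le i integrable_norm)
  then show ?thesis by simp
qed

text \<open>A bounded integrable function is square-integrable, and boundedness is inherited from
  \<open>g\<close>.\<close>

lemma hconv_L2:
  fixes g h :: "'n::finite heis \<Rightarrow> complex"
  assumes g: "bdd_compact_supp g" and h: "h \<in> L1"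
  shows "hconv g h \<in> L2"
proof -
  have gL: "g \<in> L1" using bdd_compact_supp_L1_L2[OF g] by blast
  have gm: "g \<in> borel_measurable borel" using g by (simp add: bdd_compact_supp_def)
  obtain B where B: "B > 0" "\<And>p. cmod (g p) \<le> B" using bdd_compact_supp_obtain[OF g] by metis
  have i: "integrable lborel (hconv g h)" using hconv_L1[OF gL h] by (simp add: L1_def)
  have m [measurable]: "hconv g h \<in> borel_measurable borel" using borel_measurable_integrable[OF i] by simp
  define C where "C = B * (LINT r|lborel. cmod (h r))"
  have le: "cmod (hconv g h p) \<le> C" for p unfolding C_def by (rule hconv_bound[OF gm h B(2)])
  show ?thesis unfolding L2_iff
  proof (intro conjI m)
    show "integrable lborel (\<lambda>p. (cmod (hconv g h p))\<^sup>2)"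
    proof (rule Bochner_Integration.integrable_bound[where f = "\<lambda>p. C * cmod (hconv g h p)"])
      show "integrable lborel (\<lambda>p. C * cmod (hconv g h p))" using i by simp
      show "AE p in lborel. norm ((cmod (hconv g h p))\<^sup>2) \<le> norm (C * cmod (hconv g h p))"
      proof (intro AE_I2)
        fix p
        have "(cmod (hconv g h p))\<^sup>2 \<le> C * cmod (hconv g h p)"
          unfolding power2_eq_square by (intro mult_right_mono le) simp
        then show "norm ((cmod (hconv g h p))\<^sup>2) \<le> norm (C * cmod (hconv g h p))" by simp
      qed
    qed measurable
  qed
qed

lemma schroedinger_inner_bound:
  assumes "\<phi> \<in> L2" "\<psi> \<in> L2"
  shows "cmod (l2_inner \<psi> (schroedinger l p \<phi>)) \<le> sqrt (nsq \<psi> * nsq \<phi>)"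
  using l2_Cauchy_Schwarz[OF assms(2) schroedinger_L2(1)[OF assms(1), of l p]]
  by (simp add: schroedinger_L2[OF assms(1)] real_le_rsqrt)

lemma schroedinger_inner_measurable:
  fixes \<phi> \<psi> :: "real ^ 'n::finite \<Rightarrow> complex"
  assumes [measurable]: "\<phi> \<in> borel_measurable borel" "\<psi> \<in> borel_measurable borel"
  shows "(\<lambda>p. l2_inner \<psi> (schroedinger l p \<phi>)) \<in> borel_measurable borel"
proof -
  have "(\<lambda>x. \<psi> (snd x) * cnj (schroedinger l (fst x) \<phi> (snd x))) \<in> borel_measurable (borel \<Otimes>\<^sub>M lborel)" by measurable
  then have "(\<lambda>(p, \<xi>). \<psi> \<xi> * cnj (schroedinger l p \<phi> \<xi>)) \<in> borel_measurable (borel \<Otimes>\<^sub>M lborel)" by (simp add: case_prod_unfold)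
  from lborel.borel_measurable_lebesgue_integral[OF this] show ?thesis unfolding l2_inner_def .
qed

text \<open>Matrix coefficients turn operator integrals into scalar ones. After p = q r, by right
  invariance, the homomorphism property splits the representation operator and the double integral
  separates.\<close>

lemma gft_hconv_inner:
  fixes g h :: "'n::finite heis \<Rightarrow> complex"
  assumes g: "g \<in> L1" and h: "h \<in> L1" and \<phi>: "\<phi> \<in> L2" and \<psi>: "\<psi> \<in> L2" and hL: "gft_L1 h l \<phi> \<in> L2"
  shows "l2_inner \<psi> (gft_L1 (hconv g h) l \<phi>) = l2_inner \<psi> (gft_L1 g l (gft_L1 h l \<phi>))"
proof -
  have gi: "integrable lborel g" and hi: "integrable lborel h" using g h by (auto simp: L1_def)
  have [measurable]: "g \<in> borel_measurable borel" "h \<in> borel_measurable borel"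
    using borel_measurable_integrable[OF gi] borel_measurable_integrable[OF hi] by simp_all
  define \<beta> where "\<beta> p = l2_inner \<psi> (schroedinger l p \<phi>)" for p :: "'n heis"
  define C where "C = sqrt (nsq \<psi> * nsq \<phi>)"
  have \<beta>m [measurable]: "\<beta> \<in> borel_measurable borel"
    unfolding \<beta>_def[abs_def] by (rule schroedinger_inner_measurable[OF L2_measurable[OF \<phi>] L2_measurable[OF \<psi>]])
  have \<beta>C: "cmod (\<beta> p) \<le> C" for p unfolding \<beta>_def C_def by (rule schroedinger_inner_bound[OF \<phi> \<psi>])
  let ?c = "\<lambda>x. cnj (g (hmul (fst x) (- snd x))) * cnj (h (snd x)) * \<beta> (fst x)"
  have "integrable (lborel \<Otimes>\<^sub>M lborel) (\<lambda>x. g (hmul (fst x) (- snd x)) * h (snd x) * cnj (\<beta> (fst x)))"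
    by (rule hconv_integrable_pair[OF g h, of _ C]) (simp add: \<beta>C, measurable)
  then have "integrable (lborel \<Otimes>\<^sub>M lborel) (\<lambda>x. cnj (g (hmul (fst x) (- snd x)) * h (snd x) * cnj (\<beta> (fst x))))"
    by (rule integrable_cnj)
  then have int1: "integrable (lborel \<Otimes>\<^sub>M lborel) (\<lambda>(p, r). cnj (g (hmul p (- r))) * cnj (h r) * \<beta> p)"
    by (simp add: case_prod_unfold)
  have "l2_inner \<psi> (gft_L1 (hconv g h) l \<phi>) = (LINT p|lborel. cnj (hconv g h p) * \<beta> p)"
    unfolding \<beta>_def by (rule l2_inner_gft_L1[OF hconv_L1[OF g h] \<psi> \<phi>])
  also have "\<dots> = (LINT p|lborel. LINT r|lborel. cnj (g (hmul p (- r))) * cnj (h r) * \<beta> p)"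
    unfolding hconv_def Bochner_Integration.integral_cnj[symmetric] integral_mult_left_zero[symmetric]
    by (simp only: complex_cnj_mult)
  also have "\<dots> = (LINT r|lborel. LINT p|lborel. cnj (g (hmul p (- r))) * cnj (h r) * \<beta> p)"
    by (rule lborel_pair.Fubini_integral[OF int1, symmetric])
  also have "\<dots> = (LINT r|lborel. LINT q|lborel. cnj (g q) * cnj (h r) * \<beta> (hmul q r))"
  proof (rule Bochner_Integration.integral_cong[OF refl])
    fix r :: "'n heis"
    have "(LINT q|lborel. cnj (g (hmul (hmul q r) (- r))) * cnj (h r) * \<beta> (hmul q r)) = (LINT p|lborel. cnj (g (hmul p (- r))) * cnj (h r) * \<beta> p)"
      by (rule integral_hmul[where F = "\<lambda>p. cnj (g (hmul p (- r))) * cnj (h r) * \<beta> p"]) measurable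
    then show "(LINT p|lborel. cnj (g (hmul p (- r))) * cnj (h r) * \<beta> p) = (LINT q|lborel. cnj (g q) * cnj (h r) * \<beta> (hmul q r))"
      by (simp only: hmul_inverse)
  qed
  also have "\<dots> = (LINT q|lborel. LINT r|lborel. cnj (g q) * cnj (h r) * \<beta> (hmul q r))"
  proof (rule fubini_prod_bound[where a = "\<lambda>r. C * cmod (h r)" and b = "\<lambda>q. cmod (g q)"])
    show "case_prod (\<lambda>r q. cnj (g q) * cnj (h r) * \<beta> (hmul q r)) \<in> borel_measurable (borel \<Otimes>\<^sub>M borel)"
      unfolding case_prod_unfold by measurable
    show "cmod (cnj (g q) * cnj (h r) * \<beta> (hmul q r)) \<le> C * cmod (h r) * cmod (g q)" for r q
      using mult_left_mono[OF \<beta>C[of "hmul q r"], of "cmod (g q) * cmod (h r)"] by (simp add: norm_mult ac_simps)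
  qed (use gi hi in simp_all)
  also have "\<dots> = (LINT q|lborel. cnj (g q) * l2_inner \<psi> (schroedinger l q (gft_L1 h l \<phi>)))"
  proof (intro Bochner_Integration.integral_cong refl)
    fix q :: "'n heis"
    have adj: "l2_inner \<psi> (schroedinger l q \<omega>) = l2_inner (schroedinger l (- q) \<psi>) \<omega>" if "\<omega> \<in> L2" for \<omega>
      using adj_pair_inner[OF unitary_pair_adj[OF unitary_schroedinger[of l "- q"]] \<psi> that] by simp
    have "l2_inner \<psi> (schroedinger l q (gft_L1 h l \<phi>)) = (LINT r|lborel. cnj (h r) * l2_inner (schroedinger l (- q) \<psi>) (schroedinger l r \<phi>))"
      unfolding adj[OF hL] by (rule l2_inner_gft_L1[OF h schroedinger_L2(1)[OF \<psi>] \<phi>])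
    also have "\<dots> = (LINT r|lborel. cnj (h r) * \<beta> (hmul q r))"
      unfolding \<beta>_def schroedinger_hmul by (simp only: adj[OF schroedinger_L2(1)[OF \<phi>]])
    finally show "(LINT r|lborel. cnj (g q) * cnj (h r) * \<beta> (hmul q r)) = cnj (g q) * l2_inner \<psi> (schroedinger l q (gft_L1 h l \<phi>))"
      by (simp only: mult.assoc integral_mult_right_zero)
  qed
  also have "\<dots> = l2_inner \<psi> (gft_L1 g l (gft_L1 h l \<phi>))"
    by (rule l2_inner_gft_L1[OF g \<psi> hL, symmetric])
  finally show ?thesis .
qed

lemma gft_hconv:
  fixes g h :: "'n::finite heis \<Rightarrow> complex"
  assumes g: "bdd_compact_supp g" and h: "h \<in> L1" "h \<in> L2"
  shows "AE l in lborel. op_eq (gft (hconv g h) l) (\<lambda>\<phi>. kop (kslice (kap g) l) (kop (kslice (kap h) l) \<phi>))"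
proof -
  have gL: "g \<in> L1" "g \<in> L2" using bdd_compact_supp_L1_L2[OF g] by auto
  have FL: "hconv g h \<in> L1" "hconv g h \<in> L2" using hconv_L1[OF gL(1) h(1)] hconv_L2[OF g h(1)] by auto
  show ?thesis
    using AE_gft_kop[OF FL(2) kernel_of_kap[OF FL]] AE_gft_L1_kop[OF FL] AE_gft_L1_kop[OF gL] AE_gft_L1_kop[OF h]
  proof eventually_elim
    fix l :: real
    assume F: "kslice (kap (hconv g h)) l \<in> L2 \<and> op_eq (gft (hconv g h) l) (kop (kslice (kap (hconv g h)) l))"
      and F1: "kslice (kap (hconv g h)) l \<in> L2 \<and> op_eq (gft_L1 (hconv g h) l) (kop (kslice (kap (hconv g h)) l))"
      and G: "kslice (kap g) l \<in> L2 \<and> op_eq (gft_L1 g l) (kop (kslice (kap g) l))"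
      and H: "kslice (kap h) l \<in> L2 \<and> op_eq (gft_L1 h l) (kop (kslice (kap h) l))"
    have 1: "op_eq (gft (hconv g h) l) (gft_L1 (hconv g h) l)"
      using F F1 op_eq_trans op_eq_sym by blast
    have 2: "op_eq (gft_L1 (hconv g h) l) (\<lambda>\<phi>. gft_L1 g l (gft_L1 h l \<phi>))"
      unfolding op_eq_def
    proof (intro ballI conjI)
      fix \<phi> :: "real ^ 'n \<Rightarrow> complex" assume \<phi>: "\<phi> \<in> L2"
      show A: "gft_L1 (hconv g h) l \<phi> \<in> L2" using F1 \<phi> by (simp add: op_eq_def)
      have hL: "gft_L1 h l \<phi> \<in> L2" using H \<phi> by (simp add: op_eq_def)
      then show B: "gft_L1 g l (gft_L1 h l \<phi>) \<in> L2" using G by (simp add: op_eq_def)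
      show "AE x in lborel. gft_L1 (hconv g h) l \<phi> x = gft_L1 g l (gft_L1 h l \<phi>) x"
      proof (rule l2_eqI[OF A B])
        fix \<psi> :: "real ^ 'n \<Rightarrow> complex" assume \<psi>: "\<psi> \<in> L2"
        show "l2_inner (gft_L1 (hconv g h) l \<phi>) \<psi> = l2_inner (gft_L1 g l (gft_L1 h l \<phi>)) \<psi>"
          using gft_hconv_inner[OF gL(1) h(1) \<phi> \<psi> hL] by (metis l2_inner_commute)
      qed
    qed
    have "bounded_op (gft_L1 g l)"
      using bounded_op_op_eq[OF bounded_op_kop[OF conjunct1[OF G]] op_eq_sym[OF conjunct2[OF G]]] .
    then have 3: "op_eq (\<lambda>\<phi>. gft_L1 g l (gft_L1 h l \<phi>)) (\<lambda>\<phi>. kop (kslice (kap g) l) (kop (kslice (kap h) l) \<phi>))"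
      by (rule op_eq_comp[OF _ conjunct2[OF G] conjunct2[OF H]])
    show "op_eq (gft (hconv g h) l) (\<lambda>\<phi>. kop (kslice (kap g) l) (kop (kslice (kap h) l) \<phi>))"
      by (rule op_eq_trans[OF 1 op_eq_trans[OF 2 3]])
  qed
qed

text \<open>At almost every \<open>l\<close> the trace is at most half the sum of the squared
  Hilbert-Schmidt norms of the transforms of \<open>g\<close> and \<open>h\<close>. Integrated
  against the Plancherel density these give the squared norms of \<open>kap g\<close> and
  \<open>kap h\<close>, whatever the group point.\<close>

lemma trace_integrable_hconv:
  fixes g h :: "'n::finite heis \<Rightarrow> complex"
  assumes g: "bdd_compact_supp g" and h: "h \<in> L1" "h \<in> L2"
  shows "trace_integrable (weight0 p) (inversion_op 0 0 (hconv g h) p)"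
proof -
  have gL: "g \<in> L1" "g \<in> L2" using bdd_compact_supp_L1_L2[OF g] by auto
  have FL: "hconv g h \<in> L1" "hconv g h \<in> L2" using hconv_L1[OF gL(1) h(1)] hconv_L2[OF g h(1)] by auto
  let ?\<kappa> = "kap (hconv g h)"
  let ?b = "\<lambda>l. (nsq (kslice (kap h) l) + nsq (kslice (kap g) l)) / 2"
  have \<kappa>m: "?\<kappa> \<in> borel_measurable borel" by (rule L2_measurable[OF kap_L2[OF FL]])
  have main: "AE l in lborel. trace_class (inversion_op 0 0 (hconv g h) p l) \<and>
      op_trace (inversion_op 0 0 (hconv g h) p l) = tker ?\<kappa> p l \<and> cmod (tker ?\<kappa> p l) \<le> ?b l"
    using gft_hconv[OF g h] AE_gft_kop[OF FL(2) kernel_of_kap[OF FL]] AE_kslice_L2[OF kap_L2[OF gL]] AE_kslice_L2[OF kap_L2[OF h]]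
  proof eventually_elim
    fix l :: real
    let ?D = "gft (hconv g h) l" and ?A = "kop (kslice (kap g) l)" and ?B = "kop (kslice (kap h) l)"
    let ?U = "schroedinger l p" and ?U' = "schroedinger l (- p)"
    assume D: "op_eq ?D (\<lambda>\<phi>. ?A (?B \<phi>))"
      and K: "kslice ?\<kappa> l \<in> L2 \<and> op_eq ?D (kop (kslice ?\<kappa> l))"
      and k: "kslice (kap g) l \<in> L2" "kslice (kap h) l \<in> L2"
    note hA = hilbert_schmidt_kop[OF k(1)] and hB = hilbert_schmidt_kop[OF k(2)]
    have adj: "op_eq (op_adjoint ?U) ?U'" by (rule op_adjoint_op_eq[OF unitary_pair_adj[OF unitary_schroedinger]])
    have "bounded_op (op_adjoint ?U)"
      by (rule bounded_op_op_eq[OF unitary_pair_bounded'[OF unitary_schroedinger] op_eq_sym[OF adj]])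
    from op_eq_comp[OF this adj D]
    have "op_eq (op_adjoint ?U \<circ> ?D) (\<lambda>\<phi>. ?U' (?A (?B \<phi>)))" unfolding comp_def .
    then have 1: "trace_class (inversion_op 0 0 (hconv g h) p l)"
      unfolding inversion_op_zero
      by (rule trace_classI[OF hilbert_schmidt_unitary_left[OF unitary_pair_sym[OF unitary_schroedinger] hA(1)] hB(1)])
    have 2: "op_trace (inversion_op 0 0 (hconv g h) p l) = tker ?\<kappa> p l"
      unfolding inversion_op_zero by (rule op_trace_eq_tker(1)[OF conjunct1[OF K] conjunct2[OF K]])
    let ?t = "\<lambda>i. l2_inner (kop (kslice ?\<kappa> l) (l2_basis i)) (?U (l2_basis i))"
    have le: "(\<Sum>i<n. cmod (?t i)) \<le> ?b l" for n
      using trace_unitary_bound(1)[OF hA(1) hB(1) D unitary_schroedinger[of l p], of n]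
      unfolding op_trace_eq_tker(2)[OF conjunct1[OF K] conjunct2[OF K]] hA(2) hB(2)
      by (simp add: l2_norm_sq_eq k)
    have sm: "summable ?t"
      using trace_unitary_bound(2)[OF hA(1) hB(1) D unitary_schroedinger[of l p]]
      unfolding op_trace_eq_tker(2)[OF conjunct1[OF K] conjunct2[OF K]] .
    have 3: "cmod (tker ?\<kappa> p l) \<le> ?b l"
    proof (rule LIMSEQ_le_const2)
      show "(\<lambda>n. cmod (\<Sum>i<n. ?t i)) \<longlonglongrightarrow> cmod (tker ?\<kappa> p l)"
        unfolding tker_def by (intro tendsto_norm summable_LIMSEQ sm)
      show "\<exists>N. \<forall>n\<ge>N. cmod (\<Sum>i<n. ?t i) \<le> ?b l"
        using order_trans[OF norm_sum le] by blast
    qed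
    show "trace_class (inversion_op 0 0 (hconv g h) p l) \<and>
      op_trace (inversion_op 0 0 (hconv g h) p l) = tker ?\<kappa> p l \<and> cmod (tker ?\<kappa> p l) \<le> ?b l"
      using 1 2 3 by blast
  qed
  have tm [measurable]: "(\<lambda>l. tker ?\<kappa> p l) \<in> borel_measurable borel"
  proof -
    have "(\<lambda>l. (p, l)) \<in> borel \<rightarrow>\<^sub>M borel \<Otimes>\<^sub>M borel" by measurable
    from measurable_compose[OF this tker_measurable[OF \<kappa>m]] show ?thesis by simp
  qed
  have i: "integrable lborel (\<lambda>l. weight0 p l * tker ?\<kappa> p l)"
    unfolding integrable_iff_bounded
  proof (intro conjI)
    show "(\<lambda>l. weight0 p l * tker ?\<kappa> p l) \<in> borel_measurable lborel" unfolding weight0_def by measurable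
    have "(\<integral>\<^sup>+ l. ennreal (norm (weight0 p l * tker ?\<kappa> p l)) \<partial>lborel)
      \<le> (\<integral>\<^sup>+ l. ennreal (\<bar>l\<bar> ^ CARD('n)) * l2_norm_sq (kslice (kap h) l) + ennreal (\<bar>l\<bar> ^ CARD('n)) * l2_norm_sq (kslice (kap g) l) \<partial>lborel)"
    proof (rule nn_integral_mono_AE)
      show "AE l in lborel. ennreal (norm (weight0 p l * tker ?\<kappa> p l))
        \<le> ennreal (\<bar>l\<bar> ^ CARD('n)) * l2_norm_sq (kslice (kap h) l) + ennreal (\<bar>l\<bar> ^ CARD('n)) * l2_norm_sq (kslice (kap g) l)"
        using main AE_kslice_L2[OF kap_L2[OF gL]] AE_kslice_L2[OF kap_L2[OF h]]
      proof eventually_elim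
        fix l :: real
        assume m: "trace_class (inversion_op 0 0 (hconv g h) p l) \<and>
            op_trace (inversion_op 0 0 (hconv g h) p l) = tker ?\<kappa> p l \<and> cmod (tker ?\<kappa> p l) \<le> ?b l"
          and k: "kslice (kap g) l \<in> L2" "kslice (kap h) l \<in> L2"
        have "cmod (tker ?\<kappa> p l) \<le> nsq (kslice (kap h) l) + nsq (kslice (kap g) l)"
          using m nsq_nonneg[of "kslice (kap h) l"] nsq_nonneg[of "kslice (kap g) l"] by argo
        then have "\<bar>l\<bar> ^ CARD('n) * cmod (tker ?\<kappa> p l) \<le> \<bar>l\<bar> ^ CARD('n) * (nsq (kslice (kap h) l) + nsq (kslice (kap g) l))"
          by (intro mult_left_mono) auto
        then have "ennreal (norm (weight0 p l * tker ?\<kappa> p l)) \<le> ennreal (\<bar>l\<bar> ^ CARD('n) * nsq (kslice (kap h) l) + \<bar>l\<bar> ^ CARD('n) * nsq (kslice (kap g) l))"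
          by (intro ennreal_leI) (simp add: weight0_def norm_mult norm_power distrib_left)
        then show "ennreal (norm (weight0 p l * tker ?\<kappa> p l))
          \<le> ennreal (\<bar>l\<bar> ^ CARD('n)) * l2_norm_sq (kslice (kap h) l) + ennreal (\<bar>l\<bar> ^ CARD('n)) * l2_norm_sq (kslice (kap g) l)"
          using k by (simp add: l2_norm_sq_eq ennreal_mult)
      qed
    qed
    also have "\<dots> = l2_norm_sq (kap h) + l2_norm_sq (kap g)"
    proof -
      note [measurable] = l2_norm_sq_kslice_measurable[OF L2_measurable[OF kap_L2[OF h]]]
        l2_norm_sq_kslice_measurable[OF L2_measurable[OF kap_L2[OF gL]]]
      show ?thesis
        unfolding nn_integral_kslice[OF L2_measurable[OF kap_L2[OF h]], symmetric]
          nn_integral_kslice[OF L2_measurable[OF kap_L2[OF gL]], symmetric]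
        by (rule nn_integral_add) measurable
    qed
    also have "\<dots> < \<infinity>"
      using l2_norm_sq_finite[OF kap_L2[OF h]] l2_norm_sq_finite[OF kap_L2[OF gL]] by simp
    finally show "(\<integral>\<^sup>+ l. ennreal (norm (weight0 p l * tker ?\<kappa> p l)) \<partial>lborel) < \<infinity>" .
  qed
  have "(\<lambda>l. weight0 p l * tker ?\<kappa> p l) \<in> borel_measurable lborel" using i by (rule borel_measurable_integrable)
  then have i': "integrable lebesgue (\<lambda>l. weight0 p l * tker ?\<kappa> p l)"
    using i by (subst integrable_completion)
  have "AE l in lborel. weight0 p l * tker ?\<kappa> p l = weight0 p l * op_trace (inversion_op 0 0 (hconv g h) p l)"
    using main by eventually_elim simp
  then have eq: "AE l in lebesgue. weight0 p l * tker ?\<kappa> p l = weight0 p l * op_trace (inversion_op 0 0 (hconv g h) p l)"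
    by (simp only: AE_completion_iff)
  have "integrable lebesgue (\<lambda>l. weight0 p l * op_trace (inversion_op 0 0 (hconv g h) p l))"
    by (rule integrable_cong_AE_imp[OF i' borel_measurable_AE[OF borel_measurable_integrable[OF i'] eq] eq])
  moreover have "AE l in lebesgue. trace_class (inversion_op 0 0 (hconv g h) p l)"
  proof -
    have "AE l in lborel. trace_class (inversion_op 0 0 (hconv g h) p l)" using main by eventually_elim blast
    then show ?thesis by (simp only: AE_completion_iff)
  qed
  ultimately show ?thesis unfolding trace_integrable_def by blast
qed

text \<open>The \<open>h k\<close> are normalised indicators of shrinking balls, an approximate
  identity. Continuity of \<open>g\<close> gives pointwise convergence, and a common bounded support
  gives a square-integrable majorant.\<close>

lemma hconv_approx:
  fixes g :: "'n::finite heis \<Rightarrow> complex"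
  assumes g: "cont_compact_supp g"
  obtains h where "\<And>k. h k \<in> L1" "\<And>k. h k \<in> L2" "l2_tendsto (\<lambda>k. hconv g (h k)) g"
proof -
  define B0 where "B0 k = ball (0 :: 'n heis) (1 / real (Suc k))" for k
  define m where "m k = measure lborel (B0 k)" for k
  have m: "m k > 0" for k unfolding m_def B0_def by (intro content_ball_pos) simp
  define h where "h k r = complex_of_real (indicator (B0 k) r / m k)" for k r
  have B0m [measurable]: "B0 k \<in> sets borel" for k by (simp add: B0_def)
  have B0fin: "emeasure lborel (B0 k) < \<infinity>" for k
    unfolding B0_def using emeasure_bounded_finite[OF bounded_ball] by blast
  have hb: "bdd_compact_supp (h k)" for k
    unfolding bdd_compact_supp_def
  proof (intro conjI exI[of _ "max 1 (1 / m k)"] allI impI)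
    show "h k \<in> borel_measurable borel" unfolding h_def[abs_def] by measurable
    show "cmod (h k r) \<le> max 1 (1 / m k)" for r
      using m[of k] by (auto simp: h_def indicator_def norm_divide)
    show "h k r = 0" if "max 1 (1 / m k) < norm r" for r
    proof -
      have "1 / real (Suc k) \<le> 1" by simp
      then have "\<not> norm r < 1 / real (Suc k)" using that by linarith
      then have "r \<notin> B0 k" by (simp add: B0_def)
      then show ?thesis by (simp add: h_def)
    qed
  qed
  have hL: "h k \<in> L1" "h k \<in> L2" for k using bdd_compact_supp_L1_L2[OF hb] by auto
  have hi: "integrable lborel (h k)" for k using hL by (simp add: L1_def)
  have hint: "(LINT r|lborel. cmod (h k r)) = 1" for k
  proof -
    have "(LINT r|lborel. cmod (h k r)) = (LINT r|lborel. indicator (B0 k) r / m k)"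
      using m[of k] by (intro Bochner_Integration.integral_cong refl) (simp add: h_def norm_divide)
    also have "\<dots> = 1" using m[of k] by (simp add: m_def)
    finally show ?thesis .
  qed
  have hint': "(LINT r|lborel. h k r) = 1" for k
  proof -
    have "(LINT r|lborel. h k r) = complex_of_real (LINT r|lborel. indicator (B0 k) r / m k)"
      unfolding h_def by (rule integral_complex_of_real)
    also have "\<dots> = 1" using m[of k] by (simp add: m_def)
    finally show ?thesis .
  qed
  have gb: "bdd_compact_supp g" by (rule cont_compact_supp_bdd[OF g])
  have gL: "g \<in> L1" "g \<in> L2" using bdd_compact_supp_L1_L2[OF gb] by auto
  have gm: "g \<in> borel_measurable borel" by (rule L2_measurable[OF gL(2)])
  have gc: "continuous_on UNIV g" using g by (simp add: cont_compact_supp_def)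
  obtain B where B: "B > 0" "\<And>p. cmod (g p) \<le> B" "\<And>p. norm p > B \<Longrightarrow> g p = 0"
    using bdd_compact_supp_obtain[OF gb] by metis
  have Fint: "integrable lborel (\<lambda>r. g (hmul p (- r)) * h k r)" for p k
  proof (rule Bochner_Integration.integrable_bound[where f = "\<lambda>r. B * cmod (h k r)"])
    show "integrable lborel (\<lambda>r. B * cmod (h k r))" using hi by simp
    note [measurable] = gm L2_measurable[OF hL(2)]
    show "(\<lambda>r. g (hmul p (- r)) * h k r) \<in> borel_measurable lborel" by measurable
    show "AE r in lborel. norm (g (hmul p (- r)) * h k r) \<le> norm (B * cmod (h k r))"
      using mult_right_mono[OF B(2) norm_ge_zero] B(1) by (intro AE_I2) (simp add: norm_mult)
  qed
  have "l2_tendsto (\<lambda>k. hconv g (h k)) g"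
  proof (rule l2_tendsto_dominated[where g = "\<lambda>p. complex_of_real (2 * B) * indicator (cball 0 (2 * B + 1)) p"])
    show "hconv g (h k) \<in> borel_measurable borel" for k by (rule L2_measurable[OF hconv_L2[OF gb hL(1)]])
    show "g \<in> borel_measurable borel" by (rule gm)
    show "(\<lambda>p. complex_of_real (2 * B) * indicator (cball 0 (2 * B + 1)) p) \<in> (L2 :: ('n heis \<Rightarrow> complex) set)"
    proof (rule bdd_compact_supp_L1_L2(2), unfold bdd_compact_supp_def, intro conjI exI[of _ "2 * B + 1"])
    qed (use B(1) in \<open>auto simp: norm_mult indicator_def\<close>)
    show "AE p in lborel. (\<lambda>k. hconv g (h k) p) \<longlonglongrightarrow> g p"
    proof (intro AE_I2 LIMSEQ_I)
      fix p and e :: real assume e: "e > 0"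
      have "continuous_on UNIV (\<lambda>r. g (hmul p (- r)))"
        unfolding hmul_def by (intro continuous_on_compose2[OF gc] continuous_intros) auto
      then have "isCont (\<lambda>r. g (hmul p (- r))) 0" by (rule continuous_on_interior) simp
      then obtain d where d: "d > 0" "\<And>r. norm r < d \<Longrightarrow> cmod (g (hmul p (- r)) - g (hmul p (- 0))) < e / 2"
        unfolding continuous_at_eps_delta dist_norm using e by (metis diff_zero half_gt_zero)
      have p0: "hmul p (- 0) = p" by (cases p) (simp add: zero_prod_def hmul_simp)
      obtain N where N: "1 / real (Suc N) < d"
        using reals_Archimedean[OF d(1)] by (auto simp: inverse_eq_divide)
      have "norm (hconv g (h k) p - g p) < e" if k: "k \<ge> N" for k
      proof -
        have "hconv g (h k) p - g p = (LINT r|lborel. g (hmul p (- r)) * h k r) - (LINT r|lborel. g p * h k r)"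
          unfolding hconv_def integral_mult_right_zero hint' by simp
        also have "\<dots> = (LINT r|lborel. g (hmul p (- r)) * h k r - g p * h k r)"
          using hi by (intro Bochner_Integration.integral_diff[symmetric] Fint) simp
        finally have "cmod (hconv g (h k) p - g p) \<le> (LINT r|lborel. cmod (g (hmul p (- r)) * h k r - g p * h k r))"
          by simp
        also have "\<dots> \<le> (LINT r|lborel. e / 2 * cmod (h k r))"
        proof (rule integral_mono)
          show "integrable lborel (\<lambda>r. cmod (g (hmul p (- r)) * h k r - g p * h k r))"
            using hi by (intro integrable_norm Bochner_Integration.integrable_diff Fint) simp
          show "integrable lborel (\<lambda>r. e / 2 * cmod (h k r))" using hi by simp
          fix r
          show "cmod (g (hmul p (- r)) * h k r - g p * h k r) \<le> e / 2 * cmod (h k r)"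
          proof (cases "r \<in> B0 k")
            case True
            have "1 / real (Suc k) \<le> 1 / real (Suc N)" using k by (simp add: frac_le)
            then have "norm r < d" using True N by (simp add: B0_def)
            then have "cmod (g (hmul p (- r)) - g p) \<le> e / 2" using d(2)[of r] unfolding p0 by simp
            then have "cmod (g (hmul p (- r)) - g p) * cmod (h k r) \<le> e / 2 * cmod (h k r)" by (rule mult_right_mono) simp
            then show ?thesis by (simp add: norm_mult[symmetric] left_diff_distrib)
          next
            case False then show ?thesis by (simp add: h_def)
          qed
        qed
        also have "\<dots> = e / 2" by (simp add: hint)
        finally show ?thesis using e by simp
      qed
      then show "\<exists>N. \<forall>k\<ge>N. norm (hconv g (h k) p - g p) < e" by blast
    qed
    show "AE p in lborel. cmod (hconv g (h k) p - g p) \<le> cmod (complex_of_real (2 * B) * indicator (cball 0 (2 * B + 1)) p)" for k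
    proof (intro AE_I2)
      fix p :: "'n heis"
      show "cmod (hconv g (h k) p - g p) \<le> cmod (complex_of_real (2 * B) * indicator (cball 0 (2 * B + 1)) p)"
      proof (cases "norm p \<le> 2 * B + 1")
        case True
        have "cmod (hconv g (h k) p - g p) \<le> B + B"
          using norm_triangle_ineq4[of "hconv g (h k) p" "g p"] B(2)[of p] hconv_bound[OF gm hL(1) B(2), of k p]
          by (simp add: hint)
        then show ?thesis using True B(1) by (simp add: norm_mult)
      next
        case False
        have "g (hmul p (- r)) * h k r = 0" for r
        proof (cases "r \<in> B0 k")
          case r: True
          have "1 / real (Suc k) \<le> 1" by simp
          moreover have "norm r < 1 / real (Suc k)" using r by (simp add: B0_def)
          ultimately have r1: "norm r \<le> 1" by linarith
          \<comment> \<open>The radius \<open>2 * B + 1\<close> enters here: \<open>p\<close> is the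
            product of q = \<open>hmul p (- r)\<close> and \<open>r\<close>, so its norm is at most
            that of \<open>q\<close>, plus that of \<open>r\<close>, plus the central correction.
            These are bounded by \<open>B\<close>, 1 and \<open>B\<close>.\<close>
          have "norm (hmul p (- r)) > B"
          proof (rule ccontr)
            assume "\<not> ?thesis"
            then have q: "norm (hmul p (- r)) \<le> B" by simp
            define q where "q = hmul p (- r)"
            have comp: "norm (fst z) \<le> norm z" "norm (fst (snd z)) \<le> norm z" for z :: "'n heis"
              using norm_fst_le[of "fst z" "snd z"] norm_snd_le[of "snd z" "fst z"] norm_fst_le[of "fst (snd z)" "snd (snd z)"]
              by (auto intro: order_trans)
            have c1: "\<bar>fst r \<bullet> fst (snd q)\<bar> \<le> B" "\<bar>fst (snd r) \<bullet> fst q\<bar> \<le> B"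
            proof -
              have "norm (fst r) * norm (fst (snd q)) \<le> 1 * B"
                using comp[of r] comp[of q] r1 q unfolding q_def[symmetric] by (intro mult_mono) auto
              then show "\<bar>fst r \<bullet> fst (snd q)\<bar> \<le> B" using Cauchy_Schwarz_ineq2[of "fst r" "fst (snd q)"] by linarith
              have "norm (fst (snd r)) * norm (fst q) \<le> 1 * B"
                using comp[of r] comp[of q] r1 q unfolding q_def[symmetric] by (intro mult_mono) auto
              then show "\<bar>fst (snd r) \<bullet> fst q\<bar> \<le> B" using Cauchy_Schwarz_ineq2[of "fst (snd r)" "fst q"] by linarith
            qed
            have "p = hmul q r" unfolding q_def by (rule hmul_inverse'[symmetric])
            also have "\<dots> = q + r + (0, 0, (fst r \<bullet> fst (snd q) - fst (snd r) \<bullet> fst q) / 2)"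
              by (simp add: hmul_def prod_eq_iff)
            finally have "norm p \<le> norm q + norm r + norm ((0, 0, (fst r \<bullet> fst (snd q) - fst (snd r) \<bullet> fst q) / 2) :: 'n heis)"
              by (metis add_mono_thms_linordered_semiring(3) norm_triangle_ineq norm_triangle_le)
            also have "norm ((0, 0, (fst r \<bullet> fst (snd q) - fst (snd r) \<bullet> fst q) / 2) :: 'n heis) \<le> B"
              using c1 by (simp add: norm_Pair)
            finally show False using False q r1 unfolding q_def[symmetric] by simp
          qed
          then show ?thesis using B(3) by simp
        next
          case False then show ?thesis by (simp add: h_def)
        qed
        then have "hconv g (h k) p = 0" unfolding hconv_def by (simp only: Bochner_Integration.integral_zero)
        moreover have "g p = 0" using False B(1) by (intro B(3)) simp
        ultimately show ?thesis by simp
      qed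
    qed
  qed
  then show ?thesis using that hL by blast
qed

text \<open>For each tolerance, approximate \<open>f\<close> by a continuous \<open>g\<close> of
  compact support and then \<open>g\<close> by its convolution with an approximate identity.\<close>

lemma trace_integrable_dense:
  fixes f :: "'n::finite heis \<Rightarrow> complex"
  assumes f: "f \<in> L2"
  obtains F where "\<And>k. F k \<in> L2" "\<And>k p. trace_integrable (weight0 p) (inversion_op 0 0 (F k) p)" "l2_tendsto F f"
proof -
  have "\<exists>F. F \<in> L2 \<and> (\<forall>p. trace_integrable (weight0 p) (inversion_op 0 0 F p)) \<and> nsq (\<lambda>p. F p - f p) < 1 / real (Suc k)" for k :: nat
  proof -
    define e where "e = 1 / real (Suc k)"
    have e: "e > 0" by (simp add: e_def)
    obtain g where g: "cont_compact_supp g" "nsq (\<lambda>p. f p - g p) < e / 4"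
      using cont_compact_supp_dense[OF f, of "e / 4"] e by auto
    have gb: "bdd_compact_supp g" by (rule cont_compact_supp_bdd[OF g(1)])
    have gL: "g \<in> L2" using bdd_compact_supp_L1_L2[OF gb] by blast
    obtain h where h: "\<And>k. h k \<in> L1" "\<And>k. h k \<in> L2" "l2_tendsto (\<lambda>k. hconv g (h k)) g"
      using hconv_approx[OF g(1)] by metis
    have FL: "hconv g (h j) \<in> L2" for j by (rule hconv_L2[OF gb h(1)])
    have "(\<lambda>j. nsq (\<lambda>p. hconv g (h j) p - g p)) \<longlonglongrightarrow> 0"
      using h(3) l2_tendsto_iff[of "\<lambda>k. hconv g (h k)" g] FL gL by blast
    then have "\<forall>\<^sub>F j in sequentially. nsq (\<lambda>p. hconv g (h j) p - g p) < e / 4"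
      by (rule order_tendstoD) (use e in simp)
    then obtain j where j: "nsq (\<lambda>p. hconv g (h j) p - g p) < e / 4"
      using eventually_happens' sequentially_bot by blast
    have "nsq (\<lambda>p. hconv g (h j) p - f p) < e"
      using nsq_triangle[OF FL gL f, of j] j g(2) nsq_swap[of f g] by linarith
    then show ?thesis
      using trace_integrable_hconv[OF gb h(1) h(2)] FL unfolding e_def by blast
  qed
  from choice[OF allI[OF this]] obtain F where F0: "\<forall>k. F k \<in> L2 \<and>
      (\<forall>p. trace_integrable (weight0 p) (inversion_op 0 0 (F k) p)) \<and> nsq (\<lambda>p. F k p - f p) < 1 / real (Suc k)" ..
  have F: "F k \<in> L2" "trace_integrable (weight0 p) (inversion_op 0 0 (F k) p)" "nsq (\<lambda>p. F k p - f p) < 1 / real (Suc k)" for k p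
    using spec[OF F0, of k] by blast+
  have "(\<lambda>k. nsq (\<lambda>p. F k p - f p)) \<longlonglongrightarrow> 0"
  proof (rule tendsto_sandwich[OF _ _ tendsto_const])
    show "(\<lambda>k. 1 / real (Suc k)) \<longlonglongrightarrow> 0"
      using LIMSEQ_inverse_real_of_nat by (simp add: inverse_eq_divide)
    show "\<forall>\<^sub>F k in sequentially. nsq (\<lambda>p. F k p - f p) \<le> 1 / real (Suc k)"
      using F(3) by (intro always_eventually allI less_imp_le)
  qed simp
  then have "l2_tendsto F f" using l2_tendsto_iff[of F f] F(1) f by blast
  then show ?thesis using that F(1,2) by blast
qed

section \<open>The conjugated inversion formula\<close>

text \<open>Exchanging two group elements costs a central element, and its
  \<open>t\<close>-coordinate is the symplectic form of their vector parts.\<close>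

lemma schroedinger_adjoint_conj:
  "schroedinger l (- (u, v, w)) (schroedinger l (\<xi>1, \<xi>2, 0) \<phi>)
     = schroedinger l (\<xi>1, \<xi>2, u \<bullet> \<xi>2 - v \<bullet> \<xi>1) (schroedinger l (- (u, v, w)) \<phi>)"
proof -
  have "hmul (- (u, v, w)) (\<xi>1, \<xi>2, 0) = hmul (\<xi>1, \<xi>2, u \<bullet> \<xi>2 - v \<bullet> \<xi>1) (- (u, v, w))"
    by (simp add: hmul_simp inner_commute field_simps)
  then show ?thesis by (simp only: schroedinger_hmul[symmetric])
qed

text \<open>Moving the adjoint operator past the conjugating one exposes a unitary conjugate of the
  unconjugated operator, up to a central element acting as a scalar phase. Trace class is
  unaffected, the trace acquires that phase, and the exponential in \<open>weight\<close> is its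
  inverse.\<close>

lemma
  fixes f :: "'n::finite heis \<Rightarrow> complex" and p :: "'n heis"
  assumes D: "bounded_op (gft f l)"
  shows trace_class_inversion_op: "trace_class (inversion_op \<xi>1 \<xi>2 f p l) \<longleftrightarrow> trace_class (inversion_op 0 0 f p l)"
    and weight_op_trace: "trace_class (inversion_op 0 0 f p l) \<Longrightarrow>
      weight \<xi>1 \<xi>2 p l * op_trace (inversion_op \<xi>1 \<xi>2 f p l) = weight0 p l * op_trace (inversion_op 0 0 f p l)"
proof -
  obtain u v w where p: "p = (u, v, w)" by (cases p)
  define \<tau> where "\<tau> = u \<bullet> \<xi>2 - v \<bullet> \<xi>1"
  let ?D = "gft f l"
  let ?U = "schroedinger l p" and ?U' = "schroedinger l (- p)"
  let ?V = "schroedinger l (\<xi>1, \<xi>2, 0)" and ?V' = "schroedinger l (- \<xi>1, - \<xi>2, 0)"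
  let ?Z = "schroedinger l (\<xi>1, \<xi>2, \<tau>)" and ?Z' = "schroedinger l (- (\<xi>1, \<xi>2, \<tau>))"
  let ?T = "inversion_op \<xi>1 \<xi>2 f p l" and ?R = "inversion_op 0 0 f p l"
  have V: "unitary_pair ?V ?V'" using unitary_schroedinger[of l "(\<xi>1, \<xi>2, 0)"] by simp
  note V' = unitary_pair_sym[OF V]
  have U: "unitary_pair ?U ?U'" and Z: "unitary_pair ?Z ?Z'" by (rule unitary_schroedinger)+
  have DL: "?D \<phi> \<in> L2" if "\<phi> \<in> L2" for \<phi> by (rule bounded_op_L2[OF D that])
  note UL = schroedinger_L2(1)
  have adj: "op_eq (op_adjoint ?U) ?U'" by (rule op_adjoint_op_eq[OF unitary_pair_adj[OF U]])
  have Ub: "bounded_op (op_adjoint ?U)"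
    by (rule bounded_op_op_eq[OF unitary_pair_bounded'[OF U] op_eq_sym[OF adj]])
  have refl: "op_eq S S" if "bounded_op S" for S :: "(real ^ 'n) op"
    using bounded_op_L2[OF that] by (simp add: op_eq_def)
  have T0: "op_eq ?R (\<lambda>\<phi>. ?U' (?D \<phi>))"
    using op_eq_comp[OF Ub adj refl[OF D]] unfolding inversion_op_zero comp_def .
  have VDV: "bounded_op (\<lambda>\<phi>. ?V (?D (?V' \<phi>)))"
    by (rule bounded_op_comp[OF unitary_pair_bounded[OF V] bounded_op_comp[OF D unitary_pair_bounded[OF V']]])
  have "op_eq ?T (\<lambda>\<phi>. ?U' (?V (?D (?V' \<phi>))))"
    using op_eq_comp[OF Ub adj refl[OF VDV]] unfolding inversion_op_def conj_gft_def comp_def .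
  then have T: "op_eq ?T (\<lambda>\<phi>. ?Z (?U' (?D (?V' \<phi>))))"
    unfolding p schroedinger_adjoint_conj \<tau>_def .
  have T0b: "bounded_op ?R"
    by (rule bounded_op_op_eq[OF bounded_op_comp[OF unitary_pair_bounded'[OF U] D] op_eq_sym[OF T0]])
  have TT0: "op_eq ?T (\<lambda>\<phi>. ?Z (?R (?V' \<phi>)))"
  proof -
    have "op_eq (\<lambda>\<phi>. ?R (?V' \<phi>)) (\<lambda>\<phi>. ?U' (?D (?V' \<phi>)))"
      by (rule op_eq_comp[OF T0b T0 refl[OF unitary_pair_bounded[OF V']]])
    from op_eq_comp[OF unitary_pair_bounded[OF Z] refl[OF unitary_pair_bounded[OF Z]] this]
    show ?thesis using op_eq_trans[OF T op_eq_sym] by blast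
  qed
  have "bounded_op ?T"
    by (rule bounded_op_op_eq[OF bounded_op_comp[OF unitary_pair_bounded[OF Z] bounded_op_comp[OF T0b unitary_pair_bounded[OF V']]] op_eq_sym[OF TT0]])
  \<comment> \<open>The relation between the two operators is inverted, so that trace class
    transfers in both directions.\<close>
  have T0T: "op_eq ?R (\<lambda>\<phi>. ?Z' (?T (?V \<phi>)))"
  proof -
    have "op_eq (\<lambda>\<phi>. ?T (?V \<phi>)) (\<lambda>\<phi>. ?Z (?R (?V' (?V \<phi>))))"
      by (rule op_eq_comp[OF \<open>bounded_op ?T\<close> TT0 refl[OF unitary_pair_bounded[OF V]]])
    from op_eq_comp[OF unitary_pair_bounded'[OF Z] refl[OF unitary_pair_bounded'[OF Z]] this]
    have "op_eq (\<lambda>\<phi>. ?Z' (?T (?V \<phi>))) ?R"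
      unfolding unitary_pair_right[OF Z] unitary_pair_right[OF V] .
    then show ?thesis by (rule op_eq_sym)
  qed
  show iff: "trace_class ?T \<longleftrightarrow> trace_class ?R"
  proof
    assume "trace_class ?T"
    from trace_class_unitary[OF unitary_pair_sym[OF Z] V this] show "trace_class ?R"
      by (rule trace_class_op_eq[OF _ op_eq_sym[OF T0T]])
  next
    assume "trace_class ?R"
    from trace_class_unitary[OF Z V' this] show "trace_class ?T"
      by (rule trace_class_op_eq[OF _ op_eq_sym[OF TT0]])
  qed
  assume tc: "trace_class ?R"
  define c where "c = cis (2 * pi * l * \<tau>)"
  \<comment> \<open>The central coordinate acts through its character, so the left unitary is a
    scalar multiple of the conjugating operator and the trace is taken in the basis moved by the
    inverse of that operator.\<close>
  have Zc: "?Z \<phi> = (\<lambda>\<xi>. c * ?V \<phi> \<xi>)" for \<phi>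
    by (rule ext) (simp add: schroedinger_eq c_def distrib_left mult.assoc flip: cis_mult)
  let ?e = "l2_basis :: nat \<Rightarrow> (real ^ 'n) \<Rightarrow> complex"
  have eL: "?e i \<in> L2" for i by (rule l2_onb_L2[OF l2_onb_basis])
  have term_eq: "l2_inner (?T (?e i)) (?e i) = c * l2_inner (?R (?V' (?e i))) (?V' (?e i))" for i
  proof -
    have L: "?R (?V' (?e i)) \<in> L2" by (intro bounded_op_L2[OF T0b] UL eL)
    have "l2_inner (?T (?e i)) (?e i) = l2_inner (?Z (?R (?V' (?e i)))) (?e i)"
      using TT0 eL[of i] unfolding op_eq_def by (intro l2_inner_cong_AE) auto
    also have "\<dots> = c * l2_inner (?V (?R (?V' (?e i)))) (?e i)"
      unfolding Zc by (rule l2_inner_cmult_left)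
    also have "l2_inner (?V (?R (?V' (?e i)))) (?e i) = l2_inner (?R (?V' (?e i))) (?V' (?e i))"
      by (rule adj_pair_inner[OF unitary_pair_adj[OF V] L eL, symmetric])
    finally show ?thesis .
  qed
  have "(\<lambda>i. c * l2_inner (?R (?V' (?e i))) (?V' (?e i))) sums (c * op_trace ?R)"
    by (rule sums_mult[OF trace_onb[OF tc unitary_pair_onb[OF V' l2_onb_basis]]])
  moreover have "(\<lambda>i. c * l2_inner (?R (?V' (?e i))) (?V' (?e i))) sums op_trace ?T"
    using trace_onb[OF iff[THEN iffD2, OF tc] l2_onb_basis] unfolding term_eq .
  ultimately have tr: "op_trace ?T = c * op_trace ?R" using sums_unique2 by blast
  have "cis (2 * pi * l * (v \<bullet> \<xi>1 - u \<bullet> \<xi>2)) * c = cis (2 * pi * l * (v \<bullet> \<xi>1 - u \<bullet> \<xi>2) + 2 * pi * l * (u \<bullet> \<xi>2 - v \<bullet> \<xi>1))"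
    unfolding c_def \<tau>_def by (rule cis_mult)
  also have "\<dots> = 1" by (simp add: algebra_simps)
  finally have one: "cis (2 * pi * l * (v \<bullet> \<xi>1 - u \<bullet> \<xi>2)) * c = 1" .
  have "weight \<xi>1 \<xi>2 p l * op_trace ?T
      = complex_of_real (\<bar>l\<bar> ^ CARD('n)) * ((cis (2 * pi * l * (v \<bullet> \<xi>1 - u \<bullet> \<xi>2)) * c) * op_trace ?R)"
    unfolding tr unfolding weight_def p prod.case by (simp only: mult.assoc)
  then show "weight \<xi>1 \<xi>2 p l * op_trace ?T = weight0 p l * op_trace ?R"
    unfolding one by (simp only: weight0_def mult_1_left)
qed

text \<open>The pointwise comparison in \<open>l\<close> requires the transform to be bounded, which
  \<open>is_gft\<close> guarantees off \<open>l = 0\<close>. Integrals over \<open>l\<close> ignore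
  that point, so the comparison is valid at each individual group point.\<close>

lemma trace_integrable_conj:
  fixes f :: "'n::finite heis \<Rightarrow> complex" and p :: "'n heis"
  assumes f: "f \<in> L2"
  shows "trace_integrable (weight \<xi>1 \<xi>2 p) (inversion_op \<xi>1 \<xi>2 f p) \<longleftrightarrow>
      trace_integrable (weight0 p) (inversion_op 0 0 f p)"
    and "trace_integrable (weight \<xi>1 \<xi>2 p) (inversion_op \<xi>1 \<xi>2 f p) \<Longrightarrow>
      trace_integral (weight \<xi>1 \<xi>2 p) (inversion_op \<xi>1 \<xi>2 f p) = trace_integral (weight0 p) (inversion_op 0 0 f p)"
proof -
  have nz: "AE l in lebesgue. bounded_op (gft f l)"
  proof -
    have "AE l in lborel. bounded_op (gft f l)"
      using AE_lborel_nonzero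
      by eventually_elim (use gft_hilbert_schmidt[OF f] in \<open>simp add: hilbert_schmidt_def\<close>)
    then show ?thesis by (simp only: AE_completion_iff)
  qed
  have cong: "integrable lebesgue b \<and> integral\<^sup>L lebesgue b = integral\<^sup>L lebesgue a"
    if "integrable lebesgue a" "AE l in lebesgue. a l = b l" for a b :: "real \<Rightarrow> complex"
  proof -
    have m: "b \<in> borel_measurable lebesgue"
      by (rule borel_measurable_AE[OF borel_measurable_integrable[OF that(1)] that(2)])
    show ?thesis
      using integrable_cong_AE_imp[OF that(1) m that(2)]
        integral_cong_AE[OF borel_measurable_integrable[OF that(1)] m that(2)] by simp
  qed
  have tc: "(AE l in lebesgue. trace_class (inversion_op \<xi>1 \<xi>2 f p l)) \<longleftrightarrow> (AE l in lebesgue. trace_class (inversion_op 0 0 f p l))"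
  proof
    assume "AE l in lebesgue. trace_class (inversion_op \<xi>1 \<xi>2 f p l)"
    with nz show "AE l in lebesgue. trace_class (inversion_op 0 0 f p l)"
      by eventually_elim (rule trace_class_inversion_op[THEN iffD1])
  next
    assume "AE l in lebesgue. trace_class (inversion_op 0 0 f p l)"
    with nz show "AE l in lebesgue. trace_class (inversion_op \<xi>1 \<xi>2 f p l)"
      by eventually_elim (rule trace_class_inversion_op[THEN iffD2])
  qed
  have eq: "AE l in lebesgue. weight \<xi>1 \<xi>2 p l * op_trace (inversion_op \<xi>1 \<xi>2 f p l) = weight0 p l * op_trace (inversion_op 0 0 f p l)"
    if "AE l in lebesgue. trace_class (inversion_op 0 0 f p l)"
    using nz that by eventually_elim (rule weight_op_trace)
  show iff: "trace_integrable (weight \<xi>1 \<xi>2 p) (inversion_op \<xi>1 \<xi>2 f p) \<longleftrightarrow>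
      trace_integrable (weight0 p) (inversion_op 0 0 f p)"
    unfolding trace_integrable_def using tc cong[OF _ eq] cong[OF _ AE_eq_sym[OF eq]] by blast
  assume "trace_integrable (weight \<xi>1 \<xi>2 p) (inversion_op \<xi>1 \<xi>2 f p)"
  then show "trace_integral (weight \<xi>1 \<xi>2 p) (inversion_op \<xi>1 \<xi>2 f p) = trace_integral (weight0 p) (inversion_op 0 0 f p)"
    unfolding trace_integrable_def trace_integral_def using tc cong[OF _ eq] by metis
qed

lemma inversion_conj:
  fixes f :: "'n::finite heis \<Rightarrow> complex"
  assumes f: "f \<in> L2" and ti: "AE p in lborel. trace_integrable (weight \<xi>1 \<xi>2 p) (inversion_op \<xi>1 \<xi>2 f p)"
  shows "AE p in lborel. trace_integral (weight \<xi>1 \<xi>2 p) (inversion_op \<xi>1 \<xi>2 f p) = f p"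
proof -
  have "AE p in lborel. trace_integrable (weight0 p) (inversion_op 0 0 f p)"
    using ti unfolding trace_integrable_conj(1)[OF f] .
  from inversion_zero[OF f this] ti show ?thesis
    by eventually_elim (simp only: trace_integrable_conj(2)[OF f])
qed

text \<open>By \<open>inv\<close> every pair in the graph consists of almost everywhere equal
  functions, and this survives limits in \<open>L2\<close>. Conversely,
  \<open>trace_integrable_dense\<close> supplies diagonal pairs converging to any \<open>f\<close>.
  Weight and operator family are parameters, so the conjugated and the plain formula are both
  instances.\<close>

lemma l2_extension_inversion:
  fixes f g :: "'n::finite heis \<Rightarrow> complex" and c :: "'n heis \<Rightarrow> real \<Rightarrow> complex"
    and T :: "('n heis \<Rightarrow> complex) \<Rightarrow> 'n heis \<Rightarrow> real \<Rightarrow> (real ^ 'n) op"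
  assumes inv: "\<And>h. h \<in> L2 \<Longrightarrow> AE p in lborel. trace_integrable (c p) (T h p) \<Longrightarrow>
      AE p in lborel. trace_integral (c p) (T h p) = h p"
    and dom: "\<And>h p. h \<in> L2 \<Longrightarrow> trace_integrable (c p) (T h p) \<longleftrightarrow> trace_integrable (weight0 p) (inversion_op 0 0 h p)"
    and f: "f \<in> L2" and g: "g \<in> L2"
  shows "l2_extension (inversion_graph c T) f g \<longleftrightarrow> (AE p in lborel. g p = f p)"
proof
  assume "l2_extension (inversion_graph c T) f g"
  then obtain F G where FG: "\<And>k. F k \<in> L2" "\<And>k. G k \<in> L2" "\<And>k. inversion_graph c T (F k) (G k)"
      "l2_tendsto F f" "l2_tendsto G g"
    unfolding l2_extension_def by blast
  have "AE p in lborel. G k p = F k p" for k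
  proof -
    have 1: "AE p in lborel. trace_integrable (c p) (T (F k) p) \<and> trace_integral (c p) (T (F k) p) = G k p"
      using FG(3) unfolding inversion_graph_def .
    then have "AE p in lborel. trace_integrable (c p) (T (F k) p)" by eventually_elim (rule conjunct1)
    from inv[OF FG(1) this] 1 show ?thesis by eventually_elim simp
  qed
  then have "l2_norm_sq (\<lambda>x. G k x - g x) = l2_norm_sq (\<lambda>x. F k x - g x)" for k
    by (intro l2_norm_sq_cong_AE) (metis (mono_tags, lifting) AE_mp AE_I2)
  then have "l2_tendsto F g" using FG(5) unfolding l2_tendsto_def by simp
  then show "AE p in lborel. g p = f p" by (rule l2_tendsto_unique[OF FG(1) g f _ FG(4)])
next
  assume eq: "AE p in lborel. g p = f p"
  obtain F where F: "\<And>k. F k \<in> L2" "\<And>k p. trace_integrable (weight0 p) (inversion_op 0 0 (F k) p)" "l2_tendsto F f"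
    using trace_integrable_dense[OF f] by metis
  have "inversion_graph c T (F k) (F k)" for k
  proof -
    have ti: "trace_integrable (c p) (T (F k) p)" for p using F(2) unfolding dom[OF F(1)] .
    then have "AE p in lborel. trace_integrable (c p) (T (F k) p)" by simp
    from inv[OF F(1) this] show ?thesis
      unfolding inversion_graph_def by eventually_elim (use ti in blast)
  qed
  moreover have "l2_tendsto F g"
  proof -
    have "l2_norm_sq (\<lambda>x. F k x - f x) = l2_norm_sq (\<lambda>x. F k x - g x)" for k
      by (rule l2_norm_sq_cong_AE) (use eq in eventually_elim, simp)
    then show ?thesis using F(3) unfolding l2_tendsto_def by simp
  qed
  ultimately show "l2_extension (inversion_graph c T) f g"
    unfolding l2_extension_def using F(1,3) by blast
qed

theorem theorem3p5:
  fixes f :: "'n::finite heis \<Rightarrow> complex"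
    and \<xi>1 \<xi>2 :: "real ^ 'n"
  assumes "f \<in> L2"
  shows
    "((AE p in lborel. trace_integrable (weight \<xi>1 \<xi>2 p) (inversion_op \<xi>1 \<xi>2 f p)) \<longrightarrow>
       (AE (u, v, w) in lborel.
          (LINT l|lebesgue. complex_of_real (\<bar>l\<bar> ^ CARD('n)) * cis (2 * pi * l * (v \<bullet> \<xi>1 - u \<bullet> \<xi>2)) *
             op_trace (op_adjoint (schroedinger l (u, v, w)) \<circ> conj_gft f l \<xi>1 \<xi>2))
          = f (u, v, w))) \<and>
     (\<forall>g\<in>L2. l2_extension (inversion_graph (weight \<xi>1 \<xi>2) (inversion_op \<xi>1 \<xi>2)) f g \<longleftrightarrow>
           (AE p in lborel. g p = f p)) \<and>
     ((AE p in lborel. trace_integrable (weight0 p) (inversion_op 0 0 f p)) \<longrightarrow>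
       (AE (u, v, w) in lborel.
          (LINT l|lebesgue. complex_of_real (\<bar>l\<bar> ^ CARD('n)) *
             op_trace (op_adjoint (schroedinger l (u, v, w)) \<circ> conj_gft f l 0 0))
          = f (u, v, w))) \<and>
     (\<forall>g\<in>L2. l2_extension (inversion_graph weight0 (inversion_op 0 0)) f g \<longleftrightarrow>
           (AE p in lborel. g p = f p))"
proof (intro conjI impI ballI)
  assume "AE p in lborel. trace_integrable (weight \<xi>1 \<xi>2 p) (inversion_op \<xi>1 \<xi>2 f p)"
  from inversion_conj[OF assms this]
  show "AE (u, v, w) in lborel.
          (LINT l|lebesgue. complex_of_real (\<bar>l\<bar> ^ CARD('n)) * cis (2 * pi * l * (v \<bullet> \<xi>1 - u \<bullet> \<xi>2)) *
             op_trace (op_adjoint (schroedinger l (u, v, w)) \<circ> conj_gft f l \<xi>1 \<xi>2))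
          = f (u, v, w)"
    by eventually_elim (auto simp: trace_integral_def weight_def inversion_op_def)
next
  assume "AE p in lborel. trace_integrable (weight0 p) (inversion_op 0 0 f p)"
  from inversion_zero[OF assms this]
  show "AE (u, v, w) in lborel.
          (LINT l|lebesgue. complex_of_real (\<bar>l\<bar> ^ CARD('n)) *
             op_trace (op_adjoint (schroedinger l (u, v, w)) \<circ> conj_gft f l 0 0))
          = f (u, v, w)"
    by eventually_elim (auto simp: trace_integral_def weight0_def inversion_op_def)
next
  fix g :: "'n heis \<Rightarrow> complex" assume g: "g \<in> L2"
  show "l2_extension (inversion_graph (weight \<xi>1 \<xi>2) (inversion_op \<xi>1 \<xi>2)) f g \<longleftrightarrow> (AE p in lborel. g p = f p)"
    by (rule l2_extension_inversion[OF inversion_conj trace_integrable_conj(1) assms g])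
  show "l2_extension (inversion_graph weight0 (inversion_op 0 0)) f g \<longleftrightarrow> (AE p in lborel. g p = f p)"
    by (rule l2_extension_inversion[OF inversion_zero refl assms g])
qed

end
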